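(* Let $N$ be a free abelian group of rank $3$ and let $\Delta \subseteq N_{\mathbb{R}} = N\otimes\mathbb{R}$ be an arbitrary $3$-dimensional canonical Fano polytope. Then $$24 = v(\Delta) - \sum_{\theta \preceq \Delta,\ \dim(\theta)=2} \frac{1}{n_\theta}\cdot v(\theta) + \sum_{\theta \preceq \Delta,\ \dim(\theta)=1} v(\theta)\cdot v(\theta^* ),$$ where the sums run over the $2$-dimensional and the $1$-dimensional faces $\theta$ of $\Delta$, respectively.
   Context: Let $N$ be a free abelian group of rank $d$ (here $d=3$), $M = \mathrm{Hom}(N,\mathbb{Z})$ its dual lattice, $N_{\mathbb{R}} = N\otimes\mathbb{R}$, $M_{\mathbb{R}} = M\otimes\mathbb{R}$, with natural pairing $\langle\cdot,\cdot\rangle : M_{\mathbb{R}}\times N_{\mathbb{R}}\to\mathbb{R}$. A lattice polytope is a $d$-dimensional convex polytope all of whose vertices lie in the lattice. $\theta\preceq\Delta$ means that $\theta$ is a face of $\Delta$. Canonical Fano polytope: a $d$-dimensional lattice polytope $\Delta\subseteq N_{\mathbb{R}}$ is called canonical Fano if the origin is the only lattice point in its interior, i.e. $\Delta^\circ\cap N=\{0\}$. Dual polytope: for a $d$-dimensional convex polytope $\Delta\subseteq N_{\mathbb{R}}$ containing $0$ in its interior, $\Delta^* = \{y\in M_{\mathbb{R}} : \langle y,x\rangle\ge -1\ \forall x\in\Delta\}$. For a face $\theta\preceq\Delta$ of dimension $k$, the dual face is $\theta^* = \{y\in\Delta^* : \langle y,x\rangle = -1\ \forall x\in\theta\}$,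 a face of $\Delta^*$ of dimension $d-k-1$. (If $\Delta$ is a lattice polytope then $\Delta^*$ is a rational polytope, in general not a lattice polytope.) Lattice distance: for a facet ($(d-1)$-dimensional face) $\theta$ of $\Delta$, $n_\theta$ is the positive integer such that $\theta$ is defined by the equation $-\langle m,x\rangle = n_\theta$ for a primitive lattice point $m\in M$. Normalized volume: for a $k$-dimensional lattice polytope $\theta$ (for example $\Delta$ itself or a face of it), $v(\theta) = k!\cdot\mathrm{vol}_k(\theta)$, where $\mathrm{vol}_k$ is the $k$-dimensional volume relative to the ambient lattice, i.e. normalized so that a fundamental parallelepiped of the rank-$k$ lattice of all lattice vectors parallel to the affine hull of $\theta$ has volume $1$. For a $k$-dimensional face $\theta$ of a rational polytope $P$, choose a positive integer $l$ such that $lP$ is a lattice polytope and put $v(\theta) = l^{-k}\, v(l\theta)$. Faces of $\Delta$ are measured with respect to $N$ and faces of $\Delta^*$ with respect to $M$. *)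

theory Defs
  imports "HOL-Analysis.Analysis"
begin

text \<open>
  A free abelian group of rank \<open>d\<close> together with its real extension is represented by a lattice
  spanned over the integers by a basis of an arbitrary Euclidean space of dimension \<open>d\<close>. The dual
  space is identified with the space itself by the inner product, which plays the role of the
  natural pairing.
\<close>

definition lattice_basis :: "nat \<Rightarrow> (nat \<Rightarrow> 'a::real_vector) \<Rightarrow> 'a set \<Rightarrow> bool" where
  "lattice_basis k b L \<longleftrightarrow>
     inj_on b {..<k} \<and> independent (b ` {..<k}) \<and>
     L = range (\<lambda>c :: nat \<Rightarrow> int. \<Sum>i<k. of_int (c i) *\<^sub>R b i)"

definition full_lattice :: "'a::euclidean_space set \<Rightarrow> bool" where
  "full_lattice N \<longleftrightarrow> (\<exists>b. lattice_basis DIM('a) b N)"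

definition dual_lattice :: "'a::euclidean_space set \<Rightarrow> 'a set" where
  "dual_lattice N = {m. \<forall>x\<in>N. m \<bullet> x \<in> \<int>}"

text \<open>The condition excludes \<open>m = 0\<close>, because \<open>0 = 2 \<cdot> 0\<close>.\<close>

definition primitive_vector :: "'a::real_vector set \<Rightarrow> 'a \<Rightarrow> bool" where
  "primitive_vector L m \<longleftrightarrow>
     m \<in> L \<and> (\<forall>k :: int. \<forall>m'\<in>L. m = of_int k *\<^sub>R m' \<longrightarrow> \<bar>k\<bar> = 1)"

text \<open>No condition on the dimension, so that faces of lattice polytopes are covered as well.\<close>

definition lattice_polytope :: "'a::euclidean_space set \<Rightarrow> 'a set \<Rightarrow> bool" where
  "lattice_polytope L P \<longleftrightarrow> polytope P \<and> {v. v extreme_point_of P} \<subseteq> L"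

definition canonical_Fano :: "'a::euclidean_space set \<Rightarrow> 'a set \<Rightarrow> bool" where
  "canonical_Fano N P \<longleftrightarrow>
     lattice_polytope N P \<and> aff_dim P = int DIM('a) \<and> interior P \<inter> N = {0}"

definition dual_polytope :: "'a::euclidean_space set \<Rightarrow> 'a set" where
  "dual_polytope P = {y. \<forall>x\<in>P. y \<bullet> x \<ge> -1}"

definition dual_face :: "'a::euclidean_space set \<Rightarrow> 'a set \<Rightarrow> 'a set" where
  "dual_face P F = {y \<in> dual_polytope P. \<forall>x\<in>F. y \<bullet> x = -1}"

definition lattice_distance :: "'a::euclidean_space set \<Rightarrow> 'a set \<Rightarrow> 'a set \<Rightarrow> nat" where
  "lattice_distance N P F =
     (THE n. n > 0 \<and>
        (\<exists>m. primitive_vector (dual_lattice N) m \<and> F = {x \<in> P. - (m \<bullet> x) = real n}))"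

definition parallel_lattice :: "'a::euclidean_space set \<Rightarrow> 'a set \<Rightarrow> 'a set" where
  "parallel_lattice L S = L \<inter> {p - q | p q. p \<in> affine hull S \<and> q \<in> affine hull S}"

text \<open>
  The \<open>k\<close>-dimensional volume relative to \<open>L\<close> is the Lebesgue measure of \<open>S\<close> in affine coordinates
  on its affine hull with respect to a basis of the parallel lattice, so that the fundamental
  parallelepiped spanned by this basis has volume 1. The value does not depend on the
  chosen origin \<open>p\<close> and basis \<open>b\<close>.
\<close>

definition relative_volume :: "'a::euclidean_space set \<Rightarrow> 'a set \<Rightarrow> real" where
  "relative_volume L S =
     (let k = nat (aff_dim S);
          b = (SOME b. lattice_basis k b (parallel_lattice L S));
          p = (SOME p. p \<in> affine hull S)
      in measure (Pi\<^sub>M {..<k} (\<lambda>_. lborel :: real measure))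
           {c \<in> {..<k} \<rightarrow>\<^sub>E UNIV. p + (\<Sum>i<k. c i *\<^sub>R b i) \<in> S})"

definition normalized_volume :: "'a::euclidean_space set \<Rightarrow> 'a set \<Rightarrow> real" where
  "normalized_volume L S = fact (nat (aff_dim S)) * relative_volume L S"

text \<open>Normalized volume of a face \<open>F\<close> of a rational polytope \<open>P\<close>.\<close>

definition rational_normalized_volume ::
    "'a::euclidean_space set \<Rightarrow> 'a set \<Rightarrow> 'a set \<Rightarrow> real" where
  "rational_normalized_volume L P F =
     (let l = (SOME l :: nat. l > 0 \<and> lattice_polytope L ((\<lambda>x. real l *\<^sub>R x) ` P))
      in normalized_volume L ((\<lambda>x. real l *\<^sub>R x) ` F) / real l ^ nat (aff_dim F))"

end

theory Submission
  imports Defs "HOL-Real_Asymp.Real_Asymp"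
begin

text \<open>
  Let \<open>\<phi>\<close> be the gauge of \<open>\<Delta>\<close>, so that \<open>\<phi> = 1\<close> on the boundary. The boundary is triangulated by
  triangles \<open>T\<close> without lattice points other than their vertices; the sublattice generated by \<open>T\<close> has
  an index \<open>n\<^sub>T\<close>, and the volumes of \<open>\<Delta>\<close> and of its facets become sums over the triangles. The
  claim turns into \<open>24 = (\<Sum>T. n\<^sub>T - 1 / n\<^sub>T) + (\<Sum>\<theta>. v(\<theta>) v(\<theta>\<^sup>*))\<close>, which follows by computing the limit of
  \<open>s (H(s) - 8 H(2s))\<close> for \<open>s \<rightarrow> 0\<close>, where \<open>H(s) = (\<Sum>x\<in>N. exp (- s \<phi>(x)))\<close>, in two ways.

  First, \<open>H\<close> is a sum of geometric series over half-open cones. As \<open>0\<close> is the only interior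
  lattice point, the nonzero points of the open fundamental parallelepiped of \<open>T\<close> have the
  heights \<open>1 + j / n\<^sub>T\<close> with \<open>0 < j < n\<^sub>T\<close>, each once, and averaging over a generic direction and its
  negative makes the series depend on the numbers \<open>n\<^sub>T\<close> only. Second, splitting \<open>N\<close> into cosets
  of \<open>2 N\<close> expresses \<open>H(s) - 8 H(2s)\<close> by fourth differences of \<open>exp (- s \<phi>)\<close> in the directions of
  these cosets. In the limit they only see the walls between the cones on which \<open>\<phi>\<close> is not
  linear: these are the cones over the edges \<open>\<theta>\<close>, and the change of the gradient of \<open>\<phi>\<close> across
  them is \<open>v(\<theta>\<^sup>*)\<close> times a primitive functional.
\<close>

section \<open>Frames and lattices\<close>

text \<open>No Euler characteristic is used; the number 24 comes from counting signs. In the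
  expansion over half-open cones the triangle \<open>T\<close> enters through the number
  \<open>neg \<xi> T\<close> of negative coordinates of a generic direction, and the squares of
  \<open>neg \<xi> T - 3 / 2\<close> sum to \<open>card \<T> / 4 + 4\<close>. The surplus 4 arises
  because exactly one cone contains \<open>\<xi>\<close> and exactly one contains
  \<open>- \<xi>\<close>; it becomes the \<open>- 6\<close> of the limit and then 48 = 2 * 24. The
  factor 8 = 2^3 cancels the pole of order three of H; the coefficient of 1 / s survives with the
  factor 1 - 8 / 2 = - 3. On the coset side, plain second differences would be too coarse: the order
  of 1 / s^3 points inside the cones would each contribute order s^2, which is not negligible after
  multiplication by s. Subtracting a quarter of the second difference with doubled step lowers this
  to order s^4, and it is free, because shifts by twice a lattice vector preserve the cosets. At a
  wall only the parity of the step, counted in lattice layers parallel to the wall, remains. It is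
  odd for four of the eight cosets, so all walls are counted alike.\<close>

definition frame :: "'a::euclidean_space set \<Rightarrow> bool" where
  "frame T \<longleftrightarrow> independent T \<and> card T = DIM('a)"

definition coord :: "'a::euclidean_space set \<Rightarrow> 'a \<Rightarrow> 'a \<Rightarrow> real" where
  "coord T w x = representation T x w"

lemma frame_finite: "frame T \<Longrightarrow> finite T"
  unfolding frame_def by (metis independent_bound)

lemma frame_span: "frame T \<Longrightarrow> span T = UNIV"
  unfolding frame_def
  by (metis card_eq_dim dim_UNIV frame_def frame_finite independent_span_bound span_UNIV
      subset_UNIV subset_antisym top_greatest dim_eq_full indep_card_eq_dim_span)

lemma frame_if_span:
  fixes T :: "'a::euclidean_space set"
  assumes "finite T" "card T \<le> DIM('a)" "span T = UNIV"
  shows "frame T"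
  unfolding frame_def
  by (metis assms card_le_dim_spanning dim_UNIV dim_span le_antisym subset_UNIV
      dim_le_card' span_superset dim_span card_eq_dim)

lemma linear_coord: "frame T \<Longrightarrow> linear (coord T w)"
  using frame_span[of T] unfolding frame_def coord_def[abs_def]
  by (intro linearI) (simp_all add: real_vector.representation_add real_vector.representation_scale)

lemma coord_add: "frame T \<Longrightarrow> coord T w (x + y) = coord T w x + coord T w y"
  by (simp add: linear_coord linear_add)

lemma coord_diff: "frame T \<Longrightarrow> coord T w (x - y) = coord T w x - coord T w y"
  by (simp add: linear_coord linear_diff)

lemma coord_scale: "frame T \<Longrightarrow> coord T w (c *\<^sub>R x) = c * coord T w x"
  by (simp add: linear_coord linear_scale)

lemma coord_sum: "frame T \<Longrightarrow> coord T w (\<Sum>i\<in>I. f i) = (\<Sum>i\<in>I. coord T w (f i))"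
  by (simp add: linear_coord linear_sum)

lemma coord_zero: "frame T \<Longrightarrow> coord T w 0 = 0"
  by (simp add: linear_coord linear_0)

lemma coord_basis: "frame T \<Longrightarrow> v \<in> T \<Longrightarrow> coord T w v = (if w = v then 1 else 0)"
  by (simp add: coord_def frame_def representation_basis)

lemma sum_coord: "frame T \<Longrightarrow> (\<Sum>w\<in>T. coord T w x *\<^sub>R w) = x"
  unfolding coord_def using frame_span[of T] frame_finite[of T]
  by (intro real_vector.sum_representation_eq) (auto simp: frame_def)

lemma coord_lincomb:
  assumes "frame T" "w \<in> T"
  shows "coord T w (\<Sum>v\<in>T. c v *\<^sub>R v) = c w"
proof -
  have "coord T w (\<Sum>v\<in>T. c v *\<^sub>R v) = (\<Sum>v\<in>T. c v * coord T w v)"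
    using assms by (simp add: coord_sum coord_scale)
  also have "\<dots> = (\<Sum>v\<in>T. if v = w then c v else 0)"
    using assms by (intro sum.cong) (auto simp: coord_basis)
  finally show ?thesis using assms frame_finite[OF assms(1)] by simp
qed

lemma coord_unique: "frame T \<Longrightarrow> w \<in> T \<Longrightarrow> x = (\<Sum>v\<in>T. c v *\<^sub>R v) \<Longrightarrow> coord T w x = c w"
  using coord_lincomb by blast

lemma coord_eqI: "frame T \<Longrightarrow> (\<And>w. w \<in> T \<Longrightarrow> coord T w x = coord T w y) \<Longrightarrow> x = y"
  by (metis (no_types, lifting) sum.cong sum_coord)

lemma linear_eq_sum_coord:
  assumes "frame T" "linear f"
  shows "f x = (\<Sum>w\<in>T. coord T w x *\<^sub>R f w)"
  by (metis (no_types, lifting) assms linear_scale linear_sum sum.cong sum_coord)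

lemma inner_eq_sum_coord:
  assumes "frame T"
  shows "h \<bullet> x = (\<Sum>w\<in>T. coord T w x * (h \<bullet> w))"
  by (subst sum_coord[OF assms, symmetric]) (simp add: inner_sum_right)

lemma coord_eq_0_imp_span:
  assumes "frame T" "w \<in> T" "coord T w x = 0"
  shows "x \<in> span (T - {w})"
proof -
  have "x = (\<Sum>v\<in>T. coord T v x *\<^sub>R v)" using sum_coord[OF assms(1)] by simp
  also have "\<dots> = (\<Sum>v\<in>T - {w}. coord T v x *\<^sub>R v)"
    using assms frame_finite[OF assms(1)] by (simp add: sum.remove)
  finally show ?thesis
    by (metis (no_types, lifting) span_base span_scale span_sum)
qed

text \<open>Steinitz exchange: the coordinate at \<open>w\<close> vanishes on the span of
  \<open>T - {w}\<close>, so \<open>v\<close> lies outside this span.\<close>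

lemma coord_pos_exchange:
  assumes "frame T" "w \<in> T" "coord T w v \<noteq> 0"
  shows "frame (insert v (T - {w}))"
proof -
  have fin: "finite T" using assms frame_finite by blast
  have nspan: "v \<notin> span (T - {w})"
  proof
    assume "v \<in> span (T - {w})"
    then have "coord T w v = 0"
    proof (induction rule: span_induct_alt)
      case base then show ?case by (simp add: assms coord_zero)
    next
      case (step c x y)
      then show ?case using assms by (auto simp: coord_add coord_scale coord_basis)
    qed
    then show False using assms by simp
  qed
  have "independent (insert v (T - {w}))"
    using nspan assms unfolding frame_def
    by (simp add: independent_insert independent_mono[of T])
  moreover have "card (insert v (T - {w})) = card T"
    using nspan fin assms(2) span_base[of v "T - {w}"]
    by (metis card.insert card.remove finite_Diff)
  ultimately show ?thesis using assms by (simp add: frame_def)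
qed

lemma linear_functional_inner:
  fixes f :: "'a::euclidean_space \<Rightarrow> real"
  assumes "linear f"
  obtains a where "\<And>x. f x = a \<bullet> x"
proof
  fix x
  have "f x = f (\<Sum>i\<in>Basis. (x \<bullet> i) *\<^sub>R i)" by (simp add: euclidean_representation)
  also have "\<dots> = (\<Sum>i\<in>Basis. f i *\<^sub>R i) \<bullet> x"
    using assms by (simp add: linear_sum linear_scale inner_sum_left inner_commute[of x] mult.commute)
  finally show "f x = (\<Sum>i\<in>Basis. f i *\<^sub>R i) \<bullet> x" .
qed

section \<open>Lattices, discreteness and common denominators\<close>

lemma lattice_basis_0: "lattice_basis k b L \<Longrightarrow> 0 \<in> L"
  unfolding lattice_basis_def by (auto intro!: image_eqI[where x = "\<lambda>_. 0"])

lemma lattice_basis_add: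
  assumes "lattice_basis k b L" "x \<in> L" "y \<in> L" shows "x + y \<in> L"
proof -
  obtain c d where "x = (\<Sum>i<k. of_int (c i) *\<^sub>R b i)" "y = (\<Sum>i<k. of_int (d i) *\<^sub>R b i)"
    using assms unfolding lattice_basis_def by auto
  then have "x + y = (\<Sum>i<k. of_int (c i + d i) *\<^sub>R b i)"
    by (simp add: sum.distrib scaleR_left_distrib)
  then show ?thesis using assms unfolding lattice_basis_def
    by (auto intro!: image_eqI[where x = "\<lambda>i. c i + d i"])
qed

lemma lattice_basis_scale:
  assumes "lattice_basis k b L" "x \<in> L" shows "of_int m *\<^sub>R x \<in> L"
proof -
  obtain c where "x = (\<Sum>i<k. of_int (c i) *\<^sub>R b i)"
    using assms unfolding lattice_basis_def by auto
  then have "of_int m *\<^sub>R x = (\<Sum>i<k. of_int (m * c i) *\<^sub>R b i)"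
    by (simp add: scaleR_sum_right)
  then show ?thesis using assms unfolding lattice_basis_def
    by (auto intro!: image_eqI[where x = "\<lambda>i. m * c i"])
qed

text \<open>Bounded denominators make the group discrete. The least positive \<open>d\<close> with
  \<open>d / k\<close> in \<open>S\<close> divides every other numerator by division with remainder;
  since 1 lies in \<open>S\<close>, it divides \<open>k\<close>, and the generator is 1 / n with
  \<open>k = d * n\<close>.\<close>

lemma real_subgroup_cyclic:
  fixes S :: "real set"
  assumes diff: "\<And>x y. x \<in> S \<Longrightarrow> y \<in> S \<Longrightarrow> x - y \<in> S" and one: "1 \<in> S"
    and k: "k > 0" "\<And>x. x \<in> S \<Longrightarrow> of_nat k * x \<in> \<int>"
  obtains n :: nat where "n > 0" "S = range (\<lambda>j::int. of_int j / of_nat n)"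
proof -
  define P where "P = (\<lambda>d::nat. d > 0 \<and> of_nat d / of_nat k \<in> S)"
  have zero: "0 \<in> S" using diff[OF one one] by simp
  have neg: "- x \<in> S" if "x \<in> S" for x using diff[OF zero that] by simp
  have add: "x + y \<in> S" if "x \<in> S" "y \<in> S" for x y using diff[OF that(1) neg[OF that(2)]] by simp
  have natmul: "of_nat j * x \<in> S" if "x \<in> S" for j x
    by (induction j) (auto simp: zero algebra_simps that add)
  have intmul: "of_int j * x \<in> S" if "x \<in> S" for j x
  proof (cases "j \<ge> 0")
    case True then show ?thesis using natmul[OF that, of "nat j"] by simp
  next
    case False then show ?thesis using neg[OF natmul[OF that, of "nat (- j)"]] by simp
  qed
  have "P k" using one k by (simp add: P_def)
  define d where "d = (LEAST d. P d)"
  have Pd: "P d" unfolding d_def using \<open>P k\<close> by (rule LeastI)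
  then have d0: "d > 0" and dS: "of_nat d / of_nat k \<in> S" by (auto simp: P_def)
  have dvd: "int d dvd j" if "of_int j / of_nat k \<in> S" for j
  proof (rule ccontr)
    assume "\<not> int d dvd j"
    then have pos: "j mod int d > 0"
      by (metis Pd P_def dvd_eq_mod_eq_0 nless_le of_nat_0_less_iff pos_mod_sign)
    have "of_int j / of_nat k - of_int (j div int d) * (of_nat d / of_nat k) \<in> S"
      using diff[OF that intmul[OF dS]] by simp
    also have "of_int j / real k - of_int (j div int d) * (real d / real k) = of_int (j mod int d) / real k"
      using k(1) by (simp add: field_simps minus_div_mult_eq_mod[symmetric])
    finally have "P (nat (j mod int d))" using pos by (simp add: P_def)
    then have "d \<le> nat (j mod int d)" unfolding d_def by (rule Least_le)
    then show False using pos_mod_bound[of "int d" j] d0 pos by linarith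
  qed
  have "int d dvd int k" using dvd[of "int k"] one k by simp
  then obtain n where n: "k = d * n" by auto
  then have n0: "n > 0" using k by auto
  show ?thesis
  proof (rule that[OF n0])
    have eq: "real d / real k = 1 / real n" using n d0 by (simp add: field_simps)
    show "S = range (\<lambda>j::int. of_int j / of_nat n)"
    proof safe
      fix x assume x: "x \<in> S"
      then obtain j where j: "of_nat k * x = of_int j" using k(2) by (metis Ints_cases)
      then have xj: "x = of_int j / of_nat k" using k by (simp add: field_simps)
      then obtain i where "j = int d * i" using dvd x by blast
      then have "x = of_int i / of_nat n" using xj n d0 by (simp add: field_simps)
      then show "x \<in> range (\<lambda>j::int. of_int j / of_nat n)" by blast
    next
      fix j :: int
      have "of_int j * (real d / real k) \<in> S" by (rule intmul[OF dS])
      then show "of_int j / of_nat n \<in> S" by (simp add: eq)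
    qed
  qed
qed

locale lattice =
  fixes N :: "'a::euclidean_space set" and b :: "nat \<Rightarrow> 'a"
  assumes basis: "lattice_basis DIM('a) b N"
begin

lemma N_0: "0 \<in> N" by (rule lattice_basis_0[OF basis])
lemma N_add: "x \<in> N \<Longrightarrow> y \<in> N \<Longrightarrow> x + y \<in> N" by (rule lattice_basis_add[OF basis])
lemma N_scale: "x \<in> N \<Longrightarrow> of_int m *\<^sub>R x \<in> N" by (rule lattice_basis_scale[OF basis])
lemma N_scale_nat: "x \<in> N \<Longrightarrow> of_nat m *\<^sub>R x \<in> N" using N_scale[of x "int m"] by simp
lemma N_neg: "x \<in> N \<Longrightarrow> - x \<in> N" using N_scale[of x "-1"] by simp
lemma N_diff: "x \<in> N \<Longrightarrow> y \<in> N \<Longrightarrow> x - y \<in> N" using N_add[OF _ N_neg] by fastforce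
lemma N_sum: "(\<And>i. i \<in> I \<Longrightarrow> f i \<in> N) \<Longrightarrow> (\<Sum>i\<in>I. f i) \<in> N"
  by (induction I rule: infinite_finite_induct) (auto simp: N_0 N_add)

lemma basis_inj: "inj_on b {..<DIM('a)}" using basis unfolding lattice_basis_def by blast

lemma basis_frame: "frame (b ` {..<DIM('a)})"
  using basis unfolding lattice_basis_def frame_def by (simp add: card_image)

lemma N_iff: "x \<in> N \<longleftrightarrow> (\<forall>i<DIM('a). coord (b ` {..<DIM('a)}) (b i) x \<in> \<int>)"
proof
  let ?B = "b ` {..<DIM('a)}"
  assume "x \<in> N"
  then obtain c :: "nat \<Rightarrow> int" where c: "x = (\<Sum>i<DIM('a). of_int (c i) *\<^sub>R b i)"
    using basis unfolding lattice_basis_def by auto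
  then have "x = (\<Sum>v\<in>?B. of_int (c (inv_into {..<DIM('a)} b v)) *\<^sub>R v)"
    by (simp add: sum.reindex[OF basis_inj] inv_into_f_f[OF basis_inj])
  then show "\<forall>i<DIM('a). coord ?B (b i) x \<in> \<int>"
    using coord_unique[OF basis_frame, of _ x "\<lambda>v. of_int (c (inv_into {..<DIM('a)} b v))"] by auto
next
  let ?B = "b ` {..<DIM('a)}"
  assume *: "\<forall>i<DIM('a). coord ?B (b i) x \<in> \<int>"
  have "x = (\<Sum>v\<in>?B. coord ?B v x *\<^sub>R v)" using sum_coord[OF basis_frame] by simp
  also have "\<dots> = (\<Sum>i<DIM('a). coord ?B (b i) x *\<^sub>R b i)" by (simp add: sum.reindex[OF basis_inj])
  also have "\<dots> = (\<Sum>i<DIM('a). of_int \<lfloor>coord ?B (b i) x\<rfloor> *\<^sub>R b i)" using * by (intro sum.cong) auto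
  finally have "x = (\<Sum>i<DIM('a). of_int \<lfloor>coord ?B (b i) x\<rfloor> *\<^sub>R b i)" .
  moreover have "N = range (\<lambda>c :: nat \<Rightarrow> int. \<Sum>i<DIM('a). of_int (c i) *\<^sub>R b i)"
    using basis unfolding lattice_basis_def by blast
  ultimately show "x \<in> N" by (elim ssubst[of N]) (rule range_eqI)
qed

lemma basis_in: "i < DIM('a) \<Longrightarrow> b i \<in> N"
  by (simp add: N_iff coord_basis[OF basis_frame])

text \<open>Coordinates with respect to the lattice basis are bounded on \<open>S\<close>, which
  leaves finitely many integer coordinate vectors.\<close>

lemma finite_N_bounded:
  assumes "bounded S" shows "finite (N \<inter> S)"
proof -
  let ?B = "b ` {..<DIM('a)}"
  have "\<exists>c. \<forall>x\<in>S. \<bar>coord ?B (b i) x\<bar> \<le> c" for i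
    using bounded_linear_image[OF assms linear_conv_bounded_linear[THEN iffD1, OF linear_coord[OF basis_frame]], of "b i"]
    by (auto simp: bounded_iff)
  then obtain c where c: "\<And>i x. x \<in> S \<Longrightarrow> \<bar>coord ?B (b i) x\<bar> \<le> c i" by metis
  let ?F = "PiE {..<DIM('a)} (\<lambda>i. {-\<lceil>c i\<rceil>..\<lceil>c i\<rceil>})"
  have "N \<inter> S \<subseteq> (\<lambda>f. \<Sum>i<DIM('a). of_int (f i) *\<^sub>R b i) ` ?F"
  proof
    fix x assume x: "x \<in> N \<inter> S"
    let ?f = "\<lambda>i\<in>{..<DIM('a)}. \<lfloor>coord ?B (b i) x\<rfloor>"
    have "x = (\<Sum>v\<in>?B. coord ?B v x *\<^sub>R v)" using sum_coord[OF basis_frame] by simp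
    also have "\<dots> = (\<Sum>i<DIM('a). coord ?B (b i) x *\<^sub>R b i)" by (simp add: sum.reindex[OF basis_inj])
    also have "\<dots> = (\<Sum>i<DIM('a). of_int (?f i) *\<^sub>R b i)"
      using x N_iff[of x] by (intro sum.cong) auto
    finally have "x = \<dots>" .
    moreover have "?f \<in> ?F"
    proof (intro PiE_I)
      fix i assume "i \<in> {..<DIM('a)}"
      then show "?f i \<in> {-\<lceil>c i\<rceil>..\<lceil>c i\<rceil>}"
        using c[of x i] x le_of_int_ceiling[of "c i"] by (simp add: abs_le_iff) linarith
    qed auto
    ultimately show "x \<in> (\<lambda>f. \<Sum>i<DIM('a). of_int (f i) *\<^sub>R b i) ` ?F" by blast
  qed
  then show ?thesis by (rule finite_subset) (auto intro!: finite_imageI finite_PiE)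
qed

text \<open>Pigeonhole: reducing the multiples of \<open>x\<close> modulo the vectors of
  \<open>T\<close> gives lattice points in a bounded region, so two multiples \<open>i\<close> and
  \<open>j\<close> have the same reduction, and \<open>j - i\<close> clears the denominators of
  \<open>x\<close>. The product of such numbers over the lattice basis serves all of
  \<open>N\<close>.\<close>

lemma coord_common_denominator:
  assumes T: "frame T" "T \<subseteq> N"
  obtains k :: nat where "k > 0" "\<And>x w. x \<in> N \<Longrightarrow> w \<in> T \<Longrightarrow> of_nat k * coord T w x \<in> \<int>"
proof -
  have fin: "finite T" using T frame_finite by blast
  have single: "\<exists>k>0. \<forall>w\<in>T. of_nat k * coord T w x \<in> \<int>" if x: "x \<in> N" for x
  proof -
    define y where "y = (\<lambda>j::nat. \<Sum>w\<in>T. frac (of_nat j * coord T w x) *\<^sub>R w)"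
    have yN: "y j \<in> N" for j
    proof -
      have "y j = of_nat j *\<^sub>R x - (\<Sum>w\<in>T. of_int \<lfloor>of_nat j * coord T w x\<rfloor> *\<^sub>R w)"
        unfolding y_def frac_def
        by (subst (2) sum_coord[OF T(1), of x, symmetric])
           (simp add: scaleR_left_diff_distrib sum_subtractf scaleR_sum_right)
      also have "\<dots> \<in> N" using T x by (intro N_diff N_scale_nat N_sum N_scale) auto
      finally show ?thesis .
    qed
    have "norm (y j) \<le> (\<Sum>w\<in>T. norm w)" for j
      unfolding y_def
      by (rule sum_norm_le)
         (auto simp: frac_lt_1 less_imp_le mult_le_cancel_right1 mult_left_le_one_le)
    then have "range y \<subseteq> N \<inter> cball 0 (\<Sum>w\<in>T. norm w)" using yN by auto
    then have "finite (range y)" using finite_N_bounded[OF bounded_cball] finite_subset by blast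
    then have "\<not> inj y" using finite_imageD infinite_UNIV_nat by blast
    then obtain i j where ij: "i < j" "y i = y j" unfolding inj_on_def by (metis nat_neq_iff)
    have "of_nat (j - i) * coord T w x \<in> \<int>" if "w \<in> T" for w
    proof -
      have "frac (of_nat i * coord T w x) = frac (of_nat j * coord T w x)"
        using ij(2) coord_lincomb[OF T(1) that] unfolding y_def by metis
      then have "of_nat j * coord T w x - of_nat i * coord T w x
          = of_int (\<lfloor>of_nat j * coord T w x\<rfloor> - \<lfloor>of_nat i * coord T w x\<rfloor>)"
        by (simp add: frac_def)
      then show ?thesis using ij(1) by (metis Ints_of_int left_diff_distrib less_imp_le of_nat_diff)
    qed
    then show ?thesis using ij by (intro exI[of _ "j - i"]) auto
  qed
  then have "\<exists>k>0. \<forall>w\<in>T. of_nat k * coord T w (b i) \<in> \<int>" if "i < DIM('a)" for i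
    using basis_in that by blast
  then obtain K where K: "\<And>i. i < DIM('a) \<Longrightarrow> K i > 0"
    "\<And>i w. i < DIM('a) \<Longrightarrow> w \<in> T \<Longrightarrow> of_nat (K i) * coord T w (b i) \<in> \<int>" by metis
  define k where "k = (\<Prod>i<DIM('a). K i)"
  have k0: "k > 0" using K by (auto simp: k_def prod_pos)
  have kb: "of_nat k * coord T w (b i) \<in> \<int>" if "i < DIM('a)" "w \<in> T" for i w
  proof -
    have "k = K i * (\<Prod>j\<in>{..<DIM('a)}-{i}. K j)" unfolding k_def using that by (simp add: prod.remove)
    then have "of_nat k * coord T w (b i) = of_nat (\<Prod>j\<in>{..<DIM('a)}-{i}. K j) * (of_nat (K i) * coord T w (b i))"
      by simp
    then show ?thesis using K that by (metis Ints_mult Ints_of_nat)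
  qed
  show ?thesis
  proof (rule that[OF k0])
    fix x w assume x: "x \<in> N" and w: "w \<in> T"
    obtain c :: "nat \<Rightarrow> int" where c: "x = (\<Sum>i<DIM('a). of_int (c i) *\<^sub>R b i)"
      using basis x unfolding lattice_basis_def by auto
    have "of_nat k * coord T w x = (\<Sum>i<DIM('a). of_int (c i) * (of_nat k * coord T w (b i)))"
      using T by (simp add: c coord_sum coord_scale sum_distrib_left mult_ac)
    also have "\<dots> \<in> \<int>" using kb w by (intro Ints_sum Ints_mult[OF Ints_of_int]) auto
    finally show "of_nat k * coord T w x \<in> \<int>" .
  qed
qed

end

section \<open>Generic weights\<close>

text \<open>The members of \<open>D\<close> are linear forms in the weights. Once the other weights
  are fixed, a form with \<open>d u \<noteq> 0\<close> forbids a single value at \<open>u\<close>,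
  and a form with \<open>d u = 0\<close> is left to the induction hypothesis; an open interval has
  room to avoid finitely many values.\<close>

lemma generic_weights:
  fixes f :: "'v \<Rightarrow> real" and D :: "('v \<Rightarrow> real) set"
  assumes "finite V" "finite D" "\<And>d. d \<in> D \<Longrightarrow> \<exists>v\<in>V. d v \<noteq> 0" "\<eta> > 0"
  shows "\<exists>\<omega>. (\<forall>v\<in>V. \<bar>\<omega> v - f v\<bar> < \<eta>) \<and> (\<forall>d\<in>D. (\<Sum>v\<in>V. d v * \<omega> v) \<noteq> 0)"
  using assms(1,2,3)
proof (induction V arbitrary: D rule: finite_induct)
  case empty
  have "D = {}" using empty.prems(2) by blast
  then show ?case by simp
next
  case (insert u V)
  let ?D = "{d\<in>D. \<exists>v\<in>V. d v \<noteq> 0}"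
  have "\<exists>\<omega>. (\<forall>v\<in>V. \<bar>\<omega> v - f v\<bar> < \<eta>) \<and> (\<forall>d\<in>?D. (\<Sum>v\<in>V. d v * \<omega> v) \<noteq> 0)"
    by (rule insert.IH) (simp_all add: insert.prems(1))
  then obtain \<omega> where w: "\<forall>v\<in>V. \<bar>\<omega> v - f v\<bar> < \<eta>" "\<forall>d\<in>?D. (\<Sum>v\<in>V. d v * \<omega> v) \<noteq> 0"
    by (elim exE conjE)
  \<comment> \<open>For \<open>d u = 0\<close> the quotient is 0 by convention, so at worst one more
    value is avoided.\<close>
  let ?bad = "(\<lambda>d. - (\<Sum>v\<in>V. d v * \<omega> v) / d u) ` D"
  have inf: "infinite {f u - \<eta><..<f u + \<eta>}" using assms(4) by (simp add: infinite_Ioo)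
  have fin: "finite ?bad" using insert.prems(1) by (rule finite_imageI)
  have "\<not> {f u - \<eta><..<f u + \<eta>} \<subseteq> ?bad" using finite_subset[OF _ fin] inf by blast
  then obtain t where t: "t \<in> {f u - \<eta><..<f u + \<eta>}" "t \<notin> ?bad"
    by (auto simp: subset_iff)
  define g where "g = (\<lambda>v. if v = u then t else \<omega> v)"
  have 1: "(\<Sum>v\<in>insert u V. d v * g v) \<noteq> 0" if d: "d \<in> D" for d
  proof -
    have "(\<Sum>v\<in>V. d v * g v) = (\<Sum>v\<in>V. d v * \<omega> v)"
      using insert.hyps by (intro sum.cong) (auto simp: g_def)
    then have eq: "(\<Sum>v\<in>insert u V. d v * g v) = d u * t + (\<Sum>v\<in>V. d v * \<omega> v)"
      using insert.hyps by (simp add: g_def)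
    show ?thesis
    proof (cases "d u = 0")
      case True
      then have "d \<in> ?D" using insert.prems(2)[OF d] d by simp
      then show ?thesis using w(2) eq True by simp
    next
      case False
      have "t \<noteq> - (\<Sum>v\<in>V. d v * \<omega> v) / d u" using t d by blast
      then show ?thesis using eq False by (simp add: field_simps)
    qed
  qed
  have 2: "\<forall>v\<in>insert u V. \<bar>g v - f v\<bar> < \<eta>" using w(1) t(1) by (simp add: g_def abs_less_iff)
  show ?case by (rule exI[of _ g], rule conjI[OF 2], rule ballI, rule 1)
qed

text \<open>Perturbation of the constant weight 1 on two scales. Forms with positive coefficient sum
  are positive to leading order, those with sum zero are decided by the correction \<open>q\<close>.
  These are finitely many strict inequalities, so they survive a further, smaller perturbation into
  generic position.\<close>

lemma generic_weights_strict:
  fixes q :: "'v \<Rightarrow> real" and D D' :: "('v \<Rightarrow> real) set"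
  assumes V: "finite V" and D: "finite D" "finite D'"
    and nz: "\<And>d. d \<in> D' \<Longrightarrow> \<exists>v\<in>V. d v \<noteq> 0"
    and pos: "\<And>d. d \<in> D \<Longrightarrow> (\<Sum>v\<in>V. d v) > 0 \<or> (\<Sum>v\<in>V. d v) = 0 \<and> (\<Sum>v\<in>V. d v * q v) > 0"
  obtains \<omega> where "\<And>v. v \<in> V \<Longrightarrow> \<omega> v > 0" "\<And>d. d \<in> D \<Longrightarrow> (\<Sum>v\<in>V. d v * \<omega> v) > 0"
    "\<And>d. d \<in> D' \<Longrightarrow> (\<Sum>v\<in>V. d v * \<omega> v) \<noteq> 0"
proof -
  have lim: "((\<lambda>e. a + e * c) \<longlongrightarrow> a) (at_right 0)" for a c :: real
    by (rule tendsto_eq_rhs[OF tendsto_add[OF tendsto_const tendsto_mult[OF tendsto_ident_at tendsto_const]]]) simp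
  have gt0: "\<forall>\<^sub>F e in at_right (0::real). e > 0" by (rule eventually_at_right_less)
  have 1: "\<forall>\<^sub>F e in at_right (0::real). (\<Sum>v\<in>V. d v) + e * (\<Sum>v\<in>V. d v * q v) > 0" if "d \<in> D" for d
    using pos[OF that]
  proof
    assume "(\<Sum>v\<in>V. d v) > 0"
    then show ?thesis by (rule order_tendstoD(1)[OF lim])
  next
    assume *: "(\<Sum>v\<in>V. d v) = 0 \<and> (\<Sum>v\<in>V. d v * q v) > 0"
    show ?thesis by (rule eventually_mono[OF gt0]) (simp add: *)
  qed
  have 2: "\<forall>\<^sub>F e in at_right (0::real). 1 + e * q v > 0" for v
    by (rule order_tendstoD(1)[OF lim]) simp
  have "\<forall>\<^sub>F e in at_right (0::real). (\<forall>d\<in>D. (\<Sum>v\<in>V. d v) + e * (\<Sum>v\<in>V. d v * q v) > 0) \<and> (\<forall>v\<in>V. 1 + e * q v > 0)"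
    using 1 2 V D by (intro eventually_conj eventually_ball_finite) auto
  from eventually_happens'[OF trivial_limit_at_right_real this] obtain e
    where e0: "(\<forall>d\<in>D. (\<Sum>v\<in>V. d v) + e * (\<Sum>v\<in>V. d v * q v) > 0) \<and> (\<forall>v\<in>V. 1 + e * q v > 0)"
    by (elim exE)
  note e = e0[THEN conjunct1, rule_format] e0[THEN conjunct2, rule_format]
  define f where "f v = 1 + e * q v" for v
  have f: "(\<Sum>v\<in>V. d v * f v) > 0" if "d \<in> D" for d
    using e(1)[OF that] by (simp add: f_def distrib_left sum.distrib sum_distrib_left mult.left_commute)
  have 3: "\<forall>\<^sub>F x in at_right (0::real). (\<Sum>v\<in>V. d v * f v) - x * (\<Sum>v\<in>V. \<bar>d v\<bar>) > 0" if "d \<in> D" for d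
    using order_tendstoD(1)[OF lim f[OF that], of "- (\<Sum>v\<in>V. \<bar>d v\<bar>)"] by simp
  have 4: "\<forall>\<^sub>F x in at_right (0::real). x < f v" if "v \<in> V" for v
    using order_tendstoD(2)[OF tendsto_ident_at, of 0 "f v"] e(2)[OF that] by (simp add: f_def)
  have "\<forall>\<^sub>F x in at_right (0::real). (\<forall>d\<in>D. (\<Sum>v\<in>V. d v * f v) - x * (\<Sum>v\<in>V. \<bar>d v\<bar>) > 0)
      \<and> (\<forall>v\<in>V. x < f v) \<and> x > 0"
    using 3 4 V D gt0 by (intro eventually_conj eventually_ball_finite) auto
  from eventually_happens'[OF trivial_limit_at_right_real this] obtain \<eta>
    where \<eta>0: "(\<forall>d\<in>D. (\<Sum>v\<in>V. d v * f v) - \<eta> * (\<Sum>v\<in>V. \<bar>d v\<bar>) > 0) \<and> (\<forall>v\<in>V. \<eta> < f v) \<and> \<eta> > 0"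
    by (elim exE)
  note \<eta> = \<eta>0[THEN conjunct1, rule_format] \<eta>0[THEN conjunct2, THEN conjunct1, rule_format] \<eta>0[THEN conjunct2, THEN conjunct2]
  obtain \<omega> where w: "\<forall>v\<in>V. \<bar>\<omega> v - f v\<bar> < \<eta>" "\<forall>d\<in>D'. (\<Sum>v\<in>V. d v * \<omega> v) \<noteq> 0"
    using generic_weights[OF V D(2) nz \<eta>(3)] by blast
  show ?thesis
  proof (rule that)
    fix v assume "v \<in> V" then show "\<omega> v > 0" using w(1)[rule_format, of v] \<eta>(2)[of v] by linarith
  next
    fix d assume d: "d \<in> D"
    have le: "\<bar>d v\<bar> * \<bar>\<omega> v - f v\<bar> \<le> \<bar>d v\<bar> * \<eta>" if "v \<in> V" for v
      using w(1)[rule_format, OF that] by (intro mult_left_mono) simp_all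
    have "\<bar>\<Sum>v\<in>V. d v * (\<omega> v - f v)\<bar> \<le> (\<Sum>v\<in>V. \<bar>d v * (\<omega> v - f v)\<bar>)" by (rule sum_abs)
    also have "\<dots> \<le> (\<Sum>v\<in>V. \<bar>d v\<bar> * \<eta>)" using le by (intro sum_mono) (simp add: abs_mult)
    also have "\<dots> = \<eta> * (\<Sum>v\<in>V. \<bar>d v\<bar>)" by (simp add: sum_distrib_left mult.commute)
    finally have "\<bar>\<Sum>v\<in>V. d v * (\<omega> v - f v)\<bar> \<le> \<eta> * (\<Sum>v\<in>V. \<bar>d v\<bar>)" .
    moreover have "(\<Sum>v\<in>V. d v * (\<omega> v - f v)) = (\<Sum>v\<in>V. d v * \<omega> v) - (\<Sum>v\<in>V. d v * f v)"
      by (simp add: right_diff_distrib sum_subtractf)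
    ultimately have "(\<Sum>v\<in>V. d v * \<omega> v) \<ge> (\<Sum>v\<in>V. d v * f v) - \<eta> * (\<Sum>v\<in>V. \<bar>d v\<bar>)"
      by linarith
    then show "(\<Sum>v\<in>V. d v * \<omega> v) > 0" using \<eta>(1)[OF d] by linarith
  next
    fix d assume "d \<in> D'" then show "(\<Sum>v\<in>V. d v * \<omega> v) \<noteq> 0" using w(2) by blast
  qed
qed

section \<open>The gauge of a polytope\<close>

text \<open>The finite set \<open>E\<close> merely cuts out \<open>\<Delta>\<close> and may contain
  functionals that support no facet. Later arguments therefore take maxima and minima over
  \<open>E\<close>, or treat arbitrary valid functionals.\<close>

locale fano = lattice N b for N :: "'a::euclidean_space set" and b +
  fixes \<Delta> E :: "'a set"
  assumes lattice_polytope: "lattice_polytope N \<Delta>"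
    and finite_E: "finite E"
    and \<Delta>_eq: "\<Delta> = {x. \<forall>h\<in>E. h \<bullet> x \<le> 1}"
    and interior_N: "interior \<Delta> \<inter> N = {0}"
begin

lemma polytope: "polytope \<Delta>" using lattice_polytope by (simp add: lattice_polytope_def)
lemma bounded: "bounded \<Delta>" using polytope polytope_imp_bounded by blast

text \<open>Otherwise the whole ray through \<open>x\<close> would lie in the bounded set
  \<open>\<Delta>\<close>.\<close>

lemma not_all_nonpos:
  assumes "x \<noteq> 0" shows "\<exists>h\<in>E. h \<bullet> x > 0"
proof (rule ccontr)
  assume "\<not> (\<exists>h\<in>E. h \<bullet> x > 0)"
  then have le: "h \<bullet> x \<le> 0" if "h \<in> E" for h using that by (simp add: not_less)
  obtain B where B: "\<And>y. y \<in> \<Delta> \<Longrightarrow> norm y \<le> B" using bounded bounded_iff by blast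
  define c where "c = (\<bar>B\<bar> + 1) / norm x"
  have "c \<ge> 0" by (simp add: c_def)
  then have "c *\<^sub>R x \<in> \<Delta>" unfolding \<Delta>_eq using le
    by (auto intro: order.trans[OF mult_nonneg_nonpos])
  then have "norm (c *\<^sub>R x) \<le> B" by (rule B)
  then show False using assms by (simp add: c_def)
qed

lemma E_nonempty: "E \<noteq> {}"
proof -
  obtain i :: 'a where "i \<in> Basis" using nonempty_Basis by blast
  then have "i \<noteq> 0" by auto
  then show ?thesis using not_all_nonpos by blast
qed

text \<open>The Minkowski functional of \<open>\<Delta>\<close>. Written as a maximum, it gives
  access to the functionals that are active at a point.\<close>

definition gauge :: "'a \<Rightarrow> real" where "gauge x = Max ((\<lambda>h. h \<bullet> x) ` E)"

lemma gauge_ge: "h \<in> E \<Longrightarrow> h \<bullet> x \<le> gauge x"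
  unfolding gauge_def using finite_E by simp

lemma gauge_attained: obtains h where "h \<in> E" "h \<bullet> x = gauge x"
proof -
  have "gauge x \<in> (\<lambda>h. h \<bullet> x) ` E"
    unfolding gauge_def by (rule Max_in) (simp_all add: finite_E E_nonempty)
  then show ?thesis by (elim imageE) (rule that, simp_all)
qed

lemma gauge_le_iff: "gauge x \<le> c \<longleftrightarrow> (\<forall>h\<in>E. h \<bullet> x \<le> c)"
  unfolding gauge_def using finite_E E_nonempty by simp

lemma gauge_pos: "x \<noteq> 0 \<Longrightarrow> gauge x > 0"
  using not_all_nonpos gauge_ge by (metis less_le_trans)

lemma gauge_0: "gauge 0 = 0"
  using gauge_attained[of 0] by auto

lemma gauge_scale: assumes "c \<ge> 0" shows "gauge (c *\<^sub>R x) = c * gauge x"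
proof -
  obtain h where "h \<in> E" "h \<bullet> (c *\<^sub>R x) = gauge (c *\<^sub>R x)" by (rule gauge_attained)
  moreover obtain h' where "h' \<in> E" "h' \<bullet> x = gauge x" by (rule gauge_attained)
  moreover from this have "h' \<bullet> (c *\<^sub>R x) = c * gauge x" by simp
  ultimately show ?thesis
    using gauge_ge[of h x] gauge_ge[of h' "c *\<^sub>R x"] assms
    by (metis antisym inner_scaleR_right mult_left_mono)
qed

lemma gauge_add: "gauge (x + y) \<le> gauge x + gauge y"
  by (simp add: gauge_le_iff inner_add_right add_mono gauge_ge)

lemma \<Delta>_iff: "x \<in> \<Delta> \<longleftrightarrow> gauge x \<le> 1"
  by (simp add: gauge_le_iff \<Delta>_eq)

lemma zero_interior: "0 \<in> interior \<Delta>" using interior_N by blast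

lemma gauge_less_1_interior: assumes "gauge x < 1" shows "x \<in> interior \<Delta>"
proof -
  have "open (\<Inter>h\<in>E. {x. h \<bullet> x < 1})"
    using finite_E by (intro open_INT) (auto simp: open_halfspace_lt)
  moreover have "(\<Inter>h\<in>E. {x. h \<bullet> x < 1}) \<subseteq> \<Delta>" by (auto simp: \<Delta>_eq less_imp_le)
  moreover have "x \<in> (\<Inter>h\<in>E. {x. h \<bullet> x < 1})"
    using assms gauge_ge[of _ x] by (auto intro: le_less_trans)
  ultimately show ?thesis by (meson interiorI)
qed

lemma N_gauge_less_1: "x \<in> N \<Longrightarrow> gauge x < 1 \<Longrightarrow> x = 0"
  using gauge_less_1_interior interior_N by blast

text \<open>Scaling \<open>x\<close> to gauge 1 puts it into \<open>\<Delta>\<close>. This brings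
  functionals outside \<open>E\<close> under control, such as those exposing an edge.\<close>

lemma valid_le_gauge:
  assumes "\<And>x. x \<in> \<Delta> \<Longrightarrow> h \<bullet> x \<le> 1" shows "h \<bullet> x \<le> gauge x"
proof (cases "x = 0")
  case True then show ?thesis by (simp add: gauge_0)
next
  case False
  then have g: "gauge x > 0" by (rule gauge_pos)
  have "gauge ((1 / gauge x) *\<^sub>R x) = 1" using g by (simp add: gauge_scale)
  then have "(1 / gauge x) *\<^sub>R x \<in> \<Delta>" by (simp add: \<Delta>_iff)
  then have "h \<bullet> ((1 / gauge x) *\<^sub>R x) \<le> 1" by (rule assms)
  then show ?thesis using g by (simp add: field_simps)
qed

text \<open>All lattice points on the boundary (see \<open>gauge_V\<close>), not only the vertices
  of \<open>\<Delta>\<close>: the triangulation has to use each of them to leave no lattice point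
  inside a triangle.\<close>

definition V :: "'a set" where "V = N \<inter> \<Delta> - {0}"

lemma finite_V: "finite V"
  unfolding V_def using finite_N_bounded[OF bounded] by simp

lemma V_N: "V \<subseteq> N" and V_\<Delta>: "V \<subseteq> \<Delta>" and V_nonzero: "v \<in> V \<Longrightarrow> v \<noteq> 0" by (auto simp: V_def)

lemma gauge_V: "v \<in> V \<Longrightarrow> gauge v = 1"
  using N_gauge_less_1[of v] \<Delta>_iff[of v] unfolding V_def by (auto simp: le_less)

lemma V_inner_le: "v \<in> V \<Longrightarrow> h \<in> E \<Longrightarrow> h \<bullet> v \<le> 1"
  using gauge_ge[of h v] gauge_V by simp

lemma extreme_points_V: "{v. v extreme_point_of \<Delta>} \<subseteq> V"
proof -
  have "\<not> 0 extreme_point_of \<Delta>" using zero_interior extreme_point_not_in_interior by blast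
  then show ?thesis using lattice_polytope unfolding lattice_polytope_def V_def
    by (auto simp: extreme_point_of_def)
qed

lemma hull_V: "convex hull V = \<Delta>"
proof
  have "convex \<Delta>" using polytope polytope_imp_convex by blast
  then show "convex hull V \<subseteq> \<Delta>" using V_\<Delta> by (simp add: hull_minimal)
  have "\<Delta> = convex hull {v. v extreme_point_of \<Delta>}"
    using polytope by (simp add: Krein_Milman_polytope polytope_imp_compact polytope_imp_convex
      Krein_Milman_Minkowski)
  then show "\<Delta> \<subseteq> convex hull V" using hull_mono[OF extreme_points_V] by metis
qed

lemma V_combination:
  assumes "x \<in> \<Delta>"
  shows "\<exists>c. (\<forall>v\<in>V. c v \<ge> 0) \<and> (\<Sum>v\<in>V. c v) = 1 \<and> x = (\<Sum>v\<in>V. c v *\<^sub>R v)"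
proof -
  have "x \<in> convex hull V" using assms hull_V by simp
  then show ?thesis unfolding convex_hull_finite[OF finite_V] by blast
qed

end

section \<open>Triangulation of the boundary\<close>

lemma finite_ex_min:
  fixes f :: "'b \<Rightarrow> real"
  assumes "finite P" "P \<noteq> {}"
  shows "\<exists>w\<in>P. \<forall>u\<in>P. f w \<le> f u"
  using ex_is_arg_min_if_finite[OF assms, of f] by (auto simp: is_arg_min_linorder)

context fano
begin

text \<open>Membership in a proper subspace spanned by points of \<open>V\<close> is excluded so
  that all coordinates with respect to all frames in \<open>V\<close> are nonzero. Only finitely
  many subspaces are involved.\<close>

definition generic :: "'a \<Rightarrow> bool" where
  "generic x \<longleftrightarrow> (\<forall>S\<subseteq>V. span S \<noteq> UNIV \<longrightarrow> x \<notin> span S)"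

lemma generic_nonzero: "generic x \<Longrightarrow> x \<noteq> 0"
  unfolding generic_def by (metis empty_subsetI insertI1 nonempty_Basis nonzero_Basis span_empty
      singletonD UNIV_I equals0I)

lemma generic_neg: "generic x \<Longrightarrow> generic (- x)"
  unfolding generic_def by (metis add.inverse_inverse span_neg)

lemma generic_coord:
  assumes "generic x" "frame T" "T \<subseteq> V" "w \<in> T"
  shows "coord T w x \<noteq> 0"
proof
  assume "coord T w x = 0"
  then have x: "x \<in> span (T - {w})" using assms by (intro coord_eq_0_imp_span)
  have "card (T - {w}) < DIM('a)"
    using assms frame_finite[of T] by (simp add: frame_def card_gt_0_iff)
  then have "span (T - {w}) \<noteq> (UNIV :: 'a set)"
    by (metis assms(2) dim_UNIV dim_le_card' dim_span finite_Diff frame_finite linorder_not_less)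
  then show False using x assms unfolding generic_def by blast
qed

lemma finite_spans: "finite {span S | S. S \<subseteq> V \<and> span S \<noteq> UNIV}"
  using finite_V by simp

lemma generic_exists: obtains x where "generic x"
proof -
  have "negligible (\<Union> {span S | S. S \<subseteq> V \<and> span S \<noteq> UNIV})"
  proof (rule negligible_Union[OF finite_spans])
    fix W assume "W \<in> {span S | S. S \<subseteq> V \<and> span S \<noteq> UNIV}"
    then obtain S where "W = span S" "span S \<noteq> UNIV" by blast
    then show "negligible W"
      by (metis dim_eq_full dim_span dim_subset_UNIV le_neq_implies_less negligible_lowdim span_span)
  qed
  moreover define A where "A = \<Union> {span S | S. S \<subseteq> V \<and> span S \<noteq> UNIV}"
  ultimately have "A \<noteq> UNIV" using open_not_negligible[OF open_UNIV UNIV_not_empty] by metis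
  then obtain x where x: "x \<notin> A" by blast
  have "generic x" unfolding generic_def
  proof (intro allI impI notI)
    fix S assume "S \<subseteq> V" "span S \<noteq> UNIV" "x \<in> span S"
    then have "x \<in> A" unfolding A_def by blast
    then show False using x by simp
  qed
  then show ?thesis by (rule that)
qed

text \<open>The direction \<open>\<xi>\<close> lies outside each of the finitely many subspaces, so
  the line through \<open>x\<close> meets each of them at most once.\<close>

lemma generic_perturb:
  assumes "generic \<xi>"
  shows "\<forall>\<^sub>F e in at_right (0::real). generic (x + e *\<^sub>R \<xi>)"
proof -
  have "\<forall>\<^sub>F e in at_right (0::real). x + e *\<^sub>R \<xi> \<notin> W"
    if W: "W \<in> {span S | S. S \<subseteq> V \<and> span S \<noteq> UNIV}" for W
  proof -
    obtain S where S: "W = span S" "S \<subseteq> V" "span S \<noteq> UNIV" using W by blast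
    have un: "e = e'" if "x + e *\<^sub>R \<xi> \<in> W" "x + e' *\<^sub>R \<xi> \<in> W" for e e'
    proof (rule ccontr)
      assume ne: "e \<noteq> e'"
      have "(1 / (e - e')) *\<^sub>R ((x + e *\<^sub>R \<xi>) - (x + e' *\<^sub>R \<xi>)) \<in> W"
        using that unfolding S by (intro span_scale span_diff)
      also have "(1 / (e - e')) *\<^sub>R ((x + e *\<^sub>R \<xi>) - (x + e' *\<^sub>R \<xi>)) = \<xi>"
        using ne by (simp add: scaleR_left_diff_distrib[symmetric])
      finally show False using assms S unfolding generic_def by blast
    qed
    show ?thesis
    proof (cases "\<exists>c. x + c *\<^sub>R \<xi> \<in> W")
      case True
      then obtain c where c: "x + c *\<^sub>R \<xi> \<in> W" by blast
      have "\<forall>\<^sub>F e in at_right (0::real). e \<noteq> c" by (rule eventually_neq_at_within)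
      then show ?thesis by (rule eventually_mono) (use un c in blast)
    next
      case False then show ?thesis by simp
    qed
  qed
  then have "\<forall>\<^sub>F e in at_right (0::real). \<forall>W\<in>{span S | S. S \<subseteq> V \<and> span S \<noteq> UNIV}. x + e *\<^sub>R \<xi> \<notin> W"
    using finite_spans by (intro eventually_ball_finite) blast+
  then show ?thesis by (rule eventually_mono) (auto simp: generic_def)
qed

text \<open>Scaled to gauge 1, \<open>x\<close> lies on a supporting hyperplane of
  \<open>\<Delta>\<close>, and only points of \<open>V\<close> on this hyperplane enter its convex
  combination. Caratheodory's theorem leaves at most \<open>DIM('a)\<close> of them, and genericity
  forces these to span the space.\<close>

lemma generic_in_frame:
  assumes "generic x"
  obtains T where "T \<subseteq> V" "frame T" "\<And>w. w \<in> T \<Longrightarrow> coord T w x \<ge> 0"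
proof -
  have g: "gauge x > 0" using generic_nonzero[OF assms] by (rule gauge_pos)
  define y where "y = (1 / gauge x) *\<^sub>R x"
  have gy: "gauge y = 1" using g by (simp add: y_def gauge_scale)
  have xy: "x = gauge x *\<^sub>R y" using g by (simp add: y_def)
  obtain h where h: "h \<in> E" "h \<bullet> y = 1" using gauge_attained gy by metis
  have "y \<in> \<Delta>" by (simp add: \<Delta>_iff gy)
  then obtain c where c: "\<And>v. v \<in> V \<Longrightarrow> c v \<ge> 0" "(\<Sum>v\<in>V. c v) = 1" "y = (\<Sum>v\<in>V. c v *\<^sub>R v)"
    using V_combination by blast
  define W where "W = {v\<in>V. h \<bullet> v = 1}"
  have WV: "W \<subseteq> V" by (auto simp: W_def)
  have "(\<Sum>v\<in>V. c v * (1 - h \<bullet> v)) = (\<Sum>v\<in>V. c v) - h \<bullet> y"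
    by (simp add: c(3) right_diff_distrib sum_subtractf inner_sum_right)
  then have "(\<Sum>v\<in>V. c v * (1 - h \<bullet> v)) = 0" using c(2) h(2) by simp
  then have "\<forall>v\<in>V. c v * (1 - h \<bullet> v) = 0"
    using c(1) V_inner_le[OF _ h(1)] by (subst (asm) sum_nonneg_eq_0_iff[OF finite_V]) auto
  then have c0: "c v = 0" if "v \<in> V - W" for v using that by (auto simp: W_def)
  have yW: "y \<in> convex hull W"
    unfolding convex_hull_finite[OF finite_subset[OF WV finite_V]]
  proof (intro CollectI exI[of _ c] conjI ballI)
    show "sum c W = 1"
      using c(2) sum.mono_neutral_left[OF finite_V WV, of c] c0 by auto
    show "(\<Sum>x\<in>W. c x *\<^sub>R x) = y"
      unfolding c(3) using c0 by (intro sum.mono_neutral_left[OF finite_V WV]) auto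
  qed (use c(1) WV in auto)
  have "\<exists>S. finite S \<and> S \<subseteq> W \<and> card S \<le> aff_dim W + 1 \<and> y \<in> convex hull S"
    using equalityD1[OF caratheodory_aff_dim[of W], THEN subsetD, OF yW] by (simp only: mem_Collect_eq)
  then obtain S where S: "finite S" "S \<subseteq> W" "card S \<le> aff_dim W + 1" "y \<in> convex hull S"
    by (elim exE conjE)
  \<comment> \<open>The hyperplane has one dimension less than the space, so Caratheodory's bound
    becomes \<open>DIM('a)\<close> instead of \<open>DIM('a) + 1\<close>.\<close>
  have "h \<noteq> 0" using h by auto
  then have "aff_dim {z. h \<bullet> z = 1} = int DIM('a) - 1" by (simp add: aff_dim_hyperplane)
  moreover have "aff_dim W \<le> aff_dim {z. h \<bullet> z = 1}" by (rule aff_dim_subset) (auto simp: W_def)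
  ultimately have card: "card S \<le> DIM('a)" using S(3) by linarith
  have "y \<in> span S" using S(4) convex_hull_subset_span by blast
  then have "x \<in> span S" by (subst xy) (rule span_scale)
  then have "span S = UNIV" using assms S(2) WV unfolding generic_def by blast
  then have fr: "frame S" using S(1) card by (intro frame_if_span)
  obtain u where u: "\<forall>w\<in>S. 0 \<le> u w" "sum u S = 1" "(\<Sum>w\<in>S. u w *\<^sub>R w) = y"
    using S(4) unfolding convex_hull_finite[OF S(1)] by blast
  show ?thesis
  proof (rule that[of S])
    show "S \<subseteq> V" using S(2) WV by blast
    show "frame S" by (rule fr)
    fix w assume w: "w \<in> S"
    have "coord S w y = u w" using coord_unique[OF fr w u(3)[symmetric]] .
    then have "coord S w x = gauge x * u w" by (subst xy) (simp add: coord_scale[OF fr])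
    then show "coord S w x \<ge> 0" using u w g by simp
  qed
qed

text \<open>The weights on \<open>T\<close> extended linearly. It is the objective value of the
  basis \<open>T\<close> in the linear program that writes \<open>x\<close> as a nonnegative
  combination of points of \<open>V\<close> at least cost.\<close>

definition lcost :: "('a \<Rightarrow> real) \<Rightarrow> 'a set \<Rightarrow> 'a \<Rightarrow> real" where
  "lcost \<omega> T x = (\<Sum>w\<in>T. coord T w x * \<omega> w)"

lemma linear_lcost: "frame T \<Longrightarrow> linear (lcost \<omega> T)"
  unfolding lcost_def[abs_def]
  by (intro linearI) (simp_all add: coord_add coord_scale distrib_right distrib_left sum.distrib sum_distrib_left mult_ac)

lemma lcost_basis:
  assumes "frame T" "w \<in> T" shows "lcost \<omega> T w = \<omega> w"
proof -
  have "lcost \<omega> T w = (\<Sum>v\<in>T. if v = w then \<omega> v else 0)"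
    unfolding lcost_def using assms by (intro sum.cong) (auto simp: coord_basis)
  then show ?thesis using assms(2) frame_finite[OF assms(1)] by simp
qed

text \<open>A step of the simplex method: \<open>v\<close> enters because its weight is below its
  price, the minimum ratio test selects the leaving vertex \<open>w\<close>. Genericity of
  \<open>x\<close> excludes degenerate steps, so \<open>t > 0\<close> and the cost drops
  strictly.\<close>

lemma pivot:
  assumes pos: "\<And>v. v \<in> V \<Longrightarrow> \<omega> v > 0" and x: "generic x"
    and T: "T \<subseteq> V" "frame T" "\<And>w. w \<in> T \<Longrightarrow> coord T w x \<ge> 0"
    and v: "v \<in> V" "lcost \<omega> T v > \<omega> v"
  obtains T' where "T' \<subseteq> V" "frame T'" "\<And>w. w \<in> T' \<Longrightarrow> coord T' w x \<ge> 0"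
    "lcost \<omega> T' x < lcost \<omega> T x"
proof -
  have fin: "finite T" using frame_finite[OF T(2)] .
  let ?a = "\<lambda>w. coord T w x" and ?b = "\<lambda>w. coord T w v"
  let ?P = "{w\<in>T. ?b w > 0}"
  \<comment> \<open>The program is not unbounded: without positive coordinates the price of
    \<open>v\<close> would be nonpositive, although it exceeds a positive weight.\<close>
  have "?P \<noteq> {}"
  proof
    assume "?P = {}"
    then have "lcost \<omega> T v \<le> 0"
      unfolding lcost_def using pos T(1) by (intro sum_nonpos mult_nonpos_nonneg) (auto simp: not_less less_imp_le)
    then show False using v pos by fastforce
  qed
  then obtain w where w: "w \<in> ?P" and wmin: "\<And>u. u \<in> ?P \<Longrightarrow> ?a w / ?b w \<le> ?a u / ?b u"
    using finite_ex_min[of ?P "\<lambda>w. ?a w / ?b w"] fin by auto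
  then have wT: "w \<in> T" and bw: "?b w > 0" by auto
  define t where "t = ?a w / ?b w"
  have "?a w > 0" using T(3)[OF wT] generic_coord[OF x T(2,1) wT] by simp
  then have t: "t > 0" using bw by (simp add: t_def)
  have vT: "v \<notin> T" using v(2) lcost_basis[OF T(2), of v \<omega>] by auto
  let ?T = "insert v (T - {w})"
  have fr: "frame ?T" using coord_pos_exchange[OF T(2) wT] bw by simp
  have ne: "u \<noteq> v" if "u \<in> T - {w}" for u using that vT by blast
  have xeq: "x = (\<Sum>u\<in>?T. (if u = v then t else ?a u - t * ?b u) *\<^sub>R u)"
  proof -
    have "(\<Sum>u\<in>?T. (if u = v then t else ?a u - t * ?b u) *\<^sub>R u)
        = t *\<^sub>R v + (\<Sum>u\<in>T - {w}. (?a u - t * ?b u) *\<^sub>R u)"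
      using fin vT by (subst sum.insert) (simp_all add: ne cong: sum.cong_simp)
    also have "(\<Sum>u\<in>T - {w}. (?a u - t * ?b u) *\<^sub>R u) = (\<Sum>u\<in>T. (?a u - t * ?b u) *\<^sub>R u)"
      using fin wT bw by (simp add: sum.remove[of T w] t_def)
    also have "\<dots> = x - t *\<^sub>R v"
      using sum_coord[OF T(2), of x] sum_coord[OF T(2), of v]
      by (simp add: scaleR_left_diff_distrib sum_subtractf scaleR_scaleR[symmetric] scaleR_sum_right[symmetric] del: scaleR_scaleR)
    finally show ?thesis by simp
  qed
  have cu: "coord ?T u x = (if u = v then t else ?a u - t * ?b u)" if "u \<in> ?T" for u
    using coord_unique[OF fr that xeq] .
  show ?thesis
  proof (rule that[of ?T])
    show "?T \<subseteq> V" using v T by blast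
    show "frame ?T" by (rule fr)
    fix u assume u: "u \<in> ?T"
    show "coord ?T u x \<ge> 0"
    proof (cases "u = v")
      case True then show ?thesis using cu[OF u] t by simp
    next
      case False
      then have uT: "u \<in> T" using u by blast
      have "t * ?b u \<le> ?a u"
      proof (cases "?b u > 0")
        case True
        then show ?thesis using wmin[of u] uT by (simp add: t_def field_simps)
      next
        case False
        then have "t * ?b u \<le> 0" using t by (simp add: mult_nonneg_nonpos)
        then show ?thesis using T(3)[OF uT] by linarith
      qed
      then show ?thesis using cu[OF u] False by simp
    qed
  next
    have "lcost \<omega> ?T x = t * \<omega> v + (\<Sum>u\<in>T - {w}. (?a u - t * ?b u) * \<omega> u)"
      unfolding lcost_def using fin vT cu by (subst sum.insert) (simp_all add: ne cong: sum.cong_simp)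
    also have "(\<Sum>u\<in>T - {w}. (?a u - t * ?b u) * \<omega> u) = (\<Sum>u\<in>T. (?a u - t * ?b u) * \<omega> u)"
      using fin wT bw by (simp add: sum.remove[of T w] t_def)
    also have "\<dots> = lcost \<omega> T x - t * lcost \<omega> T v"
      by (simp add: lcost_def left_diff_distrib sum_subtractf sum_distrib_left mult.assoc)
    finally have "lcost \<omega> ?T x = lcost \<omega> T x - t * (lcost \<omega> T v - \<omega> v)" by (simp add: algebra_simps)
    then show "lcost \<omega> ?T x < lcost \<omega> T x" using t v(2) by simp
  qed
qed

end

text \<open>Strict convexity of the squared norm; the difference of the two sides is the variance,
  the weighted sum of the squared distances of \<open>w\<close> from \<open>x\<close>.\<close>

lemma sum_sq_less_of_convex:
  fixes x :: "'a::euclidean_space"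
  assumes "finite T" "\<And>w. w \<in> T \<Longrightarrow> c w \<ge> 0" "(\<Sum>w\<in>T. c w) = 1" "x = (\<Sum>w\<in>T. c w *\<^sub>R w)" "x \<notin> T"
  shows "x \<bullet> x < (\<Sum>w\<in>T. c w * (w \<bullet> w))"
proof -
  have "\<exists>w\<in>T. c w > 0"
  proof (rule ccontr)
    assume "\<not> ?thesis"
    then have "\<forall>w\<in>T. c w = 0" using assms(2) by (auto simp: not_less intro!: antisym)
    then show False using assms(3) by simp
  qed
  then obtain w where w: "w \<in> T" "c w > 0" by blast
  then have "w \<noteq> x" using assms(5) by blast
  then have "c w * ((w - x) \<bullet> (w - x)) > 0" using w(2) by simp
  then have "(\<Sum>w\<in>T. c w * ((w - x) \<bullet> (w - x))) > 0"
    using assms(1,2) w(1) by (intro sum_pos2[of _ w]) auto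
  also have "(\<Sum>w\<in>T. c w * ((w - x) \<bullet> (w - x)))
      = (\<Sum>w\<in>T. c w * (w \<bullet> w) - 2 * (c w * (w \<bullet> x)) + c w * (x \<bullet> x))"
  proof (intro sum.cong refl)
    fix w
    show "c w * ((w - x) \<bullet> (w - x)) = c w * (w \<bullet> w) - 2 * (c w * (w \<bullet> x)) + c w * (x \<bullet> x)"
      by (simp add: inner_diff_left inner_diff_right inner_commute[of x w] algebra_simps)
  qed
  also have "\<dots> = (\<Sum>w\<in>T. c w * (w \<bullet> w)) - 2 * (\<Sum>w\<in>T. c w * (w \<bullet> x)) + (\<Sum>w\<in>T. c w) * (x \<bullet> x)"
    by (simp add: sum.distrib sum_subtractf sum_distrib_left sum_distrib_right)
  also have "(\<Sum>w\<in>T. c w * (w \<bullet> x)) = x \<bullet> x"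
    by (subst (2) assms(4)) (simp add: inner_sum_left)
  finally show ?thesis using assms(3) by simp
qed

context fano
begin

theorem exists_triangulation:
  obtains \<T> where
    "\<And>T. T \<in> \<T> \<Longrightarrow> T \<subseteq> V \<and> frame T"
    "\<And>T. T \<in> \<T> \<Longrightarrow> \<exists>h\<in>E. \<forall>v\<in>T. h \<bullet> v = 1"
    "\<And>T. T \<in> \<T> \<Longrightarrow> N \<inter> convex hull T \<subseteq> T"
    "\<And>x. generic x \<Longrightarrow> \<exists>!T. T \<in> \<T> \<and> (\<forall>w\<in>T. coord T w x \<ge> 0)"
proof -
  let ?F = "{T. T \<subseteq> V \<and> frame T}"
  have finF: "finite ?F" using finite_V by simp
  \<comment> \<open>A certificate that the vertices of \<open>T\<close> share no supporting
    hyperplane from \<open>E\<close>: their sum can be written with a smaller total coefficient,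
    that is, more cheaply for constant weights.\<close>
  define split where "split T c \<longleftrightarrow> (\<forall>v\<in>V. c v \<ge> 0) \<and> (\<Sum>v\<in>V. c v *\<^sub>R v) = \<Sum>T \<and> (\<Sum>v\<in>V. c v) < of_nat (card T)" for T c
  define B where "B = {T \<in> ?F. \<not> (\<exists>h\<in>E. \<forall>v\<in>T. h \<bullet> v = 1)}"
  have ex: "\<exists>c. split T c" if T: "T \<in> B" for T
  proof -
    have TV: "T \<subseteq> V" and fr: "frame T" and nh: "\<And>h. h \<in> E \<Longrightarrow> \<exists>v\<in>T. h \<bullet> v \<noteq> 1"
      using T unfolding B_def by auto
    have fin: "finite T" using frame_finite[OF fr] .
    define x where "x = \<Sum>T"
    have cx: "coord T w x = 1" if "w \<in> T" for w
      using coord_unique[OF fr that, of x "\<lambda>_. 1"] by (simp add: x_def)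
    have "T \<noteq> {}" using fr by (auto simp: frame_def)
    then have "x \<noteq> 0" using cx coord_zero[OF fr] by force
    then have g: "gauge x > 0" by (rule gauge_pos)
    obtain h where h: "h \<in> E" "h \<bullet> x = gauge x" by (rule gauge_attained)
    obtain v where v: "v \<in> T" "h \<bullet> v \<noteq> 1" using nh[OF h(1)] by blast
    have le: "h \<bullet> w \<le> 1" if "w \<in> T" for w using V_inner_le[of w h] that TV h(1) by auto
    have "gauge x = (\<Sum>w\<in>T. h \<bullet> w)" using h(2) by (simp add: x_def inner_sum_right)
    also have "\<dots> < (\<Sum>w\<in>T. 1)"
      using fin le v by (intro sum_strict_mono_ex1) (auto simp: less_le)
    finally have less: "gauge x < of_nat (card T)" by simp
    have "(1 / gauge x) *\<^sub>R x \<in> \<Delta>" using g by (simp add: \<Delta>_iff gauge_scale)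
    from V_combination[OF this] obtain c where c: "\<forall>v\<in>V. c v \<ge> 0" "(\<Sum>v\<in>V. c v) = 1"
      "(1 / gauge x) *\<^sub>R x = (\<Sum>v\<in>V. c v *\<^sub>R v)" by (elim exE conjE)
    have "x = gauge x *\<^sub>R ((1 / gauge x) *\<^sub>R x)" using g by simp
    also have "\<dots> = (\<Sum>v\<in>V. (gauge x * c v) *\<^sub>R v)" unfolding c(3) by (simp add: scaleR_sum_right)
    finally have "(\<Sum>v\<in>V. (gauge x * c v) *\<^sub>R v) = \<Sum>T" by (simp add: x_def)
    moreover have "(\<Sum>v\<in>V. gauge x * c v) = gauge x" by (simp add: sum_distrib_left[symmetric] c(2))
    ultimately have "split T (\<lambda>v. gauge x * c v)"
      unfolding split_def using less c(1) g by simp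
    then show ?thesis by blast
  qed
  define C where "C T = (SOME c. split T c)" for T
  have C: "split T (C T)" if "T \<in> B" for T unfolding C_def using ex[OF that] by (rule someI_ex)
  \<comment> \<open>The two requirements as linear forms in the weights: \<open>d1\<close> is the
    saving by the splitting \<open>C T\<close>, and \<open>d2\<close> compares the cost of
    \<open>u\<close> through \<open>T\<close> with the weight of \<open>u\<close> itself.\<close>
  define d1 where "d1 T = (\<lambda>v. (if v \<in> T then 1 else 0) - C T v)" for T
  define d2 where "d2 T u = (\<lambda>v. (if v \<in> T then coord T v u else 0) - (if v = u then 1 else 0 :: real))" for T :: "'a set" and u :: 'a
  have VT: "(\<Sum>v\<in>V. if v \<in> T then f v else 0) = sum f T" if "T \<subseteq> V" for T and f :: "'a \<Rightarrow> real"
    using that finite_V by (simp add: sum.inter_restrict[symmetric] Int_absorb1)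
  have sum1: "(\<Sum>v\<in>V. d1 T v * f v) = (\<Sum>v\<in>T. f v) - (\<Sum>v\<in>V. C T v * f v)" if "T \<in> ?F" for T and f :: "'a \<Rightarrow> real"
  proof -
    have "(\<Sum>v\<in>V. d1 T v * f v) = (\<Sum>v\<in>V. (if v \<in> T then f v else 0) - C T v * f v)"
      by (intro sum.cong) (auto simp: d1_def left_diff_distrib)
    then show ?thesis using that by (simp add: sum_subtractf VT)
  qed
  have sum2: "(\<Sum>v\<in>V. d2 T u v * f v) = (\<Sum>v\<in>T. coord T v u * f v) - f u"
    if "T \<in> ?F" "u \<in> V" for T :: "'a set" and u :: 'a and f :: "'a \<Rightarrow> real"
  proof -
    have "(\<Sum>v\<in>V. d2 T u v * f v) = (\<Sum>v\<in>V. (if v \<in> T then coord T v u * f v else 0) - (if v = u then f v else 0))"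
      by (intro sum.cong) (auto simp: d2_def left_diff_distrib)
    then show ?thesis using that finite_V by (simp add: sum_subtractf VT)
  qed
  define P where "P = {(T, u). T \<in> ?F \<and> u \<in> V \<and> u \<notin> T}"
  have finP: "finite P" by (rule finite_subset[of _ "?F \<times> V"]) (use finF finite_V in \<open>auto simp: P_def\<close>)
  define P' where "P' = {(T, u) \<in> P. u \<in> convex hull T}"
  have finP': "finite P'" using finP by (rule finite_subset[rotated]) (auto simp: P'_def)
  have finB: "finite B" using finF by (rule finite_subset[rotated]) (auto simp: B_def)
  define D where "D = d1 ` B \<union> case_prod d2 ` P'"
  define D' where "D' = case_prod d2 ` P"
  have nz: "\<exists>v\<in>V. d v \<noteq> 0" if dD': "d \<in> D'" for d
  proof -
    obtain T u where Tu: "(T, u) \<in> P" "d = d2 T u" using dD' by (auto simp: D'_def)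
    then have "d u = -1" "u \<in> V" by (auto simp: d2_def P_def)
    then show ?thesis by force
  qed
  have strict: "(\<Sum>v\<in>V. d v) > 0 \<or> (\<Sum>v\<in>V. d v) = 0 \<and> (\<Sum>v\<in>V. d v * (v \<bullet> v)) > 0" if "d \<in> D" for d
    using that unfolding D_def
  proof
    assume "d \<in> d1 ` B"
    then obtain T where T: "T \<in> B" "d = d1 T" by blast
    then have TF: "T \<in> ?F" by (simp add: B_def)
    have "(\<Sum>v\<in>V. d v) = of_nat (card T) - (\<Sum>v\<in>V. C T v)"
      using sum1[OF TF, of "\<lambda>_. 1"] T(2) by simp
    then show ?thesis using C[OF T(1)] by (simp add: split_def)
  next
    assume "d \<in> case_prod d2 ` P'"
    then obtain T u where Tu: "(T, u) \<in> P'" "d = d2 T u" by auto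
    then have TF: "T \<in> ?F" and u: "u \<in> V" "u \<notin> T" "u \<in> convex hull T" by (auto simp: P'_def P_def)
    have fr: "frame T" and fin: "finite T" using TF frame_finite by auto
    obtain c where c: "\<forall>w\<in>T. 0 \<le> c w" "sum c T = 1" "(\<Sum>w\<in>T. c w *\<^sub>R w) = u"
      using u(3) unfolding convex_hull_finite[OF fin] by blast
    have cu: "coord T w u = c w" if "w \<in> T" for w using coord_unique[OF fr that c(3)[symmetric]] .
    have "(\<Sum>v\<in>V. d v) = (\<Sum>w\<in>T. coord T w u) - 1"
      using sum2[OF TF u(1), of "\<lambda>_. 1"] Tu(2) by simp
    then have 1: "(\<Sum>v\<in>V. d v) = 0" using c(2) cu by simp
    have "(\<Sum>v\<in>V. d v * (v \<bullet> v)) = (\<Sum>w\<in>T. c w * (w \<bullet> w)) - u \<bullet> u"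
      using sum2[OF TF u(1), of "\<lambda>v. v \<bullet> v"] Tu(2) cu by simp
    moreover have "u \<bullet> u < (\<Sum>w\<in>T. c w * (w \<bullet> w))"
      using sum_sq_less_of_convex[OF fin _ c(2) c(3)[symmetric] u(2)] c(1) by blast
    ultimately show ?thesis using 1 by simp
  qed
  have fD: "finite D" unfolding D_def using finB finP' by simp
  have fD': "finite D'" unfolding D'_def using finP by simp
  have "\<exists>\<omega>. (\<forall>v\<in>V. \<omega> v > 0) \<and> (\<forall>d\<in>D. (\<Sum>v\<in>V. d v * \<omega> v) > 0) \<and> (\<forall>d\<in>D'. (\<Sum>v\<in>V. d v * \<omega> v) \<noteq> 0)"
  proof (rule generic_weights_strict[OF finite_V fD fD' nz strict])
    fix \<omega> :: "'a \<Rightarrow> real"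
    assume "\<And>v. v \<in> V \<Longrightarrow> 0 < \<omega> v" "\<And>d. d \<in> D \<Longrightarrow> 0 < (\<Sum>v\<in>V. d v * \<omega> v)"
      "\<And>d. d \<in> D' \<Longrightarrow> (\<Sum>v\<in>V. d v * \<omega> v) \<noteq> 0"
    then show ?thesis by (intro exI[of _ \<omega>] conjI ballI)
  qed assumption+
  then obtain \<omega> where w0: "\<forall>v\<in>V. \<omega> v > 0" "\<forall>d\<in>D. (\<Sum>v\<in>V. d v * \<omega> v) > 0"
    "\<forall>d\<in>D'. (\<Sum>v\<in>V. d v * \<omega> v) \<noteq> 0" by (elim exE conjE)
  note pos = w0(1)[rule_format] and D = w0(2)[rule_format] and D' = w0(3)[rule_format]
  define \<T> where "\<T> = {T \<in> ?F. \<forall>v\<in>V. lcost \<omega> T v \<le> \<omega> v}"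
  have \<T>F: "T \<in> ?F" and opt: "\<And>v. v \<in> V \<Longrightarrow> lcost \<omega> T v \<le> \<omega> v" if "T \<in> \<T>" for T
    using that by (auto simp: \<T>_def)
  have gen: "lcost \<omega> T u \<noteq> \<omega> u" if "T \<in> ?F" "u \<in> V" "u \<notin> T" for T u
  proof -
    have "d2 T u \<in> D'" using that by (auto simp: D'_def P_def)
    from D'[OF this] show ?thesis using sum2[OF that(1,2), of \<omega>] by (simp add: lcost_def)
  qed
  show ?thesis
  proof (rule that[of \<T>])
    fix T assume "T \<in> \<T>" then show "T \<subseteq> V \<and> frame T" by (simp add: \<T>_def)
  next
    fix T assume T: "T \<in> \<T>"
    show "\<exists>h\<in>E. \<forall>v\<in>T. h \<bullet> v = 1"
    proof (rule ccontr)
      assume "\<not> ?thesis"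
      then have TB: "T \<in> B" using \<T>F[OF T] by (simp add: B_def)
      then have "d1 T \<in> D" by (simp add: D_def)
      from D[OF this] have less: "(\<Sum>v\<in>V. C T v * \<omega> v) < (\<Sum>w\<in>T. \<omega> w)" using sum1[OF \<T>F[OF T], of \<omega>] by simp
      have fr: "frame T" using \<T>F[OF T] by simp
      have c: "\<forall>v\<in>V. C T v \<ge> 0" "(\<Sum>v\<in>V. C T v *\<^sub>R v) = \<Sum>T" using C[OF TB] by (auto simp: split_def)
      have "(\<Sum>w\<in>T. \<omega> w) = lcost \<omega> T (\<Sum>T)"
        using fr by (simp add: linear_sum[OF linear_lcost[OF fr]] lcost_basis)
      also have "\<dots> = (\<Sum>v\<in>V. C T v * lcost \<omega> T v)"
        by (simp add: c(2)[symmetric] linear_sum[OF linear_lcost[OF fr]] linear_scale[OF linear_lcost[OF fr]])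
      also have "\<dots> \<le> (\<Sum>v\<in>V. C T v * \<omega> v)"
        using c(1) opt[OF T] by (intro sum_mono mult_left_mono) auto
      finally show False using less by simp
    qed
  next
    fix T assume T: "T \<in> \<T>"
    have TF: "T \<in> ?F" by (rule \<T>F[OF T])
    then have fr: "frame T" and fin: "finite T" and TV: "T \<subseteq> V" using frame_finite by auto
    show "N \<inter> convex hull T \<subseteq> T"
    proof (rule ccontr)
      assume "\<not> ?thesis"
      then obtain u where u: "u \<in> N" "u \<in> convex hull T" "u \<notin> T" by blast
      obtain c where c: "\<forall>w\<in>T. 0 \<le> c w" "sum c T = 1" "(\<Sum>w\<in>T. c w *\<^sub>R w) = u"
        using u(2) unfolding convex_hull_finite[OF fin] by blast
      have cu: "coord T w u = c w" if "w \<in> T" for w using coord_unique[OF fr that c(3)[symmetric]] .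
      have "u \<noteq> 0"
      proof
        assume "u = 0"
        then have "\<And>w. w \<in> T \<Longrightarrow> c w = 0" using cu coord_zero[OF fr] by metis
        then show False using c(2) by simp
      qed
      moreover have "u \<in> \<Delta>" using u(2) hull_V hull_mono[OF TV] by blast
      ultimately have uV: "u \<in> V" using u(1) by (simp add: V_def)
      then have "(T, u) \<in> P'" using TF u by (simp add: P'_def P_def)
      then have "d2 T u \<in> D" unfolding D_def by force
      from D[OF this] have "\<omega> u < lcost \<omega> T u" using sum2[OF TF uV, of \<omega>] by (simp add: lcost_def)
      then show False using opt[OF T uV] by simp
    qed
  next
    fix x assume x: "generic x"
    let ?Q = "{T \<in> ?F. \<forall>w\<in>T. coord T w x \<ge> 0}"
    have finQ: "finite ?Q" using finF by (rule finite_subset[rotated]) auto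
    obtain T0 where "T0 \<subseteq> V" "frame T0" "\<And>w. w \<in> T0 \<Longrightarrow> coord T0 w x \<ge> 0"
      using generic_in_frame[OF x] by blast
    then have "T0 \<in> ?Q" by simp
    then have "?Q \<noteq> {}" by blast
    \<comment> \<open>A cheapest frame around \<open>x\<close> admits no pivot and hence belongs to
      \<open>\<T>\<close>.\<close>
    from finite_ex_min[OF finQ this, of "\<lambda>T. lcost \<omega> T x"]
    obtain T where T: "T \<in> ?Q" and Tmin: "\<And>T'. T' \<in> ?Q \<Longrightarrow> lcost \<omega> T x \<le> lcost \<omega> T' x" by blast
    have TF: "T \<subseteq> V" "frame T" "\<And>w. w \<in> T \<Longrightarrow> coord T w x \<ge> 0" using T by auto
    have "T \<in> \<T>"
    proof (rule ccontr)
      assume "T \<notin> \<T>"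
      then obtain v where v: "v \<in> V" "lcost \<omega> T v > \<omega> v" using T unfolding \<T>_def by (auto simp: not_le)
      obtain T' where T': "T' \<subseteq> V" "frame T'" "\<And>w. w \<in> T' \<Longrightarrow> coord T' w x \<ge> 0" "lcost \<omega> T' x < lcost \<omega> T x"
        using pivot[OF pos x TF v] by blast
      then have "T' \<in> ?Q" by simp
      from Tmin[OF this] T'(4) show False by simp
    qed
    \<comment> \<open>Complementary slackness: both cost functions agree at \<open>x\<close>, and
      all coordinates of \<open>x\<close> in \<open>T1\<close> are positive, so no vertex of
      \<open>T1\<close> has slack with respect to \<open>T2\<close>. Generic weights have zero slack
      only at vertices.\<close>
    moreover have "T1 \<subseteq> T2"
      if T12: "T1 \<in> \<T>" "T2 \<in> \<T>" and p: "\<forall>w\<in>T1. coord T1 w x \<ge> 0" "\<forall>w\<in>T2. coord T2 w x \<ge> 0" for T1 T2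
    proof -
      have TF1: "T1 \<subseteq> V" "frame T1" and TF2: "T2 \<subseteq> V" "frame T2" using \<T>F[OF T12(1)] \<T>F[OF T12(2)] by auto
      have mono: "lcost \<omega> A x \<le> lcost \<omega> B x" if A: "A \<in> \<T>" and B: "B \<in> \<T>" "\<forall>w\<in>B. coord B w x \<ge> 0" for A B
      proof -
        have "frame A" "frame B" "B \<subseteq> V" using \<T>F[OF A] \<T>F[OF B(1)] by auto
        then have "lcost \<omega> A x = (\<Sum>w\<in>B. coord B w x * lcost \<omega> A w)"
          by (subst linear_eq_sum_coord[of B "lcost \<omega> A"]) (simp_all add: linear_lcost)
        also have "\<dots> \<le> (\<Sum>w\<in>B. coord B w x * \<omega> w)"
          using B(2) opt[OF A] \<open>B \<subseteq> V\<close> by (intro sum_mono mult_left_mono) auto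
        finally show ?thesis by (simp add: lcost_def)
      qed
      have "lcost \<omega> T1 x = lcost \<omega> T2 x" using mono T12 p by (intro antisym) auto
      moreover have "lcost \<omega> T2 x = (\<Sum>w\<in>T1. coord T1 w x * lcost \<omega> T2 w)"
        using TF1 TF2 by (subst linear_eq_sum_coord[of T1 "lcost \<omega> T2"]) (simp_all add: linear_lcost)
      ultimately have "(\<Sum>w\<in>T1. coord T1 w x * (\<omega> w - lcost \<omega> T2 w)) = 0"
        by (simp add: lcost_def[of _ T1] right_diff_distrib sum_subtractf)
      moreover have "0 \<le> coord T1 w x * (\<omega> w - lcost \<omega> T2 w)" if "w \<in> T1" for w
        using p that opt[OF T12(2), of w] TF1(1) by (intro mult_nonneg_nonneg) auto
      ultimately have z: "\<forall>w\<in>T1. coord T1 w x * (\<omega> w - lcost \<omega> T2 w) = 0"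
        by (subst (asm) sum_nonneg_eq_0_iff[OF frame_finite[OF TF1(2)]]) auto
      show ?thesis
      proof
        fix w assume w: "w \<in> T1"
        then have "coord T1 w x \<noteq> 0" using generic_coord[OF x TF1(2,1)] by blast
        then have "lcost \<omega> T2 w = \<omega> w" using z w by auto
        then show "w \<in> T2" using gen[of T2 w] \<T>F[OF T12(2)] w TF1(1) by blast
      qed
    qed
    ultimately show "\<exists>!T. T \<in> \<T> \<and> (\<forall>w\<in>T. coord T w x \<ge> 0)" using TF(3)
      by (intro ex1I[of _ T]) (auto intro!: subset_antisym)
  qed
qed

end

section \<open>Lattice points in half-open cones\<close>

text \<open>The covering condition concerns generic points only, where no common boundary of cones
  interferes; \<open>half_unique\<close> extends it to all points.\<close>

locale triangulated = fano N b \<Delta> E for N :: "'a::euclidean_space set" and b \<Delta> E +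
  fixes \<T> :: "'a set set"
  assumes \<T>_sub: "\<And>T. T \<in> \<T> \<Longrightarrow> T \<subseteq> V" and \<T>_frame: "\<And>T. T \<in> \<T> \<Longrightarrow> frame T"
    and \<T>_face: "\<And>T. T \<in> \<T> \<Longrightarrow> \<exists>h\<in>E. \<forall>v\<in>T. h \<bullet> v = 1"
    and \<T>_empty: "\<And>T. T \<in> \<T> \<Longrightarrow> N \<inter> convex hull T \<subseteq> T"
    and \<T>_cover: "\<And>x. generic x \<Longrightarrow> \<exists>!T. T \<in> \<T> \<and> (\<forall>w\<in>T. coord T w x \<ge> 0)"
    and dim3: "DIM('a) = 3"
begin

lemma finite_\<T>: "finite \<T>"
  using \<T>_sub finite_V by (intro finite_subset[of \<T> "Pow V"]) auto

lemma finite_T: "T \<in> \<T> \<Longrightarrow> finite T" using \<T>_frame frame_finite by blast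

lemma \<T>_N: "T \<in> \<T> \<Longrightarrow> T \<subseteq> N" using \<T>_sub V_N by blast

lemma card_T: "T \<in> \<T> \<Longrightarrow> card T = 3" using \<T>_frame dim3 by (simp add: frame_def)

definition height :: "'a set \<Rightarrow> 'a \<Rightarrow> real" where
  "height T x = (\<Sum>w\<in>T. coord T w x)"

lemma linear_height: "frame T \<Longrightarrow> linear (height T)"
  unfolding height_def[abs_def]
  by (intro linearI) (simp_all add: coord_add coord_scale sum.distrib sum_distrib_left)

lemma height_basis: "frame T \<Longrightarrow> w \<in> T \<Longrightarrow> height T w = 1"
  unfolding height_def using frame_finite[of T] by (simp add: coord_basis)

lemma inner_eq_height:
  assumes "frame T" "\<forall>v\<in>T. h \<bullet> v = 1" shows "h \<bullet> x = height T x"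
  using assms(2) by (subst inner_eq_sum_coord[OF assms(1)]) (simp add: height_def)

lemma height_le_gauge: "T \<in> \<T> \<Longrightarrow> height T x \<le> gauge x"
  using \<T>_face[of T] inner_eq_height[OF \<T>_frame] gauge_ge by metis

text \<open>On the cone over \<open>T\<close> the functional of \<open>T\<close> is maximal, since
  every functional of \<open>E\<close> is at most 1 on the vertices and the coordinates are
  nonnegative.\<close>

lemma gauge_eq_height:
  assumes T: "T \<in> \<T>" and pos: "\<And>w. w \<in> T \<Longrightarrow> coord T w x \<ge> 0"
  shows "gauge x = height T x"
proof (rule antisym[OF _ height_le_gauge[OF T]])
  show "gauge x \<le> height T x"
    unfolding gauge_le_iff height_def
  proof
    fix h assume h: "h \<in> E"
    show "h \<bullet> x \<le> (\<Sum>w\<in>T. coord T w x)"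
      using pos V_inner_le[OF _ h] \<T>_sub[OF T]
      by (subst inner_eq_sum_coord[OF \<T>_frame[OF T]], intro sum_mono) (auto intro: mult_left_le)
  qed
qed

text \<open>Half-open cones: \<open>x\<close> belongs to the cone over \<open>T\<close> if a small
  move in direction \<open>\<xi>\<close> leads into the closed cone, see
  \<open>half_eventually\<close>. This distributes all common boundaries consistently.\<close>

definition half :: "'a \<Rightarrow> 'a set \<Rightarrow> 'a \<Rightarrow> bool" where
  "half \<xi> T x \<longleftrightarrow> (\<forall>w\<in>T. coord T w x > 0 \<or> coord T w x = 0 \<and> coord T w \<xi> > 0)"

lemma half_nonneg: "half \<xi> T x \<Longrightarrow> w \<in> T \<Longrightarrow> coord T w x \<ge> 0"
  unfolding half_def by fastforce

lemma half_eventually: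
  assumes T: "T \<in> \<T>" and \<xi>: "generic \<xi>"
  shows "\<forall>\<^sub>F e in at_right (0::real). (\<forall>w\<in>T. coord T w (x + e *\<^sub>R \<xi>) \<ge> 0) \<longleftrightarrow> half \<xi> T x"
proof -
  have fr: "frame T" by (rule \<T>_frame[OF T])
  have gt0: "\<forall>\<^sub>F e in at_right (0::real). e > 0" by (rule eventually_at_right_less)
  have lim: "((\<lambda>e. a + e * c) \<longlongrightarrow> a) (at_right 0)" for a c :: real
    by (rule tendsto_eq_rhs[OF tendsto_add[OF tendsto_const tendsto_mult[OF tendsto_ident_at tendsto_const]]]) simp
  have single: "\<forall>\<^sub>F e in at_right (0::real). coord T w (x + e *\<^sub>R \<xi>) \<ge> 0 \<longleftrightarrow>
      coord T w x > 0 \<or> coord T w x = 0 \<and> coord T w \<xi> > 0" if w: "w \<in> T" for w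
  proof -
    have eq: "coord T w (x + e *\<^sub>R \<xi>) = coord T w x + e * coord T w \<xi>" for e
      by (simp add: coord_add[OF fr] coord_scale[OF fr])
    have nz: "coord T w \<xi> \<noteq> 0" by (rule generic_coord[OF \<xi> fr \<T>_sub[OF T] w])
    consider "coord T w x > 0" | "coord T w x < 0" | "coord T w x = 0" by linarith
    then show ?thesis
    proof cases
      case 1
      then show ?thesis unfolding eq
        by (intro eventually_mono[OF order_tendstoD(1)[OF lim 1, of "coord T w \<xi>"]]) auto
    next
      case 2
      then show ?thesis unfolding eq
        by (intro eventually_mono[OF order_tendstoD(2)[OF lim 2, of "coord T w \<xi>"]]) auto
    next
      case 3
      then show ?thesis unfolding eq using nz
        by (intro eventually_mono[OF gt0]) (auto simp: zero_le_mult_iff)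
    qed
  qed
  have "\<forall>\<^sub>F e in at_right (0::real). \<forall>w\<in>T. coord T w (x + e *\<^sub>R \<xi>) \<ge> 0 \<longleftrightarrow>
      coord T w x > 0 \<or> coord T w x = 0 \<and> coord T w \<xi> > 0"
    using single finite_T[OF T] by (intro eventually_ball_finite) auto
  then show ?thesis by (rule eventually_mono) (auto simp: half_def)
qed

text \<open>For small positive \<open>e\<close> the point \<open>x + e *\<^sub>R \<xi>\<close> is
  generic and has the same memberships, so uniqueness is inherited from
  \<open>\<T>_cover\<close>.\<close>

lemma half_unique:
  assumes \<xi>: "generic \<xi>"
  shows "\<exists>!T. T \<in> \<T> \<and> half \<xi> T x"
proof -
  have "\<forall>\<^sub>F e in at_right (0::real). (\<forall>T\<in>\<T>. (\<forall>w\<in>T. coord T w (x + e *\<^sub>R \<xi>) \<ge> 0) \<longleftrightarrow> half \<xi> T x)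
      \<and> generic (x + e *\<^sub>R \<xi>)"
    using half_eventually[OF _ \<xi>] finite_\<T> generic_perturb[OF \<xi>]
    by (intro eventually_conj eventually_ball_finite) auto
  from eventually_happens'[OF trivial_limit_at_right_real this]
  obtain e where e: "\<forall>T\<in>\<T>. (\<forall>w\<in>T. coord T w (x + e *\<^sub>R \<xi>) \<ge> 0) \<longleftrightarrow> half \<xi> T x"
    "generic (x + e *\<^sub>R \<xi>)" by (elim exE conjE)
  show ?thesis using \<T>_cover[OF e(2)] e(1) by metis
qed

text \<open>In the half-open parallelepiped, height equals gauge, so a nonzero lattice point has
  height at least 1; height 1 would put it into the triangle, where only the vertices are lattice
  points. The same applies to the reflected point \<open>y'\<close>. Both heights exceed 1 and add
  up to the size of the support of \<open>y\<close>, which must therefore be all of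
  \<open>T\<close>.\<close>

lemma cell_interior:
  assumes T: "T \<in> \<T>" and y: "y \<in> N" "y \<noteq> 0" and c: "\<And>w. w \<in> T \<Longrightarrow> 0 \<le> coord T w y \<and> coord T w y < 1"
  shows "\<forall>w\<in>T. coord T w y > 0" "1 < height T y" "height T y < 2"
proof -
  have fr: "frame T" by (rule \<T>_frame[OF T])
  have fin: "finite T" by (rule finite_T[OF T])
  have gt1: "height T z > 1" if z: "z \<in> N" "z \<noteq> 0" and c: "\<And>w. w \<in> T \<Longrightarrow> 0 \<le> coord T w z \<and> coord T w z < 1" for z
  proof (rule ccontr)
    assume "\<not> height T z > 1"
    then have le: "height T z \<le> 1" by simp
    have g: "gauge z = height T z" using c by (intro gauge_eq_height[OF T]) auto
    have "\<not> gauge z < 1" using N_gauge_less_1[OF z(1)] z(2) by blast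
    then have h1: "(\<Sum>w\<in>T. coord T w z) = 1" using le g by (simp add: height_def)
    have "z \<in> convex hull T"
      unfolding convex_hull_finite[OF fin]
      using c h1 sum_coord[OF fr, of z] by (intro CollectI exI[of _ "\<lambda>w. coord T w z"]) simp
    then have "z \<in> T" using \<T>_empty[OF T] z(1) by blast
    then show False using c[of z] by (simp add: coord_basis[OF fr])
  qed
  \<comment> \<open>Reflection within the support alone keeps the zero coordinates of
    \<open>y\<close> at 0; reflecting them too would produce the excluded value 1.\<close>
  define P where "P = {w\<in>T. coord T w y > 0}"
  have PT: "P \<subseteq> T" and finP: "finite P" using fin by (auto simp: P_def)
  define y' where "y' = \<Sum>P - y"
  have cP: "coord T w (\<Sum>P) = (if w \<in> P then 1 else 0)" if "w \<in> T" for w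
  proof -
    have "coord T w (\<Sum>P) = (\<Sum>v\<in>P. if w = v then 1 else 0)"
      using PT by (auto simp: coord_sum[OF fr] coord_basis[OF fr] intro!: sum.cong)
    then show ?thesis using finP by simp
  qed
  have c': "coord T w y' = (if w \<in> P then 1 - coord T w y else 0)" if "w \<in> T" for w
    using cP[OF that] c[OF that] that by (auto simp: y'_def coord_diff[OF fr] P_def)
  have "y' \<in> N" unfolding y'_def using y PT \<T>_N[OF T] by (intro N_diff N_sum) auto
  moreover have "y' \<noteq> 0"
  proof
    assume "y' = 0"
    then have "coord T w y' = 0" for w by (simp add: coord_zero[OF fr])
    then have "w \<notin> P" if "w \<in> T" for w using c'[OF that] c[OF that] by (metis less_irrefl diff_gt_0_iff_gt)
    then have "\<And>w. w \<in> T \<Longrightarrow> coord T w y = coord T w 0"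
      using c by (force simp: P_def coord_zero[OF fr])
    then show False using coord_eqI[OF fr] y(2) by blast
  qed
  moreover have "0 \<le> coord T w y' \<and> coord T w y' < 1" if "w \<in> T" for w
    using c'[OF that] c[OF that] that by (auto simp: P_def)
  ultimately have h': "height T y' > 1" by (rule gt1)
  have "height T (\<Sum>P) = (\<Sum>w\<in>T. if w \<in> P then 1 else 0)"
    unfolding height_def by (intro sum.cong) (auto simp: cP)
  also have "\<dots> = of_nat (card P)" using fin PT by (simp add: sum.inter_restrict[symmetric] Int_absorb1)
  finally have hs: "height T y + height T y' = of_nat (card P)"
    unfolding y'_def by (simp add: linear_diff[OF linear_height[OF fr]])
  have hy: "height T y > 1" by (rule gt1[OF y c])
  have "card P \<le> 3" using card_mono[OF fin PT] card_T[OF T] by simp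
  moreover have "of_nat (card P) > (2::real)" using hs hy h' by linarith
  ultimately have c3: "card P = 3" by simp
  then have "P = T" using card_subset_eq[OF fin PT] card_T[OF T] by simp
  then show "\<forall>w\<in>T. coord T w y > 0" by (auto simp: P_def)
  show "1 < height T y" by (rule hy)
  show "height T y < 2" using hs h' c3 by simp
qed

section \<open>Lattice points modulo the lattice spanned by a triangle\<close>

lemma fractional_coords:
  assumes T: "T \<in> \<T>" and x: "x \<in> N"
  defines "z \<equiv> x - (\<Sum>w\<in>T. of_int \<lfloor>coord T w x\<rfloor> *\<^sub>R w)"
  shows "z \<in> N" "\<And>w. w \<in> T \<Longrightarrow> coord T w z = frac (coord T w x)"
proof -
  have fr: "frame T" by (rule \<T>_frame[OF T])
  show "z \<in> N" unfolding z_def using x \<T>_N[OF T] by (intro N_diff N_sum N_scale) auto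
  fix w assume "w \<in> T"
  then show "coord T w z = frac (coord T w x)"
    unfolding z_def by (simp add: coord_diff[OF fr] coord_lincomb[OF fr] frac_def)
qed

text \<open>If the fractional part of \<open>x\<close> is nonzero, \<open>cell_interior\<close>
  leaves neither a coordinate nor the height of it integral. So the class of \<open>x\<close> modulo
  the lattice spanned by \<open>T\<close> is trivial as soon as a single coordinate, or the height,
  says so.\<close>

lemma integral_coords:
  assumes T: "T \<in> \<T>" and x: "x \<in> N" and i: "(\<exists>w\<in>T. coord T w x \<in> \<int>) \<or> height T x \<in> \<int>" and v: "v \<in> T"
  shows "coord T v x \<in> \<int>"
proof (rule ccontr)
  assume nv: "coord T v x \<notin> \<int>"
  have fr: "frame T" by (rule \<T>_frame[OF T])
  define z where "z = x - (\<Sum>w\<in>T. of_int \<lfloor>coord T w x\<rfloor> *\<^sub>R w)"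
  have z: "z \<in> N" and cz: "\<And>w. w \<in> T \<Longrightarrow> coord T w z = frac (coord T w x)"
    using fractional_coords[OF T x] by (simp_all add: z_def)
  have "coord T v z \<noteq> 0" using nv by (simp add: cz[OF v])
  then have "z \<noteq> 0" using coord_zero[OF fr] by metis
  from cell_interior[OF T z this] cz
  have b: "\<forall>w\<in>T. coord T w z > 0" "1 < height T z" "height T z < 2"
    by (simp_all add: frac_lt_1)
  show False using i
  proof
    assume "\<exists>w\<in>T. coord T w x \<in> \<int>"
    then obtain w where "w \<in> T" "coord T w x \<in> \<int>" by blast
    then show False using b(1) cz[of w] by (metis frac_eq_0_iff less_irrefl)
  next
    assume hx: "height T x \<in> \<int>"
    have "height T z = height T x - (\<Sum>w\<in>T. of_int \<lfloor>coord T w x\<rfloor>)"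
      unfolding z_def
      by (simp add: linear_diff[OF linear_height[OF fr]] linear_sum[OF linear_height[OF fr]]
          linear_scale[OF linear_height[OF fr]] height_basis[OF fr])
    then have "height T z \<in> \<int>" using hx by (auto intro!: Ints_diff Ints_sum)
    then obtain k where "height T z = of_int k" by (rule Ints_cases)
    then have "(1::int) < k" "k < 2" using b(2,3) by simp_all
    then show False by simp
  qed
qed

text \<open>Representatives of \<open>N\<close> modulo the lattice spanned by \<open>T\<close>. The
  choice between the two half-open intervals matches \<open>half \<xi> T\<close>, so that adding
  nonnegative multiples of the vertices sweeps out the half-open cone exactly once, see
  \<open>half_bij\<close>.\<close>

definition cell :: "'a \<Rightarrow> 'a set \<Rightarrow> 'a set" where
  "cell \<xi> T = {y\<in>N. \<forall>w\<in>T. if coord T w \<xi> > 0 then 0 \<le> coord T w y \<and> coord T w y < 1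
                       else 0 < coord T w y \<and> coord T w y \<le> 1}"

definition shift :: "'a set \<Rightarrow> ('a \<Rightarrow> nat) \<Rightarrow> 'a" where
  "shift T a = (\<Sum>w\<in>T. of_nat (a w) *\<^sub>R w)"

lemma coord_shift: "frame T \<Longrightarrow> w \<in> T \<Longrightarrow> coord T w (shift T a) = of_nat (a w)"
  by (simp add: shift_def coord_lincomb)

lemma shift_N: "T \<in> \<T> \<Longrightarrow> shift T a \<in> N"
  unfolding shift_def using \<T>_N[of T] by (intro N_sum N_scale_nat) auto

lemma cell_unique_coord:
  fixes c c' :: real
  assumes "if p then 0 \<le> c \<and> c < 1 else 0 < c \<and> c \<le> 1"
    "if p then 0 \<le> c' \<and> c' < 1 else 0 < c' \<and> c' \<le> 1" "c - c' \<in> \<int>"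
  shows "c = c'"
proof -
  obtain k where "c - c' = of_int k" using assms(3) by (rule Ints_cases)
  moreover have "\<bar>c - c'\<bar> < 1" using assms(1,2) by (auto split: if_splits)
  ultimately have "\<bar>of_int k :: real\<bar> < 1" by simp
  then have "k = 0" by linarith
  then show ?thesis using \<open>c - c' = of_int k\<close> by simp
qed

lemma cell_eqI:
  assumes T: "T \<in> \<T>" and "y \<in> cell \<xi> T" "y' \<in> cell \<xi> T" "\<And>w. w \<in> T \<Longrightarrow> coord T w y - coord T w y' \<in> \<int>"
  shows "y = y'"
proof (rule coord_eqI[OF \<T>_frame[OF T]])
  fix w assume w: "w \<in> T"
  have "if coord T w \<xi> > 0 then 0 \<le> coord T w y \<and> coord T w y < 1 else 0 < coord T w y \<and> coord T w y \<le> 1"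
    "if coord T w \<xi> > 0 then 0 \<le> coord T w y' \<and> coord T w y' < 1 else 0 < coord T w y' \<and> coord T w y' \<le> 1"
    using assms(2,3) w unfolding cell_def by blast+
  then show "coord T w y = coord T w y'" by (rule cell_unique_coord[OF _ _ assms(4)[OF w]])
qed

lemma cell_reduce:
  assumes T: "T \<in> \<T>" and x: "x \<in> N"
  obtains y k where "y \<in> cell \<xi> T" "x = y + (\<Sum>w\<in>T. of_int (k w) *\<^sub>R w)"
    "\<And>w. w \<in> T \<Longrightarrow> coord T w x = coord T w y + of_int (k w)"
proof -
  have fr: "frame T" by (rule \<T>_frame[OF T])
  \<comment> \<open>Subtracting \<open>\<lceil>c\<rceil> - 1\<close> instead of the floor leaves a
    remainder in (0, 1] instead of [0, 1).\<close>
  define k where "k w = (if coord T w \<xi> > 0 then \<lfloor>coord T w x\<rfloor> else \<lceil>coord T w x\<rceil> - 1)" for w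
  define y where "y = x - (\<Sum>w\<in>T. of_int (k w) *\<^sub>R w)"
  have cy: "coord T w y = coord T w x - of_int (k w)" if "w \<in> T" for w
    using that by (simp add: y_def coord_diff[OF fr] coord_lincomb[OF fr])
  have yN: "y \<in> N" unfolding y_def using x \<T>_N[OF T] by (intro N_diff N_sum N_scale) auto
  have "if coord T w \<xi> > 0 then 0 \<le> coord T w y \<and> coord T w y < 1 else 0 < coord T w y \<and> coord T w y \<le> 1"
    if "w \<in> T" for w
  proof (cases "coord T w \<xi> > 0")
    case True
    have "of_int \<lfloor>coord T w x\<rfloor> \<le> coord T w x" "coord T w x - of_int \<lfloor>coord T w x\<rfloor> < 1"
      using floor_correct[of "coord T w x"] by linarith+
    then show ?thesis using True by (simp only: cy[OF that] k_def if_True) simp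
  next
    case False
    have "coord T w x \<le> of_int \<lceil>coord T w x\<rceil>" "of_int \<lceil>coord T w x\<rceil> - 1 < coord T w x"
      using ceiling_correct[of "coord T w x"] by simp_all
    then show ?thesis using False by (simp add: cy[OF that] k_def)
  qed
  then have "y \<in> cell \<xi> T" using yN by (simp add: cell_def)
  moreover have "x = y + (\<Sum>w\<in>T. of_int (k w) *\<^sub>R w)" by (simp add: y_def)
  moreover have "coord T w x = coord T w y + of_int (k w)" if "w \<in> T" for w using cy[OF that] by simp
  ultimately show ?thesis by (rule that)
qed

lemma finite_cell: assumes T: "T \<in> \<T>" shows "finite (cell \<xi> T)"
proof -
  have fr: "frame T" by (rule \<T>_frame[OF T])
  have "cell \<xi> T \<subseteq> N \<inter> cball 0 (\<Sum>w\<in>T. norm w)"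
  proof
    fix y assume y: "y \<in> cell \<xi> T"
    have "norm (\<Sum>w\<in>T. coord T w y *\<^sub>R w) \<le> (\<Sum>w\<in>T. norm w)"
    proof (rule sum_norm_le)
      fix w assume "w \<in> T"
      then have "0 \<le> coord T w y" "coord T w y \<le> 1" using y by (auto simp: cell_def split: if_splits)
      then show "norm (coord T w y *\<^sub>R w) \<le> norm w" by (simp add: mult_left_le_one_le)
    qed
    then show "y \<in> N \<inter> cball 0 (\<Sum>w\<in>T. norm w)" using y by (simp add: cell_def sum_coord[OF fr])
  qed
  then show ?thesis using finite_N_bounded[OF bounded_cball] finite_subset by blast
qed

lemma half_bij:
  assumes T: "T \<in> \<T>"
  shows "bij_betw (\<lambda>(y, a). y + shift T a) (cell \<xi> T \<times> PiE T (\<lambda>_. UNIV)) {x\<in>N. half \<xi> T x}"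
  unfolding bij_betw_def
proof
  have fr: "frame T" by (rule \<T>_frame[OF T])
  have cs: "coord T w (y + shift T a) = coord T w y + of_nat (a w)" if "w \<in> T" for w y a
    by (simp add: coord_add[OF fr] coord_shift[OF fr that])
  show "inj_on (\<lambda>(y, a). y + shift T a) (cell \<xi> T \<times> PiE T (\<lambda>_. UNIV))"
  proof (rule inj_onI, clarsimp)
    fix y a y' a'
    assume y: "y \<in> cell \<xi> T" "y' \<in> cell \<xi> T" and a: "a \<in> PiE T (\<lambda>_. UNIV)" "a' \<in> PiE T (\<lambda>_. UNIV)"
      and eq: "y + shift T a = y' + shift T a'"
    have ceq: "coord T w y + of_nat (a w) = coord T w y' + of_nat (a' w)" if "w \<in> T" for w
      using cs[OF that] eq by metis
    have "coord T w y - coord T w y' \<in> \<int>" if "w \<in> T" for w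
    proof -
      have "coord T w y - coord T w y' = of_int (int (a' w) - int (a w))" using ceq[OF that] by simp
      then show ?thesis by (metis Ints_of_int)
    qed
    then have "y = y'" by (rule cell_eqI[OF T y])
    moreover from this have "a = a'" using ceq a by (intro PiE_ext[OF a]) simp
    ultimately show "y = y' \<and> a = a'" by simp
  qed
  show "(\<lambda>(y, a). y + shift T a) ` (cell \<xi> T \<times> PiE T (\<lambda>_. UNIV)) = {x\<in>N. half \<xi> T x}"
  proof safe
    fix y a assume y: "y \<in> cell \<xi> T"
    show "y + shift T a \<in> N" using y shift_N[OF T] by (auto simp: cell_def intro: N_add)
    show "half \<xi> T (y + shift T a)" unfolding half_def
    proof
      fix w assume w: "w \<in> T"
      then have "if coord T w \<xi> > 0 then 0 \<le> coord T w y \<and> coord T w y < 1 else 0 < coord T w y \<and> coord T w y \<le> 1"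
        using y by (simp add: cell_def)
      then show "0 < coord T w (y + shift T a) \<or> coord T w (y + shift T a) = 0 \<and> 0 < coord T w \<xi>"
        using of_nat_0_le_iff[where ?'a=real, of "a w"] unfolding cs[OF w] by (auto split: if_splits)
    qed
  next
    fix x assume x: "x \<in> N" "half \<xi> T x"
    obtain y k where yk: "y \<in> cell \<xi> T" "x = y + (\<Sum>w\<in>T. of_int (k w) *\<^sub>R w)"
      "\<And>w. w \<in> T \<Longrightarrow> coord T w x = coord T w y + of_int (k w)" using cell_reduce[OF T x(1), of \<xi>] by blast
    have k0: "k w \<ge> 0" if w: "w \<in> T" for w
    proof -
      have "if coord T w \<xi> > 0 then 0 \<le> coord T w y \<and> coord T w y < 1 else 0 < coord T w y \<and> coord T w y \<le> 1"
        using yk(1) w by (simp add: cell_def)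
      moreover have "coord T w x > 0 \<or> coord T w x = 0 \<and> coord T w \<xi> > 0" using x(2) w by (simp add: half_def)
      \<comment> \<open>Either the coordinate of \<open>x\<close> is at least 0 and the remainder
        below 1, or the coordinate is positive and the remainder at most 1.\<close>
      ultimately have "of_int (k w) > (-1::real)" using yk(3)[OF w] by (auto split: if_splits)
      then show ?thesis by linarith
    qed
    define a where "a = restrict (\<lambda>w. nat (k w)) T"
    have "x = y + shift T a" unfolding yk(2) shift_def a_def using k0 by (auto intro!: sum.cong)
    moreover have "a \<in> PiE T (\<lambda>_. UNIV)" by (simp add: a_def)
    ultimately show "x \<in> (\<lambda>(y, a). y + shift T a) ` (cell \<xi> T \<times> PiE T (\<lambda>_. UNIV))"
      using yk(1) by (intro image_eqI[of _ _ "(y, a)"]) auto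
  qed
qed

text \<open>The index in \<open>N\<close> of the lattice spanned by \<open>T\<close>. The direction
  0 selects the interval (0, 1] throughout; by \<open>index_height\<close> every other choice gives
  the same number.\<close>

definition index :: "'a set \<Rightarrow> nat" where "index T = card (cell 0 T)"

text \<open>Since \<open>f\<close> is integral on \<open>T\<close> and detects the lattice spanned
  by \<open>T\<close>, it embeds the quotient of \<open>N\<close> into the reals modulo 1. The image
  of \<open>N\<close> is a group with bounded denominators that contains 1, hence it consists of the
  multiples of 1 / n, and the quotient is cyclic of order n.\<close>

lemma cell_cyclic:
  fixes f :: "'a \<Rightarrow> real"
  assumes T: "T \<in> \<T>" and f: "linear f" and fT: "\<And>w. w \<in> T \<Longrightarrow> f w \<in> \<int>" "\<exists>w\<in>T. f w = 1"
    and int: "\<And>x w. x \<in> N \<Longrightarrow> f x \<in> \<int> \<Longrightarrow> w \<in> T \<Longrightarrow> coord T w x \<in> \<int>"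
  shows "\<exists>n::nat. n > 0 \<and> f ` N = range (\<lambda>j::int. of_int j / of_nat n)
    \<and> (\<forall>\<xi>. bij_betw (\<lambda>y. frac (f y)) (cell \<xi> T) ((\<lambda>j. of_nat j / of_nat n) ` {..<n}))"
proof -
  have fr: "frame T" by (rule \<T>_frame[OF T])
  have fin: "finite T" by (rule finite_T[OF T])
  obtain k where k: "k > 0" "\<And>x w. x \<in> N \<Longrightarrow> w \<in> T \<Longrightarrow> of_nat k * coord T w x \<in> \<int>"
    using coord_common_denominator[OF fr \<T>_N[OF T]] by blast
  have fx: "f x = (\<Sum>w\<in>T. coord T w x * f w)" for x by (rule trans[OF linear_eq_sum_coord[OF fr f]]) simp
  have kf: "of_nat k * x \<in> \<int>" if xf: "x \<in> f ` N" for x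
  proof -
    obtain z where z: "z \<in> N" "x = f z" using xf by blast
    have "of_nat k * x = (\<Sum>w\<in>T. (of_nat k * coord T w z) * f w)"
      unfolding z(2) fx[of z] by (simp add: sum_distrib_left mult.assoc)
    also have "\<dots> \<in> \<int>" using k(2)[OF z(1)] fT(1) by (intro Ints_sum Ints_mult[of "of_nat k * _"])
    finally show ?thesis .
  qed
  have diff: "x - y \<in> f ` N" if xy: "x \<in> f ` N" "y \<in> f ` N" for x y
  proof -
    obtain u v where "u \<in> N" "v \<in> N" "x = f u" "y = f v" using xy by blast
    then show ?thesis by (intro image_eqI[of _ _ "u - v"]) (simp_all add: linear_diff[OF f] N_diff)
  qed
  have one: "1 \<in> f ` N" using fT(2) \<T>_N[OF T] by force
  obtain n :: nat where n: "n > 0" "f ` N = range (\<lambda>j::int. of_int j / of_nat n)"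
    by (rule real_subgroup_cyclic[OF diff one k(1) kf])
  have frac_shift: "frac (f x) = frac (f y)" if "x = y + (\<Sum>w\<in>T. of_int (k w) *\<^sub>R w)" for x y k
  proof -
    have "f x - f y = (\<Sum>w\<in>T. of_int (k w) * f w)"
      unfolding that by (simp add: linear_add[OF f] linear_sum[OF f] linear_scale[OF f])
    also have "\<dots> \<in> \<int>" using fT(1) by (intro Ints_sum Ints_mult Ints_of_int)
    finally obtain i where "f x - f y = of_int i" by (rule Ints_cases)
    then have "f x = f y + of_int i" by simp
    then show ?thesis by (simp add: frac_def)
  qed
  have bij: "bij_betw (\<lambda>y. frac (f y)) (cell \<xi> T) ((\<lambda>j. of_nat j / of_nat n) ` {..<n})" for \<xi>
    unfolding bij_betw_def
  proof
    show "inj_on (\<lambda>y. frac (f y)) (cell \<xi> T)"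
    proof (rule inj_onI)
      fix y y' assume y: "y \<in> cell \<xi> T" "y' \<in> cell \<xi> T" and eq: "frac (f y) = frac (f y')"
      have N: "y - y' \<in> N" using y by (auto simp: cell_def intro: N_diff)
      have "f (y - y') = of_int (\<lfloor>f y\<rfloor> - \<lfloor>f y'\<rfloor>)" using eq by (simp add: linear_diff[OF f] frac_def)
      then have "f (y - y') \<in> \<int>" by (metis Ints_of_int)
      then have "coord T w y - coord T w y' \<in> \<int>" if "w \<in> T" for w
        using int[OF N _ that] by (simp add: coord_diff[OF fr])
      then show "y = y'" by (rule cell_eqI[OF T y])
    qed
    show "(\<lambda>y. frac (f y)) ` cell \<xi> T = (\<lambda>j. of_nat j / of_nat n) ` {..<n}"
    proof safe
      fix y assume "y \<in> cell \<xi> T"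
      then have "f y \<in> f ` N" by (simp add: cell_def)
      then obtain j :: int where j: "f y = of_int j / of_nat n" using n(2) by auto
      have "frac (f y) = of_int (j mod int n) / of_nat n"
      proof -
        have "(of_int j :: real) = of_int ((j div int n) * int n + j mod int n)" by (simp only: div_mult_mod_eq)
        then have "(of_int j :: real) = of_int (j div int n) * of_nat n + of_int (j mod int n)"
          by (simp only: of_int_add of_int_mult of_int_of_nat_eq)
        then have eq: "f y = of_int (j div int n) + of_int (j mod int n) / of_nat n"
          unfolding j using n(1) by (simp add: add_divide_distrib)
        have "j mod int n < int n" using n(1) by simp
        then have "(of_int (j mod int n) :: real) < of_int (int n)" by (simp only: of_int_less_iff)
        then have lt: "of_int (j mod int n) / of_nat n < (1 :: real)" using n(1) by simp
        have ge: "0 \<le> (of_int (j mod int n) / of_nat n :: real)" using n(1) by simp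
        show ?thesis unfolding frac_unique_iff eq using lt ge by simp
      qed
      also have "\<dots> = of_nat (nat (j mod int n)) / of_nat n" using n(1) by simp
      finally show "frac (f y) \<in> (\<lambda>j. of_nat j / of_nat n) ` {..<n}"
        using n(1) by (intro image_eqI[of _ _ "nat (j mod int n)"]) (auto simp: nat_less_iff)
    next
      fix j :: nat assume j: "j < n"
      have "of_nat j / of_nat n \<in> f ` N" unfolding n(2) by (intro range_eqI[of _ _ "int j"]) simp
      then obtain x where x: "x \<in> N" "of_nat j / of_nat n = f x" by blast
      obtain y k where yk: "y \<in> cell \<xi> T" "x = y + (\<Sum>w\<in>T. of_int (k w) *\<^sub>R w)"
        by (rule cell_reduce[OF T x(1)])
      have "frac (f y) = frac (f x)" using frac_shift[OF yk(2)] by simp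
      also have "\<dots> = of_nat j / of_nat n" unfolding x(2)[symmetric] using j by (simp add: frac_eq)
      finally show "of_nat j / of_nat n \<in> (\<lambda>y. frac (f y)) ` cell \<xi> T" using yk(1) by (intro image_eqI[of _ _ y]) auto
    qed
  qed
  show ?thesis using n bij by blast
qed

lemma card_image_fractions: "n > 0 \<Longrightarrow> card ((\<lambda>j. of_nat j / of_nat n :: real) ` {..<n}) = n"
  by (subst card_image) (auto simp: inj_on_def)

lemma cell_index:
  fixes f :: "'a \<Rightarrow> real"
  assumes T: "T \<in> \<T>" and f: "linear f" and fT: "\<And>w. w \<in> T \<Longrightarrow> f w \<in> \<int>" "\<exists>w\<in>T. f w = 1"
    and int: "\<And>x w. x \<in> N \<Longrightarrow> f x \<in> \<int> \<Longrightarrow> w \<in> T \<Longrightarrow> coord T w x \<in> \<int>"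
  shows "index T > 0" "f ` N = range (\<lambda>j::int. of_int j / of_nat (index T))"
    "bij_betw (\<lambda>y. frac (f y)) (cell \<xi> T) ((\<lambda>j. of_nat j / of_nat (index T)) ` {..<index T})"
proof -
  obtain n :: nat where n: "n > 0" "f ` N = range (\<lambda>j::int. of_int j / of_nat n)"
    "\<forall>\<xi>. bij_betw (\<lambda>y. frac (f y)) (cell \<xi> T) ((\<lambda>j. of_nat j / of_nat n) ` {..<n})"
  proof -
    have "\<exists>n::nat. n > 0 \<and> f ` N = range (\<lambda>j::int. of_int j / of_nat n)
      \<and> (\<forall>\<xi>. bij_betw (\<lambda>y. frac (f y)) (cell \<xi> T) ((\<lambda>j. of_nat j / of_nat n) ` {..<n}))"
      by (rule cell_cyclic[OF T f]) (fact fT int)+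
    then show ?thesis using that by blast
  qed
  have "index T = n"
    unfolding index_def using bij_betw_same_card[OF n(3)[rule_format, of 0]] card_image_fractions[OF n(1)] by simp
  then show "index T > 0" "f ` N = range (\<lambda>j::int. of_int j / of_nat (index T))"
    "bij_betw (\<lambda>y. frac (f y)) (cell \<xi> T) ((\<lambda>j. of_nat j / of_nat (index T)) ` {..<index T})"
    using n by auto
qed

lemma T_nonempty: "T \<in> \<T> \<Longrightarrow> T \<noteq> {}" using card_T by fastforce

text \<open>By \<open>integral_coords\<close>, the height and likewise each single coordinate
  (\<open>index_coord\<close>) detect the lattice spanned by \<open>T\<close>. The quotient is thus
  cyclic, and each of these functionals meets every residue once.\<close>

lemma index_height:
  assumes T: "T \<in> \<T>"
  shows "index T > 0" "height T ` N = range (\<lambda>j::int. of_int j / of_nat (index T))"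
    "bij_betw (\<lambda>y. frac (height T y)) (cell \<xi> T) ((\<lambda>j. of_nat j / of_nat (index T)) ` {..<index T})"
proof -
  have 1: "height T w \<in> \<int>" if "w \<in> T" for w using that by (simp add: height_basis[OF \<T>_frame[OF T]])
  have 2: "\<exists>w\<in>T. height T w = 1" using T_nonempty[OF T] by (auto simp: height_basis[OF \<T>_frame[OF T]])
  have 3: "coord T w x \<in> \<int>" if "x \<in> N" "height T x \<in> \<int>" "w \<in> T" for x w
    using integral_coords[OF T that(1) _ that(3)] that(2) by blast
  show "index T > 0" "height T ` N = range (\<lambda>j::int. of_int j / of_nat (index T))"
    "bij_betw (\<lambda>y. frac (height T y)) (cell \<xi> T) ((\<lambda>j. of_nat j / of_nat (index T)) ` {..<index T})"
    by (rule cell_index[OF T linear_height[OF \<T>_frame[OF T]]], fact 1, fact 2, fact 3)+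
qed

lemma index_coord:
  assumes T: "T \<in> \<T>" and v: "v \<in> T"
  shows "coord T v ` N = range (\<lambda>j::int. of_int j / of_nat (index T))"
    "bij_betw (\<lambda>y. frac (coord T v y)) (cell \<xi> T) ((\<lambda>j. of_nat j / of_nat (index T)) ` {..<index T})"
proof -
  have 1: "coord T v w \<in> \<int>" if "w \<in> T" for w using that by (simp add: coord_basis[OF \<T>_frame[OF T]])
  have 2: "\<exists>w\<in>T. coord T v w = 1" using v by (auto simp: coord_basis[OF \<T>_frame[OF T]])
  have 3: "coord T w x \<in> \<int>" if "x \<in> N" "coord T v x \<in> \<int>" "w \<in> T" for x w
    using integral_coords[OF T that(1) _ that(3)] that(2) v by blast
  show "coord T v ` N = range (\<lambda>j::int. of_int j / of_nat (index T))"
    "bij_betw (\<lambda>y. frac (coord T v y)) (cell \<xi> T) ((\<lambda>j. of_nat j / of_nat (index T)) ` {..<index T})"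
    by (rule cell_index[OF T linear_coord[OF \<T>_frame[OF T]]], fact 1, fact 2, fact 3)+
qed

definition neg :: "'a \<Rightarrow> 'a set \<Rightarrow> nat" where "neg \<xi> T = card {w\<in>T. coord T w \<xi> < 0}"

text \<open>The trivial class is represented by \<open>y0\<close>, the sum of the vertices with
  negative coordinate of \<open>\<xi>\<close>, of height \<open>neg \<xi> T\<close>. All other
  points of the cell have nonintegral coordinates, hence a height between 1 and 2, and their
  fractional parts are the nonzero multiples of 1 / n, each once.\<close>

lemma sum_cell_height:
  fixes F :: "real \<Rightarrow> real"
  assumes T: "T \<in> \<T>" and \<xi>: "generic \<xi>"
  shows "(\<Sum>y\<in>cell \<xi> T. F (height T y))
    = F (of_nat (neg \<xi> T)) + (\<Sum>j\<in>{1..<index T}. F (1 + of_nat j / of_nat (index T)))"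
proof -
  let ?n = "index T"
  have fr: "frame T" by (rule \<T>_frame[OF T])
  have fin: "finite T" by (rule finite_T[OF T])
  have n0: "?n > 0" by (rule index_height(1)[OF T])
  define P where "P = {w\<in>T. coord T w \<xi> < 0}"
  have PT: "P \<subseteq> T" and finP: "finite P" using fin by (auto simp: P_def)
  define y0 where "y0 = \<Sum>P"
  have c0: "coord T w y0 = (if w \<in> P then 1 else 0)" if "w \<in> T" for w
  proof -
    have "coord T w (\<Sum>P) = (\<Sum>v\<in>P. if w = v then 1 else 0)"
      using PT by (auto simp: coord_sum[OF fr] coord_basis[OF fr] intro!: sum.cong)
    then show ?thesis using finP by (simp add: y0_def)
  qed
  have y0N: "y0 \<in> N" unfolding y0_def using PT \<T>_N[OF T] by (intro N_sum) auto
  have nz: "coord T w \<xi> \<noteq> 0" if "w \<in> T" for w by (rule generic_coord[OF \<xi> fr \<T>_sub[OF T] that])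
  have y0: "y0 \<in> cell \<xi> T" unfolding cell_def
    using y0N c0 nz by (auto simp: P_def not_less_iff_gr_or_eq)
  have h0: "height T y0 = of_nat (neg \<xi> T)"
  proof -
    have "height T y0 = (\<Sum>w\<in>T. if w \<in> P then 1 else 0)"
      unfolding height_def by (intro sum.cong) (auto simp: c0)
    also have "\<dots> = of_nat (card P)" using fin PT by (simp add: sum.inter_restrict[symmetric] Int_absorb1)
    finally show ?thesis by (simp add: neg_def P_def)
  qed
  have hy: "height T y = 1 + frac (height T y)" if y: "y \<in> cell \<xi> T - {y0}" for y
  proof -
    have yN: "y \<in> N" using y by (simp add: cell_def)
    have ni: "coord T w y \<notin> \<int>" if w: "w \<in> T" for w
    proof
      assume "coord T w y \<in> \<int>"
      then have "coord T v y - coord T v y0 \<in> \<int>" if "v \<in> T" for v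
        using integral_coords[OF T yN _ that] w c0[OF that] by auto
      then have "y = y0" using cell_eqI[OF T _ y0, of y] y by blast
      then show False using y by simp
    qed
    have c: "0 \<le> coord T w y \<and> coord T w y < 1" if w: "w \<in> T" for w
    proof -
      have "coord T w y \<noteq> 1" using ni[OF w] by auto
      then show ?thesis using y w by (auto simp: cell_def split: if_splits)
    qed
    obtain w where "w \<in> T" using T_nonempty[OF T] by blast
    then have "y \<noteq> 0" using ni[of w] by (auto simp: coord_zero[OF fr])
    then have "1 < height T y" "height T y < 2" using cell_interior[OF T yN _ c] by auto
    then have "\<lfloor>height T y\<rfloor> = 1" by linarith
    then show ?thesis by (simp add: frac_def)
  qed
  have bij: "bij_betw (\<lambda>y. frac (height T y)) (cell \<xi> T) ((\<lambda>j. of_nat j / of_nat ?n) ` {..<?n})"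
    by (rule index_height(3)[OF T])
  have f0: "frac (height T y0) = 0" by (simp add: h0)
  have im: "(\<lambda>y. frac (height T y)) ` (cell \<xi> T - {y0}) = (\<lambda>j. of_nat j / of_nat ?n) ` {1..<?n}"
  proof -
    have "(\<lambda>y. frac (height T y)) ` (cell \<xi> T - {y0})
        = (\<lambda>y. frac (height T y)) ` cell \<xi> T - (\<lambda>y. frac (height T y)) ` {y0}"
      using bij y0 by (intro inj_on_image_set_diff[of _ "cell \<xi> T"]) (auto simp: bij_betw_def)
    also have "\<dots> = (\<lambda>j. of_nat j / of_nat ?n) ` {..<?n} - {0}"
      using bij by (simp only: bij_betw_def image_insert image_empty f0)
    also have "\<dots> = (\<lambda>j. of_nat j / of_nat ?n) ` {1..<?n}" using n0 by (auto simp: Suc_le_eq)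
    finally show ?thesis .
  qed
  have inj: "inj_on (\<lambda>y. frac (height T y)) (cell \<xi> T - {y0})"
    using bij by (auto simp: bij_betw_def intro: inj_on_subset)
  have "(\<Sum>y\<in>cell \<xi> T. F (height T y)) = F (height T y0) + (\<Sum>y\<in>cell \<xi> T - {y0}. F (height T y))"
    using finite_cell[OF T] y0 by (simp add: sum.remove)
  also have "(\<Sum>y\<in>cell \<xi> T - {y0}. F (height T y)) = (\<Sum>y\<in>cell \<xi> T - {y0}. F (1 + frac (height T y)))"
    by (intro sum.cong refl) (metis hy)
  also have "\<dots> = (\<Sum>x\<in>(\<lambda>j. of_nat j / of_nat ?n) ` {1..<?n}. F (1 + x))"
    unfolding im[symmetric] by (simp add: sum.reindex[OF inj])
  also have "\<dots> = (\<Sum>j\<in>{1..<?n}. F (1 + of_nat j / of_nat ?n))"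
    using n0 by (subst sum.reindex) (auto simp: inj_on_def)
  finally show ?thesis by (simp add: h0)
qed

lemma sum_cell_coord:
  fixes F :: "real \<Rightarrow> real"
  assumes T: "T \<in> \<T>" and v: "v \<in> T"
  shows "(\<Sum>y\<in>cell \<xi> T. F (of_nat (index T) * coord T v y))
    = (if coord T v \<xi> > 0 then \<Sum>j<index T. F (of_nat j) else \<Sum>j<index T. F (of_nat (Suc j)))"
proof -
  let ?n = "index T"
  have n0: "?n > 0" by (rule index_height(1)[OF T])
  \<comment> \<open>\<open>F\<close> rewritten in terms of the fractional part: the part 0 stands
    for the coordinate 0 or 1, depending on which end of the interval belongs to the cell.\<close>
  define G where "G x = (if coord T v \<xi> > 0 \<or> x \<noteq> 0 then F (of_nat ?n * x) else F (of_nat ?n))" for x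
  have FG: "F (of_nat ?n * coord T v y) = G (frac (coord T v y))" if y: "y \<in> cell \<xi> T" for y
  proof -
    have c: "if coord T v \<xi> > 0 then 0 \<le> coord T v y \<and> coord T v y < 1 else 0 < coord T v y \<and> coord T v y \<le> 1"
      using y v by (simp add: cell_def)
    show ?thesis
    proof (cases "coord T v y = 1")
      case True then show ?thesis using c by (auto simp: G_def split: if_splits)
    next
      case False
      then have "frac (coord T v y) = coord T v y" using c by (auto simp: frac_eq split: if_splits)
      then show ?thesis using c by (auto simp: G_def split: if_splits)
    qed
  qed
  have bij: "bij_betw (\<lambda>y. frac (coord T v y)) (cell \<xi> T) ((\<lambda>j. of_nat j / of_nat ?n) ` {..<?n})"
    by (rule index_coord(2)[OF T v])
  have "(\<Sum>y\<in>cell \<xi> T. F (of_nat ?n * coord T v y)) = (\<Sum>y\<in>cell \<xi> T. G (frac (coord T v y)))"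
    by (intro sum.cong refl FG)
  also have "\<dots> = (\<Sum>x\<in>(\<lambda>j. of_nat j / of_nat ?n) ` {..<?n}. G x)"
    by (rule sum.reindex_bij_betw[OF bij])
  also have "\<dots> = (\<Sum>j<?n. G (of_nat j / of_nat ?n))"
    using n0 by (subst sum.reindex) (auto simp: inj_on_def)
  finally have eq: "(\<Sum>y\<in>cell \<xi> T. F (of_nat ?n * coord T v y)) = (\<Sum>j<?n. G (of_nat j / of_nat ?n))" .
  show ?thesis
  proof (cases "coord T v \<xi> > 0")
    case True then show ?thesis using n0 by (simp add: eq G_def)
  next
    case False
    obtain m where m: "?n = Suc m" using n0 gr0_implies_Suc by blast
    have "(\<Sum>j<?n. G (of_nat j / of_nat ?n)) = G 0 + (\<Sum>j<m. G (of_nat (Suc j) / of_nat ?n))"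
      unfolding m by (subst sum.lessThan_Suc_shift) simp
    also have "(\<Sum>j<m. G (of_nat (Suc j) / of_nat ?n)) = (\<Sum>j<m. F (of_nat (Suc j)))"
      by (intro sum.cong refl) (simp add: G_def m del: of_nat_Suc)
    also have "G 0 + \<dots> = (\<Sum>j<?n. F (of_nat (Suc j)))"
      using False by (simp add: G_def m)
    finally show ?thesis using False eq by simp
  qed
qed

text \<open>Stacking translates of the cell in direction \<open>v\<close> turns the residues into
  consecutive integers, starting at 0 or at 1 according to the sign of the coordinate of
  \<open>\<xi>\<close>.\<close>

lemma sum_cell_layers:
  fixes F :: "real \<Rightarrow> real"
  assumes T: "T \<in> \<T>" and v: "v \<in> T"
  shows "(\<Sum>y\<in>cell \<xi> T. \<Sum>a<C. F (of_nat (index T) * (coord T v y + of_nat a)))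
    = (if coord T v \<xi> > 0 then \<Sum>k<C * index T. F (of_nat k) else \<Sum>k<C * index T. F (of_nat (Suc k)))"
proof -
  let ?n = "index T"
  have grp: "(\<Sum>a<C. \<Sum>j<?n. f (a * ?n + j)) = (\<Sum>k<C * ?n. f k)" for f :: "nat \<Rightarrow> real"
  proof -
    have "(\<Sum>j<?n. f (a * ?n + j)) = sum f {a * ?n..<a * ?n + ?n}" for a
      using sum.shift_bounds_nat_ivl[of f 0 "a * ?n" ?n] by (simp add: atLeast0LessThan add.commute)
    then show ?thesis by (simp add: sum.nat_group)
  qed
  have "(\<Sum>y\<in>cell \<xi> T. \<Sum>a<C. F (of_nat ?n * (coord T v y + of_nat a)))
      = (\<Sum>a<C. \<Sum>y\<in>cell \<xi> T. F (of_nat ?n * coord T v y + of_nat (a * ?n)))"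
    by (subst sum.swap) (simp add: algebra_simps)
  also have "\<dots> = (\<Sum>a<C. if coord T v \<xi> > 0 then \<Sum>j<?n. F (of_nat (a * ?n + j)) else \<Sum>j<?n. F (of_nat (Suc (a * ?n + j))))"
    by (intro sum.cong refl, subst sum_cell_coord[OF T v, of "\<lambda>x. F (x + of_nat (_ * ?n))"]) (simp add: algebra_simps)
  also have "\<dots> = (if coord T v \<xi> > 0 then \<Sum>k<C * ?n. F (of_nat k) else \<Sum>k<C * ?n. F (of_nat (Suc k)))"
    using grp[of "\<lambda>k. F (of_nat k)"] grp[of "\<lambda>k. F (of_nat (Suc k))"] by simp
  finally show ?thesis .
qed

end

section \<open>Exponential sums over the lattice\<close>

lemma has_sum_sum:
  fixes f :: "'i \<Rightarrow> 'b \<Rightarrow> real"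
  assumes "finite I" "\<And>i. i \<in> I \<Longrightarrow> (f i has_sum s i) A"
  shows "((\<lambda>x. \<Sum>i\<in>I. f i x) has_sum (\<Sum>i\<in>I. s i)) A"
  using assms by (induction I rule: finite_induct) (auto intro: has_sum_add)

text \<open>Nonnegativity provides the summability over the product set that an iterated sum alone
  does not give.\<close>

lemma has_sum_PiE_prod_nonneg:
  fixes f :: "'i \<Rightarrow> 'b \<Rightarrow> real"
  assumes "finite A" "\<And>i. i \<in> A \<Longrightarrow> (f i has_sum s i) (B i)" "\<And>i y. i \<in> A \<Longrightarrow> y \<in> B i \<Longrightarrow> f i y \<ge> 0"
  shows "((\<lambda>g. \<Prod>i\<in>A. f i (g i)) has_sum (\<Prod>i\<in>A. s i)) (PiE A B)"
  using assms
proof (induction A rule: finite_induct)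
  case empty
  then show ?case by (simp add: has_sum_finiteI)
next
  case (insert x A)
  let ?P = "\<Prod>i\<in>A. s i"
  have IH: "((\<lambda>g. \<Prod>i\<in>A. f i (g i)) has_sum ?P) (PiE A B)"
    using insert.prems by (intro insert.IH) auto
  have nn: "(\<Prod>i\<in>A. f i (g i)) \<ge> 0" if "g \<in> PiE A B" for g
    using that insert.prems(2) by (intro prod_nonneg) (auto simp: PiE_iff)
  let ?F = "\<lambda>(y, g). f x y * (\<Prod>i\<in>A. f i (g i))"
  have inner: "((\<lambda>g. ?F (y, g)) has_sum f x y * ?P) (PiE A B)" for y
    using has_sum_cmult_right[OF IH, of "f x y"] by simp
  have outer: "((\<lambda>y. f x y * ?P) has_sum s x * ?P) (B x)"
    using insert.prems(1)[of x] by (intro has_sum_cmult_left) simp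
  have "?F summable_on (B x \<times> PiE A B)"
    by (rule summable_on_SigmaI[OF inner])
       (use outer insert.prems(2)[of x] nn in \<open>auto simp: summable_on_def intro: mult_nonneg_nonneg\<close>)
  then have *: "(?F has_sum s x * ?P) (B x \<times> PiE A B)"
    by (rule has_sum_SigmaI[OF inner outer])
  have bij: "bij_betw (\<lambda>(y, g). g(x := y)) (B x \<times> PiE A B) (PiE (insert x A) B)"
    unfolding bij_betw_def PiE_insert_eq
    using inj_combinator[OF insert.hyps(2)] by (auto simp: image_def)
  have F: "?F = (\<lambda>z. \<Prod>i\<in>insert x A. f i (((\<lambda>(y, g). g(x := y)) z) i))"
  proof
    fix z :: "'b \<times> ('i \<Rightarrow> 'b)"
    obtain y g where z: "z = (y, g)" by (cases z)
    have "(\<Prod>i\<in>A. f i ((g(x := y)) i)) = (\<Prod>i\<in>A. f i (g i))"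
      using insert.hyps by (intro prod.cong) auto
    then show "?F z = (\<Prod>i\<in>insert x A. f i (((\<lambda>(y, g). g(x := y)) z) i))" using insert.hyps z by simp
  qed
  have "((\<lambda>g. \<Prod>i\<in>insert x A. f i (g i)) has_sum s x * ?P) (PiE (insert x A) B)"
    using * unfolding F has_sum_reindex_bij_betw[OF bij, of "\<lambda>g. \<Prod>i\<in>insert x A. f i (g i)"] .
  then show ?case using insert.hyps by simp
qed

text \<open>Exponents are sorted by their truncation at \<open>C\<close>: each class below
  \<open>C\<close> is a single term, the class of \<open>C\<close> is a full geometric
  series.\<close>

lemma has_sum_truncated_geometric:
  fixes t :: real
  assumes t: "0 \<le> t" "t < 1" and c: "c \<le> C"
  shows "((\<lambda>k. if min k C = c then t ^ (k - C) else 0) has_sum (if c = C then 1 / (1 - t) else 1)) UNIV"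
proof (rule sums_nonneg_imp_has_sum)
  let ?g = "\<lambda>k. if min k C = c then t ^ (k - C) else 0"
  show "?g sums (if c = C then 1 / (1 - t) else 1)"
  proof (cases "c = C")
    case True
    have "(\<lambda>k. ?g (k + C)) sums (1 / (1 - t))"
      using geometric_sums[of t] t True by simp
    moreover have "(\<Sum>k<C. ?g k) = 0" using True by (intro sum.neutral) auto
    ultimately show ?thesis using True sums_iff_shift[of ?g C "1 / (1 - t)"] by simp
  next
    case False
    then have "?g = (\<lambda>k. if k = c then 1 else 0)" using c by (auto simp: fun_eq_iff min_def)
    then show ?thesis using False sums_single[of c "\<lambda>_. 1 :: real"] by simp
  qed
  show "?g k \<ge> 0" for k using t by simp
qed

text \<open>All \<open>a\<close> with the same truncation at \<open>C\<close> are summed together.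
  Such a fibre is a product of single points and full rays, with one factor
  \<open>1 / (1 - t)\<close> for each coordinate that has reached \<open>C\<close>.\<close>

lemma has_sum_stable:
  fixes f :: "('i \<Rightarrow> nat) \<Rightarrow> real" and t :: real
  assumes fin: "finite T" and t: "0 \<le> t" "t < 1"
    and st: "\<And>a. a \<in> PiE T (\<lambda>_. UNIV) \<Longrightarrow> f a = f (\<lambda>w\<in>T. min (a w) C) * t ^ (\<Sum>w\<in>T. a w - C)"
  shows "(f has_sum (\<Sum>a\<in>PiE T (\<lambda>_. {..C}). f a * (\<Prod>w\<in>T. if a w = C then 1 / (1 - t) else 1)))
    (PiE T (\<lambda>_. UNIV))"
proof -
  let ?Q = "PiE T (\<lambda>_. {..C})"
  let ?g = "\<lambda>c k. if min k C = c then t ^ (k - C) else 0 :: real"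
  have finQ: "finite ?Q" using fin by (intro finite_PiE) auto
  have "((\<lambda>a. \<Prod>w\<in>T. ?g (a' w) (a w)) has_sum (\<Prod>w\<in>T. if a' w = C then 1 / (1 - t) else 1)) (PiE T (\<lambda>_. UNIV))"
    if "a' \<in> ?Q" for a'
    using that t by (intro has_sum_PiE_prod_nonneg[OF fin] has_sum_truncated_geometric) (auto simp: PiE_iff)
  then have "((\<lambda>a. \<Sum>a'\<in>?Q. f a' * (\<Prod>w\<in>T. ?g (a' w) (a w)))
      has_sum (\<Sum>a'\<in>?Q. f a' * (\<Prod>w\<in>T. if a' w = C then 1 / (1 - t) else 1))) (PiE T (\<lambda>_. UNIV))"
    by (intro has_sum_sum[OF finQ] has_sum_cmult_right)
  moreover have "(\<Sum>a'\<in>?Q. f a' * (\<Prod>w\<in>T. ?g (a' w) (a w))) = f a" if a: "a \<in> PiE T (\<lambda>_. UNIV)" for a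
  proof -
    define m where "m = (\<lambda>w\<in>T. min (a w) C)"
    have mQ: "m \<in> ?Q" by (auto simp: m_def)
    have z: "f a' * (\<Prod>w\<in>T. ?g (a' w) (a w)) = (if a' = m then f m * t ^ (\<Sum>w\<in>T. a w - C) else 0)"
      if a': "a' \<in> ?Q" for a'
    proof (cases "a' = m")
      case True
      then have "(\<Prod>w\<in>T. ?g (a' w) (a w)) = (\<Prod>w\<in>T. t ^ (a w - C))"
        by (intro prod.cong) (auto simp: m_def)
      then show ?thesis using True by (simp add: power_sum)
    next
      case False
      have "\<exists>w\<in>T. a' w \<noteq> m w"
      proof (rule ccontr)
        assume "\<not> ?thesis"
        then have "a' = m" using PiE_ext[OF a' mQ] by blast
        then show False using False by simp
      qed
      then obtain w where "w \<in> T" "a' w \<noteq> m w" by blast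
      then have "(\<Prod>w\<in>T. ?g (a' w) (a w)) = 0"
        using fin by (intro prod_zero) (auto simp: m_def intro!: bexI[of _ w])
      then show ?thesis using False by simp
    qed
    have "(\<Sum>a'\<in>?Q. f a' * (\<Prod>w\<in>T. ?g (a' w) (a w))) = (\<Sum>a'\<in>?Q. if a' = m then f m * t ^ (\<Sum>w\<in>T. a w - C) else 0)"
      by (intro sum.cong refl z)
    also have "\<dots> = f m * t ^ (\<Sum>w\<in>T. a w - C)" using finQ mQ by simp
    also have "\<dots> = f a" using st[OF a] by (simp add: m_def)
    finally show ?thesis .
  qed
  ultimately show ?thesis
    by (subst (asm) has_sum_cong[of _ _ f]) auto
qed

context triangulated
begin

lemma has_sum_cells:
  fixes F :: "'a \<Rightarrow> real"
  assumes \<xi>: "generic \<xi>" and nn: "\<And>x. F x \<ge> 0"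
    and S: "\<And>T y. T \<in> \<T> \<Longrightarrow> y \<in> cell \<xi> T \<Longrightarrow> ((\<lambda>a. F (y + shift T a)) has_sum S T y) (PiE T (\<lambda>_. UNIV))"
  shows "(F has_sum (\<Sum>T\<in>\<T>. \<Sum>y\<in>cell \<xi> T. S T y)) N"
proof -
  have 1: "(F has_sum (\<Sum>y\<in>cell \<xi> T. S T y)) {x\<in>N. half \<xi> T x}" if T: "T \<in> \<T>" for T
  proof -
    let ?F = "\<lambda>z. F ((\<lambda>(y, a). y + shift T a) z)"
    have inner: "((\<lambda>a. ?F (y, a)) has_sum S T y) (PiE T (\<lambda>_. UNIV))" if "y \<in> cell \<xi> T" for y
      using S[OF T that] by simp
    have outer: "(S T has_sum (\<Sum>y\<in>cell \<xi> T. S T y)) (cell \<xi> T)"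
      by (rule has_sum_finite[OF finite_cell[OF T]])
    have sm: "?F summable_on (cell \<xi> T \<times> PiE T (\<lambda>_. UNIV))"
      by (rule summable_on_SigmaI[where f = ?F, OF inner]) (use nn finite_cell[OF T] in auto)
    have "(?F has_sum (\<Sum>y\<in>cell \<xi> T. S T y)) (cell \<xi> T \<times> PiE T (\<lambda>_. UNIV))"
      using inner outer sm by (rule has_sum_SigmaI[where f = ?F])
    then show ?thesis
      by (subst (asm) has_sum_reindex_bij_betw[OF half_bij[OF T], of F])
  qed
  let ?S = "Sigma \<T> (\<lambda>T. {x\<in>N. half \<xi> T x})"
  let ?F = "\<lambda>z. F (snd z)"
  have inner: "((\<lambda>x. ?F (T, x)) has_sum (\<Sum>y\<in>cell \<xi> T. S T y)) {x\<in>N. half \<xi> T x}" if "T \<in> \<T>" for T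
    using 1[OF that] by simp
  have outer: "((\<lambda>T. \<Sum>y\<in>cell \<xi> T. S T y) has_sum (\<Sum>T\<in>\<T>. \<Sum>y\<in>cell \<xi> T. S T y)) \<T>"
    by (rule has_sum_finite[OF finite_\<T>])
  have sm: "?F summable_on ?S"
    by (rule summable_on_SigmaI[where f = ?F, OF inner]) (use nn finite_\<T> in auto)
  have "(?F has_sum (\<Sum>T\<in>\<T>. \<Sum>y\<in>cell \<xi> T. S T y)) ?S"
    using inner outer sm by (rule has_sum_SigmaI[where f = ?F])
  moreover have "bij_betw snd ?S N"
    unfolding bij_betw_def
  proof
    show "inj_on snd ?S"
    proof (rule inj_onI)
      fix p q assume p: "p \<in> ?S" and q: "q \<in> ?S" and eq: "snd p = snd q"
      have "fst p \<in> \<T>" "half \<xi> (fst p) (snd p)" using p by auto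
      moreover have "fst q \<in> \<T>" "half \<xi> (fst q) (snd p)" using q eq by auto
      ultimately have "fst p = fst q" using half_unique[OF \<xi>, of "snd p"] by blast
      then show "p = q" using eq by (rule prod_eqI)
    qed
    show "snd ` ?S = N"
    proof safe
      fix x assume x: "x \<in> N"
      obtain T where "T \<in> \<T>" "half \<xi> T x" using half_unique[OF \<xi>, of x] by blast
      then show "x \<in> snd ` ?S" using x by (intro image_eqI[of _ _ "(T, x)"]) auto
    qed auto
  qed
  ultimately show ?thesis
    by (subst (asm) has_sum_reindex_bij_betw[of snd _ N F]) auto
qed

text \<open>On each cone the gauge is the additive height, so the sum over shifts of a point of the
  cell splits into three geometric series.\<close>

lemma has_sum_gauge:
  assumes \<xi>: "generic \<xi>" and s: "s > (0::real)"
  shows "((\<lambda>x. exp (- s * gauge x)) has_sum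
    (\<Sum>T\<in>\<T>. \<Sum>y\<in>cell \<xi> T. exp (- s * height T y) / (1 - exp (- s)) ^ 3)) N"
proof (rule has_sum_cells[OF \<xi>])
  fix T y assume T: "T \<in> \<T>" and y: "y \<in> cell \<xi> T"
  have fr: "frame T" by (rule \<T>_frame[OF T])
  have fin: "finite T" by (rule finite_T[OF T])
  have t: "exp (- s) < 1" using s by simp
  have "((\<lambda>a. \<Prod>w\<in>T. exp (- s) ^ a w) has_sum (\<Prod>w\<in>T. 1 / (1 - exp (- s)))) (PiE T (\<lambda>_. UNIV))"
    using t by (intro has_sum_PiE_prod_nonneg[OF fin] sums_nonneg_imp_has_sum geometric_sums) auto
  from has_sum_cmult_right[OF this, of "exp (- s * height T y)"]
  have "((\<lambda>a. exp (- s * height T y) * (\<Prod>w\<in>T. exp (- s) ^ a w)) has_sum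
      (exp (- s * height T y) / (1 - exp (- s)) ^ 3)) (PiE T (\<lambda>_. UNIV))"
    by (simp add: card_T[OF T] power_one_over divide_simps)
  moreover have "exp (- s * height T y) * (\<Prod>w\<in>T. exp (- s) ^ a w) = exp (- s * gauge (y + shift T a))" for a
  proof -
    have "0 \<le> coord T w (y + shift T a)" if w: "w \<in> T" for w
      using y w by (auto simp: coord_add[OF fr] coord_shift[OF fr w] cell_def split: if_splits)
    then have "gauge (y + shift T a) = height T y + height T (shift T a)"
      by (simp add: gauge_eq_height[OF T] linear_add[OF linear_height[OF fr]])
    also have "height T (shift T a) = (\<Sum>w\<in>T. of_nat (a w))"
      unfolding height_def by (intro sum.cong refl coord_shift[OF fr])
    finally have "exp (- s * gauge (y + shift T a)) = exp (- s * height T y) * exp (\<Sum>w\<in>T. of_nat (a w) * (- s))"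
      by (simp add: exp_add[symmetric] sum_distrib_left algebra_simps)
    also have "exp (\<Sum>w\<in>T. of_nat (a w) * (- s)) = (\<Prod>w\<in>T. exp (- s) ^ a w)"
      using fin by (simp add: exp_sum exp_of_nat_mult[symmetric])
    finally show ?thesis by simp
  qed
  ultimately show "((\<lambda>a. exp (- s * gauge (y + shift T a))) has_sum
      (exp (- s * height T y) / (1 - exp (- s)) ^ 3)) (PiE T (\<lambda>_. UNIV))" by simp
qed simp

text \<open>Depth \<open>C\<close> along \<open>w\<close> suffices to force every functional active
  at \<open>2 *\<^sub>R x + u\<close> to be 1 at \<open>w\<close>. A further step by
  \<open>w\<close> then raises the gauge there by exactly 2, see
  \<open>gauge_stable_step\<close>.\<close>

definition stable :: "nat \<Rightarrow> 'a set \<Rightarrow> bool" where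
  "stable C U \<longleftrightarrow> (\<forall>T\<in>\<T>. \<forall>x. (\<forall>v\<in>T. coord T v x \<ge> 0) \<longrightarrow> (\<forall>w\<in>T. coord T w x \<ge> of_nat C \<longrightarrow>
     (\<forall>u\<in>U. \<forall>h\<in>E. h \<bullet> (2 *\<^sub>R x + u) = gauge (2 *\<^sub>R x + u) \<longrightarrow> h \<bullet> w = 1)))"

lemma stable_mono: "stable C U \<Longrightarrow> C \<le> C' \<Longrightarrow> stable C' U"
  unfolding stable_def by (meson of_nat_mono order_trans)

text \<open>The values of functionals at points of \<open>V\<close> below 1 stay below by a gap
  \<open>\<eta>\<close>. A functional with such a value at \<open>w\<close> falls behind the
  functional of \<open>T\<close> by \<open>\<eta> * coord T w x\<close> at \<open>x\<close>, while
  \<open>u\<close> can make up for at most \<open>B\<close>. Depth above \<open>B / \<eta>\<close>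
  excludes it.\<close>

lemma stable_exists:
  assumes "finite U" obtains C where "stable C U"
proof -
  have "\<exists>B. \<forall>h\<in>E. \<forall>u\<in>U. \<bar>h \<bullet> u\<bar> \<le> B"
  proof (intro exI ballI)
    fix h u assume hu: "h \<in> E" "u \<in> U"
    have "\<bar>h \<bullet> u\<bar> \<le> (\<Sum>u\<in>U. \<bar>h \<bullet> u\<bar>)"
      using hu(2) assms by (intro member_le_sum[of u U "\<lambda>u. \<bar>h \<bullet> u\<bar>"]) auto
    also have "\<dots> \<le> (\<Sum>h\<in>E. \<Sum>u\<in>U. \<bar>h \<bullet> u\<bar>)"
      using hu(1) finite_E by (intro member_le_sum[of h E "\<lambda>h. \<Sum>u\<in>U. \<bar>h \<bullet> u\<bar>"]) (auto intro: sum_nonneg)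
    finally show "\<bar>h \<bullet> u\<bar> \<le> (\<Sum>h\<in>E. \<Sum>u\<in>U. \<bar>h \<bullet> u\<bar>)" .
  qed
  then obtain B where B: "\<And>h u. h \<in> E \<Longrightarrow> u \<in> U \<Longrightarrow> \<bar>h \<bullet> u\<bar> \<le> B" by blast
  let ?P = "{(h, v) \<in> E \<times> V. h \<bullet> v \<noteq> 1}"
  have finP: "finite ?P"
    by (rule finite_subset[of _ "E \<times> V"]) (use finite_E finite_V in auto)
  have "\<exists>\<eta>>0. \<forall>(h, v)\<in>?P. h \<bullet> v \<le> 1 - \<eta>"
  proof (cases "?P = {}")
    case True then show ?thesis by (intro exI[of _ 1]) simp
  next
    case False
    obtain p where p: "p \<in> ?P" "\<forall>q\<in>?P. 1 - fst p \<bullet> snd p \<le> 1 - fst q \<bullet> snd q"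
      using finite_ex_min[OF finP False, of "\<lambda>p. 1 - fst p \<bullet> snd p"] by blast
    have "1 - fst p \<bullet> snd p > 0" using p(1) V_inner_le by (fastforce simp: less_le)
    then show ?thesis using p(2) by (intro exI[of _ "1 - fst p \<bullet> snd p"]) auto
  qed
  then obtain \<eta> where \<eta>: "\<eta> > 0" "\<And>h v. h \<in> E \<Longrightarrow> v \<in> V \<Longrightarrow> h \<bullet> v \<noteq> 1 \<Longrightarrow> h \<bullet> v \<le> 1 - \<eta>" by auto
  obtain C :: nat where C: "of_nat C > B / \<eta>" using reals_Archimedean2 by blast
  have "stable C U" unfolding stable_def
  proof (intro ballI allI impI)
    fix T x w u h
    assume T: "T \<in> \<T>" and x: "\<forall>v\<in>T. coord T v x \<ge> 0" and w: "w \<in> T" and wC: "coord T w x \<ge> of_nat C"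
      and u: "u \<in> U" and h: "h \<in> E" and act: "h \<bullet> (2 *\<^sub>R x + u) = gauge (2 *\<^sub>R x + u)"
    have fr: "frame T" by (rule \<T>_frame[OF T])
    have fin: "finite T" by (rule finite_T[OF T])
    show "h \<bullet> w = 1"
    proof (rule ccontr)
      assume ne: "h \<bullet> w \<noteq> 1"
      have hw: "h \<bullet> w \<le> 1 - \<eta>" using \<eta>(2)[OF h _ ne] w \<T>_sub[OF T] by blast
      obtain g where g: "g \<in> E" "\<forall>v\<in>T. g \<bullet> v = 1" using \<T>_face[OF T] by blast
      have "2 * height T x - B \<le> g \<bullet> (2 *\<^sub>R x + u)"
        using inner_eq_height[OF fr g(2), of x] B[OF g(1) u] by (simp add: inner_add_right abs_le_iff)
      also have "\<dots> \<le> gauge (2 *\<^sub>R x + u)" by (rule gauge_ge[OF g(1)])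
      also have "\<dots> = 2 * (h \<bullet> x) + h \<bullet> u" by (simp add: act[symmetric] inner_add_right)
      also have "\<dots> \<le> 2 * (h \<bullet> x) + B" using B[OF h u] by (simp add: abs_le_iff)
      finally have 1: "height T x - B \<le> h \<bullet> x" by simp
      have "h \<bullet> x = coord T w x * (h \<bullet> w) + (\<Sum>v\<in>T - {w}. coord T v x * (h \<bullet> v))"
        by (subst inner_eq_sum_coord[OF fr]) (simp add: sum.remove[OF fin w])
      also have "\<dots> \<le> coord T w x * (1 - \<eta>) + (\<Sum>v\<in>T - {w}. coord T v x)"
        using x w hw V_inner_le[OF _ h] \<T>_sub[OF T]
        by (intro add_mono mult_left_mono sum_mono) (auto intro: mult_left_le)
      also have "\<dots> = height T x - \<eta> * coord T w x"
        by (simp add: height_def sum.remove[OF fin w] algebra_simps)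
      finally have "\<eta> * coord T w x \<le> B" using 1 by simp
      moreover have "B < \<eta> * of_nat C" using C \<eta>(1) by (simp add: field_simps)
      moreover have "\<eta> * of_nat C \<le> \<eta> * coord T w x" using wC \<eta>(1) by simp
      ultimately show False by simp
    qed
  qed
  then show ?thesis by (rule that)
qed

lemma gauge_stable_step:
  assumes st: "stable C U" and T: "T \<in> \<T>" and x: "\<And>v. v \<in> T \<Longrightarrow> coord T v x \<ge> 0"
    and w: "w \<in> T" "coord T w x \<ge> of_nat C" and u: "u \<in> U"
  shows "gauge (2 *\<^sub>R (x + w) + u) = gauge (2 *\<^sub>R x + u) + 2"
proof (rule antisym)
  have eq: "2 *\<^sub>R (x + w) + u = (2 *\<^sub>R x + u) + 2 *\<^sub>R w" by (simp add: scaleR_add_right)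
  have "gauge (2 *\<^sub>R w) = 2" using gauge_V[of w] \<T>_sub[OF T] w(1) by (auto simp: gauge_scale)
  then show "gauge (2 *\<^sub>R (x + w) + u) \<le> gauge (2 *\<^sub>R x + u) + 2"
    unfolding eq using gauge_add[of "2 *\<^sub>R x + u" "2 *\<^sub>R w"] by simp
  obtain h where h: "h \<in> E" "h \<bullet> (2 *\<^sub>R x + u) = gauge (2 *\<^sub>R x + u)" by (rule gauge_attained)
  have "h \<bullet> w = 1" using st T x w u h unfolding stable_def by blast
  then have "h \<bullet> (2 *\<^sub>R (x + w) + u) = gauge (2 *\<^sub>R x + u) + 2"
    unfolding eq inner_add_right[of h "2 *\<^sub>R x + u"] h(2) by simp
  then show "gauge (2 *\<^sub>R x + u) + 2 \<le> gauge (2 *\<^sub>R (x + w) + u)"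
    using gauge_ge[OF h(1), of "2 *\<^sub>R (x + w) + u"] by simp
qed

lemma shift_Suc:
  assumes "T \<in> \<T>" "w \<in> T"
  shows "shift T (a(w := Suc (a w))) = shift T a + w"
proof -
  have "shift T (a(w := Suc (a w))) = of_nat (Suc (a w)) *\<^sub>R w + (\<Sum>v\<in>T - {w}. of_nat (a v) *\<^sub>R v)"
    unfolding shift_def using finite_T[OF assms(1)] assms(2) by (simp add: sum.remove)
  moreover have "shift T a = of_nat (a w) *\<^sub>R w + (\<Sum>v\<in>T - {w}. of_nat (a v) *\<^sub>R v)"
    unfolding shift_def using finite_T[OF assms(1)] assms(2) by (simp add: sum.remove)
  ultimately show ?thesis by (simp add: algebra_simps)
qed

lemma shift_restrict: "shift T (restrict a T) = shift T a"
  unfolding shift_def by (intro sum.cong) auto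

lemma gauge_stable:
  assumes st: "stable C U" and T: "T \<in> \<T>" and y: "y \<in> cell \<xi> T" and u: "u \<in> U"
  shows "gauge (2 *\<^sub>R (y + shift T a) + u)
    = gauge (2 *\<^sub>R (y + shift T (\<lambda>w. min (a w) C)) + u) + 2 * of_nat (\<Sum>w\<in>T. a w - C)"
proof (induction "\<Sum>w\<in>T. a w - C" arbitrary: a)
  case 0
  then have "\<forall>w\<in>T. a w - C = 0" using finite_T[OF T] by simp
  then have "shift T (\<lambda>w. min (a w) C) = shift T a"
    unfolding shift_def by (intro sum.cong) (auto simp: min_def)
  then show ?case using 0 by simp
next
  case (Suc n)
  have fr: "frame T" by (rule \<T>_frame[OF T])
  have fin: "finite T" by (rule finite_T[OF T])
  have "\<exists>w\<in>T. a w - C \<noteq> 0" using Suc(2) by (metis Zero_neq_Suc sum.neutral)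
  then obtain w where w: "w \<in> T" "a w > C" by auto
  define a' where "a' = a(w := a w - 1)"
  have aa: "a = a'(w := Suc (a' w))" using w by (auto simp: a'_def)
  have "(\<Sum>v\<in>T. a v - C) = Suc (\<Sum>v\<in>T. a' v - C)"
  proof -
    have "(\<Sum>v\<in>T - {w}. a' v - C) = (\<Sum>v\<in>T - {w}. a v - C)" by (intro sum.cong) (auto simp: a'_def)
    then show ?thesis using w by (simp add: sum.remove[OF fin w(1)] a'_def)
  qed
  then have n: "n = (\<Sum>v\<in>T. a' v - C)" using Suc(2) by simp
  have m: "(\<lambda>v. min (a' v) C) = (\<lambda>v. min (a v) C)" using w by (auto simp: a'_def fun_eq_iff)
  have c: "coord T v (y + shift T a') = coord T v y + of_nat (a' v)" if "v \<in> T" for v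
    by (simp add: coord_add[OF fr] coord_shift[OF fr that])
  have c0: "coord T v y \<ge> 0" if "v \<in> T" for v using y that by (auto simp: cell_def split: if_splits)
  have "gauge (2 *\<^sub>R (y + shift T a' + w) + u) = gauge (2 *\<^sub>R (y + shift T a') + u) + 2"
  proof (rule gauge_stable_step[OF st T _ w(1) _ u])
    show "coord T v (y + shift T a') \<ge> 0" if "v \<in> T" for v using c[OF that] c0[OF that] by simp
    have "of_nat C \<le> (of_nat (a' w) :: real)" using w by (simp add: a'_def)
    then show "of_nat C \<le> coord T w (y + shift T a')" using c[OF w(1)] c0[OF w(1)] by linarith
  qed
  moreover have "y + shift T a' + w = y + shift T a"
    using shift_Suc[OF T w(1), of a'] aa by (simp add: add.assoc)
  ultimately have "gauge (2 *\<^sub>R (y + shift T a) + u) = gauge (2 *\<^sub>R (y + shift T a') + u) + 2" by simp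
  also have "gauge (2 *\<^sub>R (y + shift T a') + u) = gauge (2 *\<^sub>R (y + shift T (\<lambda>w. min (a w) C)) + u) + 2 * of_nat n"
    using Suc(1)[OF n] m n by simp
  finally show ?case using Suc(2)[symmetric] by simp
qed

text \<open>The geometric factors for the directions that have reached the truncation bound. The
  ratio is \<open>exp (- 2 * s)\<close> because the gauge grows by 2 per step.\<close>

definition weight :: "real \<Rightarrow> nat \<Rightarrow> 'a set \<Rightarrow> ('a \<Rightarrow> nat) \<Rightarrow> real" where
  "weight s C T a = (1 / (1 - exp (- 2 * s))) ^ card {w\<in>T. a w = C}"

lemma has_sum_gauge_double:
  assumes \<xi>: "generic \<xi>" and s: "s > (0::real)" and st: "stable C U" and u: "u \<in> U"
  shows "((\<lambda>x. exp (- s * gauge (2 *\<^sub>R x + u))) has_sum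
    (\<Sum>T\<in>\<T>. \<Sum>y\<in>cell \<xi> T. \<Sum>a\<in>PiE T (\<lambda>_. {..C}).
      exp (- s * gauge (2 *\<^sub>R (y + shift T a) + u)) * weight s C T a)) N"
proof (rule has_sum_cells[OF \<xi>])
  fix T y assume T: "T \<in> \<T>" and y: "y \<in> cell \<xi> T"
  have fin: "finite T" by (rule finite_T[OF T])
  let ?t = "exp (- 2 * s)"
  have t: "0 \<le> ?t" "?t < 1" using s by simp_all
  let ?f = "\<lambda>a. exp (- s * gauge (2 *\<^sub>R (y + shift T a) + u))"
  have st': "?f a = ?f (\<lambda>w\<in>T. min (a w) C) * ?t ^ (\<Sum>w\<in>T. a w - C)" if "a \<in> PiE T (\<lambda>_. UNIV)" for a
  proof -
    have "shift T (\<lambda>w\<in>T. min (a w) C) = shift T (\<lambda>w. min (a w) C)" by (rule shift_restrict)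
    then show ?thesis
      using gauge_stable[OF st T y u, of a]
      by (simp add: exp_of_nat_mult[symmetric] exp_add[symmetric] algebra_simps)
  qed
  have w: "(\<Prod>w\<in>T. if a w = C then 1 / (1 - ?t) else 1) = weight s C T a" for a :: "'a \<Rightarrow> nat"
    unfolding weight_def using fin by (simp add: prod.If_cases Int_def)
  show "(?f has_sum (\<Sum>a\<in>PiE T (\<lambda>_. {..C}). ?f a * weight s C T a)) (PiE T (\<lambda>_. UNIV))"
    using has_sum_stable[OF fin t st'] unfolding w .
qed simp

end

text \<open>The denominator is 2 s^3 (1 + s^2 / 8 + ...), so the quotient expands as 1 / s^3 + (l^2
  / 2 - 1 / 8) / s + O(s). Subtracting 8 times its value at 2 s cancels the first term and
  multiplies the second by 1 - 8 / 2.\<close>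

lemma sinh_cube_limit:
  fixes l :: real
  shows "((\<lambda>s. s * ((exp (- s * l) + exp (s * l)) / (2 * (exp (s / 2) - exp (- s / 2)) ^ 3)
      - 8 * ((exp (- (2 * s) * l) + exp (2 * s * l)) / (2 * (exp (2 * s / 2) - exp (- (2 * s) / 2)) ^ 3))))
    \<longlongrightarrow> - 3 * (l\<^sup>2 / 2 - 1 / 8)) (at_right 0)"
  by (cases l "0 :: real" rule: linorder_cases) (real_asymp simp: field_simps power2_eq_square)+

lemma lim_0: "((\<lambda>s::real. s / (1 - exp (- 2 * s))) \<longlongrightarrow> 1 / 2) (at_right 0)"
  by real_asymp

lemma lim_exp: "((\<lambda>s::real. (exp (- s * g) - 1) / s) \<longlongrightarrow> - g) (at_right 0)"
  by (cases g "0 :: real" rule: linorder_cases) real_asymp+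

lemma lim_cosh: "((\<lambda>s::real. ((exp (s * g) + exp (- s * g)) / 2 - 1) / s) \<longlongrightarrow> 0) (at_right 0)"
  by (cases g "0 :: real" rule: linorder_cases) real_asymp+

text \<open>The source of the expression n - 1 / n: the coefficients of 1 / s contributed by the
  nontrivial points of a cell, summed by the formulas for the first two power sums.\<close>

lemma sum_second_moment:
  assumes "n > 0"
  shows "(\<Sum>j\<in>{1..<n}. (of_nat j / of_nat n - 1 / 2)\<^sup>2 / 2 - 1 / 8 :: real) = - (of_nat n - 1 / of_nat n) / 12"
proof -
  have 1: "(\<Sum>j\<in>{1..<n}. of_nat j :: real) = of_nat n * (of_nat n - 1) / 2"
    using assms by (induction n rule: nat_induct_non_zero) (auto simp: field_simps)
  have 2: "(\<Sum>j\<in>{1..<n}. (of_nat j :: real)\<^sup>2) = of_nat n * (of_nat n - 1) * (2 * of_nat n - 1) / 6"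
    using assms by (induction n rule: nat_induct_non_zero) (auto simp: field_simps power2_eq_square)
  have "(of_nat j / of_nat n - 1 / 2)\<^sup>2 / 2 - 1 / 8 = (of_nat j)\<^sup>2 * (1 / (2 * (of_nat n)\<^sup>2)) - of_nat j * (1 / (2 * of_nat n) :: real)" for j
    using assms by (simp add: field_simps power2_eq_square)
  then have 3: "(\<Sum>j\<in>{1..<n}. (of_nat j / of_nat n - 1 / 2)\<^sup>2 / 2 - 1 / 8 :: real)
      = (\<Sum>j\<in>{1..<n}. (of_nat j)\<^sup>2) * (1 / (2 * (of_nat n)\<^sup>2)) - (\<Sum>j\<in>{1..<n}. of_nat j) * (1 / (2 * of_nat n))"
    by (simp add: sum_subtractf sum_distrib_right sum_divide_distrib)
  show ?thesis unfolding 3 unfolding 1 2 using assms by (simp add: field_simps power2_eq_square)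
qed

text \<open>The part of \<open>exp (- s * l) / (exp (s / 2) - exp (- s / 2)) ^ 3\<close> that is
  even in \<open>l\<close>. Only this part survives the averaging over \<open>\<xi>\<close> and
  \<open>- \<xi>\<close>.\<close>

definition kernel :: "real \<Rightarrow> real \<Rightarrow> real" where
  "kernel l s = (exp (- s * l) + exp (s * l)) / (2 * (exp (s / 2) - exp (- s / 2)) ^ 3)"

text \<open>Each of the three geometric factors has its centre of symmetry at 1 / 2, so heights are
  to be measured from 3 / 2.\<close>

lemma exp_over_cube:
  "exp (- s * x) / (1 - exp (- s)) ^ 3 = exp (- s * (x - 3 / 2)) / (exp (s / 2) - exp (- s / 2)) ^ 3" for s x :: real
proof -
  have "(exp (s / 2) - exp (- s / 2)) = exp (s / 2) * (1 - exp (- s))"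
    by (simp add: algebra_simps exp_add[symmetric])
  then have "(exp (s / 2) - exp (- s / 2)) ^ 3 = exp (3 * s / 2) * (1 - exp (- s)) ^ 3"
    by (simp add: power_mult_distrib exp_of_nat_mult[symmetric])
  moreover have "exp (- s * (x - 3 / 2)) = exp (3 * s / 2) * exp (- s * x)"
    by (simp add: exp_add[symmetric] algebra_simps)
  ultimately show ?thesis by simp
qed

section \<open>The limit computed from the half-open cones\<close>

context triangulated
begin

lemma neg_le_3: "T \<in> \<T> \<Longrightarrow> neg \<xi> T \<le> 3"
  unfolding neg_def using card_mono[of T "{w \<in> T. coord T w \<xi> < 0}"] finite_T[of T] card_T[of T] by auto

lemma neg_uminus:
  assumes T: "T \<in> \<T>" and \<xi>: "generic \<xi>"
  shows "neg (- \<xi>) T = 3 - neg \<xi> T"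
proof -
  have fr: "frame T" by (rule \<T>_frame[OF T])
  have "coord T w (- \<xi>) = - coord T w \<xi>" for w using coord_diff[OF fr, of w 0 \<xi>] by (simp add: coord_zero[OF fr])
  then have "{w\<in>T. coord T w (- \<xi>) < 0} = T - {w\<in>T. coord T w \<xi> < 0}"
    using generic_coord[OF \<xi> fr \<T>_sub[OF T]] by force
  then show ?thesis unfolding neg_def using finite_T[OF T] card_T[OF T] by (simp add: card_Diff_subset)
qed

text \<open>The possible squares are 1 / 4, for \<open>neg \<xi> T\<close> equal to 1 or 2, and 9 /
  4, for 0 or 3. The value 0 belongs to the unique cone containing \<open>\<xi>\<close>, the value 3
  to the unique cone containing \<open>- \<xi>\<close>; each adds 2 to the generic 1 / 4.\<close>

lemma sum_neg_squares:
  assumes \<xi>: "generic \<xi>"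
  shows "(\<Sum>T\<in>\<T>. (of_nat (neg \<xi> T) - 3 / 2 :: real)\<^sup>2) = of_nat (card \<T>) / 4 + 4"
proof -
  have nz: "neg \<xi> T = 0 \<longleftrightarrow> (\<forall>w\<in>T. coord T w \<xi> \<ge> 0)" if "T \<in> \<T>" for T \<xi>
    unfolding neg_def using finite_T[OF that] by (auto simp: not_less)
  have one: "(\<Sum>T\<in>\<T>. if neg \<xi> T = 0 then 1 else 0 :: real) = 1" if g: "generic \<xi>" for \<xi>
  proof -
    obtain T0 where T0: "T0 \<in> \<T>" "neg \<xi> T0 = 0" "\<And>T. T \<in> \<T> \<Longrightarrow> neg \<xi> T = 0 \<Longrightarrow> T = T0"
      using \<T>_cover[OF g] nz by metis
    have "(\<Sum>T\<in>\<T>. if neg \<xi> T = 0 then 1 else 0 :: real) = (\<Sum>T\<in>\<T>. if T = T0 then 1 else 0)"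
      using T0 by (intro sum.cong refl) metis
    then show ?thesis using finite_\<T> T0(1) by simp
  qed
  have "(of_nat (neg \<xi> T) - 3 / 2 :: real)\<^sup>2
      = 1 / 4 + 2 * (if neg \<xi> T = 0 then 1 else 0) + 2 * (if neg (- \<xi>) T = 0 then 1 else 0)" if T: "T \<in> \<T>" for T
  proof -
    have "neg \<xi> T \<in> {0, 1, 2, 3}" using neg_le_3[OF T, of \<xi>] by auto
    then show ?thesis unfolding neg_uminus[OF T \<xi>] by (auto simp: power2_eq_square)
  qed
  then have "(\<Sum>T\<in>\<T>. (of_nat (neg \<xi> T) - 3 / 2 :: real)\<^sup>2)
     = (\<Sum>T\<in>\<T>. 1 / 4) + 2 * (\<Sum>T\<in>\<T>. if neg \<xi> T = 0 then 1 else 0) + 2 * (\<Sum>T\<in>\<T>. if neg (- \<xi>) T = 0 then 1 else 0)"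
    by (simp add: sum.distrib sum_distrib_left)
  then show ?thesis by (simp only: one[OF \<xi>] one[OF generic_neg[OF \<xi>]]) simp
qed

definition lattice_sum :: "real \<Rightarrow> real" where
  "lattice_sum s = (\<Sum>\<^sub>\<infinity>x\<in>N. exp (- s * gauge x))"

lemma lattice_sum_half:
  assumes \<xi>: "generic \<xi>" and s: "s > 0"
  shows "lattice_sum s = (\<Sum>T\<in>\<T>. exp (- s * (of_nat (neg \<xi> T) - 3 / 2)) / (exp (s / 2) - exp (- s / 2)) ^ 3
    + (\<Sum>j\<in>{1..<index T}. kernel (of_nat j / of_nat (index T) - 1 / 2) s))"
proof -
  have "lattice_sum s = (\<Sum>T\<in>\<T>. \<Sum>y\<in>cell \<xi> T. exp (- s * height T y) / (1 - exp (- s)) ^ 3)"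
    unfolding lattice_sum_def by (rule infsumI[OF has_sum_gauge[OF \<xi> s]])
  also have "\<dots> = (\<Sum>T\<in>\<T>. exp (- s * (of_nat (neg \<xi> T) - 3 / 2)) / (exp (s / 2) - exp (- s / 2)) ^ 3
    + (\<Sum>j\<in>{1..<index T}. kernel (of_nat j / of_nat (index T) - 1 / 2) s))"
  proof (intro sum.cong refl)
    fix T assume T: "T \<in> \<T>"
    let ?n = "index T" and ?D = "(exp (s / 2) - exp (- s / 2)) ^ 3"
    have n0: "?n > 0" by (rule index_height(1)[OF T])
    let ?f = "\<lambda>j::nat. exp (- s * (of_nat j / of_nat ?n - 1 / 2)) / ?D"
    \<comment> \<open>Replacing \<open>j\<close> by \<open>?n - j\<close> changes the sign of the
      centred height, so these terms are symmetric without any averaging over directions.\<close>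
    have "(\<Sum>j\<in>{1..<?n}. ?f j) = (\<Sum>j\<in>{1..<?n}. ?f (?n - j))"
      using n0 by (intro sum.reindex_bij_witness[of _ "\<lambda>j. ?n - j" "\<lambda>j. ?n - j"]) auto
    also have "\<dots> = (\<Sum>j\<in>{1..<?n}. exp (s * (of_nat j / of_nat ?n - 1 / 2)) / ?D)"
      using n0 by (intro sum.cong refl) (simp add: of_nat_diff field_simps)
    finally have sym: "(\<Sum>j\<in>{1..<?n}. ?f j) = (\<Sum>j\<in>{1..<?n}. exp (s * (of_nat j / of_nat ?n - 1 / 2)) / ?D)" .
    have "(\<Sum>j\<in>{1..<?n}. (?f j + exp (s * (of_nat j / of_nat ?n - 1 / 2)) / ?D) / 2)
        = ((\<Sum>j\<in>{1..<?n}. ?f j) + (\<Sum>j\<in>{1..<?n}. exp (s * (of_nat j / of_nat ?n - 1 / 2)) / ?D)) / 2"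
      by (simp only: sum.distrib sum_divide_distrib[symmetric])
    also have "\<dots> = (\<Sum>j\<in>{1..<?n}. ?f j)" unfolding sym[symmetric] by simp
    finally have "(\<Sum>j\<in>{1..<?n}. ?f j) = (\<Sum>j\<in>{1..<?n}. (?f j + exp (s * (of_nat j / of_nat ?n - 1 / 2)) / ?D) / 2)" ..
    also have "\<dots> = (\<Sum>j\<in>{1..<?n}. kernel (of_nat j / of_nat ?n - 1 / 2) s)"
      by (simp add: kernel_def add_divide_distrib mult.commute)
    finally have k: "(\<Sum>j\<in>{1..<?n}. ?f j) = (\<Sum>j\<in>{1..<?n}. kernel (of_nat j / of_nat ?n - 1 / 2) s)" .
    have "exp (- s * (1 + of_nat j / of_nat ?n - 3 / 2)) / ?D = ?f j" for j
      by (simp add: algebra_simps)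
    then show "(\<Sum>y\<in>cell \<xi> T. exp (- s * height T y) / (1 - exp (- s)) ^ 3)
      = exp (- s * (of_nat (neg \<xi> T) - 3 / 2)) / ?D + (\<Sum>j\<in>{1..<?n}. kernel (of_nat j / of_nat ?n - 1 / 2) s)"
      unfolding exp_over_cube sum_cell_height[OF T \<xi>, of "\<lambda>x. exp (- s * (x - 3 / 2)) / ?D"] k[symmetric] by simp
  qed
  finally show ?thesis .
qed

text \<open>The mean of the expansions for \<open>\<xi>\<close> and \<open>- \<xi>\<close>: by
  \<open>neg_uminus\<close> the centred heights of the trivial classes change sign.\<close>

lemma lattice_sum_kernel:
  assumes \<xi>: "generic \<xi>" and s: "s > 0"
  shows "lattice_sum s = (\<Sum>T\<in>\<T>. kernel (of_nat (neg \<xi> T) - 3 / 2) s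
    + (\<Sum>j\<in>{1..<index T}. kernel (of_nat j / of_nat (index T) - 1 / 2) s))"
proof -
  let ?D = "(exp (s / 2) - exp (- s / 2)) ^ 3"
  let ?K = "\<Sum>T\<in>\<T>. \<Sum>j\<in>{1..<index T}. kernel (of_nat j / of_nat (index T) - 1 / 2) s"
  have 1: "lattice_sum s = (\<Sum>T\<in>\<T>. exp (- s * (of_nat (neg \<xi> T) - 3 / 2)) / ?D) + ?K"
    using lattice_sum_half[OF \<xi> s] by (simp add: sum.distrib)
  have "(\<Sum>T\<in>\<T>. exp (- s * (of_nat (neg (- \<xi>) T) - 3 / 2)) / ?D) = (\<Sum>T\<in>\<T>. exp (s * (of_nat (neg \<xi> T) - 3 / 2)) / ?D)"
    using neg_le_3 by (intro sum.cong refl) (simp add: neg_uminus[OF _ \<xi>] of_nat_diff algebra_simps)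
  then have 2: "lattice_sum s = (\<Sum>T\<in>\<T>. exp (s * (of_nat (neg \<xi> T) - 3 / 2)) / ?D) + ?K"
    using lattice_sum_half[OF generic_neg[OF \<xi>] s] by (simp add: sum.distrib)
  have "(\<Sum>T\<in>\<T>. kernel (of_nat (neg \<xi> T) - 3 / 2) s)
      = ((\<Sum>T\<in>\<T>. exp (- s * (of_nat (neg \<xi> T) - 3 / 2)) / ?D) + (\<Sum>T\<in>\<T>. exp (s * (of_nat (neg \<xi> T) - 3 / 2)) / ?D)) / 2"
    by (simp add: kernel_def sum.distrib[symmetric] sum_divide_distrib add_divide_distrib mult.commute)
  also have "\<dots> = lattice_sum s - ?K" using 1 2 by simp
  finally show ?thesis by (simp add: sum.distrib)
qed

lemma lattice_sum_limit:
  "((\<lambda>s. s * (lattice_sum s - 8 * lattice_sum (2 * s)))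
     \<longlongrightarrow> - 6 + (\<Sum>T\<in>\<T>. of_nat (index T) - 1 / of_nat (index T)) / 4) (at_right 0)"
proof -
  obtain \<xi> where \<xi>: "generic \<xi>" by (rule generic_exists)
  define c where "c l s = s * (kernel l s - 8 * kernel l (2 * s))" for l s
  have c: "(c l \<longlongrightarrow> - 3 * (l\<^sup>2 / 2 - 1 / 8)) (at_right 0)" for l
    unfolding c_def kernel_def using sinh_cube_limit[of l] by simp
  let ?F = "\<lambda>s. \<Sum>T\<in>\<T>. c (of_nat (neg \<xi> T) - 3 / 2) s + (\<Sum>j\<in>{1..<index T}. c (of_nat j / of_nat (index T) - 1 / 2) s)"
  have "(?F \<longlongrightarrow> (\<Sum>T\<in>\<T>. - 3 * ((of_nat (neg \<xi> T) - 3 / 2)\<^sup>2 / 2 - 1 / 8)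
      + (\<Sum>j\<in>{1..<index T}. - 3 * ((of_nat j / of_nat (index T) - 1 / 2)\<^sup>2 / 2 - 1 / 8)))) (at_right 0)"
    by (intro tendsto_sum tendsto_add c)
  also have "(\<Sum>T\<in>\<T>. - 3 * ((of_nat (neg \<xi> T) - 3 / 2 :: real)\<^sup>2 / 2 - 1 / 8)
      + (\<Sum>j\<in>{1..<index T}. - 3 * ((of_nat j / of_nat (index T) - 1 / 2)\<^sup>2 / 2 - 1 / 8)))
    = (\<Sum>T\<in>\<T>. (- 3 / 2) * (of_nat (neg \<xi> T) - 3 / 2)\<^sup>2 + 3 / 8 + (of_nat (index T) - 1 / of_nat (index T)) / 4)"
  proof (intro sum.cong refl)
    fix T assume T: "T \<in> \<T>"
    have "(\<Sum>j\<in>{1..<index T}. - 3 * ((of_nat j / of_nat (index T) - 1 / 2)\<^sup>2 / 2 - 1 / 8 :: real))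
      = - 3 * (- (of_nat (index T) - 1 / of_nat (index T)) / 12)"
      unfolding sum_distrib_left[symmetric] sum_second_moment[OF index_height(1)[OF T]] ..
    moreover have "- 3 * (x / 2 - 1 / 8) + - 3 * (- m / 12) = (- 3 / 2) * x + 3 / 8 + m / 4" for x m :: real
      by simp
    ultimately show "- 3 * ((of_nat (neg \<xi> T) - 3 / 2 :: real)\<^sup>2 / 2 - 1 / 8)
      + (\<Sum>j\<in>{1..<index T}. - 3 * ((of_nat j / of_nat (index T) - 1 / 2)\<^sup>2 / 2 - 1 / 8))
     = (- 3 / 2) * (of_nat (neg \<xi> T) - 3 / 2)\<^sup>2 + 3 / 8 + (of_nat (index T) - 1 / of_nat (index T)) / 4"
      by (simp only:)
  qed
  also have "\<dots> = (- 3 / 2) * (\<Sum>T\<in>\<T>. (of_nat (neg \<xi> T) - 3 / 2)\<^sup>2) + of_nat (card \<T>) * 3 / 8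
      + (\<Sum>T\<in>\<T>. of_nat (index T) - 1 / of_nat (index T)) / 4"
    by (simp only: sum.distrib sum_distrib_left[symmetric] sum_divide_distrib[symmetric] sum_constant times_divide_eq_right)
  \<comment> \<open>The number of triangles cancels: - 3 / 2 * (\<open>card \<T>\<close> / 4 + 4) +
    3 / 8 * \<open>card \<T>\<close> = - 6.\<close>
  also have "\<dots> = - 6 + (\<Sum>T\<in>\<T>. of_nat (index T) - 1 / of_nat (index T)) / 4"
    unfolding sum_neg_squares[OF \<xi>] by (simp add: field_simps)
  finally have lim: "(?F \<longlongrightarrow> - 6 + (\<Sum>T\<in>\<T>. of_nat (index T) - 1 / of_nat (index T)) / 4) (at_right 0)" .
  have "?F s = s * (lattice_sum s - 8 * lattice_sum (2 * s))" if s: "s > 0" for s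
  proof -
    have "2 * s > 0" using s by simp
    note L = lattice_sum_kernel[OF \<xi> s] lattice_sum_kernel[OF \<xi> this]
    show ?thesis unfolding L c_def
      by (simp add: sum_distrib_left sum_subtractf sum.distrib right_diff_distrib distrib_left)
  qed
  then have "\<forall>\<^sub>F s in at_right 0. ?F s = s * (lattice_sum s - 8 * lattice_sum (2 * s))"
    by (intro eventually_mono[OF eventually_at_right_less]) auto
  from Lim_transform_eventually[OF lim this] show ?thesis .
qed

end

section \<open>Fourth differences of exponentials and of the absolute value\<close>

lemma exp_combination_limits:
  fixes c g :: "'i \<Rightarrow> real"
  assumes c0: "(\<Sum>i\<in>I. c i) = 0"
  defines "\<Phi> \<equiv> \<lambda>s. \<Sum>i\<in>I. c i * exp (- s * g i)"
  shows "(\<Phi> \<longlongrightarrow> 0) (at_right 0)" "((\<lambda>s. \<Phi> s / s) \<longlongrightarrow> - (\<Sum>i\<in>I. c i * g i)) (at_right 0)"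
proof -
  have "((\<lambda>s. \<Sum>i\<in>I. c i * exp (- s * g i)) \<longlongrightarrow> (\<Sum>i\<in>I. c i * exp (- 0 * g i))) (at_right 0)"
    by (intro tendsto_intros)
  then show "(\<Phi> \<longlongrightarrow> 0) (at_right 0)" using c0 by (simp add: \<Phi>_def)
  have "((\<lambda>s. \<Sum>i\<in>I. c i * ((exp (- s * g i) - 1) / s)) \<longlongrightarrow> (\<Sum>i\<in>I. c i * - g i)) (at_right 0)"
    by (intro tendsto_sum tendsto_mult tendsto_const lim_exp)
  moreover have "(\<Sum>i\<in>I. c i * ((exp (- s * g i) - 1) / s)) = \<Phi> s / s" for s
  proof -
    have "(\<Sum>i\<in>I. c i * ((exp (- s * g i) - 1) / s)) = (\<Sum>i\<in>I. (c i * exp (- s * g i) - c i) / s)"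
      by (simp add: right_diff_distrib)
    also have "\<dots> = (\<Phi> s - (\<Sum>i\<in>I. c i)) / s"
      by (simp add: \<Phi>_def sum_subtractf sum_divide_distrib[symmetric])
    finally show ?thesis by (simp add: c0)
  qed
  ultimately show "((\<lambda>s. \<Phi> s / s) \<longlongrightarrow> - (\<Sum>i\<in>I. c i * g i)) (at_right 0)"
    by (simp add: sum_negf)
qed

text \<open>
  The weights of the operator \<open>\<delta>\<^sub>u - \<delta>\<^sub>2\<^sub>u / 4\<close>, where \<open>\<delta>\<^sub>u\<close> is the second difference in
  direction \<open>u\<close>: it annihilates cubic polynomials, and its sum over the even integers
  applied to \<open>\<lambda>x. \<bar>x\<bar>\<close> detects the parity of the step.
\<close>

definition stencil :: "int \<Rightarrow> real" where
  "stencil i = (if i = 0 then - 3 / 2 else if \<bar>i\<bar> = 1 then 1 else - 1 / 4)"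

lemma stencil_set: "{-2..2::int} = {-2, -1, 0, 1, 2}" by auto

lemma sum_stencil: "(\<Sum>i\<in>{-2..2}. stencil i * f i) = - f (-2) / 4 + f (-1) - 3 / 2 * f 0 + f 1 - f 2 / 4"
  for f :: "int \<Rightarrow> real"
  unfolding stencil_set by (simp add: stencil_def)

lemma stencil_0: "(\<Sum>i\<in>{-2..2}. stencil i) = 0"
  using sum_stencil[of "\<lambda>_. 1"] by simp

lemma stencil_affine: "(\<Sum>i\<in>{-2..2}. stencil i * (a + of_int i * b)) = 0"
  unfolding sum_stencil by (simp add: field_simps)

text \<open>With c = cosh (s b) this is 2 c - 3 / 2 - (2 c^2 - 1) / 2 = - (c - 1)^2. As c - 1 has
  order s^2, the stencil has order s^4 on exponentials of affine functions.\<close>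

lemma stencil_cosh: "(\<Sum>i\<in>{-2..2}. stencil i * exp (- s * (a + of_int i * b)))
    = - exp (- s * a) * ((exp (s * b) + exp (- s * b)) / 2 - 1)\<^sup>2 * 1" for s a b :: real
proof -
  define E where "E = exp (s * b)"
  have E: "E \<noteq> 0" "exp (- s * b) = 1 / E" "exp (s * b) = E" by (simp_all add: E_def exp_minus field_simps)
  have e: "exp (- s * (a + of_int (-2) * b)) = exp (- s * a) * E\<^sup>2" "exp (- s * (a + of_int (-1) * b)) = exp (- s * a) * E"
    "exp (- s * (a + of_int 0 * b)) = exp (- s * a)" "exp (- s * (a + of_int 1 * b)) = exp (- s * a) / E"
    "exp (- s * (a + of_int 2 * b)) = exp (- s * a) / E\<^sup>2"
    by (simp_all add: E_def exp_add[symmetric] exp_diff[symmetric] power2_eq_square algebra_simps)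
  show ?thesis unfolding sum_stencil e E(2,3) using E(1)
    by (simp add: field_simps power2_eq_square)
qed

text \<open>The model of the gauge across a wall: the stencil with step \<open>q\<close> at the even
  point \<open>2 * k\<close>, applied to the absolute value, where \<open>k\<close> and
  \<open>q\<close> count lattice layers parallel to the wall.\<close>

definition kink :: "int \<Rightarrow> nat \<Rightarrow> real" where
  "kink q k = (\<Sum>i\<in>{-2..2}. stencil i * \<bar>2 * of_nat k + of_int i * of_int q\<bar>)"

text \<open>This form makes visible that the kink vanishes for \<open>k \<ge> m\<close>, where all
  five points lie on one side of the wall.\<close>

lemma kink_eq:
  assumes "q = int m \<or> q = - int m"
  shows "kink q k = 2 * of_nat (max (2 * k) m) - 3 * of_nat k - of_nat (max k m)"
proof -
  have "kink q k = - \<bar>2 * of_nat k - 2 * of_int q\<bar> / 4 + \<bar>2 * of_nat k - of_int q\<bar> - 3 * of_nat k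
      + \<bar>2 * of_nat k + of_int q\<bar> - \<bar>2 * of_nat k + 2 * of_int q\<bar> / 4"
    unfolding kink_def sum_stencil by simp
  also have "\<dots> = - \<bar>2 * of_nat k - 2 * of_nat m\<bar> / 4 + \<bar>2 * of_nat k - of_nat m\<bar> - 3 * of_nat k
      + \<bar>2 * of_nat k + of_nat m\<bar> - \<bar>2 * of_nat k + 2 * of_nat m\<bar> / 4"
    using assms by auto
  also have "\<dots> = 2 * max (2 * of_nat k) (of_nat m) - 3 * of_nat k - max (of_nat k) (of_nat m)"
    by (simp add: abs_if max_def) (simp add: field_simps)
  finally show ?thesis by (simp add: of_nat_max)
qed

text \<open>The kink is even in \<open>k\<close>, so the two sums together cover both sides of the
  wall. The intermediate cases serve the induction; from \<open>j = m\<close> on only the parity of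
  \<open>m\<close> remains.\<close>

lemma kink_partial_sum:
  assumes "q = int m \<or> q = - int m"
  shows "(\<Sum>k<j. kink q k) + (\<Sum>k<j. kink q (Suc k))
    = (if 2 * j \<le> m then of_nat j * (2 * of_nat m - 3 * of_nat j)
       else if j \<le> m then (of_nat m - of_nat j)\<^sup>2 + (if odd m then 1 else 0)
       else (if odd m then 1 else 0))"
proof (induction j)
  case 0 then show ?case using assms by (auto simp: kink_eq[OF assms])
next
  case (Suc j)
  have "(\<Sum>k<Suc j. kink q k) + (\<Sum>k<Suc j. kink q (Suc k))
      = (\<Sum>k<j. kink q k) + (\<Sum>k<j. kink q (Suc k)) + kink q j + kink q (Suc j)" by simp
  also have "\<dots> = (if 2 * j \<le> m then of_nat j * (2 * of_nat m - 3 * of_nat j)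
       else if j \<le> m then (of_nat m - of_nat j)\<^sup>2 + (if odd m then 1 else 0)
       else (if odd m then 1 else 0)) + kink q j + kink q (Suc j)" by (simp only: Suc.IH)
  also have "\<dots> = (if 2 * Suc j \<le> m then of_nat (Suc j) * (2 * of_nat m - 3 * of_nat (Suc j))
       else if Suc j \<le> m then (of_nat m - of_nat (Suc j))\<^sup>2 + (if odd m then 1 else 0)
       else (if odd m then 1 else 0))"
  proof -
    consider "2 * Suc j \<le> m" | "m = 2 * j" | "m = 2 * j + 1" | "m < 2 * j" "Suc j \<le> m" | "m = j" "0 < j" | "m < j"
      by atomize_elim presburger
    then show ?thesis
      by cases (auto simp: kink_eq[OF assms] max_def algebra_simps power2_eq_square)
  qed
  finally show ?case .
qed

text \<open>Over all even integers, the second differences of the absolute value with step m sum to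
  m^2 for even m and to m^2 + 1 for odd m. With step 2 m they sum to (2 m)^2, of which a quarter is
  subtracted.\<close>

lemma kink_sum:
  assumes "nat \<bar>q\<bar> \<le> j"
  shows "(\<Sum>k<j. kink q k) + (\<Sum>k<j. kink q (Suc k)) = (if odd q then 1 else 0)"
proof -
  have q: "q = int (nat \<bar>q\<bar>) \<or> q = - int (nat \<bar>q\<bar>)" by auto
  have "odd (nat \<bar>q\<bar>) \<longleftrightarrow> odd q" by (metis abs_ge_zero dvd_abs_iff even_nat_iff)
  then show ?thesis using assms unfolding kink_partial_sum[OF q] by auto
qed

section \<open>The gauge near a wall between two cones\<close>

context triangulated
begin

text \<open>The functional of \<open>T\<close> is among those considered and has the value 1 at
  \<open>w\<close>; the one that is smallest at \<open>w\<close> dominates on the other side of the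
  wall over \<open>T - {w}\<close>.\<close>

definition kink_min :: "'a set \<Rightarrow> 'a \<Rightarrow> real" where
  "kink_min T w = Min ((\<lambda>h. h \<bullet> w) ` {h\<in>E. \<forall>v\<in>T - {w}. h \<bullet> v = 1})"

text \<open>The lattice length of the dual of the edge \<open>T - {w}\<close>, which is zero inside a facet.\<close>

definition jump :: "'a set \<Rightarrow> 'a \<Rightarrow> real" where
  "jump T w = (1 - kink_min T w) / of_nat (index T)"

lemma kink_min_props:
  assumes T: "T \<in> \<T>"
  shows "finite {h\<in>E. \<forall>v\<in>T - {w}. h \<bullet> v = 1}" "{h\<in>E. \<forall>v\<in>T - {w}. h \<bullet> v = 1} \<noteq> {}"
    "h \<in> E \<Longrightarrow> \<forall>v\<in>T - {w}. h \<bullet> v = 1 \<Longrightarrow> kink_min T w \<le> h \<bullet> w"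
    "\<exists>h\<in>E. (\<forall>v\<in>T - {w}. h \<bullet> v = 1) \<and> h \<bullet> w = kink_min T w"
proof -
  show f: "finite {h\<in>E. \<forall>v\<in>T - {w}. h \<bullet> v = 1}" using finite_E by simp
  show ne: "{h\<in>E. \<forall>v\<in>T - {w}. h \<bullet> v = 1} \<noteq> {}" using \<T>_face[OF T] by auto
  show "h \<in> E \<Longrightarrow> \<forall>v\<in>T - {w}. h \<bullet> v = 1 \<Longrightarrow> kink_min T w \<le> h \<bullet> w"
    unfolding kink_min_def using f by (intro Min_le) auto
  have "kink_min T w \<in> (\<lambda>h. h \<bullet> w) ` {h\<in>E. \<forall>v\<in>T - {w}. h \<bullet> v = 1}"
    unfolding kink_min_def using f ne by (intro Min_in) auto
  then show "\<exists>h\<in>E. (\<forall>v\<in>T - {w}. h \<bullet> v = 1) \<and> h \<bullet> w = kink_min T w" by auto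
qed

lemma inner_edge:
  assumes T: "T \<in> \<T>" and w: "w \<in> T" and h: "\<forall>v\<in>T - {w}. h \<bullet> v = 1"
  shows "h \<bullet> z = height T z - (1 - h \<bullet> w) * coord T w z"
proof -
  have fr: "frame T" by (rule \<T>_frame[OF T])
  have fin: "finite T" by (rule finite_T[OF T])
  have "h \<bullet> z = coord T w z * (h \<bullet> w) + (\<Sum>v\<in>T - {w}. coord T v z)"
    using h by (subst inner_eq_sum_coord[OF fr]) (simp add: sum.remove[OF fin w])
  also have "(\<Sum>v\<in>T - {w}. coord T v z) = height T z - coord T w z"
    by (simp add: height_def sum.remove[OF fin w])
  finally show ?thesis by (simp add: algebra_simps)
qed

text \<open>All functionals active at \<open>z\<close> equal 1 on the wall, so they differ only by a
  multiple of the coordinate at \<open>w\<close>. On the side of \<open>T\<close> the height wins,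
  beyond it the functional with value \<open>kink_min T w\<close>; the correction is a multiple of
  the negative part of the coordinate.\<close>

lemma gauge_near_edge:
  assumes T: "T \<in> \<T>" and w: "w \<in> T"
    and act: "\<And>h v. h \<in> E \<Longrightarrow> h \<bullet> z = gauge z \<Longrightarrow> v \<in> T - {w} \<Longrightarrow> h \<bullet> v = 1"
  shows "gauge z = height T z + (1 - kink_min T w) * (\<bar>coord T w z\<bar> - coord T w z) / 2"
proof -
  obtain g where g: "g \<in> E" "\<forall>v\<in>T - {w}. g \<bullet> v = 1" "g \<bullet> w = kink_min T w"
    using kink_min_props(4)[OF T] by blast
  have gw: "kink_min T w \<le> 1" using V_inner_le[of w g] g w \<T>_sub[OF T] by auto
  have 1: "height T z \<le> gauge z" by (rule height_le_gauge[OF T])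
  have 2: "height T z - (1 - kink_min T w) * coord T w z \<le> gauge z"
    using gauge_ge[OF g(1), of z] inner_edge[OF T w g(2), of z] g(3) by simp
  obtain h where h: "h \<in> E" "h \<bullet> z = gauge z" by (rule gauge_attained)
  have he: "\<forall>v\<in>T - {w}. h \<bullet> v = 1" using act[OF h] by blast
  have hz: "gauge z = height T z - (1 - h \<bullet> w) * coord T w z" using inner_edge[OF T w he, of z] h(2) by simp
  have hw: "kink_min T w \<le> h \<bullet> w" "h \<bullet> w \<le> 1"
    using kink_min_props(3)[OF T h(1) he] V_inner_le[of w h] h w \<T>_sub[OF T] by auto
  show ?thesis
  proof (cases "coord T w z \<ge> 0")
    case True
    then have "gauge z \<le> height T z" using hz hw by simp
    then show ?thesis using 1 True by simp
  next
    case False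
    then have "(1 - kink_min T w) * coord T w z \<le> (1 - h \<bullet> w) * coord T w z"
      using hw by (intro mult_right_mono_neg) auto
    then have "gauge z = height T z - (1 - kink_min T w) * coord T w z" using hz 2 by linarith
    then show ?thesis using False by simp
  qed
qed

text \<open>The stencil kills the affine part of \<open>gauge_near_edge\<close>. Multiplication by
  the index turns the remaining absolute value of the coordinate into one of an integer.\<close>

lemma stencil_gauge:
  assumes T: "T \<in> \<T>" and w: "w \<in> T"
    and act: "\<And>i h v. i \<in> {-2..2} \<Longrightarrow> h \<in> E \<Longrightarrow> h \<bullet> (2 *\<^sub>R x + of_int i *\<^sub>R u) = gauge (2 *\<^sub>R x + of_int i *\<^sub>R u)
      \<Longrightarrow> v \<in> T - {w} \<Longrightarrow> h \<bullet> v = 1"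
    and k: "of_nat (index T) * coord T w x = of_nat k" and q: "of_nat (index T) * coord T w u = of_int q"
  shows "(\<Sum>i\<in>{-2..2}. stencil i * gauge (2 *\<^sub>R x + of_int i *\<^sub>R u)) = jump T w / 2 * kink q k"
proof -
  have fr: "frame T" by (rule \<T>_frame[OF T])
  have n0: "index T > 0" by (rule index_height(1)[OF T])
  let ?c = "\<lambda>i. 2 * coord T w x + of_int i * coord T w u"
  have g: "gauge (2 *\<^sub>R x + of_int i *\<^sub>R u) = (2 * height T x - (1 - kink_min T w) * coord T w x
      + of_int i * (height T u - (1 - kink_min T w) * coord T w u / 2)) + (1 - kink_min T w) / 2 * \<bar>?c i\<bar>"
    if "i \<in> {-2..2}" for i
    by (subst gauge_near_edge[OF T w act[OF that]])
       (simp_all add: linear_add[OF linear_height[OF fr]] linear_scale[OF linear_height[OF fr]]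
          coord_add[OF fr] coord_scale[OF fr] field_simps)
  have abs: "\<bar>?c i\<bar> = \<bar>2 * of_nat k + of_int i * of_int q\<bar> / of_nat (index T)" for i
  proof -
    have "2 * of_nat k + of_int i * of_int q = of_nat (index T) * ?c i"
      by (simp add: k[symmetric] q[symmetric] algebra_simps)
    then show ?thesis using n0 by (simp add: abs_mult)
  qed
  have "(\<Sum>i\<in>{-2..2}. stencil i * gauge (2 *\<^sub>R x + of_int i *\<^sub>R u))
      = (\<Sum>i\<in>{-2..2}. stencil i * ((2 * height T x - (1 - kink_min T w) * coord T w x)
      + of_int i * (height T u - (1 - kink_min T w) * coord T w u / 2))
      + (1 - kink_min T w) / 2 / of_nat (index T) * (stencil i * \<bar>2 * of_nat k + of_int i * of_int q\<bar>))"
    by (intro sum.cong refl) (simp only: g abs, simp add: algebra_simps)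
  also have "\<dots> = (1 - kink_min T w) / 2 / of_nat (index T) * kink q k"
    by (simp only: sum.distrib stencil_affine kink_def sum_distrib_left[symmetric] add_0)
  finally show ?thesis by (simp add: jump_def)
qed

end

text \<open>For three vertices and \<open>k = 2\<close> these are the points deep along two vertices
  at once, grouped by the vertex \<open>w\<close> opposite to the wall they are close to.\<close>

lemma sum_PiE_all_but_one:
  fixes f :: "('i \<Rightarrow> nat) \<Rightarrow> real"
  assumes fin: "finite T" and card: "card T = Suc k"
  shows "(\<Sum>a\<in>PiE T (\<lambda>_. {..C}). if card {w\<in>T. a w = C} = k then f a else 0)
    = (\<Sum>w\<in>T. \<Sum>j<C. f (\<lambda>v\<in>T. if v = w then j else C))"
proof -
  let ?g = "\<lambda>(w, j). \<lambda>v\<in>T. if v = w then j else C"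
  have c: "{v\<in>T. (\<lambda>v\<in>T. if v = w then j else C) v = C} = T - {w}" if "w \<in> T" "j < C" for w j
    using that by auto
  have inj: "inj_on ?g (T \<times> {..<C})"
  proof (rule inj_onI, clarsimp)
    fix w j w' j' assume w: "w \<in> T" "j < C" "w' \<in> T" "j' < C"
      and eq: "(\<lambda>v\<in>T. if v = w then j else C) = (\<lambda>v\<in>T. if v = w' then j' else C)"
    from fun_cong[OF eq, of w] have "j = (if w = w' then j' else C)" using w by simp
    then show "w = w' \<and> j = j'" using w by (auto split: if_splits)
  qed
  have im: "?g ` (T \<times> {..<C}) = {a\<in>PiE T (\<lambda>_. {..C}). card {w\<in>T. a w = C} = k}"
  proof (intro equalityI subsetI)
    fix a assume "a \<in> ?g ` (T \<times> {..<C})"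
    then obtain w j where wj: "w \<in> T" "j < C" and a: "a = (\<lambda>v\<in>T. if v = w then j else C)" by auto
    have "card {v\<in>T. a v = C} = k" unfolding a c[OF wj] using wj fin card by simp
    then show "a \<in> {a\<in>PiE T (\<lambda>_. {..C}). card {w\<in>T. a w = C} = k}" using wj by (simp add: a PiE_iff)
  next
    fix a assume "a \<in> {a\<in>PiE T (\<lambda>_. {..C}). card {w\<in>T. a w = C} = k}"
    then have a: "a \<in> PiE T (\<lambda>_. {..C})" "card {w\<in>T. a w = C} = k" by auto
    have "card (T - {w\<in>T. a w = C}) = 1" using a(2) card fin by (simp add: card_Diff_subset)
    then obtain w where w: "T - {w\<in>T. a w = C} = {w}" by (auto simp: card_1_singleton_iff)
    then have wT: "w \<in> T" "a w \<noteq> C" by auto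
    moreover have "a w \<le> C" using a(1) wT by (auto simp: PiE_iff)
    moreover have "a v = C" if "v \<in> T" "v \<noteq> w" for v using w that by blast
    ultimately show "a \<in> ?g ` (T \<times> {..<C})"
      using a(1) by (intro image_eqI[of _ _ "(w, a w)"]) (auto simp: fun_eq_iff PiE_iff extensional_def)
  qed
  have "(\<Sum>a\<in>PiE T (\<lambda>_. {..C}). if card {w\<in>T. a w = C} = k then f a else 0)
      = sum f {a\<in>PiE T (\<lambda>_. {..C}). card {w\<in>T. a w = C} = k}"
    using fin by (intro sum.inter_filter[symmetric] finite_PiE) auto
  also have "\<dots> = (\<Sum>z\<in>T \<times> {..<C}. f (?g z))"
    unfolding im[symmetric] by (subst sum.reindex[OF inj]) (simp add: o_def)
  also have "\<dots> = (\<Sum>w\<in>T. \<Sum>j<C. f (\<lambda>v\<in>T. if v = w then j else C))"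
    by (simp add: sum.cartesian_product case_prod_unfold)
  finally show ?thesis .
qed

section \<open>Cosets of twice the lattice and the limit computed at the walls\<close>

context triangulated
begin

text \<open>The sums over subsets of the lattice basis: the eight representatives of
  \<open>N\<close> modulo twice \<open>N\<close>, see \<open>N_coset_bij\<close>.\<close>

fun step :: "bool \<times> bool \<times> bool \<Rightarrow> 'a" where
  "step (p, q, r) = of_bool p *\<^sub>R b 0 + of_bool q *\<^sub>R b 1 + of_bool r *\<^sub>R b 2"

lemma sum_less_DIM: "(\<Sum>i<DIM('a). f i) = f 0 + f 1 + f (2::nat)"
  by (simp add: dim3 eval_nat_numeral)

lemma step_N: "step e \<in> N"
proof -
  obtain p q r where e: "e = (p, q, r)" by (cases e)
  have "b 0 \<in> N" "b 1 \<in> N" "b 2 \<in> N" using basis_in dim3 by auto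
  then show ?thesis unfolding e step.simps
    using N_scale_nat[of _ "of_bool _"] by (intro N_add) (metis of_nat_of_bool)+
qed

lemma N_coset_bij: "bij_betw (\<lambda>(e, x). 2 *\<^sub>R x + step e) (UNIV \<times> N) N"
  unfolding bij_betw_def
proof
  let ?B = "b ` {..<DIM('a)}"
  let ?c = "\<lambda>i x. coord ?B (b i) x"
  have fr: "frame ?B" by (rule basis_frame)
  have cb: "?c i (b j) = of_bool (i = j)" if "i < 3" "j < 3" for i j
  proof -
    have ij: "i \<in> {..<DIM('a)}" "j \<in> {..<DIM('a)}" using that dim3 by auto
    then have "b j \<in> ?B" by blast
    then show ?thesis using coord_basis[OF fr] inj_on_eq_iff[OF basis_inj ij] by auto
  qed
  have cs: "?c 0 (step (p, q, r)) = of_bool p" "?c 1 (step (p, q, r)) = of_bool q" "?c 2 (step (p, q, r)) = of_bool r" for p q r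
    by (simp_all add: coord_add[OF fr] coord_scale[OF fr] cb)
  show "inj_on (\<lambda>(e, x). 2 *\<^sub>R x + step e) (UNIV \<times> N)"
  proof (rule inj_onI, clarsimp simp del: step.simps)
    fix p q r x p' q' r' x'
    assume N: "x \<in> N" "x' \<in> N" and eq: "2 *\<^sub>R x + step (p, q, r) = 2 *\<^sub>R x' + step (p', q', r')"
    have c: "2 * ?c i x + ?c i (step (p, q, r)) = 2 * ?c i x' + ?c i (step (p', q', r'))" for i
      using arg_cong[OF eq, of "?c i"] by (simp only: coord_add[OF fr] coord_scale[OF fr])
    have par: "s = s' \<and> ?c i x = ?c i x'"
      if "i < 3" "2 * ?c i x + of_bool s = 2 * ?c i x' + of_bool s'" for i s s'
    proof -
      have "?c i x \<in> \<int>" "?c i x' \<in> \<int>" using N that(1) unfolding N_iff dim3 by auto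
      then obtain k k' where k: "?c i x = of_int k" "?c i x' = of_int k'" by (metis Ints_cases)
      have "(of_int (2 * k + of_bool s) :: real) = of_int (2 * k' + of_bool s')" using that(2) k by simp
      then have "2 * k + of_bool s = 2 * k' + of_bool s'" by (simp only: of_int_eq_iff)
      then have "s = s' \<and> k = k'" by (cases s; cases s'; simp; presburger)
      then show ?thesis using k by simp
    qed
    have 1: "p = p' \<and> ?c 0 x = ?c 0 x'" "q = q' \<and> ?c 1 x = ?c 1 x'" "r = r' \<and> ?c 2 x = ?c 2 x'"
      using c[of 0] c[of 1] c[of 2] unfolding cs by (auto dest: par[rotated])
    then have "?c i x = ?c i x'" if "i < 3" for i
      using that by (auto simp: eval_nat_numeral less_Suc_eq)
    then have "x = x'" by (intro coord_eqI[OF fr]) (auto simp: dim3)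
    then show "p = p' \<and> q = q' \<and> r = r' \<and> x = x'" using 1 by simp
  qed
  show "(\<lambda>(e, x). 2 *\<^sub>R x + step e) ` (UNIV \<times> N) = N"
  proof safe
    fix e x assume "x \<in> N"
    then show "2 *\<^sub>R x + step e \<in> N" using N_scale[of x 2] step_N by (intro N_add) auto
  next
    fix x assume "x \<in> N"
    then obtain c :: "nat \<Rightarrow> int" where c: "x = (\<Sum>i<DIM('a). of_int (c i) *\<^sub>R b i)"
      using basis unfolding lattice_basis_def by auto
    define x' where "x' = (\<Sum>i<DIM('a). of_int (c i div 2) *\<^sub>R b i)"
    have x'N: "x' \<in> N" unfolding x'_def using basis_in by (intro N_sum N_scale) auto
    have d: "(of_int k :: real) = 2 * of_int (k div 2) + of_bool (odd k)" for k :: int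
    proof -
      have e: "k = 2 * (k div 2) + of_bool (odd k)" by (cases "even k") auto
      have "(of_int k :: real) = of_int (2 * (k div 2) + of_bool (odd k))" by (rule arg_cong[OF e])
      then show ?thesis by (simp only: of_int_add of_int_mult of_int_of_bool of_int_numeral)
    qed
    have "x = 2 *\<^sub>R x' + step (odd (c 0), odd (c 1), odd (c 2))"
      unfolding c x'_def sum_less_DIM step.simps
      by (subst d[of "c 0"], subst d[of "c 1"], subst d[of "c 2"]) (simp add: algebra_simps)
    then show "x \<in> (\<lambda>(e, x). 2 *\<^sub>R x + step e) ` (UNIV \<times> N)"
      using x'N by (intro image_eqI[of _ _ "((odd (c 0), odd (c 1), odd (c 2)), x')"]) auto
  qed
qed

lemma translate_bij: "u \<in> N \<Longrightarrow> bij_betw (\<lambda>x. x + u) N N"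
  by (rule bij_betwI[of _ _ _ "\<lambda>x. x - u"]) (auto intro: N_add N_diff)

definition coset_sum :: "'a \<Rightarrow> real \<Rightarrow> real" where
  "coset_sum u s = (\<Sum>\<^sub>\<infinity>x\<in>N. exp (- s * gauge (2 *\<^sub>R x + u)))"

lemma coset_sum_translate:
  assumes "v \<in> N" shows "coset_sum (u + 2 *\<^sub>R v) s = coset_sum u s"
  unfolding coset_sum_def
  using infsum_reindex_bij_betw[OF translate_bij[OF assms], of "\<lambda>x. exp (- s * gauge (2 *\<^sub>R x + u))"]
  by (simp add: algebra_simps)

lemma coset_sum_0: "coset_sum 0 s = lattice_sum (2 * s)"
  unfolding coset_sum_def lattice_sum_def by (simp add: gauge_scale mult_ac)

lemma coset_has_sum:
  assumes s: "s > 0"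
  shows "((\<lambda>x. exp (- s * gauge (2 *\<^sub>R x + u))) has_sum coset_sum u s) N"
proof -
  obtain \<xi> where \<xi>: "generic \<xi>" by (rule generic_exists)
  obtain C where C: "stable C {u}" using stable_exists[of "{u}"] by blast
  show ?thesis
    unfolding coset_sum_def using has_sum_gauge_double[OF \<xi> s C] by (intro has_sum_infsum) (auto simp: summable_on_def)
qed

lemma lattice_sum_cosets:
  assumes s: "s > 0"
  shows "lattice_sum s = (\<Sum>e\<in>UNIV. coset_sum (step e) s)"
proof -
  obtain \<xi> where \<xi>: "generic \<xi>" by (rule generic_exists)
  let ?f = "\<lambda>x. exp (- s * gauge x)"
  let ?g = "\<lambda>(e, x). 2 *\<^sub>R x + step e"
  have "?f summable_on N" using has_sum_gauge[OF \<xi> s] by (auto simp: summable_on_def)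
  then have "(?f has_sum lattice_sum s) N" unfolding lattice_sum_def by (rule has_sum_infsum)
  then have "((\<lambda>z. ?f (?g z)) has_sum lattice_sum s) (UNIV \<times> N)"
    unfolding has_sum_reindex_bij_betw[OF N_coset_bij, of ?f] .
  then have h: "((\<lambda>e. coset_sum (step e) s) has_sum lattice_sum s) UNIV"
    by (rule has_sum_SigmaD) (use coset_has_sum[OF s] in simp)
  show ?thesis by (rule has_sum_unique[OF h has_sum_finite]) simp
qed

text \<open>The shifts by 0 and by twice the step leave the trivial coset, the shifts by plus or
  minus the step that of \<open>step e\<close>. Hence the stencil yields twice the difference
  between the coset and the trivial one, and the trivial one, subtracted eight times, accounts for
  \<open>8 * lattice_sum (2 * s)\<close>.\<close>

lemma lattice_sum_stencil:
  assumes s: "s > 0"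
  shows "lattice_sum s - 8 * lattice_sum (2 * s)
    = (\<Sum>e\<in>UNIV. \<Sum>i\<in>{-2..2}. stencil i * coset_sum (of_int i *\<^sub>R step e) s) / 2"
proof -
  have "(\<Sum>i\<in>{-2..2}. stencil i * coset_sum (of_int i *\<^sub>R u) s) = 2 * (coset_sum u s - coset_sum 0 s)" if u: "u \<in> N" for u
  proof -
    have "coset_sum (of_int 2 *\<^sub>R u) s = coset_sum 0 s" "coset_sum (of_int (-2) *\<^sub>R u) s = coset_sum 0 s"
      "coset_sum (of_int (-1) *\<^sub>R u) s = coset_sum u s"
      using coset_sum_translate[OF u, of 0 s] coset_sum_translate[OF N_neg[OF u], of 0 s]
        coset_sum_translate[OF N_neg[OF u], of u s] by (simp_all add: scaleR_2)
    then show ?thesis unfolding sum_stencil by simp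
  qed
  then have "(\<Sum>e\<in>UNIV. \<Sum>i\<in>{-2..2}. stencil i * coset_sum (of_int i *\<^sub>R step e) s)
      = (\<Sum>e\<in>UNIV. 2 * (coset_sum (step e) s - coset_sum 0 s))"
    using step_N by simp
  also have "\<dots> = 2 * (lattice_sum s - 8 * lattice_sum (2 * s))"
    by (simp add: sum_distrib_left[symmetric] sum_subtractf lattice_sum_cosets[OF s] coset_sum_0 card_UNIV_bool)
  finally show ?thesis by simp
qed

text \<open>If k coordinates have reached \<open>C\<close>, the weight grows like (1 / (2 s))^k. The
  stencil of the exponentials tends to 0 and is - s times the stencil of the gauge to first order.
  So k < 2 gives 0 and k = 2 the factor (1 / 2)^2; for k = 3 the gauge is affine on all five points,
  and by \<open>stencil_cosh\<close> the term vanishes in the limit.\<close>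

lemma stencil_term_limit:
  assumes st: "stable C U" and U: "\<And>i. i \<in> {-2..2} \<Longrightarrow> of_int i *\<^sub>R u \<in> U"
    and T: "T \<in> \<T>" and x: "\<And>v. v \<in> T \<Longrightarrow> coord T v x \<ge> 0" and deep: "\<And>v. v \<in> T \<Longrightarrow> a v = C \<Longrightarrow> coord T v x \<ge> of_nat C"
  shows "((\<lambda>s. s * ((\<Sum>i\<in>{-2..2}. stencil i * exp (- s * gauge (2 *\<^sub>R x + of_int i *\<^sub>R u))) * weight s C T a))
     \<longlongrightarrow> (if card {w\<in>T. a w = C} = 2 then - (\<Sum>i\<in>{-2..2}. stencil i * gauge (2 *\<^sub>R x + of_int i *\<^sub>R u)) / 4 else 0)) (at_right 0)"
    (is "(?f \<longlongrightarrow> _) _")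
proof -
  let ?g = "\<lambda>i. gauge (2 *\<^sub>R x + of_int i *\<^sub>R u)"
  define \<Phi> where "\<Phi> s = (\<Sum>i\<in>{-2..2}. stencil i * exp (- s * ?g i))" for s
  define k where "k = card {w\<in>T. a w = C}"
  have \<Phi>: "(\<Phi> \<longlongrightarrow> 0) (at_right 0)" "((\<lambda>s. \<Phi> s / s) \<longlongrightarrow> - (\<Sum>i\<in>{-2..2}. stencil i * ?g i)) (at_right 0)"
    unfolding \<Phi>_def by (rule exp_combination_limits[OF stencil_0])+
  have pos: "\<forall>\<^sub>F s in at_right (0::real). s > 0" by (rule eventually_at_right_less)
  have fin: "finite T" by (rule finite_T[OF T])
  have w: "?f s = s * (\<Phi> s * (1 / (1 - exp (- 2 * s))) ^ k)" for s by (simp add: \<Phi>_def weight_def k_def)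
  have "{w\<in>T. a w = C} \<subseteq> T" by blast
  then have k3: "k \<le> 3" unfolding k_def using card_mono[OF fin] card_T[OF T] by metis
  consider "k = 0" | "k = 1" | "k = 2" | "k = 3" using k3 by linarith
  then show ?thesis
  proof cases
    case 1
    have "((\<lambda>s. s * \<Phi> s) \<longlongrightarrow> 0 * 0) (at_right 0)" by (intro tendsto_mult \<Phi> tendsto_ident_at)
    then show ?thesis unfolding w using 1 by (simp add: k_def[symmetric])
  next
    case 2
    have "((\<lambda>s. \<Phi> s * (s / (1 - exp (- 2 * s)))) \<longlongrightarrow> 0 * (1 / 2)) (at_right 0)" by (intro tendsto_mult \<Phi> lim_0)
    then show ?thesis unfolding w using 2 by (simp add: k_def[symmetric] mult_ac)
  next
    case 3
    have "((\<lambda>s. \<Phi> s / s * (s / (1 - exp (- 2 * s)))\<^sup>2) \<longlongrightarrow> - (\<Sum>i\<in>{-2..2}. stencil i * ?g i) * (1 / 2)\<^sup>2) (at_right 0)"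
      by (intro tendsto_mult tendsto_power \<Phi> lim_0)
    moreover have "\<forall>\<^sub>F s in at_right 0. \<Phi> s / s * (s / (1 - exp (- 2 * s)))\<^sup>2 = ?f s"
      unfolding w 3 using pos by (rule eventually_mono) (simp add: power2_eq_square)
    ultimately have "(?f \<longlongrightarrow> - (\<Sum>i\<in>{-2..2}. stencil i * ?g i) * (1 / 2)\<^sup>2) (at_right 0)"
      by (rule Lim_transform_eventually)
    then show ?thesis using 3 by (simp add: k_def[symmetric] power2_eq_square)
  next
    case 4
    have fr: "frame T" by (rule \<T>_frame[OF T])
    have "{w\<in>T. a w = C} = T" using 4 card_T[OF T] fin by (intro card_subset_eq) (auto simp: k_def)
    then have all: "coord T v x \<ge> of_nat C" if "v \<in> T" for v using deep that by blast
    have g: "?g i = 2 * height T x + of_int i * height T u" if i: "i \<in> {-2..2}" for i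
    proof -
      obtain h where h: "h \<in> E" "h \<bullet> (2 *\<^sub>R x + of_int i *\<^sub>R u) = ?g i" by (rule gauge_attained)
      have "\<forall>v\<in>T. h \<bullet> v = 1" using st T x all h U[OF i] unfolding stable_def by blast
      then have "?g i = height T (2 *\<^sub>R x + of_int i *\<^sub>R u)" using inner_eq_height[OF fr] h(2) by metis
      then show ?thesis by (simp add: linear_add[OF linear_height[OF fr]] linear_scale[OF linear_height[OF fr]])
    qed
    define c where "c s = (exp (s * height T u) + exp (- s * height T u)) / 2 - 1" for s
    have \<Phi>c: "\<Phi> s = - exp (- s * (2 * height T x)) * (c s)\<^sup>2 * 1" for s
      unfolding \<Phi>_def c_def stencil_cosh[symmetric] by (intro sum.cong refl) (simp only: g)
    have "((\<lambda>s. - exp (- s * (2 * height T x)) * (c s / s)\<^sup>2 * (s / (1 - exp (- 2 * s))) ^ 3)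
      \<longlongrightarrow> - exp (- 0 * (2 * height T x)) * 0\<^sup>2 * (1 / 2) ^ 3) (at_right 0)"
      unfolding c_def by (intro tendsto_mult tendsto_power tendsto_minus tendsto_exp tendsto_ident_at tendsto_const lim_cosh lim_0)
    moreover have "\<forall>\<^sub>F s in at_right 0. - exp (- s * (2 * height T x)) * (c s / s)\<^sup>2 * (s / (1 - exp (- 2 * s))) ^ 3 = ?f s"
      unfolding w 4 \<Phi>c using pos by (rule eventually_mono) (simp add: power2_eq_square power3_eq_cube)
    ultimately have "(?f \<longlongrightarrow> - exp (- 0 * (2 * height T x)) * 0\<^sup>2 * (1 / 2) ^ 3) (at_right 0)"
      by (rule Lim_transform_eventually)
    then show ?thesis using 4 by (simp add: k_def[symmetric])
  qed
qed

text \<open>The number of lattice layers between a point and the wall opposite to \<open>w\<close>.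
  The floor only changes the type, as the product is an integer on \<open>N\<close> by
  \<open>par_eq\<close>.\<close>

definition par :: "'a set \<Rightarrow> 'a \<Rightarrow> 'a \<Rightarrow> int" where
  "par T w u = \<lfloor>of_nat (index T) * coord T w u\<rfloor>"

lemma par_eq:
  assumes "T \<in> \<T>" "w \<in> T" "x \<in> N"
  shows "of_int (par T w x) = of_nat (index T) * coord T w x"
proof -
  have "coord T w x \<in> range (\<lambda>j::int. of_int j / of_nat (index T))"
    using assms(3) unfolding index_coord(1)[OF assms(1,2), symmetric] by blast
  then obtain j :: int where "coord T w x = of_int j / of_nat (index T)" by blast
  then show ?thesis using index_height(1)[OF assms(1)] by (simp add: par_def)
qed

lemma par_surj:
  assumes T: "T \<in> \<T>" "w \<in> T"
  obtains x where "x \<in> N" "par T w x = 1"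
proof -
  have "1 / of_nat (index T) \<in> range (\<lambda>j::int. of_int j / of_nat (index T) :: real)"
    by (intro range_eqI[of _ _ 1]) simp
  then obtain x where x: "x \<in> N" "coord T w x = 1 / of_nat (index T)"
    unfolding index_coord(1)[OF T, symmetric] by force
  then have "par T w x = 1" using index_height(1)[OF T(1)] by (simp add: par_def)
  then show ?thesis using that x(1) by blast
qed

lemma sum_bool: "(\<Sum>p\<in>UNIV. f p) = f True + f False" for f :: "bool \<Rightarrow> real"
  by (simp add: UNIV_bool)

lemma sum_UNIV_prod: "(\<Sum>e\<in>UNIV. f e) = (\<Sum>p\<in>UNIV. \<Sum>z\<in>UNIV. f (p, z))"
  for f :: "'x::finite \<times> 'y::finite \<Rightarrow> real"
  by (simp add: sum.cartesian_product)

text \<open>By \<open>par_surj\<close> the homomorphism \<open>par T w\<close> is nonzero modulo 2,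
  so it is a nonzero linear form on the eight classes and takes the value 1 on half of them.\<close>

lemma count_odd_steps:
  assumes T: "T \<in> \<T>" "w \<in> T"
  shows "(\<Sum>e\<in>UNIV. if odd (par T w (step e)) then 1 else 0 :: real) = 4"
proof -
  have fr: "frame T" by (rule \<T>_frame[OF T(1)])
  have bN: "b 0 \<in> N" "b 1 \<in> N" "b 2 \<in> N" using basis_in dim3 by auto
  let ?m = "\<lambda>i. par T w (b i)"
  have st: "par T w (step (p, q, r)) = of_bool p * ?m 0 + of_bool q * ?m 1 + of_bool r * ?m 2" for p q r
  proof -
    have "(of_int (par T w (step (p, q, r))) :: real) = of_nat (index T) * coord T w (step (p, q, r))"
      by (rule par_eq[OF T step_N])
    also have "\<dots> = of_int (of_bool p * ?m 0 + of_bool q * ?m 1 + of_bool r * ?m 2)"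
      by (simp add: coord_add[OF fr] coord_scale[OF fr] par_eq[OF T bN(1)] par_eq[OF T bN(2)[unfolded One_nat_def]]
          par_eq[OF T bN(3)] algebra_simps)
    finally show ?thesis by (simp only: of_int_eq_iff)
  qed
  obtain x where x: "x \<in> N" "par T w x = 1" by (rule par_surj[OF T])
  obtain c :: "nat \<Rightarrow> int" where c: "x = (\<Sum>i<DIM('a). of_int (c i) *\<^sub>R b i)"
    using basis x(1) unfolding lattice_basis_def by auto
  have "(1 :: real) = of_nat (index T) * coord T w x" using par_eq[OF T x(1)] x(2) by simp
  also have "\<dots> = of_int (c 0 * ?m 0 + c 1 * ?m 1 + c 2 * ?m 2)"
    unfolding c sum_less_DIM
    by (simp add: coord_add[OF fr] coord_scale[OF fr] par_eq[OF T bN(1)] par_eq[OF T bN(2)[unfolded One_nat_def]]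
          par_eq[OF T bN(3)] algebra_simps)
  finally have "(of_int 1 :: real) = of_int (c 0 * ?m 0 + c 1 * ?m 1 + c 2 * ?m 2)" by simp
  then have "1 = c 0 * ?m 0 + c 1 * ?m 1 + c 2 * ?m 2" by (simp only: of_int_eq_iff)
  then have "odd (c 0 * ?m 0 + c 1 * ?m 1 + c 2 * ?m 2)" by (metis odd_one)
  then have odd: "odd (?m 0) \<or> odd (?m 1) \<or> odd (?m 2)" by auto
  have "(\<Sum>e\<in>UNIV. if odd (par T w (step e)) then 1 else 0 :: real)
    = (\<Sum>p\<in>UNIV. \<Sum>q\<in>UNIV. \<Sum>r\<in>UNIV. if odd (par T w (step (p, q, r))) then 1 else 0)"
    by (simp only: sum_UNIV_prod)
  also have "\<dots> = 4" unfolding st sum_bool using odd by auto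
  finally show ?thesis .
qed

text \<open>Only terms deep along two vertices survive. For each remaining vertex \<open>w\<close>
  they pass through consecutive layers parallel to the opposite wall, and the factors 1 / 4 of
  \<open>stencil_term_limit\<close> and 1 / 2 of \<open>stencil_gauge\<close> combine to 1 /
  8.\<close>

lemma cell_limit:
  assumes st: "stable C U" and U: "\<And>i. i \<in> {-2..2} \<Longrightarrow> of_int i *\<^sub>R u \<in> U" and u: "u \<in> N" and T: "T \<in> \<T>"
  shows "((\<lambda>s. s * (\<Sum>y\<in>cell \<xi> T. \<Sum>a\<in>PiE T (\<lambda>_. {..C}).
        (\<Sum>i\<in>{-2..2}. stencil i * exp (- s * gauge (2 *\<^sub>R (y + shift T a) + of_int i *\<^sub>R u))) * weight s C T a))
     \<longlongrightarrow> (\<Sum>w\<in>T. - jump T w / 8 * (if coord T w \<xi> > 0 then \<Sum>k<C * index T. kink (par T w u) k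
                   else \<Sum>k<C * index T. kink (par T w u) (Suc k)))) (at_right 0)"
proof -
  have fr: "frame T" by (rule \<T>_frame[OF T])
  have fin: "finite T" by (rule finite_T[OF T])
  let ?G = "\<lambda>x. - (\<Sum>i\<in>{-2..2}. stencil i * gauge (2 *\<^sub>R x + of_int i *\<^sub>R u)) / 4"
  have cy: "coord T v y \<ge> 0" if "y \<in> cell \<xi> T" "v \<in> T" for y v
    using that by (auto simp: cell_def split: if_splits)
  have cs: "coord T v (y + shift T a) = coord T v y + of_nat (a v)" if "v \<in> T" for v y a
    by (simp add: coord_add[OF fr] coord_shift[OF fr that])
  have lim: "((\<lambda>s. \<Sum>y\<in>cell \<xi> T. \<Sum>a\<in>PiE T (\<lambda>_. {..C}). s * (
        (\<Sum>i\<in>{-2..2}. stencil i * exp (- s * gauge (2 *\<^sub>R (y + shift T a) + of_int i *\<^sub>R u))) * weight s C T a))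
     \<longlongrightarrow> (\<Sum>y\<in>cell \<xi> T. \<Sum>a\<in>PiE T (\<lambda>_. {..C}). if card {w\<in>T. a w = C} = 2 then ?G (y + shift T a) else 0)) (at_right 0)"
  proof (intro tendsto_sum stencil_term_limit[OF st U T])
    fix y a v assume "y \<in> cell \<xi> T" "v \<in> T"
    then show "0 \<le> coord T v (y + shift T a)" "a v = C \<Longrightarrow> of_nat C \<le> coord T v (y + shift T a)"
      using cs[of v y a] cy[of y v] by auto
  qed auto
  have G: "?G (y + shift T (\<lambda>v\<in>T. if v = w then j else C))
      = - jump T w / 8 * kink (par T w u) (nat \<lfloor>of_nat (index T) * (coord T w y + of_nat j)\<rfloor>)"
    if y: "y \<in> cell \<xi> T" and w: "w \<in> T" for y w j
  proof -
    let ?x = "y + shift T (\<lambda>v\<in>T. if v = w then j else C)"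
    have x: "coord T w ?x = coord T w y + of_nat j" "\<And>v. v \<in> T - {w} \<Longrightarrow> coord T v ?x = coord T v y + of_nat C"
      using w by (auto simp: cs)
    have pos: "coord T v ?x \<ge> 0" if "v \<in> T" for v using cy[OF y that] cs[OF that] by simp
    have xN: "?x \<in> N" using y shift_N[OF T] by (auto simp: cell_def intro: N_add)
    have k: "of_nat (index T) * coord T w ?x = of_nat (nat (par T w ?x))"
    proof -
      have "par T w ?x \<ge> 0" unfolding par_def using pos[OF w] by simp
      then show ?thesis using par_eq[OF T w xN] by simp
    qed
    have "(\<Sum>i\<in>{-2..2}. stencil i * gauge (2 *\<^sub>R ?x + of_int i *\<^sub>R u)) = jump T w / 2 * kink (par T w u) (nat (par T w ?x))"
    proof (rule stencil_gauge[OF T w _ k par_eq[OF T w u, symmetric]])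
      fix i :: int and h v
      assume i: "i \<in> {-2..2}" and h: "h \<in> E" "h \<bullet> (2 *\<^sub>R ?x + of_int i *\<^sub>R u) = gauge (2 *\<^sub>R ?x + of_int i *\<^sub>R u)"
        and v: "v \<in> T - {w}"
      have "of_nat C \<le> coord T v ?x" using x(2)[OF v] cy[OF y] v by simp
      then show "h \<bullet> v = 1" using st T pos v U[OF i] h unfolding stable_def by blast
    qed
    moreover have "par T w ?x = \<lfloor>of_nat (index T) * (coord T w y + of_nat j)\<rfloor>" by (simp add: par_def x(1))
    ultimately show ?thesis by simp
  qed
  have "(\<Sum>y\<in>cell \<xi> T. \<Sum>a\<in>PiE T (\<lambda>_. {..C}). if card {w\<in>T. a w = C} = 2 then ?G (y + shift T a) else 0)
      = (\<Sum>y\<in>cell \<xi> T. \<Sum>w\<in>T. \<Sum>j<C. ?G (y + shift T (\<lambda>v\<in>T. if v = w then j else C)))"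
    using card_T[OF T] by (intro sum.cong refl sum_PiE_all_but_one[OF fin]) simp
  also have "\<dots> = (\<Sum>y\<in>cell \<xi> T. \<Sum>w\<in>T. \<Sum>j<C. - jump T w / 8 * kink (par T w u) (nat \<lfloor>of_nat (index T) * (coord T w y + of_nat j)\<rfloor>))"
    by (intro sum.cong refl G)
  also have "\<dots> = (\<Sum>w\<in>T. \<Sum>y\<in>cell \<xi> T. \<Sum>j<C. - jump T w / 8 * kink (par T w u) (nat \<lfloor>of_nat (index T) * (coord T w y + of_nat j)\<rfloor>))"
    by (rule sum.swap)
  also have "\<dots> = (\<Sum>w\<in>T. - jump T w / 8 * (\<Sum>y\<in>cell \<xi> T. \<Sum>j<C. kink (par T w u) (nat \<lfloor>of_nat (index T) * (coord T w y + of_nat j)\<rfloor>)))"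
    by (simp only: sum_distrib_left)
  also have "\<dots> = (\<Sum>w\<in>T. - jump T w / 8 * (if coord T w \<xi> > 0 then \<Sum>k<C * index T. kink (par T w u) k
                   else \<Sum>k<C * index T. kink (par T w u) (Suc k)))"
    by (intro sum.cong refl arg_cong2[where f = "(*)"], subst sum_cell_layers[OF T, of _ "\<lambda>r. kink _ (nat \<lfloor>r\<rfloor>)"])
       (auto simp del: of_nat_Suc)
  finally show ?thesis using lim by (simp only: sum_distrib_left)
qed

lemma lattice_sum_limit_half:
  assumes \<xi>: "generic \<xi>" and st: "stable C U" and U: "\<And>i e. i \<in> {-2..2} \<Longrightarrow> of_int i *\<^sub>R step e \<in> U"
  shows "((\<lambda>s. s * (lattice_sum s - 8 * lattice_sum (2 * s)))
     \<longlongrightarrow> (\<Sum>e\<in>UNIV. \<Sum>T\<in>\<T>. \<Sum>w\<in>T. - jump T w / 8 * (if coord T w \<xi> > 0 then \<Sum>k<C * index T. kink (par T w (step e)) k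
                   else \<Sum>k<C * index T. kink (par T w (step e)) (Suc k))) / 2) (at_right 0)"
proof -
  let ?W = "\<lambda>s e T. \<Sum>y\<in>cell \<xi> T. \<Sum>a\<in>PiE T (\<lambda>_. {..C}).
        (\<Sum>i\<in>{-2..2}. stencil i * exp (- s * gauge (2 *\<^sub>R (y + shift T a) + of_int i *\<^sub>R step e))) * weight s C T a"
  let ?L = "\<lambda>e T. \<Sum>w\<in>T. - jump T w / 8 * (if coord T w \<xi> > 0 then \<Sum>k<C * index T. kink (par T w (step e)) k
                   else \<Sum>k<C * index T. kink (par T w (step e)) (Suc k))"
  have "((\<lambda>s. (\<Sum>e\<in>UNIV. \<Sum>T\<in>\<T>. s * ?W s e T) / 2) \<longlongrightarrow> (\<Sum>e\<in>UNIV. \<Sum>T\<in>\<T>. ?L e T) / 2) (at_right 0)"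
    by (intro tendsto_divide tendsto_sum cell_limit[OF st U step_N] tendsto_const) auto
  moreover have "(\<Sum>e\<in>UNIV. \<Sum>T\<in>\<T>. s * ?W s e T) / 2 = s * (lattice_sum s - 8 * lattice_sum (2 * s))" if s: "s > 0" for s
  proof -
    have cs: "coset_sum (of_int i *\<^sub>R step e) s = (\<Sum>T\<in>\<T>. \<Sum>y\<in>cell \<xi> T. \<Sum>a\<in>PiE T (\<lambda>_. {..C}).
        exp (- s * gauge (2 *\<^sub>R (y + shift T a) + of_int i *\<^sub>R step e)) * weight s C T a)" if "i \<in> {-2..2}" for i e
      unfolding coset_sum_def using that by (intro infsumI has_sum_gauge_double[OF \<xi> s st U])
    have "(\<Sum>i\<in>{-2..2}. stencil i * coset_sum (of_int i *\<^sub>R step e) s) = (\<Sum>T\<in>\<T>. ?W s e T)" for e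
    proof -
      have "(\<Sum>i\<in>{-2..2}. stencil i * coset_sum (of_int i *\<^sub>R step e) s)
        = (\<Sum>i\<in>{-2..2}. \<Sum>T\<in>\<T>. \<Sum>y\<in>cell \<xi> T. \<Sum>a\<in>PiE T (\<lambda>_. {..C}).
        stencil i * exp (- s * gauge (2 *\<^sub>R (y + shift T a) + of_int i *\<^sub>R step e)) * weight s C T a)"
        by (intro sum.cong refl) (simp only: cs sum_distrib_left mult.assoc)
      also have "\<dots> = (\<Sum>T\<in>\<T>. \<Sum>i\<in>{-2..2}. \<Sum>y\<in>cell \<xi> T. \<Sum>a\<in>PiE T (\<lambda>_. {..C}).
        stencil i * exp (- s * gauge (2 *\<^sub>R (y + shift T a) + of_int i *\<^sub>R step e)) * weight s C T a)"
        by (rule sum.swap)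
      also have "\<dots> = (\<Sum>T\<in>\<T>. \<Sum>y\<in>cell \<xi> T. \<Sum>i\<in>{-2..2}. \<Sum>a\<in>PiE T (\<lambda>_. {..C}).
        stencil i * exp (- s * gauge (2 *\<^sub>R (y + shift T a) + of_int i *\<^sub>R step e)) * weight s C T a)"
        by (intro sum.cong refl sum.swap)
      also have "\<dots> = (\<Sum>T\<in>\<T>. \<Sum>y\<in>cell \<xi> T. \<Sum>a\<in>PiE T (\<lambda>_. {..C}). \<Sum>i\<in>{-2..2}.
        stencil i * exp (- s * gauge (2 *\<^sub>R (y + shift T a) + of_int i *\<^sub>R step e)) * weight s C T a)"
        by (intro sum.cong refl sum.swap)
      finally show ?thesis by (simp only: sum_distrib_right)
    qed
    then show ?thesis unfolding lattice_sum_stencil[OF s] by (simp only: sum_distrib_left[symmetric] times_divide_eq_right)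
  qed
  then have "\<forall>\<^sub>F s in at_right 0. (\<Sum>e\<in>UNIV. \<Sum>T\<in>\<T>. s * ?W s e T) / 2 = s * (lattice_sum s - 8 * lattice_sum (2 * s))"
    by (intro eventually_mono[OF eventually_at_right_less])
  ultimately show ?thesis by (rule Lim_transform_eventually)
qed

text \<open>The two evaluations of the limit are equated for \<open>\<xi>\<close> and for
  \<open>- \<xi>\<close> and added. The layers counted from 0 and from 1 then combine to a parity by
  \<open>kink_sum\<close>, and four odd cosets per wall give \<open>2 * L\<close> as minus a quarter
  of the sum of all jumps.\<close>

theorem sum_jumps:
  "(\<Sum>T\<in>\<T>. \<Sum>w\<in>T. jump T w) = 48 - 2 * (\<Sum>T\<in>\<T>. of_nat (index T) - 1 / of_nat (index T))"
proof -
  obtain \<xi> where \<xi>: "generic \<xi>" by (rule generic_exists)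
  define U where "U = (\<lambda>(i, e). of_int i *\<^sub>R step e) ` ({-2..2} \<times> UNIV)"
  have U: "of_int i *\<^sub>R step e \<in> U" if "i \<in> {-2..2}" for i e using that unfolding U_def by force
  have finU: "finite U" unfolding U_def by (intro finite_imageI finite_cartesian_product) auto
  obtain C0 where C0: "stable C0 U" by (rule stable_exists[OF finU])
  \<comment> \<open>Besides stability, \<open>C\<close> must reach the size of every step in layers,
    so that the sums of kinks are complete.\<close>
  define C where "C = max C0 (\<Sum>T\<in>\<T>. \<Sum>w\<in>T. \<Sum>e\<in>UNIV. nat \<bar>par T w (step e)\<bar>)"
  have st: "stable C U" by (rule stable_mono[OF C0]) (simp add: C_def)
  have bound: "nat \<bar>par T w (step e)\<bar> \<le> C * index T" if T: "T \<in> \<T>" and w: "w \<in> T" for T w e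
  proof -
    have "nat \<bar>par T w (step e)\<bar> \<le> (\<Sum>e\<in>UNIV. nat \<bar>par T w (step e)\<bar>)" by (rule member_le_sum) auto
    also have "\<dots> \<le> (\<Sum>w\<in>T. \<Sum>e\<in>UNIV. nat \<bar>par T w (step e)\<bar>)"
      using w finite_T[OF T] by (intro member_le_sum[of w T "\<lambda>w. \<Sum>e\<in>UNIV. nat \<bar>par T w (step e)\<bar>"]) auto
    also have "\<dots> \<le> (\<Sum>T\<in>\<T>. \<Sum>w\<in>T. \<Sum>e\<in>UNIV. nat \<bar>par T w (step e)\<bar>)"
      using T finite_\<T> by (intro member_le_sum[of T \<T> "\<lambda>T. \<Sum>w\<in>T. \<Sum>e\<in>UNIV. nat \<bar>par T w (step e)\<bar>"]) auto
    also have "\<dots> \<le> C" by (simp add: C_def)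
    also have "\<dots> \<le> C * index T" using index_height(1)[OF T] by simp
    finally show ?thesis .
  qed
  let ?h = "\<lambda>\<xi> e T w. - jump T w / 8 * (if coord T w \<xi> > 0 then \<Sum>k<C * index T. kink (par T w (step e)) k
                   else \<Sum>k<C * index T. kink (par T w (step e)) (Suc k))"
  define L :: real where "L = - 6 + (\<Sum>T\<in>\<T>. of_nat (index T) - 1 / of_nat (index T)) / 4"
  have eqL: "(\<Sum>e\<in>UNIV. \<Sum>T\<in>\<T>. \<Sum>w\<in>T. ?h \<xi> e T w) / 2 = L" if "generic \<xi>" for \<xi>
    unfolding L_def
    by (rule tendsto_unique[OF trivial_limit_at_right_real lattice_sum_limit_half[OF that st U] lattice_sum_limit])
  have "2 * L = (\<Sum>e\<in>UNIV. \<Sum>T\<in>\<T>. \<Sum>w\<in>T. ?h \<xi> e T w) / 2 + (\<Sum>e\<in>UNIV. \<Sum>T\<in>\<T>. \<Sum>w\<in>T. ?h (- \<xi>) e T w) / 2"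
    using eqL[OF \<xi>] eqL[OF generic_neg[OF \<xi>]] by simp
  also have "\<dots> = (\<Sum>e\<in>UNIV. \<Sum>T\<in>\<T>. \<Sum>w\<in>T. ?h \<xi> e T w + ?h (- \<xi>) e T w) / 2"
    by (simp only: sum.distrib add_divide_distrib)
  also have "\<dots> = (\<Sum>e\<in>UNIV. \<Sum>T\<in>\<T>. \<Sum>w\<in>T. - jump T w / 8 * (if odd (par T w (step e)) then 1 else 0)) / 2"
  proof (intro arg_cong2[where f = "(/)"] sum.cong refl)
    fix e T w assume T: "T \<in> \<T>" and w: "w \<in> T"
    have fr: "frame T" by (rule \<T>_frame[OF T])
    have "coord T w (- \<xi>) = - coord T w \<xi>" using coord_diff[OF fr, of w 0 \<xi>] by (simp add: coord_zero[OF fr])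
    moreover have "coord T w \<xi> \<noteq> 0" by (rule generic_coord[OF \<xi> fr \<T>_sub[OF T] w])
    ultimately have "?h \<xi> e T w + ?h (- \<xi>) e T w
        = - jump T w / 8 * ((\<Sum>k<C * index T. kink (par T w (step e)) k) + (\<Sum>k<C * index T. kink (par T w (step e)) (Suc k)))"
      by (cases "coord T w \<xi> > 0") (simp_all add: distrib_left not_less)
    also have "\<dots> = - jump T w / 8 * (if odd (par T w (step e)) then 1 else 0)"
      by (simp only: kink_sum[OF bound[OF T w]])
    finally show "?h \<xi> e T w + ?h (- \<xi>) e T w = - jump T w / 8 * (if odd (par T w (step e)) then 1 else 0)" .
  qed
  also have "\<dots> = (\<Sum>T\<in>\<T>. \<Sum>w\<in>T. - jump T w / 8 * (\<Sum>e\<in>UNIV. if odd (par T w (step e)) then 1 else 0)) / 2"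
    by (simp only: sum_distrib_left sum.swap[of _ _ "UNIV :: (bool \<times> bool \<times> bool) set"])
  also have "\<dots> = (\<Sum>T\<in>\<T>. \<Sum>w\<in>T. - jump T w / 8 * 4) / 2"
    using count_odd_steps by (intro arg_cong2[where f = "(/)"] sum.cong refl) (simp only: )
  also have "\<dots> = - (\<Sum>T\<in>\<T>. \<Sum>w\<in>T. jump T w) / 4"
    by (simp add: sum_negf sum_divide_distrib[symmetric])
  finally show ?thesis unfolding L_def by (simp add: field_simps)
qed

end

section \<open>Relative volumes\<close>

text \<open>Coordinates are taken in a vector type, where determinants and Lebesgue measure are at
  hand; \<open>relative_volume_eq\<close> relates this to the coordinate functions on
  \<open>{..<k}\<close>.\<close>

definition lincomb :: "('n::finite \<Rightarrow> 'a::euclidean_space) \<Rightarrow> (real, 'n) vec \<Rightarrow> 'a" where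
  "lincomb v x = (\<Sum>i\<in>UNIV. x $ i *\<^sub>R v i)"

definition integral_vectors :: "(real, 'n::finite) vec set" where
  "integral_vectors = {x. \<forall>i. x $ i \<in> \<int>}"

lemma linear_lincomb: "linear (lincomb v)"
  unfolding lincomb_def[abs_def]
  by (intro linearI) (simp_all add: scaleR_left_distrib sum.distrib scaleR_sum_right)

lemma lincomb_axis: "lincomb v (axis j 1) = v j"
proof -
  have "lincomb v (axis j 1) = (\<Sum>i\<in>UNIV. if i = j then v i else 0)"
    unfolding lincomb_def by (intro sum.cong) (auto simp: axis_def)
  then show ?thesis by simp
qed

lemma lincomb_matrix:
  fixes A :: "((real, 'n::{finite,wellorder}) vec, 'n) vec" and w :: "'n \<Rightarrow> 'a::euclidean_space"
  assumes "\<And>j. w j = lincomb v (\<chi> i. A $ i $ j)"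
  shows "lincomb w x = lincomb v (A *v x)"
proof -
  have "lincomb w x = (\<Sum>j\<in>UNIV. \<Sum>i\<in>UNIV. (x $ j * A $ i $ j) *\<^sub>R v i)"
    unfolding lincomb_def[of w] assms by (simp add: lincomb_def scaleR_sum_right)
  also have "\<dots> = (\<Sum>i\<in>UNIV. \<Sum>j\<in>UNIV. (x $ j * A $ i $ j) *\<^sub>R v i)" by (rule sum.swap)
  also have "\<dots> = lincomb v (A *v x)"
    by (simp add: lincomb_def matrix_vector_mult_def scaleR_sum_left mult.commute)
  finally show ?thesis .
qed

lemma compact_lincomb_preimage:
  assumes S: "compact S" and inj: "inj (lincomb v)"
  shows "compact {x. p + lincomb v x \<in> S}"
proof -
  obtain g where g: "linear g" "g \<circ> lincomb v = id"
    using linear_injective_left_inverse[OF linear_lincomb inj] by blast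
  have cont: "continuous_on UNIV (\<lambda>x. p + lincomb v x)"
    by (intro continuous_intros linear_continuous_on linear_conv_bounded_linear[THEN iffD1] linear_lincomb)
  have "closed ((\<lambda>x. p + lincomb v x) -` S)"
    using S cont by (intro continuous_closed_vimage) (auto simp: compact_imp_closed continuous_on_eq_continuous_at)
  moreover have "(\<lambda>x. p + lincomb v x) -` S = {x. p + lincomb v x \<in> S}" by auto
  moreover have "{x. p + lincomb v x \<in> S} \<subseteq> g ` ((\<lambda>y. - p + y) ` S)"
  proof
    fix x assume "x \<in> {x. p + lincomb v x \<in> S}"
    moreover have "x = g (- p + (p + lincomb v x))" using g(2) by (simp add: pointfree_idE)
    ultimately show "x \<in> g ` ((\<lambda>y. - p + y) ` S)" by blast
  qed
  moreover have "bounded (g ` ((\<lambda>y. - p + y) ` S))"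
    using S g(1) by (intro bounded_linear_image[OF _ linear_conv_bounded_linear[THEN iffD1]]
        bounded_translation compact_imp_bounded)
  ultimately show ?thesis by (metis bounded_subset compact_eq_bounded_closed)
qed

lemma measure_change_basis:
  fixes A :: "((real, 'n::{finite,wellorder}) vec, 'n) vec" and w :: "'n \<Rightarrow> 'a::euclidean_space"
  assumes S: "compact S" and inj: "inj (lincomb w)" and A: "invertible A"
    and w: "\<And>j. w j = lincomb v (\<chi> i. A $ i $ j)" and q: "q = p + lincomb v r"
  shows "measure lebesgue {x. p + lincomb v x \<in> S} = \<bar>det A\<bar> * measure lebesgue {x. q + lincomb w x \<in> S}"
proof -
  have eq: "{x. p + lincomb v x \<in> S} = (+) r ` ((*v) A ` {x. q + lincomb w x \<in> S})"
  proof (intro equalityI subsetI)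
    fix x assume x: "x \<in> {x. p + lincomb v x \<in> S}"
    obtain B where B: "A ** B = mat 1" using A unfolding invertible_def by blast
    define y where "y = B *v (x - r)"
    have Ay: "A *v y = x - r" by (simp add: y_def matrix_vector_mul_assoc B)
    have "q + lincomb w y = p + lincomb v x"
      unfolding lincomb_matrix[OF w] Ay q by (simp add: linear_diff[OF linear_lincomb])
    then have "y \<in> {x. q + lincomb w x \<in> S}" using x by simp
    moreover have "x = r + A *v y" by (simp add: Ay)
    ultimately show "x \<in> (+) r ` ((*v) A ` {x. q + lincomb w x \<in> S})" by blast
  next
    fix x assume "x \<in> (+) r ` ((*v) A ` {x. q + lincomb w x \<in> S})"
    then obtain y where "q + lincomb w y \<in> S" "x = r + A *v y" by blast
    then show "x \<in> {x. p + lincomb v x \<in> S}"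
      unfolding lincomb_matrix[OF w] q by (simp add: linear_add[OF linear_lincomb] add.assoc)
  qed
  have "{x. q + lincomb w x \<in> S} \<in> lmeasurable"
    by (rule lmeasurable_compact[OF compact_lincomb_preimage[OF S inj]])
  then have "measure lebesgue ((*v) A ` {x. q + lincomb w x \<in> S})
      = \<bar>det (matrix ((*v) A))\<bar> * measure lebesgue {x. q + lincomb w x \<in> S}"
    by (intro measure_linear_image) auto
  then show ?thesis unfolding eq by (simp add: measure_translation)
qed

lemma det_integral: "(\<And>i j. A $ i $ j \<in> \<int>) \<Longrightarrow> det (A :: ((real, 'n::finite) vec, 'n) vec) \<in> \<int>"
  unfolding det_def by (intro Ints_sum Ints_mult Ints_prod) auto

text \<open>The transition matrices between two bases of one lattice are integral and inverse to
  each other, so their determinants are 1 or - 1.\<close>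

lemma measure_lattice_rebase:
  fixes v w :: "'n::{finite,wellorder} \<Rightarrow> 'a::euclidean_space"
  assumes S: "compact S" and inj: "inj (lincomb v)" "inj (lincomb w)"
    and L: "lincomb v ` integral_vectors = lincomb w ` integral_vectors" and q: "q = p + lincomb v r"
  shows "measure lebesgue {x. p + lincomb v x \<in> S} = measure lebesgue {x. q + lincomb w x \<in> S}"
proof -
  have ax: "axis j 1 \<in> integral_vectors" for j :: 'n by (simp add: integral_vectors_def axis_def)
  have "\<exists>z\<in>integral_vectors. w j = lincomb v z" for j
    using L imageI[OF ax, of "lincomb w" j] by (auto simp: lincomb_axis)
  then obtain a where a: "\<And>j. a j \<in> integral_vectors" "\<And>j. w j = lincomb v (a j)" by metis
  have "\<exists>z\<in>integral_vectors. v j = lincomb w z" for j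
    using L imageI[OF ax, of "lincomb v" j] by (auto simp: lincomb_axis)
  then obtain c where c: "\<And>j. c j \<in> integral_vectors" "\<And>j. v j = lincomb w (c j)" by metis
  define A :: "((real, 'n) vec, 'n) vec" where "A = (\<chi> i j. a j $ i)"
  define B :: "((real, 'n) vec, 'n) vec" where "B = (\<chi> i j. c j $ i)"
  have wA: "w j = lincomb v (\<chi> i. A $ i $ j)" for j by (simp add: A_def a(2)[symmetric])
  have vB: "v j = lincomb w (\<chi> i. B $ i $ j)" for j by (simp add: B_def c(2)[symmetric])
  have "lincomb v (A *v (B *v x)) = lincomb v x" for x
    using lincomb_matrix[OF wA, of "B *v x"] lincomb_matrix[OF vB, of x] by simp
  then have "(A ** B) *v x = mat 1 *v x" for x
    using inj(1) by (simp add: matrix_vector_mul_assoc[symmetric] inj_eq)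
  then have AB: "A ** B = mat 1" by (simp add: matrix_eq)
  then have invA: "invertible A" using matrix_left_right_inverse[of A B] unfolding invertible_def by blast
  have "det A * det B = 1" using arg_cong[OF AB, of det] by (simp add: det_mul)
  moreover have "det A \<in> \<int>" "det B \<in> \<int>"
    using a(1) c(1) by (auto intro!: det_integral simp: A_def B_def integral_vectors_def)
  ultimately have "\<bar>det A\<bar> = 1"
  proof -
    assume *: "det A * det B = 1" and "det A \<in> \<int>" "det B \<in> \<int>"
    then obtain i j where ij: "det A = of_int i" "det B = of_int j" by (metis Ints_cases)
    then have "of_int (i * j) = (of_int 1 :: real)" using * by simp
    then have "i * j = 1" by (simp only: of_int_eq_iff)
    then have "\<bar>i\<bar> = 1" by (metis abs_zmult_eq_1 abs_1)
    then show ?thesis using ij by simp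
  qed
  then show ?thesis using measure_change_basis[OF S inj(2) invA wA q] by simp
qed

text \<open>Lebesgue measure is determined by its values on boxes, and the image of the product
  measure under relabelling of coordinates has these values.\<close>

lemma measure_PiM_vec:
  fixes e :: "nat \<Rightarrow> 'n::{finite,wellorder}"
  assumes e: "bij_betw e {..<k} UNIV" and A: "A \<in> sets borel"
  shows "measure (Pi\<^sub>M {..<k} (\<lambda>_. lborel :: real measure)) {c \<in> {..<k} \<rightarrow>\<^sub>E UNIV. (\<chi> i. c (inv_into {..<k} e i)) \<in> A}
    = measure lborel (A :: ((real, 'n) vec) set)"
proof -
  let ?M = "Pi\<^sub>M {..<k} (\<lambda>_. lborel :: real measure)"
  let ?g = "inv_into {..<k} e"
  let ?f = "\<lambda>c. (\<chi> i. c (?g i)) :: (real, 'n) vec"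
  have gk: "?g i \<in> {..<k}" for i using e by (metis UNIV_I bij_betw_imp_surj_on inv_into_into)
  have eg: "e (?g i) = i" for i using e by (metis UNIV_I bij_betw_imp_surj_on f_inv_into_f)
  have ge: "?g (e j) = j" if "j < k" for j using e that by (simp add: bij_betw_imp_inj_on)
  interpret product_sigma_finite "\<lambda>_::nat. lborel :: real measure" by standard
  have meas: "?f \<in> borel_measurable ?M"
  proof (subst borel_measurable_euclidean_space, intro ballI)
    fix j :: "(real, 'n) vec" assume "j \<in> Basis"
    then obtain i where j: "j = axis i 1" by (auto simp: Basis_vec_def)
    have "(\<lambda>c. c (?g i)) \<in> borel_measurable ?M"
      using gk[of i] by measurable
    then show "(\<lambda>c. ?f c \<bullet> j) \<in> borel_measurable ?M" by (simp add: j inner_axis)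
  qed
  have prodB: "(\<Prod>j\<in>Basis. x \<bullet> j) = (\<Prod>i\<in>UNIV. x $ i)" for x :: "(real, 'n) vec"
    by (simp add: Basis_vec_def UNION_singleton_eq_range prod.reindex axis_eq_axis inj_on_def inner_axis)
  have "lborel = distr ?M borel ?f"
  proof (rule lborel_eqI)
    fix l u :: "(real, 'n) vec" assume le: "\<And>j. j \<in> Basis \<Longrightarrow> l \<bullet> j \<le> u \<bullet> j"
    have lu: "l $ i \<le> u $ i" for i using le[of "axis i 1"] by (simp add: inner_axis)
    have "?f -` box l u \<inter> space ?M = PiE {..<k} (\<lambda>j. {l $ e j<..<u $ e j})"
    proof (intro equalityI subsetI)
      fix c assume c: "c \<in> ?f -` box l u \<inter> space ?M"
      then have "l $ i < c (?g i) \<and> c (?g i) < u $ i" for i by (simp add: mem_box_cart)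
      then have "l $ e j < c j \<and> c j < u $ e j" if "j < k" for j using ge[OF that] by metis
      then show "c \<in> PiE {..<k} (\<lambda>j. {l $ e j<..<u $ e j})" using c by (auto simp: space_PiM PiE_iff)
    next
      fix c assume c: "c \<in> PiE {..<k} (\<lambda>j. {l $ e j<..<u $ e j})"
      then have "l $ e (?g i) < c (?g i) \<and> c (?g i) < u $ e (?g i)" for i using gk[of i] by (auto simp: PiE_iff)
      then have "l $ i < c (?g i) \<and> c (?g i) < u $ i" for i by (simp only: eg)
      then show "c \<in> ?f -` box l u \<inter> space ?M" using c by (auto simp: space_PiM PiE_iff mem_box_cart)
    qed
    then have "emeasure (distr ?M borel ?f) (box l u) = emeasure ?M (PiE {..<k} (\<lambda>j. {l $ e j<..<u $ e j}))"
      using meas by (simp add: emeasure_distr)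
    also have "\<dots> = (\<Prod>j<k. emeasure lborel {l $ e j<..<u $ e j})"
      by (intro emeasure_PiM) auto
    also have "\<dots> = (\<Prod>j<k. ennreal (u $ e j - l $ e j))" by (simp add: lu)
    also have "\<dots> = (\<Prod>i\<in>UNIV. ennreal (u $ i - l $ i))"
      by (rule prod.reindex_bij_betw[OF e])
    also have "\<dots> = ennreal (\<Prod>i\<in>UNIV. (u - l) $ i)" by (simp add: prod_ennreal lu)
    also have "\<dots> = ennreal (\<Prod>j\<in>Basis. (u - l) \<bullet> j)" by (simp only: prodB)
    finally show "emeasure (distr ?M borel ?f) (box l u) = ennreal (\<Prod>j\<in>Basis. (u - l) \<bullet> j)" .
  qed simp
  then have "measure lborel A = measure (distr ?M borel ?f) A" by simp
  also have "\<dots> = measure ?M (?f -` A \<inter> space ?M)" using A meas by (intro measure_distr) auto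
  also have "?f -` A \<inter> space ?M = {c \<in> {..<k} \<rightarrow>\<^sub>E UNIV. ?f c \<in> A}" by (auto simp: space_PiM)
  finally show ?thesis by simp
qed

lemma inj_lincomb_iff:
  "inj (lincomb v) \<longleftrightarrow> inj v \<and> independent (range v)"
  for v :: "'n::{finite,wellorder} \<Rightarrow> 'a::euclidean_space"
proof
  assume inj: "inj (lincomb v)"
  have iv: "inj v"
  proof (rule injI)
    fix i j assume "v i = v j"
    then have "lincomb v (axis i 1) = lincomb v (axis j 1)" by (simp add: lincomb_axis)
    then have "axis i 1 = (axis j 1 :: (real, 'n) vec)" using inj by (simp add: inj_eq)
    then show "i = j" by (simp add: axis_eq_axis)
  qed
  moreover have "independent (range v)"
  proof (rule independent_if_scalars_zero)
    fix f x assume f: "(\<Sum>x\<in>range v. f x *\<^sub>R x) = 0" and "x \<in> range v"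
    then obtain i where x: "x = v i" by blast
    have "lincomb v (\<chi> i. f (v i)) = lincomb v 0"
      using f by (simp add: lincomb_def sum.reindex[OF iv])
    then have "(\<chi> i. f (v i)) = (0 :: (real, 'n) vec)" using inj by (simp add: inj_eq)
    then show "f x = 0" unfolding x by (metis vec_lambda_beta zero_index)
  qed simp
  ultimately show "inj v \<and> independent (range v)" by simp
next
  assume *: "inj v \<and> independent (range v)"
  have "x = 0" if "lincomb v x = 0" for x
  proof -
    have "(\<Sum>y\<in>range v. x $ inv v y *\<^sub>R y) = 0"
      using that * by (simp add: sum.reindex lincomb_def)
    then have "x $ inv v (v i) = 0" for i
      using * independentD[of "range v" "range v" "\<lambda>y. x $ inv v y" "v i"] by simp
    then show ?thesis using * by (simp add: vec_eq_iff)
  qed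
  then show "inj (lincomb v)" by (simp add: linear_injective_0[OF linear_lincomb])
qed

lemma lattice_basis_lincomb:
  fixes e :: "nat \<Rightarrow> 'n::{finite,wellorder}" and v :: "'n \<Rightarrow> 'a::euclidean_space"
  assumes e: "bij_betw e {..<k} UNIV"
  shows "lattice_basis k (\<lambda>j. v (e j)) L \<longleftrightarrow> inj (lincomb v) \<and> L = lincomb v ` integral_vectors"
proof -
  have inj: "inj_on (\<lambda>j. v (e j)) {..<k} \<longleftrightarrow> inj v"
    using e comp_inj_on_iff[of e "{..<k}" v] by (simp add: bij_betw_def o_def)
  have im: "(\<lambda>j. v (e j)) ` {..<k} = range v"
    using e by (metis bij_betw_imp_surj_on image_image)
  have "range (\<lambda>c :: nat \<Rightarrow> int. \<Sum>i<k. of_int (c i) *\<^sub>R v (e i)) = lincomb v ` integral_vectors"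
  proof (intro equalityI subsetI)
    fix x assume "x \<in> range (\<lambda>c :: nat \<Rightarrow> int. \<Sum>i<k. of_int (c i) *\<^sub>R v (e i))"
    then obtain c :: "nat \<Rightarrow> int" where c: "x = (\<Sum>i<k. of_int (c i) *\<^sub>R v (e i))" by blast
    let ?g = "inv_into {..<k} e"
    have "x = (\<Sum>i<k. of_int (c (?g (e i))) *\<^sub>R v (e i))"
      unfolding c using e by (intro sum.cong) (auto simp: bij_betw_def inv_into_f_f)
    also have "\<dots> = (\<Sum>i\<in>UNIV. of_int (c (?g i)) *\<^sub>R v i)" by (rule sum.reindex_bij_betw[OF e])
    also have "\<dots> = lincomb v (\<chi> i. of_int (c (?g i)))" by (simp add: lincomb_def)
    finally show "x \<in> lincomb v ` integral_vectors" by (auto simp: integral_vectors_def)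
  next
    fix x assume "x \<in> lincomb v ` integral_vectors"
    then obtain z where z: "z \<in> integral_vectors" "x = lincomb v z" by blast
    have "x = (\<Sum>i\<in>UNIV. of_int \<lfloor>z $ i\<rfloor> *\<^sub>R v i)"
      using z by (auto simp: lincomb_def integral_vectors_def intro!: sum.cong)
    also have "\<dots> = (\<Sum>i<k. of_int \<lfloor>z $ e i\<rfloor> *\<^sub>R v (e i))" by (rule sum.reindex_bij_betw[OF e, symmetric])
    finally show "x \<in> range (\<lambda>c :: nat \<Rightarrow> int. \<Sum>i<k. of_int (c i) *\<^sub>R v (e i))"
      by (auto intro: range_eqI[of _ _ "\<lambda>i. \<lfloor>z $ e i\<rfloor>"])
  qed
  then show ?thesis unfolding lattice_basis_def inj im inj_lincomb_iff by auto
qed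

text \<open>Independence of the choices in \<open>relative_volume\<close>: the chosen basis and
  origin are exchanged for the given ones by \<open>measure_lattice_rebase\<close>.\<close>

lemma relative_volume_eq:
  fixes v :: "'n::{finite,wellorder} \<Rightarrow> 'a::euclidean_space"
  assumes S: "compact S" and dim: "aff_dim S = int CARD('n)" and inj: "inj (lincomb v)"
    and L: "parallel_lattice L S = lincomb v ` integral_vectors"
    and p: "\<And>q. q \<in> affine hull S \<Longrightarrow> \<exists>r. q = p + lincomb v r"
  shows "relative_volume L S = measure lebesgue {x. p + lincomb v x \<in> S}"
proof -
  define k where "k = CARD('n)"
  obtain e :: "nat \<Rightarrow> 'n" where e: "bij_betw e {..<k} UNIV"
    unfolding k_def using ex_bij_betw_nat_finite[of "UNIV :: 'n set"] by (auto simp: atLeast0LessThan)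
  let ?g = "inv_into {..<k} e"
  define b where "b = (SOME b. lattice_basis k b (parallel_lattice L S))"
  define q where "q = (SOME q. q \<in> affine hull S)"
  have "lattice_basis k (\<lambda>j. v (e j)) (parallel_lattice L S)"
    unfolding lattice_basis_lincomb[OF e] using inj L by simp
  then have b: "lattice_basis k b (parallel_lattice L S)" unfolding b_def
    by (rule someI[where P = "\<lambda>b. lattice_basis k b (parallel_lattice L S)"])
  define w where "w i = b (?g i)" for i
  have bw: "b j = w (e j)" if "j < k" for j
    using that e by (simp add: w_def bij_betw_imp_inj_on)
  have "lattice_basis k (\<lambda>j. w (e j)) (parallel_lattice L S) = lattice_basis k b (parallel_lattice L S)"
    unfolding lattice_basis_def using bw by (intro arg_cong2[where f = "(\<and>)"]) (auto simp: inj_on_def cong: image_cong_simp)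
  then have w: "inj (lincomb w)" "parallel_lattice L S = lincomb w ` integral_vectors"
    using b unfolding lattice_basis_lincomb[OF e] by auto
  have "S \<noteq> {}" using dim by auto
  then have "q \<in> affine hull S" unfolding q_def by (metis affine_hull_eq_empty equals0I someI_ex)
  then obtain r where r: "q = p + lincomb v r" using p by blast
  have sum: "(\<Sum>i<k. c i *\<^sub>R b i) = lincomb w (\<chi> i. c (?g i))" for c
  proof -
    have "(\<Sum>i<k. c i *\<^sub>R b i) = (\<Sum>i<k. c (?g (e i)) *\<^sub>R w (e i))"
      using e bw by (intro sum.cong) (auto simp: bij_betw_imp_inj_on)
    also have "\<dots> = (\<Sum>i\<in>UNIV. c (?g i) *\<^sub>R w i)" by (rule sum.reindex_bij_betw[OF e])
    finally show ?thesis by (simp add: lincomb_def)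
  qed
  have cl: "{x. q + lincomb w x \<in> S} \<in> sets borel"
    using compact_lincomb_preimage[OF S w(1)] by (simp add: borel_compact)
  have "relative_volume L S = measure (Pi\<^sub>M {..<k} (\<lambda>_. lborel :: real measure))
           {c \<in> {..<k} \<rightarrow>\<^sub>E UNIV. q + (\<Sum>i<k. c i *\<^sub>R b i) \<in> S}"
    unfolding relative_volume_def Let_def using dim by (simp add: b_def q_def k_def)
  also have "\<dots> = measure (Pi\<^sub>M {..<k} (\<lambda>_. lborel :: real measure))
           {c \<in> {..<k} \<rightarrow>\<^sub>E UNIV. (\<chi> i. c (?g i)) \<in> {x. q + lincomb w x \<in> S}}"
    by (simp only: sum mem_Collect_eq)
  also have "\<dots> = measure lborel {x. q + lincomb w x \<in> S}" by (rule measure_PiM_vec[OF e cl])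
  also have "\<dots> = measure lebesgue {x. q + lincomb w x \<in> S}" using cl by (simp add: measure_completion)
  also have "\<dots> = measure lebesgue {x. p + lincomb v x \<in> S}"
    by (rule measure_lattice_rebase[OF S inj w(1) _ r, symmetric]) (use L w(2) in simp)
  finally show ?thesis .
qed

text \<open>In the coordinates of its own edge vectors the simplex is the standard simplex.\<close>

lemma lincomb_preimage_simplex:
  fixes w :: "'n::{finite,wellorder} \<Rightarrow> 'a::euclidean_space"
  assumes inj: "inj (lincomb w)"
  shows "measure lebesgue {x. p + lincomb w x \<in> convex hull (insert p (range (\<lambda>i. p + w i)))} = 1 / fact CARD('n)"
proof -
  let ?C = "convex hull (insert 0 Basis) :: (real, 'n) vec set"
  have "lincomb w ` insert 0 Basis = insert 0 (range w)"
    by (auto simp: Basis_vec_def lincomb_axis linear_0[OF linear_lincomb] image_iff)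
  then have "convex hull (insert p (range (\<lambda>i. p + w i))) = (+) p ` (lincomb w ` ?C)"
    by (simp add: convex_hull_linear_image[OF linear_lincomb] convex_hull_translation[symmetric] image_image)
  then have "{x. p + lincomb w x \<in> convex hull (insert p (range (\<lambda>i. p + w i)))} = ?C"
    using inj by (auto simp: inj_eq image_iff)
  moreover have "?C \<in> sets borel"
    by (intro borel_compact compact_convex_hull finite_imp_compact) simp
  ultimately show ?thesis using content_std_simplex[where 'a = "(real, 'n) vec"] by (simp add: measure_completion)
qed

lemma relative_volume_segment:
  fixes A d :: "'a::euclidean_space"
  assumes d: "d \<noteq> 0" and L: "\<And>t. t *\<^sub>R d \<in> L \<longleftrightarrow> t \<in> \<int>" and r: "r > 0"
  defines "S \<equiv> closed_segment A (A + r *\<^sub>R d)"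
  shows "aff_dim S = 1" "relative_volume L S = r"
proof -
  have hull: "affine hull S = range (\<lambda>t. A + t *\<^sub>R d)"
  proof -
    have "affine hull S = affine hull {A, A + r *\<^sub>R d}" by (simp add: S_def segment_convex_hull)
    also have "\<dots> = range (\<lambda>t. A + t *\<^sub>R d)"
    proof (intro equalityI subsetI)
      fix x assume "x \<in> affine hull {A, A + r *\<^sub>R d}"
      then obtain u v where "u + v = 1" "x = u *\<^sub>R A + v *\<^sub>R (A + r *\<^sub>R d)" by (auto simp: affine_hull_2)
      then have "x = A + (v * r) *\<^sub>R d" by (simp add: algebra_simps flip: scaleR_add_left)
      then show "x \<in> range (\<lambda>t. A + t *\<^sub>R d)" by blast
    next
      fix x assume "x \<in> range (\<lambda>t. A + t *\<^sub>R d)"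
      then obtain t where "x = A + t *\<^sub>R d" by blast
      then have "x = (1 - t / r) *\<^sub>R A + (t / r) *\<^sub>R (A + r *\<^sub>R d)" using r by (simp add: algebra_simps)
      then show "x \<in> affine hull {A, A + r *\<^sub>R d}"
        unfolding affine_hull_2 by (intro CollectI exI[of _ "1 - t / r"] exI[of _ "t / r"]) simp
    qed
    finally show ?thesis .
  qed
  show dim: "aff_dim S = 1"
    using d r by (simp add: S_def segment_convex_hull aff_dim_convex_hull aff_dim_2)
  let ?v = "\<lambda>_::1. d"
  have lc: "lincomb ?v x = x $ 1 *\<^sub>R d" for x by (simp add: lincomb_def)
  have inj: "inj (lincomb ?v)" using d by (auto simp: inj_def lc vec_eq_iff)
  have "{p - q | p q. p \<in> affine hull S \<and> q \<in> affine hull S} = range (\<lambda>t. t *\<^sub>R d)"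
  proof (intro equalityI subsetI)
    fix x assume "x \<in> {p - q | p q. p \<in> affine hull S \<and> q \<in> affine hull S}"
    then obtain t u where "x = (A + t *\<^sub>R d) - (A + u *\<^sub>R d)" unfolding hull by blast
    then have "x = (t - u) *\<^sub>R d" by (simp add: algebra_simps)
    then show "x \<in> range (\<lambda>t. t *\<^sub>R d)" by blast
  next
    fix x assume "x \<in> range (\<lambda>t. t *\<^sub>R d)"
    then obtain t where "x = (A + t *\<^sub>R d) - (A + 0 *\<^sub>R d)" by auto
    then show "x \<in> {p - q | p q. p \<in> affine hull S \<and> q \<in> affine hull S}" unfolding hull by blast
  qed
  then have "parallel_lattice L S = lincomb ?v ` integral_vectors"
    unfolding parallel_lattice_def using L
    by (auto simp: lc integral_vectors_def image_iff intro!: exI[of _ "\<chi> i. _"])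
  moreover have "\<exists>z. q = A + lincomb ?v z" if q: "q \<in> affine hull S" for q
  proof -
    obtain t where "q = A + t *\<^sub>R d" using q unfolding hull by blast
    then show ?thesis by (intro exI[of _ "\<chi> i. t"]) (simp add: lc)
  qed
  moreover have "compact S" by (simp add: S_def)
  moreover have "aff_dim S = int CARD(1)" by (simp add: dim)
  ultimately have "relative_volume L S = measure lebesgue {x. A + lincomb ?v x \<in> S}"
    by (intro relative_volume_eq[OF _ _ inj])
  also have "{x. A + lincomb ?v x \<in> S} = cbox 0 (\<chi> i. r)"
  proof -
    have "A + t *\<^sub>R d \<in> S \<longleftrightarrow> 0 \<le> t \<and> t \<le> r" for t
    proof
      assume "A + t *\<^sub>R d \<in> S"
      then obtain u where u: "0 \<le> u" "u \<le> 1" "A + t *\<^sub>R d = (1 - u) *\<^sub>R A + u *\<^sub>R (A + r *\<^sub>R d)"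
        unfolding S_def in_segment by blast
      then have "t *\<^sub>R d = (u * r) *\<^sub>R d" by (simp add: algebra_simps)
      then have "t = u * r" using d by simp
      then show "0 \<le> t \<and> t \<le> r" using u r by (simp add: mult_left_le_one_le)
    next
      assume "0 \<le> t \<and> t \<le> r"
      then show "A + t *\<^sub>R d \<in> S" unfolding S_def in_segment using r
        by (intro conjI exI[of _ "t / r"]) (auto simp: algebra_simps)
    qed
    then have "{x. A + lincomb ?v x \<in> S} = {x. 0 \<le> x $ 1 \<and> x $ 1 \<le> r}" by (simp only: lc)
    also have "\<dots> = cbox 0 (\<chi> i. r)" by (simp add: set_eq_iff mem_box_cart forall_1)
    finally show ?thesis .
  qed
  also have "measure lebesgue \<dots> = r"
  proof -
    have "cbox 0 (\<chi> i. r) \<noteq> ({} :: (real, 1) vec set)" using r by (simp add: interval_ne_empty_cart forall_1)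
    then have "measure lborel (cbox 0 (\<chi> i. r) :: (real, 1) vec set) = r" by (simp add: content_cbox_cart)
    then show ?thesis by (simp add: measure_completion)
  qed
  finally show "relative_volume L S = r" .
qed

section \<open>Facets\<close>

context triangulated
begin

lemma convex_\<Delta>: "convex \<Delta>" using polytope polytope_imp_convex by blast
lemma compact_\<Delta>: "compact \<Delta>" using polytope polytope_imp_compact by blast

lemma aff_dim_\<Delta>: "aff_dim \<Delta> = 3"
  using aff_dim_nonempty_interior[of \<Delta>] zero_interior dim3 by auto

text \<open>A supporting inequality can be scaled to right-hand side 1 because 0 lies in
  \<open>\<Delta>\<close> and the bound is not 0: the bound 0 would fail at a positive multiple of
  \<open>a\<close>, unless \<open>a = 0\<close>, and then the face would be all of
  \<open>\<Delta>\<close>.\<close>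

lemma proper_face_exposed:
  assumes \<theta>: "\<theta> face_of \<Delta>" "aff_dim \<theta> < 3" "\<theta> \<noteq> {}"
  obtains h where "\<And>x. x \<in> \<Delta> \<Longrightarrow> h \<bullet> x \<le> 1" "\<theta> = {x\<in>\<Delta>. h \<bullet> x = 1}"
proof -
  have "\<theta> exposed_face_of \<Delta>"
    using exposed_face_of_polyhedron[OF polytope_imp_polyhedron[OF polytope]] \<theta>(1) by blast
  then obtain a c where ac: "\<Delta> \<subseteq> {x. a \<bullet> x \<le> c}" "\<theta> = \<Delta> \<inter> {x. a \<bullet> x = c}"
    unfolding exposed_face_of_def by blast
  have "0 \<in> \<Delta>" using zero_interior interior_subset by blast
  then have c0: "c \<ge> 0" using ac(1) by auto
  have "c \<noteq> 0"
  proof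
    assume c: "c = 0"
    have "a = 0"
    proof (rule ccontr)
      assume a: "a \<noteq> 0"
      then have g: "gauge a > 0" by (rule gauge_pos)
      then have "(1 / gauge a) *\<^sub>R a \<in> \<Delta>" by (simp add: \<Delta>_iff gauge_scale)
      then have "a \<bullet> ((1 / gauge a) *\<^sub>R a) \<le> 0" using ac(1) c by auto
      then have "a \<bullet> a \<le> 0" using g by (simp add: divide_le_0_iff)
      then show False using a by (metis inner_gt_zero_iff not_less)
    qed
    then have "\<theta> = \<Delta>" using ac c by auto
    then show False using \<theta>(2) aff_dim_\<Delta> by simp
  qed
  then have c: "c > 0" using c0 by simp
  show ?thesis
  proof (rule that[of "(1 / c) *\<^sub>R a"])
    show "(1 / c) *\<^sub>R a \<bullet> x \<le> 1" if "x \<in> \<Delta>" for x using ac(1) that c by (auto simp: field_simps)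
    show "\<theta> = {x\<in>\<Delta>. (1 / c) *\<^sub>R a \<bullet> x = 1}" unfolding ac(2) using c by (auto simp: field_simps)
  qed
qed

text \<open>The intersection is a face of each of the two and contains \<open>S\<close>; as a proper
  face it would have a smaller dimension.\<close>

lemma face_eqI:
  assumes F: "F face_of \<Delta>" "F' face_of \<Delta>" and S: "S \<subseteq> F" "S \<subseteq> F'"
    and dim: "aff_dim F \<le> aff_dim S" "aff_dim F' \<le> aff_dim S"
  shows "F = F'"
proof -
  have I: "F \<inter> F' face_of \<Delta>" by (rule face_of_Int[OF F])
  have "F \<inter> F' = G" if G: "G face_of \<Delta>" "F \<inter> F' \<subseteq> G" "aff_dim G \<le> aff_dim S" for G
  proof (rule ccontr)
    assume ne: "F \<inter> F' \<noteq> G"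
    have "F \<inter> F' face_of G" using face_of_subset[OF I G(2)] face_of_imp_subset[OF G(1)] by blast
    then have "aff_dim (F \<inter> F') < aff_dim G"
      using face_of_aff_dim_lt[OF face_of_imp_convex[OF G(1)]] ne by blast
    moreover have "aff_dim S \<le> aff_dim (F \<inter> F')" using S by (intro aff_dim_subset) auto
    ultimately show False using G(3) by simp
  qed
  from this[OF F(1)] this[OF F(2)] dim show ?thesis by blast
qed

lemma height_functional:
  assumes "T \<in> \<T>"
  obtains h where "h \<in> E" "\<And>x. h \<bullet> x = height T x"
  using \<T>_face[OF assms] inner_eq_height[OF \<T>_frame[OF assms]] by blast

definition facet :: "'a set \<Rightarrow> 'a set" where "facet T = {x\<in>\<Delta>. height T x = 1}"

lemma aff_dim_T: assumes "T \<in> \<T>" shows "aff_dim T = 2"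
proof -
  have "independent T" using \<T>_frame[OF assms] by (simp add: frame_def)
  then have "\<not> affine_dependent T" using affine_dependent_imp_dependent by blast
  then show ?thesis using card_T[OF assms] aff_dim_affine_independent[of T] by simp
qed

lemma facet_face:
  assumes T: "T \<in> \<T>"
  shows "facet T face_of \<Delta>" "T \<subseteq> facet T" "aff_dim (facet T) = 2"
proof -
  obtain h where h: "h \<in> E" "\<And>x. h \<bullet> x = height T x" using height_functional[OF T] by blast
  have eq: "facet T = \<Delta> \<inter> {x. h \<bullet> x = 1}" by (auto simp: facet_def h(2))
  show "facet T face_of \<Delta>" unfolding eq
    using h(1) by (intro face_of_Int_supporting_hyperplane_le convex_\<Delta>) (auto simp: \<Delta>_eq)
  show sub: "T \<subseteq> facet T"
    using \<T>_sub[OF T] V_\<Delta> by (auto simp: facet_def height_basis[OF \<T>_frame[OF T]])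
  obtain w where "w \<in> T" using T_nonempty[OF T] by blast
  then have "h \<noteq> 0" using h(2)[of w] by (auto simp: height_basis[OF \<T>_frame[OF T]])
  then have "aff_dim {x. h \<bullet> x = 1} = 2" using dim3 by (simp add: aff_dim_hyperplane)
  moreover have "aff_dim (facet T) \<le> aff_dim {x. h \<bullet> x = 1}" by (rule aff_dim_subset) (auto simp: eq)
  moreover have "aff_dim T \<le> aff_dim (facet T)" by (rule aff_dim_subset[OF sub])
  ultimately show "aff_dim (facet T) = 2" using aff_dim_T[OF T] by simp
qed

lemma facet_unique:
  assumes T: "T \<in> \<T>" and F: "F face_of \<Delta>" "aff_dim F = 2" "T \<subseteq> F"
  shows "F = facet T"
  using face_eqI[OF F(1) facet_face(1)[OF T] F(3) facet_face(2)[OF T]] facet_face(3)[OF T] F(2) aff_dim_T[OF T] by simp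

lemma facet_iff: "T \<in> \<T> \<Longrightarrow> F face_of \<Delta> \<Longrightarrow> aff_dim F = 2 \<Longrightarrow> T \<subseteq> F \<longleftrightarrow> facet T = F"
  using facet_unique facet_face(2) by blast

text \<open>A functional exposing \<open>F\<close> is at most 1 on the vertices and equals 1 at
  \<open>y\<close>, a combination with positive coefficients of sum at most 1. So it equals 1 at
  every vertex.\<close>

lemma generic_triangle_in_face:
  assumes x: "generic x" "x = c *\<^sub>R y" "c > 0" "y \<in> F" and F: "F face_of \<Delta>" "aff_dim F = 2"
    and T: "T \<in> \<T>" "\<And>w. w \<in> T \<Longrightarrow> coord T w x \<ge> 0"
  shows "T \<subseteq> F" "y \<in> convex hull T"
proof -
  have fr: "frame T" by (rule \<T>_frame[OF T(1)])
  have fin: "finite T" by (rule finite_T[OF T(1)])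
  have "F \<noteq> {}" using F(2) by auto
  then obtain h where h: "\<And>x. x \<in> \<Delta> \<Longrightarrow> h \<bullet> x \<le> 1" "F = {x\<in>\<Delta>. h \<bullet> x = 1}"
    using proper_face_exposed[OF F(1)] F(2) by auto
  have pos: "coord T w y > 0" if w: "w \<in> T" for w
  proof -
    have "c * coord T w y \<ge> 0" "c * coord T w y \<noteq> 0"
      using T(2)[OF w] generic_coord[OF x(1) fr \<T>_sub[OF T(1)] w] x(2) coord_scale[OF fr] by auto
    then show ?thesis using x(3) by (auto simp: zero_le_mult_iff)
  qed
  have y: "y \<in> \<Delta>" "h \<bullet> y = 1" using x(4) h(2) by auto
  have hw: "h \<bullet> w \<le> 1" if "w \<in> T" for w using h(1) that \<T>_sub[OF T(1)] V_\<Delta> by blast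
  have "height T y \<le> 1" using height_le_gauge[OF T(1), of y] y(1) \<Delta>_iff by simp
  moreover have hy: "h \<bullet> y = (\<Sum>w\<in>T. coord T w y * (h \<bullet> w))" by (rule inner_eq_sum_coord[OF fr])
  moreover have le: "coord T w y * (h \<bullet> w) \<le> coord T w y" if "w \<in> T" for w
    using hw[OF that] pos[OF that] by (simp add: mult_left_le)
  moreover have "(\<Sum>w\<in>T. coord T w y * (h \<bullet> w)) \<le> height T y" unfolding height_def by (rule sum_mono[OF le])
  ultimately have h1: "height T y = 1" and "(\<Sum>w\<in>T. coord T w y * (h \<bullet> w)) = (\<Sum>w\<in>T. coord T w y)"
    using y(2) by (auto simp: height_def)
  then have "(\<Sum>w\<in>T. coord T w y - coord T w y * (h \<bullet> w)) = 0" by (simp add: sum_subtractf)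
  then have "\<forall>w\<in>T. coord T w y - coord T w y * (h \<bullet> w) = 0"
    using le fin by (subst (asm) sum_nonneg_eq_0_iff) auto
  then have "h \<bullet> w = 1" if "w \<in> T" for w using pos[OF that] that by auto
  then show "T \<subseteq> F" unfolding h(2) using \<T>_sub[OF T(1)] V_\<Delta> by auto
  show "y \<in> convex hull T"
    unfolding convex_hull_finite[OF fin]
    using pos h1 sum_coord[OF fr, of y] by (intro CollectI exI[of _ "\<lambda>w. coord T w y"]) (auto simp: height_def less_imp_le)
qed

text \<open>The sum of an affine basis of \<open>F\<close> lies inside the cone over
  \<open>F\<close>. A small generic perturbation stays there, and the triangle whose cone contains
  it lies in \<open>F\<close>.\<close>

lemma facet_contains_triangle:
  assumes F: "F face_of \<Delta>" "aff_dim F = 2"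
  obtains T where "T \<in> \<T>" "T \<subseteq> F"
proof -
  have "F \<noteq> {}" using F(2) by auto
  then obtain h where h: "\<And>x. x \<in> \<Delta> \<Longrightarrow> h \<bullet> x \<le> 1" "F = {x\<in>\<Delta>. h \<bullet> x = 1}"
    using proper_face_exposed[OF F(1)] F(2) by auto
  have convF: "convex F" using face_of_imp_convex[OF F(1)] .
  obtain B where B: "\<not> affine_dependent B" "B \<subseteq> F" "affine hull B = affine hull F"
    using affine_basis_exists[of F] by blast
  have finB: "finite B" using B(1) aff_independent_finite by blast
  have "int (card B) = 3"
    using aff_dim_affine_independent[OF B(1)] F(2) B(3) aff_dim_affine_hull[of B] aff_dim_affine_hull[of F] by simp
  then have cB: "card B = 3" by simp
  have hB: "h \<bullet> v = 1" if "v \<in> B" for v using that B(2) h(2) by auto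
  have "independent B"
  proof (rule independent_if_scalars_zero[OF finB])
    fix f x assume f: "(\<Sum>x\<in>B. f x *\<^sub>R x) = 0" and x: "x \<in> B"
    have "(\<Sum>x\<in>B. f x) = h \<bullet> (\<Sum>x\<in>B. f x *\<^sub>R x)" using hB by (simp add: inner_sum_right)
    then have "sum f B = 0" using f by simp
    then show "f x = 0" using B(1) f x affine_dependent_explicit_finite[OF finB] by blast
  qed
  then have frB: "frame B" using cB dim3 by (simp add: frame_def)
  obtain \<xi> where \<xi>: "generic \<xi>" by (rule generic_exists)
  have lim: "((\<lambda>e. a + e * c) \<longlongrightarrow> a) (at_right 0)" for a c :: real
    by (rule tendsto_eq_rhs[OF tendsto_add[OF tendsto_const tendsto_mult[OF tendsto_ident_at tendsto_const]]]) simp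
  have "\<forall>\<^sub>F e in at_right 0. coord B w (\<Sum>B + e *\<^sub>R \<xi>) > 0" if w: "w \<in> B" for w
  proof -
    have "coord B w (\<Sum>B) = 1" using coord_unique[OF frB w, of "\<Sum>B" "\<lambda>_. 1"] by simp
    then show ?thesis using order_tendstoD(1)[OF lim, of 0 1 "coord B w \<xi>"]
      by (simp add: coord_add[OF frB] coord_scale[OF frB])
  qed
  then have "\<forall>\<^sub>F e in at_right 0. (\<forall>w\<in>B. coord B w (\<Sum>B + e *\<^sub>R \<xi>) > 0) \<and> generic (\<Sum>B + e *\<^sub>R \<xi>)"
    using finB generic_perturb[OF \<xi>] by (intro eventually_conj eventually_ball_finite) auto
  from eventually_happens'[OF trivial_limit_at_right_real this]
  obtain e where e: "\<forall>w\<in>B. coord B w (\<Sum>B + e *\<^sub>R \<xi>) > 0" "generic (\<Sum>B + e *\<^sub>R \<xi>)" by (elim exE conjE)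
  define x where "x = \<Sum>B + e *\<^sub>R \<xi>"
  define c where "c = (\<Sum>w\<in>B. coord B w x)"
  have "B \<noteq> {}" using cB by auto
  then have c0: "c > 0" unfolding c_def using e(1) finB by (intro sum_pos) (auto simp: x_def)
  have "(\<Sum>w\<in>B. (coord B w x / c) *\<^sub>R w) \<in> F"
    using convF finB B(2) e(1) c0 by (intro convex_sum) (auto simp: x_def c_def sum_divide_distrib[symmetric] less_imp_le)
  moreover have "x = c *\<^sub>R (\<Sum>w\<in>B. (coord B w x / c) *\<^sub>R w)"
    using c0 by (simp add: scaleR_sum_right sum_coord[OF frB])
  moreover obtain T where T: "T \<in> \<T>" "\<forall>w\<in>T. coord T w x \<ge> 0" using \<T>_cover[of x] e(2) by (auto simp: x_def)
  moreover have "generic x" using e(2) by (simp add: x_def)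
  ultimately have "T \<subseteq> F" using generic_triangle_in_face(1)[OF _ _ c0 _ F T(1), of x] by blast
  then show ?thesis using that T(1) by blast
qed

text \<open>The value 1 on a lattice point is what makes the functional primitive: any integer
  factor would divide 1.\<close>

lemma functional_in_dual:
  assumes T: "T \<in> \<T>" and f: "linear f" and fN: "\<And>x. x \<in> N \<Longrightarrow> f x \<in> \<int>" and f1: "x1 \<in> N" "f x1 = 1"
  obtains m where "\<And>x. m \<bullet> x = f x" "primitive_vector (dual_lattice N) m"
proof -
  obtain m where m: "\<And>x. f x = m \<bullet> x" using linear_functional_inner[OF f] by blast
  have "m \<in> dual_lattice N" using fN m by (auto simp: dual_lattice_def)
  moreover have "\<bar>k\<bar> = 1" if m': "m' \<in> dual_lattice N" "m = of_int k *\<^sub>R m'" for k m'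
  proof -
    have "m' \<bullet> x1 \<in> \<int>" using m'(1) f1(1) by (simp add: dual_lattice_def)
    then obtain j where j: "m' \<bullet> x1 = of_int j" by (rule Ints_cases)
    have "of_int (k * j) = (of_int 1 :: real)" using m[of x1] f1(2) m'(2) j by simp
    then have "k * j = 1" by (simp only: of_int_eq_iff)
    then show ?thesis by (metis abs_zmult_eq_1 abs_1)
  qed
  ultimately have "primitive_vector (dual_lattice N) m" by (auto simp: primitive_vector_def)
  then show ?thesis using that m by simp
qed

text \<open>The height takes exactly the multiples of 1 / n on \<open>N\<close>, so n times the
  height is primitive. Any competitor is a multiple of the height as well, hence an integer multiple
  of this functional, and primitivity with positivity of \<open>n'\<close> fixes the factor.\<close>

lemma lattice_distance_facet:
  assumes T: "T \<in> \<T>"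
  shows "lattice_distance N \<Delta> (facet T) = index T"
proof -
  let ?n = "index T"
  have n0: "?n > 0" by (rule index_height(1)[OF T])
  have fr: "frame T" by (rule \<T>_frame[OF T])
  have hN: "of_nat ?n * height T x \<in> \<int>" if "x \<in> N" for x
  proof -
    have "height T x \<in> range (\<lambda>j::int. of_int j / of_nat ?n)" using that index_height(2)[OF T] by blast
    then obtain j :: int where "height T x = of_int j / of_nat ?n" by blast
    then show ?thesis using n0 by simp
  qed
  have "1 / of_nat ?n \<in> range (\<lambda>j::int. of_int j / of_nat ?n :: real)" by (intro range_eqI[of _ _ 1]) simp
  then obtain x1 where x1: "x1 \<in> N" "height T x1 = 1 / of_nat ?n" unfolding index_height(2)[OF T, symmetric] by force
  \<comment> \<open>The sign follows the convention of \<open>lattice_distance\<close>, where the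
    facet is given by \<open>- (m \<bullet> x) = n\<close>.\<close>
  have "linear (\<lambda>x. - (of_nat ?n * height T x))"
    using linear_height[OF fr] by (intro linear_compose_neg linear_compose_scale_right[of "height T", unfolded real_scaleR_def])
  then obtain m where m: "\<And>x. m \<bullet> x = - (of_nat ?n * height T x)" "primitive_vector (dual_lattice N) m"
    using functional_in_dual[OF T, of "\<lambda>x. - (of_nat ?n * height T x)" "- x1"] hN x1 n0 N_neg[OF x1(1)]
      linear_neg[OF linear_height[OF fr]] by auto
  show ?thesis unfolding lattice_distance_def
  proof (rule the_equality)
    have "facet T = {x\<in>\<Delta>. - (m \<bullet> x) = of_nat ?n}" using n0 by (auto simp: facet_def m(1))
    then show "?n > 0 \<and> (\<exists>m. primitive_vector (dual_lattice N) m \<and> facet T = {x\<in>\<Delta>. - (m \<bullet> x) = of_nat ?n})"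
      using n0 m(2) by blast
  next
    fix n' assume "n' > 0 \<and> (\<exists>m. primitive_vector (dual_lattice N) m \<and> facet T = {x\<in>\<Delta>. - (m \<bullet> x) = of_nat n'})"
    then obtain m' where n': "n' > 0" and m': "primitive_vector (dual_lattice N) m'" "facet T = {x\<in>\<Delta>. - (m' \<bullet> x) = of_nat n'}" by blast
    have "m' \<bullet> w = - of_nat n'" if "w \<in> T" for w using facet_face(2)[OF T] m'(2) that by auto
    then have m'x: "m' \<bullet> x = - of_nat n' * height T x" for x
      by (subst inner_eq_sum_coord[OF fr]) (simp add: height_def sum_distrib_left mult.commute sum_negf)
    have "m' \<bullet> x1 \<in> \<int>" using m'(1) x1(1) by (simp add: primitive_vector_def dual_lattice_def)
    then obtain j where j: "m' \<bullet> x1 = of_int j" by (rule Ints_cases)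
    have "of_nat n' = - of_int j * (of_nat ?n :: real)"
      using j m'x[of x1] x1(2) n0 by (simp add: field_simps)
    then have nj: "- of_int j * (of_nat ?n :: real) = of_nat n'" by simp
    have "m' = of_int (- j) *\<^sub>R m"
    proof (rule vector_eq_rdot[THEN iffD1], rule allI)
      fix x show "m' \<bullet> x = (of_int (- j) *\<^sub>R m) \<bullet> x"
        unfolding inner_scaleR_left m(1) m'x nj[symmetric] by simp
    qed
    then have "\<bar>- j\<bar> = 1" using m' m(2) unfolding primitive_vector_def by blast
    then have "of_nat n' = (of_nat ?n :: real)" using nj n' n0 by (auto simp: abs_if split: if_splits)
    then show "n' = ?n" by simp
  qed
qed

text \<open>Overlaps and gaps of the pieces contain no generic points. The condition on
  \<open>span\<close> keeps the parametrized affine space from lying in a proper subspace, so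
  nongeneric points form a null set. This serves facets and the solid polytope alike.\<close>

lemma measure_dissection:
  fixes v :: "'n::{finite,wellorder} \<Rightarrow> 'a"
  assumes inj: "inj (lincomb v)" and span: "span (insert p (range v)) = UNIV"
    and S: "compact S" and G: "\<G> \<subseteq> \<T>" and K: "\<And>T. T \<in> \<G> \<Longrightarrow> compact (K T) \<and> K T \<subseteq> S"
    and Kpos: "\<And>T x w. T \<in> \<G> \<Longrightarrow> x \<in> K T \<Longrightarrow> w \<in> T \<Longrightarrow> coord T w x \<ge> 0"
    and cover: "\<And>x. generic x \<Longrightarrow> x \<in> S \<Longrightarrow> \<exists>T\<in>\<G>. x \<in> K T"
  shows "measure lebesgue {x. p + lincomb v x \<in> S} = (\<Sum>T\<in>\<G>. measure lebesgue {x. p + lincomb v x \<in> K T})"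
proof -
  let ?f = "\<lambda>x. p + lincomb v x"
  let ?D = "\<lambda>T. {x. ?f x \<in> K T}"
  let ?Z = "\<Union>W\<in>{span S | S. S \<subseteq> V \<and> span S \<noteq> UNIV}. {x. ?f x \<in> W}"
  have "negligible {x. ?f x \<in> W}" if W: "W \<in> {span S | S. S \<subseteq> V \<and> span S \<noteq> UNIV}" for W
  proof -
    obtain S where S: "W = span S" "span S \<noteq> UNIV" using W by blast
    then have "dim S < DIM('a)" by (metis dim_eq_full dim_subset_UNIV le_neq_implies_less)
    then obtain a where a: "a \<noteq> 0" "span S \<subseteq> {x. a \<bullet> x = 0}" using lowdim_subset_hyperplane by blast
    define c :: "(real, 'n) vec" where "c = (\<chi> i. a \<bullet> v i)"
    have "c \<noteq> 0 \<or> - (a \<bullet> p) \<noteq> 0"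
    proof (rule ccontr)
      assume "\<not> ?thesis"
      then have "insert p (range v) \<subseteq> {x. a \<bullet> x = 0}" by (auto simp: c_def vec_eq_iff)
      then have "span (insert p (range v)) \<subseteq> {x. a \<bullet> x = 0}" by (intro span_minimal subspace_hyperplane)
      then have "a \<in> {x. a \<bullet> x = 0}" using span by blast
      then have "a \<bullet> a = 0" by blast
      then show False using a(1) by simp
    qed
    then have "negligible {x. c \<bullet> x = - (a \<bullet> p)}" by (rule negligible_hyperplane)
    moreover have "{x. ?f x \<in> W} \<subseteq> {x. c \<bullet> x = - (a \<bullet> p)}"
    proof
      fix x assume "x \<in> {x. ?f x \<in> W}"
      then have "a \<bullet> ?f x = 0" using a(2) S(1) by auto
      moreover have "a \<bullet> lincomb v x = c \<bullet> x"
        by (simp add: lincomb_def inner_sum_right inner_vec_def c_def mult.commute)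
      ultimately show "x \<in> {x. c \<bullet> x = - (a \<bullet> p)}" by (simp add: inner_add_right)
    qed
    ultimately show ?thesis by (rule negligible_subset)
  qed
  then have negZ: "negligible ?Z" using finite_spans by (intro negligible_Union finite_imageI) auto
  have gen: "generic (?f x)" if "x \<notin> ?Z" for x using that unfolding generic_def by blast
  have finG: "finite \<G>" using G finite_\<T> finite_subset by blast
  have D: "?D T \<in> lmeasurable" if "T \<in> \<G>" for T
    using K[OF that] by (intro lmeasurable_compact compact_lincomb_preimage[OF _ inj]) auto
  have disj: "pairwise (\<lambda>T T'. negligible (?D T \<inter> ?D T')) \<G>"
  proof (rule pairwiseI)
    fix T T' assume T: "T \<in> \<G>" "T' \<in> \<G>" "T \<noteq> T'"
    have "?D T \<inter> ?D T' \<subseteq> ?Z"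
    proof (rule subsetI, rule ccontr)
      fix x assume x: "x \<in> ?D T \<inter> ?D T'" "x \<notin> ?Z"
      have "\<exists>!T. T \<in> \<T> \<and> (\<forall>w\<in>T. coord T w (?f x) \<ge> 0)" by (rule \<T>_cover[OF gen[OF x(2)]])
      moreover have "T \<in> \<T> \<and> (\<forall>w\<in>T. coord T w (?f x) \<ge> 0)" "T' \<in> \<T> \<and> (\<forall>w\<in>T'. coord T' w (?f x) \<ge> 0)"
        using T G x(1) Kpos by auto
      ultimately show False using T(3) by blast
    qed
    then show "negligible (?D T \<inter> ?D T')" by (rule negligible_subset[OF negZ])
  qed
  have "measure lebesgue (\<Union>(?D ` \<G>)) = (\<Sum>T\<in>\<G>. measure lebesgue (?D T))"
    by (rule measure_negligible_finite_Union_image[OF finG D disj])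
  moreover have "measure lebesgue {x. ?f x \<in> S} = measure lebesgue (\<Union>(?D ` \<G>))"
  proof (rule measure_negligible_symdiff)
    show "\<Union>(?D ` \<G>) \<in> lmeasurable" using finG D by (intro fmeasurable.finite_UN) auto
    have "{x. ?f x \<in> S} - \<Union>(?D ` \<G>) \<subseteq> ?Z"
    proof (rule subsetI, rule ccontr)
      fix x assume x: "x \<in> {x. ?f x \<in> S} - \<Union>(?D ` \<G>)" "x \<notin> ?Z"
      then show False using cover[OF gen[OF x(2)]] by blast
    qed
    moreover have "\<Union>(?D ` \<G>) - {x. ?f x \<in> S} = {}" using K by blast
    ultimately show "negligible (\<Union>(?D ` \<G>) - {x. ?f x \<in> S} \<union> ({x. ?f x \<in> S} - \<Union>(?D ` \<G>)))"
      using negligible_subset[OF negZ] by simp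
  qed
  ultimately show ?thesis by simp
qed

section \<open>Volumes of the facets and of the polytope\<close>

lemma three_vertices:
  assumes "T \<in> \<T>"
  obtains u v w where "T = {u, v, w}" "u \<noteq> v" "u \<noteq> w" "v \<noteq> w"
  using card_T[OF assms] card_3_iff[of T] by auto

text \<open>Lattice points of height 0 have integral coordinates by \<open>integral_coords\<close>:
  the edge vectors of \<open>T\<close> form a basis of the lattice in their plane, whatever the
  index of \<open>T\<close> in space.\<close>

lemma facet_param:
  assumes T: "T \<in> \<T>"
  shows "\<exists>w (v :: 2 \<Rightarrow> 'a). w \<in> T \<and> T = insert w (range (\<lambda>i. w + v i)) \<and> inj (lincomb v)
    \<and> range (lincomb v) = {x. height T x = 0} \<and> lincomb v ` integral_vectors = {x\<in>N. height T x = 0}"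
proof -
  have fr: "frame T" by (rule \<T>_frame[OF T])
  obtain w1 w2 w3 where T3: "T = {w1, w2, w3}" and ne: "w1 \<noteq> w2" "w1 \<noteq> w3" "w2 \<noteq> w3"
    using three_vertices[OF T] by blast
  have wT: "w1 \<in> T" "w2 \<in> T" "w3 \<in> T" using T3 by auto
  define v :: "2 \<Rightarrow> 'a" where "v i = (if i = 1 then w2 - w1 else w3 - w1)" for i
  have lc: "lincomb v x = x $ 1 *\<^sub>R (w2 - w1) + x $ 2 *\<^sub>R (w3 - w1)" for x
    by (simp add: lincomb_def sum_2 v_def)
  have c: "coord T w1 (lincomb v x) = - x $ 1 - x $ 2" "coord T w2 (lincomb v x) = x $ 1"
    "coord T w3 (lincomb v x) = x $ 2" for x
    using ne wT by (simp_all add: lc coord_add[OF fr] coord_scale[OF fr] coord_diff[OF fr] coord_basis[OF fr])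
  have h: "height T (lincomb v x) = 0" for x
    unfolding height_def T3 using ne c[unfolded T3] by simp
  have eq: "x = lincomb v (vector [coord T w2 x, coord T w3 x])" if "height T x = 0" for x
  proof (rule coord_eqI[OF fr])
    have "coord T w1 x + coord T w2 x + coord T w3 x = 0"
      using that ne unfolding height_def by (subst (asm) T3) simp
    then show "coord T w x = coord T w (lincomb v (vector [coord T w2 x, coord T w3 x]))" if "w \<in> T" for w
      using that T3 c[of "vector [coord T w2 x, coord T w3 x]"] by auto
  qed
  have "inj (lincomb v)"
  proof (rule injI)
    fix x y assume "lincomb v x = lincomb v y"
    then have "x $ 1 = y $ 1" "x $ 2 = y $ 2" using c by metis+
    then show "x = y" by (simp add: vec_eq_iff forall_2)
  qed
  moreover have "range (lincomb v) = {x. height T x = 0}" using h eq by auto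
  moreover have "lincomb v ` integral_vectors = {x\<in>N. height T x = 0}"
  proof (intro equalityI subsetI)
    fix x assume "x \<in> lincomb v ` integral_vectors"
    then obtain z where z: "z \<in> integral_vectors" "x = lincomb v z" by blast
    obtain i j where ij: "z $ 1 = of_int i" "z $ 2 = of_int j"
      using z(1) unfolding integral_vectors_def by (metis (mono_tags, lifting) Ints_cases mem_Collect_eq)
    have "x \<in> N" unfolding z(2) lc ij using wT \<T>_N[OF T] by (intro N_add N_scale N_diff) auto
    then show "x \<in> {x\<in>N. height T x = 0}" using h z(2) by simp
  next
    fix x assume x: "x \<in> {x\<in>N. height T x = 0}"
    then have i: "coord T w x \<in> \<int>" if "w \<in> T" for w using integral_coords[OF T _ _ that] by auto
    have "(vector [coord T w2 x, coord T w3 x] :: real ^ 2) \<in> integral_vectors"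
      using i wT by (simp add: integral_vectors_def forall_2)
    then show "x \<in> lincomb v ` integral_vectors" using eq x by blast
  qed
  moreover have "T = insert w1 (range (\<lambda>i. w1 + v i))"
    unfolding T3 using ne by (auto simp: v_def UNIV_2)
  ultimately show ?thesis using wT(1) by blast
qed

lemma affine_hull_T:
  assumes T: "T \<in> \<T>" shows "affine hull T = {x. height T x = 1}"
proof (intro equalityI subsetI)
  fix x assume "x \<in> affine hull T"
  then obtain u where u: "sum u T = 1" "(\<Sum>v\<in>T. u v *\<^sub>R v) = x"
    unfolding affine_hull_finite[OF finite_T[OF T]] by blast
  have "height T x = sum u T"
    unfolding height_def by (intro sum.cong refl coord_unique[OF \<T>_frame[OF T] _ u(2)[symmetric]])
  then show "x \<in> {x. height T x = 1}" using u(1) by simp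
next
  fix x assume "x \<in> {x. height T x = 1}"
  then show "x \<in> affine hull T"
    unfolding affine_hull_finite[OF finite_T[OF T]] height_def
    using sum_coord[OF \<T>_frame[OF T], of x] by (intro CollectI exI[of _ "\<lambda>w. coord T w x"]) simp
qed

lemma affine_hull_facet:
  assumes T: "T \<in> \<T>" shows "affine hull (facet T) = {x. height T x = 1}"
proof
  show "{x. height T x = 1} \<subseteq> affine hull (facet T)"
    unfolding affine_hull_T[OF T, symmetric] by (rule hull_mono[OF facet_face(2)[OF T]])
  have "affine {x. height T x = 1}" unfolding affine_hull_T[OF T, symmetric] by (rule affine_affine_hull)
  then show "affine hull (facet T) \<subseteq> {x. height T x = 1}" by (intro hull_minimal) (auto simp: facet_def)
qed

lemma height_eq_if_same_facet:
  assumes T: "T \<in> \<T>" "T' \<in> \<T>" and sub: "T' \<subseteq> facet T"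
  shows "height T' x = height T x"
proof -
  have "height T x = (\<Sum>w\<in>T'. coord T' w x *\<^sub>R height T w)"
    by (rule linear_eq_sum_coord[OF \<T>_frame[OF T(2)] linear_height[OF \<T>_frame[OF T(1)]]])
  also have "\<dots> = height T' x" using sub by (auto simp: height_def facet_def intro!: sum.cong)
  finally show ?thesis ..
qed

text \<open>The triangles dissect the facet, and each has area 1 / 2 since it is unimodular in its
  plane.\<close>

theorem normalized_volume_facet:
  assumes T0: "T0 \<in> \<T>"
  shows "normalized_volume N (facet T0) = of_nat (card {T\<in>\<T>. T \<subseteq> facet T0})"
proof -
  let ?F = "facet T0"
  obtain p and v :: "2 \<Rightarrow> 'a" where pv: "p \<in> T0" "T0 = insert p (range (\<lambda>i. p + v i))" "inj (lincomb v)"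
    "range (lincomb v) = {x. height T0 x = 0}" "lincomb v ` integral_vectors = {x\<in>N. height T0 x = 0}"
    using facet_param[OF T0] by (elim exE conjE)
  have fr: "frame T0" by (rule \<T>_frame[OF T0])
  have p1: "height T0 p = 1" using height_basis[OF fr pv(1)] .
  note lin = linear_height[OF fr]
  have sub: "?F \<subseteq> \<Delta>" by (auto simp: facet_def)
  have F: "compact ?F"
    using compact_\<Delta> face_of_imp_compact[OF convex_\<Delta> compact_\<Delta> facet_face(1)[OF T0]] by blast
  have convF: "convex ?F" using face_of_imp_convex[OF facet_face(1)[OF T0]] .
  have "{x - y | x y. x \<in> affine hull ?F \<and> y \<in> affine hull ?F} = {x. height T0 x = 0}"
  proof (intro equalityI subsetI)
    fix x assume "x \<in> {x. height T0 x = 0}"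
    then have "x = (p + x) - p \<and> p + x \<in> affine hull ?F \<and> p \<in> affine hull ?F"
      by (simp add: affine_hull_facet[OF T0] p1 linear_add[OF lin])
    then show "x \<in> {x - y | x y. x \<in> affine hull ?F \<and> y \<in> affine hull ?F}" by blast
  qed (auto simp: affine_hull_facet[OF T0] linear_diff[OF lin])
  then have L: "parallel_lattice N ?F = lincomb v ` integral_vectors"
    unfolding parallel_lattice_def pv(5) by auto
  have ex: "\<exists>r. q = p + lincomb v r" if "height T0 q = 1" for q
  proof -
    have "q - p \<in> range (lincomb v)" unfolding pv(4) using that p1 by (simp add: linear_diff[OF lin])
    then obtain r where "q - p = lincomb v r" by blast
    then show ?thesis by (intro exI[of _ r]) (simp add: algebra_simps)
  qed
  have "relative_volume N ?F = measure lebesgue {x. p + lincomb v x \<in> ?F}"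
    using facet_face(3)[OF T0] ex by (intro relative_volume_eq[OF F _ pv(3) L]) (auto simp: affine_hull_facet[OF T0])
  also have "\<dots> = (\<Sum>T\<in>{T\<in>\<T>. T \<subseteq> ?F}. measure lebesgue {x. p + lincomb v x \<in> convex hull T})"
  proof (rule measure_dissection[OF pv(3) _ F])
    have "p + v i \<in> span (insert p (range v))" for i by (intro span_add span_base) auto
    then have "T0 \<subseteq> span (insert p (range v))" by (subst pv(2)) (auto intro: span_base)
    then have "span T0 \<subseteq> span (insert p (range v))" by (intro span_minimal) auto
    then show "span (insert p (range v)) = UNIV" using frame_span[OF fr] by auto
  next
    fix T assume T: "T \<in> {T\<in>\<T>. T \<subseteq> ?F}"
    then show "compact (convex hull T) \<and> convex hull T \<subseteq> ?F"
      using finite_T[of T] convF by (intro conjI finite_imp_compact_convex_hull hull_minimal) auto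
    fix x w assume x: "x \<in> convex hull T" and w: "w \<in> T"
    have "finite T" using T finite_T by blast
    then obtain u where u: "\<forall>w\<in>T. 0 \<le> u w" "(\<Sum>w\<in>T. u w *\<^sub>R w) = x"
      using x unfolding convex_hull_finite[OF \<open>finite T\<close>] by blast
    have "frame T" using T \<T>_frame by blast
    then show "coord T w x \<ge> 0" using coord_unique[OF _ w u(2)[symmetric]] u(1) w by simp
  next
    fix x assume x: "generic x" "x \<in> ?F"
    obtain T where T: "T \<in> \<T>" "\<forall>w\<in>T. coord T w x \<ge> 0" using \<T>_cover[OF x(1)] by blast
    have "T \<subseteq> ?F" "x \<in> convex hull T"
      using generic_triangle_in_face[OF x(1) _ _ x(2) facet_face(1,3)[OF T0] T(1), of 1] T(2) by auto
    then show "\<exists>T\<in>{T\<in>\<T>. T \<subseteq> ?F}. x \<in> convex hull T" using T(1) by blast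
  qed blast
  also have "\<dots> = (\<Sum>T\<in>{T\<in>\<T>. T \<subseteq> ?F}. 1 / 2)"
  proof (intro sum.cong refl)
    fix T assume T: "T \<in> {T\<in>\<T>. T \<subseteq> ?F}"
    then have T': "T \<in> \<T>" "T \<subseteq> ?F" by auto
    obtain q and u :: "2 \<Rightarrow> 'a" where qu: "q \<in> T" "T = insert q (range (\<lambda>i. q + u i))" "inj (lincomb u)"
      "range (lincomb u) = {x. height T x = 0}" "lincomb u ` integral_vectors = {x\<in>N. height T x = 0}"
      using facet_param[OF T'(1)] by (elim exE conjE)
    have "height T0 q = 1" using qu(1) T'(2) by (auto simp: facet_def)
    then obtain r where r: "q = p + lincomb v r" using ex by blast
    have "measure lebesgue {x. p + lincomb v x \<in> convex hull T} = measure lebesgue {x. q + lincomb u x \<in> convex hull T}"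
      using height_eq_if_same_facet[OF T0 T'] finite_T[OF T'(1)]
      by (intro measure_lattice_rebase[OF _ pv(3) qu(3) _ r]) (simp_all add: pv(5) qu(5) finite_imp_compact_convex_hull)
    also have "\<dots> = 1 / 2"
      using lincomb_preimage_simplex[OF qu(3), of q] unfolding qu(2)[symmetric] by simp
    finally show "measure lebesgue {x. p + lincomb v x \<in> convex hull T} = 1 / 2" .
  qed
  finally show ?thesis using facet_face(3)[OF T0] by (simp add: normalized_volume_def)
qed

text \<open>A lattice point \<open>p\<close> of height 1 / n completes the basis of the lattice at
  height 0 to a basis of \<open>N\<close>. In this basis the vertices of \<open>T\<close> have
  determinant n.\<close>

lemma solid_param:
  assumes T: "T \<in> \<T>"
  shows "\<exists>v :: 3 \<Rightarrow> 'a. inj (lincomb v) \<and> lincomb v ` integral_vectors = N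
    \<and> measure lebesgue {x. 0 + lincomb v x \<in> convex hull (insert 0 T)} = of_nat (index T) / 6"
proof -
  let ?n = "index T"
  have n0: "?n > 0" by (rule index_height(1)[OF T])
  have fr: "frame T" by (rule \<T>_frame[OF T])
  note lin = linear_height[OF fr]
  obtain w1 w2 w3 where T3: "T = {w1, w2, w3}" and ne: "w1 \<noteq> w2" "w1 \<noteq> w3" "w2 \<noteq> w3"
    using three_vertices[OF T] by blast
  have wT: "w1 \<in> T" "w2 \<in> T" "w3 \<in> T" using T3 by auto
  have wN: "w1 \<in> N" "w2 \<in> N" "w3 \<in> N" using wT \<T>_N[OF T] by auto
  have hw: "height T w1 = 1" "height T w2 = 1" "height T w3 = 1" using wT height_basis[OF fr] by auto
  have "1 / of_nat ?n \<in> range (\<lambda>j::int. of_int j / of_nat ?n :: real)" by (intro range_eqI[of _ _ 1]) simp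
  then obtain p where p: "p \<in> N" "height T p = 1 / of_nat ?n" unfolding index_height(2)[OF T, symmetric] by force
  define v :: "3 \<Rightarrow> 'a" where "v i = (if i = 1 then p else if i = 2 then w2 - w1 else w3 - w1)" for i
  have lc: "lincomb v x = x $ 1 *\<^sub>R p + (x $ 2 *\<^sub>R (w2 - w1) + x $ 3 *\<^sub>R (w3 - w1))" for x
    by (simp add: lincomb_def sum_3 v_def)
  have flat: "\<exists>i j. x = of_int i *\<^sub>R (w2 - w1) + of_int j *\<^sub>R (w3 - w1)" if x: "x \<in> N" "height T x = 0" for x
  proof -
    have "coord T w x \<in> \<int>" if "w \<in> T" for w using integral_coords[OF T x(1) _ that] x(2) by simp
    then obtain i j where ij: "coord T w2 x = of_int i" "coord T w3 x = of_int j" using wT by (metis Ints_cases)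
    have "coord T w1 x + coord T w2 x + coord T w3 x = 0"
      using x(2) ne unfolding height_def by (subst (asm) T3) simp
    then have c1: "coord T w1 x = - of_int i - of_int j" unfolding ij by linarith
    have "x = coord T w1 x *\<^sub>R w1 + (coord T w2 x *\<^sub>R w2 + coord T w3 x *\<^sub>R w3)"
      using sum_coord[OF fr, of x] ne by (subst (asm) (1) T3) simp
    then have "x = (- of_int i - of_int j) *\<^sub>R w1 + (of_int i *\<^sub>R w2 + of_int j *\<^sub>R w3)"
      unfolding c1 ij .
    then have "x = of_int i *\<^sub>R (w2 - w1) + of_int j *\<^sub>R (w3 - w1)" by (simp add: algebra_simps)
    then show ?thesis by blast
  qed
  have hl: "height T (lincomb v x) = x $ 1 / of_nat ?n" for x
    by (simp add: lc linear_add[OF lin] linear_scale[OF lin] linear_diff[OF lin] hw p(2))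
  have inj: "inj (lincomb v)"
    unfolding linear_injective_0[OF linear_lincomb]
  proof (intro allI impI)
    fix x assume x: "lincomb v x = 0"
    then have 1: "x $ 1 = 0" using hl[of x] n0 linear_0[OF lin] by simp
    have "coord T w2 (lincomb v x) = x $ 2" "coord T w3 (lincomb v x) = x $ 3"
      using ne wT 1 by (simp_all add: lc coord_add[OF fr] coord_scale[OF fr] coord_diff[OF fr] coord_basis[OF fr])
    then show "x = 0" using 1 x by (simp add: vec_eq_iff forall_3 coord_zero[OF fr])
  qed
  have im: "lincomb v ` integral_vectors = N"
  proof (intro equalityI subsetI)
    fix x assume "x \<in> lincomb v ` integral_vectors"
    then obtain z where z: "z \<in> integral_vectors" "x = lincomb v z" by blast
    obtain i j k where ij: "z $ 1 = of_int i" "z $ 2 = of_int j" "z $ 3 = of_int k"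
      using z(1) unfolding integral_vectors_def by (metis (mono_tags, lifting) Ints_cases mem_Collect_eq)
    show "x \<in> N" unfolding z(2) lc ij using wN p(1) by (intro N_add N_scale N_diff)
  next
    fix x assume x: "x \<in> N"
    then have "height T x \<in> range (\<lambda>j::int. of_int j / of_nat ?n)" unfolding index_height(2)[OF T, symmetric] by blast
    then obtain k :: int where k: "height T x = of_int k / of_nat ?n" by blast
    have "x - of_int k *\<^sub>R p \<in> N" using x p(1) by (intro N_diff N_scale)
    moreover have "height T (x - of_int k *\<^sub>R p) = 0" by (simp add: linear_diff[OF lin] linear_scale[OF lin] k p(2))
    ultimately obtain i j where ij: "x - of_int k *\<^sub>R p = of_int i *\<^sub>R (w2 - w1) + of_int j *\<^sub>R (w3 - w1)" using flat by blast
    have "x = of_int k *\<^sub>R p + (x - of_int k *\<^sub>R p)" by simp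
    also have "\<dots> = lincomb v (vector [of_int k, of_int i, of_int j])" unfolding ij by (simp add: lc)
    finally show "x \<in> lincomb v ` integral_vectors"
      by (rule image_eqI) (simp add: integral_vectors_def forall_3)
  qed
  have "w1 - of_nat ?n *\<^sub>R p \<in> N" using wN p(1) by (intro N_diff N_scale_nat)
  moreover have "height T (w1 - of_nat ?n *\<^sub>R p) = 0"
    using n0 by (simp add: linear_diff[OF lin] linear_scale[OF lin] p(2) hw)
  ultimately obtain \<alpha> \<beta> where ab: "w1 - of_nat ?n *\<^sub>R p = of_int \<alpha> *\<^sub>R (w2 - w1) + of_int \<beta> *\<^sub>R (w3 - w1)" using flat by blast
  have w1: "w1 = of_nat ?n *\<^sub>R p + (of_int \<alpha> *\<^sub>R (w2 - w1) + of_int \<beta> *\<^sub>R (w3 - w1))"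
    unfolding ab[symmetric] by simp
  \<comment> \<open>The columns are the coordinates of \<open>w1\<close>, \<open>w2\<close>,
    \<open>w3\<close> with respect to \<open>p\<close>, \<open>w2 - w1\<close>,
    \<open>w3 - w1\<close>: height 1 amounts to n times \<open>p\<close>, and the second and third
    column differ from the first by a unit vector.\<close>
  define A :: "real ^ 3 ^ 3" where "A = vector [vector [of_nat ?n, of_nat ?n, of_nat ?n],
    vector [of_int \<alpha>, of_int \<alpha> + 1, of_int \<alpha>], vector [of_int \<beta>, of_int \<beta>, of_int \<beta> + 1]]"
  define u :: "3 \<Rightarrow> 'a" where "u i = (if i = 1 then w1 else if i = 2 then w2 else w3)" for i
  have detA: "det A = of_nat ?n" by (simp add: det_3 A_def algebra_simps)
  have uA: "u j = lincomb v (\<chi> i. A $ i $ j)" for j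
  proof -
    have 1: "w1 = lincomb v (\<chi> i. A $ i $ 1)" unfolding lc by (simp add: A_def w1[symmetric])
    have "w2 = w1 + (w2 - w1)" by simp
    also have "\<dots> = lincomb v (\<chi> i. A $ i $ 2)" unfolding lc by (subst w1) (simp add: A_def algebra_simps)
    finally have 2: "w2 = lincomb v (\<chi> i. A $ i $ 2)" .
    have "w3 = w1 + (w3 - w1)" by simp
    also have "\<dots> = lincomb v (\<chi> i. A $ i $ 3)" unfolding lc by (subst w1) (simp add: A_def algebra_simps)
    finally have 3: "w3 = lincomb v (\<chi> i. A $ i $ 3)" .
    show ?thesis using exhaust_3[of j] 1 2 3 by (auto simp: u_def)
  qed
  have ru: "range u = T" unfolding T3 UNIV_3 by (simp add: u_def insert_commute)
  have "inj u" using ne by (auto simp: inj_def forall_3 u_def)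
  then have iu: "inj (lincomb u)" unfolding inj_lincomb_iff ru using fr by (simp add: frame_def)
  have "invertible A" using detA n0 by (simp add: invertible_det_nz)
  then have "measure lebesgue {x. 0 + lincomb v x \<in> convex hull (insert 0 T)}
      = \<bar>det A\<bar> * measure lebesgue {x. 0 + lincomb u x \<in> convex hull (insert 0 T)}"
    using finite_T[OF T] linear_0[OF linear_lincomb, of v]
    by (intro measure_change_basis[OF _ iu _ uA, of _ _ _ 0]) (auto intro: finite_imp_compact_convex_hull)
  also have "measure lebesgue {x. 0 + lincomb u x \<in> convex hull (insert 0 T)} = 1 / 6"
    using lincomb_preimage_simplex[OF iu, of 0] by (simp add: ru fact_numeral)
  finally have "measure lebesgue {x. 0 + lincomb v x \<in> convex hull (insert 0 T)} = of_nat ?n / 6" by (simp add: detA)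
  then show ?thesis using inj im by blast
qed

theorem normalized_volume_\<Delta>: "normalized_volume N \<Delta> = (\<Sum>T\<in>\<T>. of_nat (index T))"
proof -
  obtain \<xi> where \<xi>: "generic \<xi>" by (rule generic_exists)
  obtain T0 where T0: "T0 \<in> \<T>" using \<T>_cover[OF \<xi>] by blast
  obtain v :: "3 \<Rightarrow> 'a" where v: "inj (lincomb v)" "lincomb v ` integral_vectors = N"
    using solid_param[OF T0] by blast
  have aff: "affine hull \<Delta> = UNIV" using aff_dim_eq_full[of \<Delta>] aff_dim_\<Delta> dim3 by simp
  have "x \<in> {x - y | x y. x \<in> (UNIV::'a set) \<and> y \<in> (UNIV::'a set)}" for x :: 'a
    by (intro CollectI exI[of _ x] exI[of _ 0]) simp
  then have L: "parallel_lattice N \<Delta> = lincomb v ` integral_vectors" unfolding parallel_lattice_def aff v(2) by blast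
  have range: "range (lincomb v) = UNIV"
  proof -
    have "dim (range (lincomb v)) = dim (UNIV :: (real ^ 3) set)"
      by (rule dim_image_eq[OF linear_lincomb]) (use v(1) in auto)
    then have "dim (range (lincomb v)) = DIM('a)" using dim3 by simp
    then have "span (range (lincomb v)) = UNIV" by (simp add: dim_eq_full)
    then show ?thesis using linear_subspace_image[OF linear_lincomb subspace_UNIV, of v] span_eq_iff by metis
  qed
  have "relative_volume N \<Delta> = measure lebesgue {x. 0 + lincomb v x \<in> \<Delta>}"
  proof (rule relative_volume_eq[OF compact_\<Delta> _ v(1) L])
    show "\<exists>r. q = 0 + lincomb v r" for q using range by (metis add_0 rangeE UNIV_I)
  qed (simp add: aff_dim_\<Delta>)
  also have "\<dots> = (\<Sum>T\<in>\<T>. measure lebesgue {x. 0 + lincomb v x \<in> convex hull (insert 0 T)})"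
  proof (rule measure_dissection[OF v(1) _ compact_\<Delta>])
    have "lincomb v x \<in> span (insert 0 (range v))" for x
      unfolding lincomb_def by (intro span_sum span_scale span_base) auto
    then show "span (insert 0 (range v)) = UNIV" using range by (metis UNIV_eq_I rangeE UNIV_I)
  next
    fix T assume T: "T \<in> \<T>"
    have "insert 0 T \<subseteq> \<Delta>" using \<T>_sub[OF T] V_\<Delta> zero_interior interior_subset by blast
    then show "compact (convex hull (insert 0 T)) \<and> convex hull (insert 0 T) \<subseteq> \<Delta>"
      using finite_T[OF T] convex_\<Delta> by (intro conjI finite_imp_compact_convex_hull hull_minimal) auto
    fix x w assume x: "x \<in> convex hull (insert 0 T)" and w: "w \<in> T"
    have fr: "frame T" by (rule \<T>_frame[OF T])
    have "convex {x. coord T w x \<ge> 0}"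
      using convex_linear_vimage[OF linear_coord[OF fr], of "{0..}" w] by (simp add: vimage_def)
    then have "convex hull (insert 0 T) \<subseteq> {x. coord T w x \<ge> 0}"
      by (intro hull_minimal) (auto simp: coord_zero[OF fr] coord_basis[OF fr])
    then show "coord T w x \<ge> 0" using x by blast
  next
    fix x assume x: "generic x" "x \<in> \<Delta>"
    obtain T where T: "T \<in> \<T>" "\<forall>w\<in>T. coord T w x \<ge> 0" using \<T>_cover[OF x(1)] by blast
    have fr: "frame T" by (rule \<T>_frame[OF T(1)])
    have fin: "finite T" by (rule finite_T[OF T(1)])
    have "height T x \<le> 1" using height_le_gauge[OF T(1), of x] x(2) \<Delta>_iff by simp
    moreover have T0: "0 \<notin> T" using \<T>_sub[OF T(1)] V_nonzero by blast
    moreover from T0 have "(\<Sum>w\<in>T. (if w = 0 then 1 - height T x else coord T w x) *\<^sub>R w) = (\<Sum>w\<in>T. coord T w x *\<^sub>R w)"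
      "(\<Sum>w\<in>T. (if w = 0 then 1 - height T x else coord T w x)) = (\<Sum>w\<in>T. coord T w x)"
      by (auto intro!: sum.cong)
    ultimately have "x \<in> convex hull (insert 0 T)"
      unfolding convex_hull_finite[OF finite.insertI[OF fin]] using T(2) fin sum_coord[OF fr, of x]
      by (intro CollectI exI[of _ "\<lambda>w. if w = 0 then 1 - height T x else coord T w x"])
         (simp add: height_def)
    then show "\<exists>T\<in>\<T>. x \<in> convex hull (insert 0 T)" using T(1) by blast
  qed simp
  also have "\<dots> = (\<Sum>T\<in>\<T>. of_nat (index T) / 6)"
  proof (intro sum.cong refl)
    fix T assume T: "T \<in> \<T>"
    obtain u :: "3 \<Rightarrow> 'a" where u: "inj (lincomb u)" "lincomb u ` integral_vectors = N"
      "measure lebesgue {x. 0 + lincomb u x \<in> convex hull (insert 0 T)} = of_nat (index T) / 6"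
      using solid_param[OF T] by blast
    have z: "(0::'a) = 0 + lincomb v 0" by (simp add: linear_0[OF linear_lincomb])
    show "measure lebesgue {x. 0 + lincomb v x \<in> convex hull (insert 0 T)} = of_nat (index T) / 6"
      unfolding u(3)[symmetric] using finite_T[OF T]
      by (intro measure_lattice_rebase[OF _ v(1) u(1) _ z]) (simp_all add: v(2) u(2) finite_imp_compact_convex_hull)
  qed
  finally show ?thesis by (simp add: normalized_volume_def aff_dim_\<Delta> sum_divide_distrib[symmetric] fact_numeral)
qed

section \<open>Edges\<close>

text \<open>The numbers \<open>t\<close> with \<open>t *\<^sub>R (B - A)\<close> in \<open>N\<close>
  form a group containing 1; a nonzero integral coordinate of \<open>B - A\<close> bounds their
  denominators.\<close>

lemma line_lattice:
  assumes AB: "A \<in> N" "B \<in> N" "A \<noteq> B"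
  shows "\<exists>d (l::nat). l > 0 \<and> B = A + of_nat l *\<^sub>R d \<and> d \<noteq> 0 \<and> (\<forall>t. t *\<^sub>R d \<in> N \<longleftrightarrow> t \<in> \<int>)"
proof -
  let ?B = "b ` {..<DIM('a)}"
  have fr: "frame ?B" by (rule basis_frame)
  define S where "S = {t. t *\<^sub>R (B - A) \<in> N}"
  have "\<exists>i<DIM('a). coord ?B (b i) (B - A) \<noteq> 0"
  proof (rule ccontr)
    assume "\<not> ?thesis"
    then have "B - A = 0" by (intro coord_eqI[OF fr]) (auto simp: coord_zero[OF fr])
    then show False using AB by simp
  qed
  then obtain i where i: "i < DIM('a)" "coord ?B (b i) (B - A) \<noteq> 0" by blast
  have "B - A \<in> N" using AB by (intro N_diff)
  then have "coord ?B (b i) (B - A) \<in> \<int>" using i(1) N_iff by blast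
  then obtain k where k: "coord ?B (b i) (B - A) = of_int k" by (rule Ints_cases)
  have diff: "x - y \<in> S" if "x \<in> S" "y \<in> S" for x y
    using that N_diff[of "x *\<^sub>R (B - A)" "y *\<^sub>R (B - A)"] by (simp add: S_def scaleR_left_diff_distrib)
  have one: "1 \<in> S" using AB by (simp add: S_def N_diff)
  have k0: "nat \<bar>k\<bar> > 0" using i(2) k by simp
  have kS: "of_nat (nat \<bar>k\<bar>) * x \<in> \<int>" if "x \<in> S" for x
  proof -
    have "coord ?B (b i) (x *\<^sub>R (B - A)) \<in> \<int>" using that i(1) N_iff[of "x *\<^sub>R (B - A)"] unfolding S_def by blast
    then have "x * of_int k \<in> \<int>" using k coord_scale[OF fr] by metis
    then show ?thesis by (cases "k \<ge> 0") (auto simp: mult.commute)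
  qed
  obtain l :: nat where l: "l > 0" "S = range (\<lambda>j::int. of_int j / of_nat l)"
    by (rule real_subgroup_cyclic[OF diff one k0 kS])
  define d where "d = (1 / of_nat l) *\<^sub>R (B - A)"
  have "t *\<^sub>R d \<in> N \<longleftrightarrow> t \<in> \<int>" for t
  proof -
    have "t *\<^sub>R d \<in> N \<longleftrightarrow> t / of_nat l \<in> S" by (simp add: d_def S_def)
    also have "\<dots> \<longleftrightarrow> t \<in> \<int>" unfolding l(2) using l(1) by (auto simp: Ints_def)
    finally show ?thesis .
  qed
  moreover have "B = A + of_nat l *\<^sub>R d" "d \<noteq> 0" using l(1) AB by (auto simp: d_def)
  ultimately show ?thesis using l(1) by blast
qed

definition edge :: "'a set \<Rightarrow> bool" where "edge \<theta> \<longleftrightarrow> \<theta> face_of \<Delta> \<and> aff_dim \<theta> = 1"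

lemma edge_exposed:
  assumes "edge \<theta>"
  obtains h where "\<And>x. x \<in> \<Delta> \<Longrightarrow> h \<bullet> x \<le> 1" "\<theta> = {x\<in>\<Delta>. h \<bullet> x = 1}"
proof -
  have "\<theta> face_of \<Delta>" "aff_dim \<theta> < 3" "\<theta> \<noteq> {}" using assms by (auto simp: edge_def)
  then show ?thesis by (rule proper_face_exposed) (rule that)
qed

text \<open>Since \<open>d\<close> is primitive, \<open>l\<close> is the lattice length, and the
  lattice points of the edge are the points \<open>A + of_nat i *\<^sub>R d\<close> with
  \<open>i \<le> l\<close>.\<close>

definition edge_data :: "'a set \<Rightarrow> 'a \<Rightarrow> 'a \<Rightarrow> nat \<Rightarrow> bool" where
  "edge_data \<theta> A d l \<longleftrightarrow> l > 0 \<and> d \<noteq> 0 \<and> (\<forall>t. t *\<^sub>R d \<in> N \<longleftrightarrow> t \<in> \<int>) \<and> A \<in> N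
     \<and> \<theta> = closed_segment A (A + of_nat l *\<^sub>R d)"

lemma edge_data_exists:
  assumes \<theta>: "edge \<theta>"
  obtains A d l where "edge_data \<theta> A d l"
proof -
  have f: "\<theta> face_of \<Delta>" "aff_dim \<theta> = 1" using \<theta> by (auto simp: edge_def)
  have "convex \<theta>" using face_of_imp_convex[OF f(1)] .
  moreover have "compact \<theta>" using face_of_imp_compact[OF convex_\<Delta> compact_\<Delta> f(1)] .
  moreover have "collinear \<theta>" using f(2) by (simp add: collinear_aff_dim)
  moreover have "\<theta> \<noteq> {}" using f(2) by auto
  ultimately obtain A B where AB: "\<theta> = closed_segment A B" using compact_convex_collinear_segment by blast
  have "A \<noteq> B" using AB f(2) by auto
  have "A extreme_point_of \<theta>" "B extreme_point_of \<theta>" unfolding AB by (simp_all add: extreme_point_of_segment)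
  then have "A extreme_point_of \<Delta>" "B extreme_point_of \<Delta>" using extreme_point_of_face[OF f(1)] by auto
  then have "A \<in> N" "B \<in> N" using extreme_points_V V_N by auto
  from line_lattice[OF this \<open>A \<noteq> B\<close>] show ?thesis using that \<open>A \<in> N\<close> unfolding edge_data_def AB by blast
qed

lemma normalized_volume_edge:
  assumes "edge_data \<theta> A d l" shows "normalized_volume N \<theta> = of_nat l"
proof -
  have d: "d \<noteq> 0" "\<And>t. t *\<^sub>R d \<in> N \<longleftrightarrow> t \<in> \<int>" "(of_nat l :: real) > 0" "\<theta> = closed_segment A (A + of_nat l *\<^sub>R d)"
    using assms by (auto simp: edge_data_def)
  show ?thesis
    using relative_volume_segment[OF d(1) d(2) d(3), of A] by (simp add: normalized_volume_def d(4))
qed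

lemma edge_point_iff:
  assumes "edge_data \<theta> A d l"
  shows "x \<in> \<theta> \<longleftrightarrow> (\<exists>t. 0 \<le> t \<and> t \<le> of_nat l \<and> x = A + t *\<^sub>R d)"
proof
  have l: "l > 0" and \<theta>: "\<theta> = closed_segment A (A + of_nat l *\<^sub>R d)" using assms by (auto simp: edge_data_def)
  {
    assume "x \<in> \<theta>"
    then obtain u where "0 \<le> u" "u \<le> 1" "x = (1 - u) *\<^sub>R A + u *\<^sub>R (A + of_nat l *\<^sub>R d)" unfolding \<theta> in_segment by blast
    then show "\<exists>t. 0 \<le> t \<and> t \<le> of_nat l \<and> x = A + t *\<^sub>R d"
      by (intro exI[of _ "u * of_nat l"]) (auto simp: algebra_simps mult_left_le_one_le)
  next
    assume "\<exists>t. 0 \<le> t \<and> t \<le> of_nat l \<and> x = A + t *\<^sub>R d"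
    then obtain t where "0 \<le> t" "t \<le> of_nat l" "x = A + t *\<^sub>R d" by blast
    then show "x \<in> \<theta>" unfolding \<theta> in_segment using l by (intro exI[of _ "t / of_nat l"]) (auto simp: algebra_simps)
  }
qed

lemma edge_lattice_point:
  assumes e: "edge_data \<theta> A d l" and x: "x \<in> \<theta>" "x \<in> N"
  obtains i where "i \<le> l" "x = A + of_nat i *\<^sub>R d"
proof -
  obtain t where t: "0 \<le> t" "t \<le> of_nat l" "x = A + t *\<^sub>R d" using edge_point_iff[OF e] x(1) by blast
  have "t *\<^sub>R d = x - A" using t(3) by simp
  then have "t *\<^sub>R d \<in> N" using x(2) e by (auto simp: edge_data_def intro: N_diff)
  then have "t \<in> \<int>" using e by (auto simp: edge_data_def)
  then obtain k where k: "t = of_int k" by (rule Ints_cases)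
  then have "t = of_nat (nat k)" using t(1) by simp
  then show ?thesis using that[of "nat k"] t(2,3) by simp
qed

lemma edge_point_N:
  assumes "edge_data \<theta> A d l" shows "A + of_nat i *\<^sub>R d \<in> N"
proof -
  have "A \<in> N" "of_nat i *\<^sub>R d \<in> N" using assms by (simp_all add: edge_data_def)
  then show ?thesis by (rule N_add)
qed

lemma between_vertices:
  assumes e: "edge_data \<theta> A d l" and T: "T \<in> \<T>" and v: "A + of_nat i *\<^sub>R d \<in> T" "A + of_nat j *\<^sub>R d \<in> T"
    and k: "i \<le> k" "k \<le> j"
  shows "A + of_nat k *\<^sub>R d \<in> T"
proof (cases "i = j")
  case True then show ?thesis using v k by simp
next
  case False
  define u where "u = (of_nat k - of_nat i) / (of_nat j - of_nat i :: real)"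
  have u: "0 \<le> u" "u \<le> 1" using False k by (auto simp: u_def field_simps)
  have uk: "of_nat k = of_nat i + u * (of_nat j - of_nat i :: real)" using False k by (simp add: u_def)
  have "A + of_nat k *\<^sub>R d = (1 - u) *\<^sub>R (A + of_nat i *\<^sub>R d) + u *\<^sub>R (A + of_nat j *\<^sub>R d)"
    unfolding uk by (simp add: algebra_simps)
  also have "\<dots> \<in> convex hull T"
    using u v by (intro convexD[OF convex_convex_hull] hull_inc) auto
  finally show ?thesis using \<T>_empty[OF T] edge_point_N[OF e] by blast
qed

text \<open>A lattice point strictly between the two vertices would be a vertex of the empty
  triangle, hence \<open>w\<close>; but the coordinate at \<open>w\<close> vanishes on the
  line.\<close>

lemma edge_points_in_triangle:
  assumes e: "edge_data \<theta> A d l" and T: "T \<in> \<T>" and w: "w \<in> T" and sub: "T - {w} \<subseteq> \<theta>"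
  obtains i where "i < l" "T - {w} = {A + of_nat i *\<^sub>R d, A + of_nat (Suc i) *\<^sub>R d}"
proof -
  have fr: "frame T" by (rule \<T>_frame[OF T])
  have d0: "d \<noteq> 0" using e by (simp add: edge_data_def)
  have "card (T - {w}) = 2" using card_T[OF T] finite_T[OF T] w by simp
  then obtain u v where uv: "T - {w} = {u, v}" "u \<noteq> v" by (auto simp: card_2_iff)
  have uT: "u \<in> T" "v \<in> T" and uw: "u \<noteq> w" "v \<noteq> w" using uv by auto
  then have "u \<in> N" "v \<in> N" using \<T>_N[OF T] by auto
  moreover have "u \<in> \<theta>" "v \<in> \<theta>" using uv sub by auto
  ultimately obtain i j where i: "i \<le> l" "u = A + of_nat i *\<^sub>R d" and j: "j \<le> l" "v = A + of_nat j *\<^sub>R d"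
    using edge_lattice_point[OF e] by metis
  have ij: "i \<noteq> j" using uv(2) i j by auto
  have adj: "j' = Suc i'"
    if "A + of_nat i' *\<^sub>R d \<in> T - {w}" "A + of_nat j' *\<^sub>R d \<in> T - {w}" "i' < j'"
       "T - {w} = {A + of_nat i' *\<^sub>R d, A + of_nat j' *\<^sub>R d}" for i' j'
  proof (rule ccontr)
    assume ne: "j' \<noteq> Suc i'"
    let ?x = "A + of_nat (Suc i') *\<^sub>R d"
    have "i' \<le> Suc i'" "Suc i' \<le> j'" using that(3) by simp_all
    then have xT: "?x \<in> T" by (rule between_vertices[OF e T DiffD1[OF that(1)] DiffD1[OF that(2)]])
    have "?x \<noteq> A + of_nat i' *\<^sub>R d" "?x \<noteq> A + of_nat j' *\<^sub>R d"
      using d0 ne unfolding add_left_cancel scaleR_cancel_right of_nat_eq_iff by simp_all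
    then have "?x = w" using xT that(4) by blast
    define c where "c = 1 / (of_nat j' - of_nat i' :: real)"
    have c: "c * (of_nat j' - of_nat i') = 1" using that(3) by (simp add: c_def)
    have "?x = (1 - c) *\<^sub>R (A + of_nat i' *\<^sub>R d) + c *\<^sub>R (A + of_nat j' *\<^sub>R d)"
    proof -
      have "(1 - c) *\<^sub>R (A + of_nat i' *\<^sub>R d) + c *\<^sub>R (A + of_nat j' *\<^sub>R d)
        = A + (of_nat i' + c * (of_nat j' - of_nat i')) *\<^sub>R d" by (simp add: algebra_simps)
      then show ?thesis unfolding c by (simp add: add.commute)
    qed
    moreover have "coord T w (A + of_nat i' *\<^sub>R d) = 0" "coord T w (A + of_nat j' *\<^sub>R d) = 0"
      using DiffD2[OF that(1)] DiffD2[OF that(2)] coord_basis[OF fr DiffD1[OF that(1)], of w]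
        coord_basis[OF fr DiffD1[OF that(2)], of w] by (metis singletonI)+
    ultimately have "coord T w ?x = 0" by (simp only: coord_add[OF fr] coord_scale[OF fr] mult_zero_right add_0)
    then show False using \<open>?x = w\<close> coord_basis[OF fr w, of w] by simp
  qed
  show ?thesis
  proof (cases "i < j")
    case True
    then have "j = Suc i" using adj[of i j] uv i j by auto
    then show ?thesis using that[of i] uv(1) i j by auto
  next
    case False
    then have "j < i" using ij by simp
    then have "i = Suc j" using adj[of j i] uv i j by (auto simp: insert_commute)
    then show ?thesis using that[of j] uv(1) i j by (auto simp: insert_commute)
  qed
qed

lemma third_vertex:
  assumes T: "T \<in> \<T>" and uv: "{u, v} \<subseteq> T" "u \<noteq> v"
  obtains w where "w \<in> T" "T - {w} = {u, v}" "T = {u, v, w}" "w \<noteq> u" "w \<noteq> v"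
proof -
  have "card (T - {u, v}) = 1" using card_T[OF T] finite_T[OF T] uv by (simp add: card_Diff_subset)
  then obtain w where w: "T - {u, v} = {w}" by (auto simp: card_1_singleton_iff)
  then have "w \<in> T" "w \<noteq> u" "w \<noteq> v" "T = {u, v, w}" using uv by auto
  then show ?thesis using that uv by blast
qed

text \<open>Instead of a manifold argument, \<open>half_unique\<close> is applied at
  \<open>x\<close>, twice the midpoint of the segment, for \<open>\<xi>\<close> and for
  \<open>- \<xi>\<close>. A half-open cone contains \<open>x\<close> exactly if its triangle has
  both end points as vertices and the direction has positive coordinate at the third. This gives one
  triangle for each of the two signs.\<close>

lemma edge_triangles_card:
  assumes \<theta>: "edge \<theta>" and e: "edge_data \<theta> A d l" and i: "i < l"
  shows "card {T\<in>\<T>. {A + of_nat i *\<^sub>R d, A + of_nat (Suc i) *\<^sub>R d} \<subseteq> T} = 2"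
proof -
  let ?P = "\<lambda>j::nat. A + of_nat j *\<^sub>R d"
  define x where "x = ?P i + ?P (Suc i)"
  have d0: "d \<noteq> 0" using e by (simp add: edge_data_def)
  have ne: "?P i \<noteq> ?P (Suc i)" using d0 by simp
  obtain h where h: "\<And>x. x \<in> \<Delta> \<Longrightarrow> h \<bullet> x \<le> 1" "\<theta> = {x\<in>\<Delta>. h \<bullet> x = 1}"
    by (rule edge_exposed[OF \<theta>]) (rule that)
  have P: "?P j \<in> \<theta>" if "j \<le> l" for j
    using that unfolding edge_point_iff[OF e] by (intro exI[of _ "of_nat j"]) simp
  have hP: "h \<bullet> ?P j = 1" "?P j \<in> \<Delta>" if "j \<le> l" for j using P[OF that] h(2) by auto
  obtain \<xi> where \<xi>: "generic \<xi>" by (rule generic_exists)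
  \<comment> \<open>The gauge of \<open>x\<close> is at most 2 and the exposing functional has the
    value 2 at \<open>x\<close>, so all vertices with positive coordinate lie on
    \<open>\<theta>\<close>. Their weighted mean position is i + 1 / 2, so they occur on both sides
    of the segment, and \<open>between_vertices\<close> fills in its end points.\<close>
  have sub: "{?P i, ?P (Suc i)} \<subseteq> T" if T: "T \<in> \<T>" and hT: "half \<zeta> T x" for T \<zeta>
  proof -
    have fr: "frame T" by (rule \<T>_frame[OF T])
    have fin: "finite T" by (rule finite_T[OF T])
    let ?c = "\<lambda>v. coord T v x"
    have c0: "?c v \<ge> 0" if "v \<in> T" for v by (rule half_nonneg[OF hT that])
    have "gauge x = height T x" by (rule gauge_eq_height[OF T c0])
    moreover have "gauge x \<le> gauge (?P i) + gauge (?P (Suc i))" unfolding x_def by (rule gauge_add)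
    moreover have "gauge (?P i) \<le> 1" "gauge (?P (Suc i)) \<le> 1"
      using hP(2)[of i] hP(2)[of "Suc i"] i unfolding \<Delta>_iff by simp_all
    ultimately have h2: "(\<Sum>v\<in>T. ?c v) \<le> 2" by (simp add: height_def)
    have hv: "h \<bullet> v \<le> 1" if "v \<in> T" for v using h(1) that \<T>_sub[OF T] V_\<Delta> by blast
    have le: "?c v * (h \<bullet> v) \<le> ?c v" if "v \<in> T" for v using c0[OF that] hv[OF that] by (simp add: mult_left_le)
    have "h \<bullet> x = (\<Sum>v\<in>T. ?c v * (h \<bullet> v))" by (rule inner_eq_sum_coord[OF fr])
    moreover have "h \<bullet> x = 2" using hP(1)[of i] hP(1)[of "Suc i"] i by (simp add: x_def inner_add_right)
    moreover have "(\<Sum>v\<in>T. ?c v * (h \<bullet> v)) \<le> (\<Sum>v\<in>T. ?c v)" by (rule sum_mono[OF le])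
    ultimately have s2: "(\<Sum>v\<in>T. ?c v) = 2" and "(\<Sum>v\<in>T. ?c v - ?c v * (h \<bullet> v)) = 0"
      using h2 by (auto simp: sum_subtractf)
    then have z: "\<forall>v\<in>T. ?c v - ?c v * (h \<bullet> v) = 0" using le fin by (subst (asm) sum_nonneg_eq_0_iff) auto
    define S where "S = {v\<in>T. ?c v > 0}"
    have ST: "S \<subseteq> T" and finS: "finite S" using fin by (auto simp: S_def)
    have S0: "?c v = 0" if "v \<in> T - S" for v using that c0[of v] by (auto simp: S_def)
    have "\<exists>j. j \<le> l \<and> v = ?P j" if "v \<in> S" for v
    proof -
      have "h \<bullet> v = 1" using z that by (auto simp: S_def)
      moreover have "v \<in> \<Delta>" "v \<in> N" using that ST \<T>_sub[OF T] V_\<Delta> V_N by auto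
      ultimately show ?thesis using edge_lattice_point[OF e, of v] h(2) by blast
    qed
    then obtain j where j: "\<And>v. v \<in> S \<Longrightarrow> v = ?P (j v)" by metis
    have s2': "(\<Sum>v\<in>S. ?c v) = 2" using s2 sum.mono_neutral_left[OF fin ST, of ?c] S0 by auto
    have "x = (\<Sum>v\<in>T. ?c v *\<^sub>R v)" using sum_coord[OF fr] by simp
    also have "\<dots> = (\<Sum>v\<in>S. ?c v *\<^sub>R v)" using S0 by (intro sum.mono_neutral_right[OF fin ST]) auto
    also have "\<dots> = (\<Sum>v\<in>S. ?c v *\<^sub>R A + (?c v * of_nat (j v)) *\<^sub>R d)"
    proof (intro sum.cong refl)
      fix v assume "v \<in> S"
      have "?c v *\<^sub>R v = ?c v *\<^sub>R ?P (j v)" using j[OF \<open>v \<in> S\<close>] by simp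
      then show "?c v *\<^sub>R v = ?c v *\<^sub>R A + (?c v * of_nat (j v)) *\<^sub>R d" by (simp add: scaleR_add_right)
    qed
    also have "\<dots> = 2 *\<^sub>R A + (\<Sum>v\<in>S. ?c v * of_nat (j v)) *\<^sub>R d"
      by (simp add: sum.distrib scaleR_sum_left[symmetric] s2')
    finally have "x = 2 *\<^sub>R A + (\<Sum>v\<in>S. ?c v * of_nat (j v)) *\<^sub>R d" .
    moreover have "x = 2 *\<^sub>R A + (2 * of_nat i + 1) *\<^sub>R d"
    proof -
      have e: "2 * of_nat i + 1 = (of_nat i + of_nat (Suc i) :: real)" by simp
      show ?thesis unfolding e x_def by (simp only: scaleR_left_distrib scaleR_2 add_ac)
    qed
    ultimately have "(\<Sum>v\<in>S. ?c v * of_nat (j v)) *\<^sub>R d = (2 * of_nat i + 1) *\<^sub>R d" by (metis add_left_cancel)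
    then have avg: "(\<Sum>v\<in>S. ?c v * of_nat (j v)) = 2 * of_nat i + 1" using d0 by simp
    have "\<exists>v\<in>S. j v \<le> i"
    proof (rule ccontr)
      assume "\<not> ?thesis"
      then have "(\<Sum>v\<in>S. ?c v * (of_nat i + 1)) \<le> (\<Sum>v\<in>S. ?c v * of_nat (j v))"
        by (intro sum_mono mult_left_mono) (auto simp: S_def not_le)
      then show False unfolding avg sum_distrib_right[symmetric] s2' by simp
    qed
    then obtain v where v: "v \<in> S" "j v \<le> i" by blast
    have "\<exists>v\<in>S. j v \<ge> Suc i"
    proof (rule ccontr)
      assume "\<not> ?thesis"
      then have "(\<Sum>v\<in>S. ?c v * of_nat (j v)) \<le> (\<Sum>v\<in>S. ?c v * of_nat i)"
        by (intro sum_mono mult_left_mono) (auto simp: S_def not_le)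
      then show False unfolding avg sum_distrib_right[symmetric] s2' by simp
    qed
    then obtain v' where v': "v' \<in> S" "j v' \<ge> Suc i" by blast
    have "?P (j v) \<in> T" "?P (j v') \<in> T" using j[OF v(1)] j[OF v'(1)] v(1) v'(1) ST by auto
    note mid = between_vertices[OF e T this]
    show ?thesis unfolding insert_subset
      using mid[of i] mid[of "Suc i"] v(2) v'(2) le_SucI[of "j v" i] Suc_leD[of i "j v'"] by blast
  qed
  have crit: "half \<zeta> T x \<longleftrightarrow> coord T w \<zeta> > 0"
    if T: "T \<in> \<T>" and w: "w \<in> T" "T = {?P i, ?P (Suc i), w}" "w \<noteq> ?P i" "w \<noteq> ?P (Suc i)" for T w \<zeta>
  proof -
    have fr: "frame T" by (rule \<T>_frame[OF T])
    have PT: "?P i \<in> T" "?P (Suc i) \<in> T" by (subst w(2), simp)+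
    have "coord T (?P i) x = 1" "coord T (?P (Suc i)) x = 1" "coord T w x = 0"
      unfolding x_def coord_add[OF fr, of _ "?P i" "?P (Suc i)"]
      using coord_basis[OF fr PT(1)] coord_basis[OF fr PT(2)] ne w(3,4) by simp_all
    moreover have "half \<zeta> T x \<longleftrightarrow> (\<forall>v\<in>{?P i, ?P (Suc i), w}. coord T v x > 0 \<or> coord T v x = 0 \<and> coord T v \<zeta> > 0)"
      unfolding half_def using w(2) by blast
    ultimately show ?thesis by simp
  qed
  obtain T1 where T1: "T1 \<in> \<T>" "half \<xi> T1 x" "\<And>T. T \<in> \<T> \<Longrightarrow> half \<xi> T x \<Longrightarrow> T = T1"
    using half_unique[OF \<xi>, of x] by blast
  obtain T2 where T2: "T2 \<in> \<T>" "half (- \<xi>) T2 x" "\<And>T. T \<in> \<T> \<Longrightarrow> half (- \<xi>) T x \<Longrightarrow> T = T2"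
    using half_unique[OF generic_neg[OF \<xi>], of x] by blast
  have cneg: "coord T w (- \<xi>) = - coord T w \<xi>" if "T \<in> \<T>" for T w
    using coord_diff[OF \<T>_frame[OF that], of w 0 \<xi>] coord_zero[OF \<T>_frame[OF that], of w] by simp
  have "{T\<in>\<T>. {?P i, ?P (Suc i)} \<subseteq> T} = {T1, T2}"
  proof (intro equalityI subsetI)
    fix T assume T: "T \<in> {T\<in>\<T>. {?P i, ?P (Suc i)} \<subseteq> T}"
    then have T': "T \<in> \<T>" "{?P i, ?P (Suc i)} \<subseteq> T" by auto
    obtain w where w: "w \<in> T" "T = {?P i, ?P (Suc i), w}" "w \<noteq> ?P i" "w \<noteq> ?P (Suc i)"
      by (rule third_vertex[OF T' ne])
    have "coord T w \<xi> \<noteq> 0" by (rule generic_coord[OF \<xi> \<T>_frame[OF T'(1)] \<T>_sub[OF T'(1)] w(1)])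
    then have "coord T w \<xi> > 0 \<or> coord T w (- \<xi>) > 0" using cneg[OF T'(1)] by auto
    then show "T \<in> {T1, T2}" using crit[OF T'(1) w] T1(3)[OF T'(1)] T2(3)[OF T'(1)] by blast
  next
    fix T assume "T \<in> {T1, T2}"
    then show "T \<in> {T\<in>\<T>. {?P i, ?P (Suc i)} \<subseteq> T}" using sub[OF T1(1,2)] sub[OF T2(1,2)] T1(1) T2(1) by blast
  qed
  moreover have "T1 \<noteq> T2"
  proof
    assume eq: "T1 = T2"
    obtain w where w: "w \<in> T1" "T1 = {?P i, ?P (Suc i), w}" "w \<noteq> ?P i" "w \<noteq> ?P (Suc i)"
      by (rule third_vertex[OF T1(1) sub[OF T1(1,2)] ne])
    have "coord T1 w \<xi> > 0" "coord T1 w (- \<xi>) > 0" using crit[OF T1(1) w] T1(2) T2(2) eq by blast+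
    then show False using cneg[OF T1(1), of w] by simp
  qed
  ultimately show ?thesis by simp
qed

text \<open>The edge consists of \<open>l\<close> primitive segments, and each of them is a side of
  exactly two triangles.\<close>

lemma edge_incidence_sum:
  assumes \<theta>: "edge \<theta>" and e: "edge_data \<theta> A d l"
  shows "(\<Sum>T\<in>\<T>. \<Sum>w\<in>T. if T - {w} \<subseteq> \<theta> then 1 else 0 :: real) = 2 * of_nat l"
proof -
  let ?P = "\<lambda>j::nat. A + of_nat j *\<^sub>R d"
  let ?e = "\<lambda>i. {?P i, ?P (Suc i)}"
  have d0: "d \<noteq> 0" using e by (simp add: edge_data_def)
  have inj: "?P i = ?P j \<longleftrightarrow> i = j" for i j using d0 by simp
  have ne: "?P i \<noteq> ?P (Suc i)" for i using inj[of i "Suc i"] by simp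
  have einj: "i = j" if "?e i = ?e j" for i j
  proof -
    have "(?P i = ?P j \<or> ?P i = ?P (Suc j)) \<and> (?P j = ?P i \<or> ?P j = ?P (Suc i))" using that by blast
    then show ?thesis unfolding inj by auto
  qed
  have 1: "(if T - {w} \<subseteq> \<theta> then 1 else 0) = (\<Sum>i<l. if T - {w} = ?e i then 1 else 0 :: real)"
    if T: "T \<in> \<T>" "w \<in> T" for T w
  proof (cases "T - {w} \<subseteq> \<theta>")
    case True
    obtain i where i: "i < l" "T - {w} = ?e i" by (rule edge_points_in_triangle[OF e T True])
    have "(\<Sum>j<l. if T - {w} = ?e j then 1 else 0 :: real) = (\<Sum>j<l. if j = i then 1 else 0)"
      using i(2) einj by (intro sum.cong refl) metis
    then show ?thesis using True i(1) by simp
  next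
    case False
    have "?e i \<subseteq> \<theta>" if "i < l" for i
      using that unfolding insert_subset edge_point_iff[OF e]
      by (intro conjI exI[of _ "of_nat i"] exI[of _ "of_nat (Suc i)"]) simp_all
    then have "(\<Sum>i<l. if T - {w} = ?e i then 1 else 0 :: real) = 0"
      using False by (intro sum.neutral ballI) (metis lessThan_iff)
    then show ?thesis using False by simp
  qed
  have 2: "(\<Sum>w\<in>T. if T - {w} = ?e i then 1 else 0 :: real) = (if ?e i \<subseteq> T then 1 else 0)" if T: "T \<in> \<T>" for T i
  proof (cases "?e i \<subseteq> T")
    case True
    obtain w where w: "w \<in> T" "T - {w} = ?e i" by (rule third_vertex[OF T True ne])
    have "T - {v} = ?e i \<longleftrightarrow> v = w" if "v \<in> T" for v using w that by blast
    then have "(\<Sum>v\<in>T. if T - {v} = ?e i then 1 else 0 :: real) = (\<Sum>v\<in>T. if v = w then 1 else 0)"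
      by (intro sum.cong refl) simp
    then show ?thesis using True w(1) finite_T[OF T] by simp
  next
    case False
    then have "T - {v} \<noteq> ?e i" for v by blast
    then show ?thesis using False by simp
  qed
  have "(\<Sum>T\<in>\<T>. \<Sum>w\<in>T. if T - {w} \<subseteq> \<theta> then 1 else 0 :: real) = (\<Sum>T\<in>\<T>. \<Sum>w\<in>T. \<Sum>i<l. if T - {w} = ?e i then 1 else 0)"
    by (intro sum.cong refl 1)
  also have "\<dots> = (\<Sum>T\<in>\<T>. \<Sum>i<l. \<Sum>w\<in>T. if T - {w} = ?e i then 1 else 0)" by (intro sum.cong refl sum.swap)
  also have "\<dots> = (\<Sum>T\<in>\<T>. \<Sum>i<l. if ?e i \<subseteq> T then 1 else 0)" by (intro sum.cong refl 2)
  also have "\<dots> = (\<Sum>i<l. \<Sum>T\<in>\<T>. if ?e i \<subseteq> T then 1 else 0)" by (rule sum.swap)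
  also have "\<dots> = (\<Sum>i<l. 2)"
  proof (intro sum.cong refl)
    fix i assume "i \<in> {..<l}"
    have "(\<Sum>T\<in>\<T>. if ?e i \<subseteq> T then 1 else 0 :: real) = of_nat (card {T\<in>\<T>. ?e i \<subseteq> T})"
      using finite_\<T> by (simp add: sum.inter_filter[symmetric])
    then show "(\<Sum>T\<in>\<T>. if ?e i \<subseteq> T then 1 else 0 :: real) = 2"
      using edge_triangles_card[OF \<theta> e, of i] \<open>i \<in> {..<l}\<close> by simp
  qed
  finally show ?thesis by simp
qed

end

section \<open>Dual faces\<close>

context fano
begin

lemma dual_polytope_eq: "dual_polytope \<Delta> = {y. \<forall>v\<in>V. y \<bullet> v \<ge> - 1}"
proof (intro equalityI subsetI)
  fix y assume "y \<in> dual_polytope \<Delta>"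
  then show "y \<in> {y. \<forall>v\<in>V. y \<bullet> v \<ge> - 1}" using V_\<Delta> by (auto simp: dual_polytope_def)
next
  fix y assume y: "y \<in> {y. \<forall>v\<in>V. y \<bullet> v \<ge> - 1}"
  have "y \<bullet> x \<ge> - 1" if x: "x \<in> \<Delta>" for x
  proof -
    obtain c where c: "\<forall>v\<in>V. c v \<ge> 0" "(\<Sum>v\<in>V. c v) = 1" "x = (\<Sum>v\<in>V. c v *\<^sub>R v)"
      using V_combination[OF x] by blast
    have "- 1 = (\<Sum>v\<in>V. c v * (- 1))" using c(2) by (simp add: sum_negf)
    also have "\<dots> \<le> (\<Sum>v\<in>V. c v * (y \<bullet> v))" using y c(1) by (intro sum_mono mult_left_mono) auto
    also have "\<dots> = y \<bullet> x" unfolding c(3) by (simp add: inner_sum_right)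
    finally show ?thesis .
  qed
  then show "y \<in> dual_polytope \<Delta>" by (simp add: dual_polytope_def)
qed

lemma polytope_dual: "polytope (dual_polytope \<Delta>)"
  unfolding polytope_eq_bounded_polyhedron
proof
  have "dual_polytope \<Delta> = \<Inter>((\<lambda>v. {y. v \<bullet> y \<ge> - 1}) ` V)" unfolding dual_polytope_eq by (auto simp: inner_commute)
  moreover have "polyhedron (\<Inter>((\<lambda>v. {y. v \<bullet> y \<ge> - 1}) ` V))"
    using finite_V polyhedron_halfspace_ge by (intro polyhedron_Inter) fast+
  ultimately show "polyhedron (dual_polytope \<Delta>)" by simp
  obtain e where e: "e > 0" "cball 0 e \<subseteq> \<Delta>"
    using zero_interior unfolding mem_interior_cball by blast
  have "norm y \<le> 1 / e" if y: "y \<in> dual_polytope \<Delta>" for y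
  proof (cases "y = 0")
    case False
    let ?x = "- (e / norm y) *\<^sub>R y"
    have "?x \<in> \<Delta>" using e False by (intro subsetD[OF e(2)]) simp
    then have "y \<bullet> ?x \<ge> - 1" using y unfolding dual_polytope_def by blast
    moreover have "y \<bullet> ?x = - (e * norm y)" using False by (simp add: dot_square_norm power2_eq_square)
    ultimately show ?thesis using e(1) by (simp add: field_simps)
  qed (use e in simp)
  then show "bounded (dual_polytope \<Delta>)" unfolding bounded_iff by blast
qed

text \<open>The constraints tight at \<open>y\<close> span the space; otherwise \<open>y\<close>
  could move both ways along an orthogonal vector \<open>a\<close>. On a frame of tight lattice
  points \<open>y\<close> is - 1, so a common denominator of the coordinates clears
  \<open>y\<close>.\<close>

lemma dual_vertex_rational:
  assumes y: "y extreme_point_of dual_polytope \<Delta>"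
  shows "\<exists>k::nat. k > 0 \<and> of_nat k *\<^sub>R y \<in> dual_lattice N"
proof -
  define A where "A = {v\<in>V. y \<bullet> v = - 1}"
  have yD: "y \<in> dual_polytope \<Delta>" using y by (simp add: extreme_point_of_def)
  have span: "span A = UNIV"
  proof (rule ccontr)
    assume "span A \<noteq> UNIV"
    then obtain a where a: "a \<noteq> 0" "\<And>x. x \<in> span A \<Longrightarrow> a \<bullet> x = 0" using span_not_UNIV_orthogonal by blast
    have "\<forall>\<^sub>F e in at_right (0::real). e * \<bar>a \<bullet> v\<bar> \<le> y \<bullet> v + 1" if v: "v \<in> V" for v
    proof (cases "v \<in> A")
      case True then show ?thesis using a(2)[OF span_base[OF True]] by (simp add: A_def)
    next
      case False
      then have "y \<bullet> v + 1 > 0" using v yD by (force simp: A_def dual_polytope_eq)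
      moreover have "((\<lambda>e. e * \<bar>a \<bullet> v\<bar>) \<longlongrightarrow> 0) (at_right (0::real))" by (auto intro!: tendsto_eq_intros)
      ultimately have "\<forall>\<^sub>F e in at_right (0::real). e * \<bar>a \<bullet> v\<bar> < y \<bullet> v + 1" by (rule order_tendstoD(2)[rotated])
      then show ?thesis by eventually_elim simp
    qed
    then have "\<forall>\<^sub>F e in at_right (0::real). \<forall>v\<in>V. e * \<bar>a \<bullet> v\<bar> \<le> y \<bullet> v + 1"
      using finite_V by (intro eventually_ball_finite) auto
    moreover have "\<forall>\<^sub>F e in at_right (0::real). e > 0" by (rule eventually_at_right_less)
    ultimately have "\<forall>\<^sub>F e in at_right (0::real). e > 0 \<and> (\<forall>v\<in>V. e * \<bar>a \<bullet> v\<bar> \<le> y \<bullet> v + 1)" by eventually_elim blast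
    then obtain e where e: "e > 0" "\<And>v. v \<in> V \<Longrightarrow> e * \<bar>a \<bullet> v\<bar> \<le> y \<bullet> v + 1"
      using eventually_happens trivial_limit_at_right_real by blast
    have "\<bar>e * (a \<bullet> v)\<bar> \<le> y \<bullet> v + 1" if "v \<in> V" for v using e(2)[OF that] e(1) by (simp add: abs_mult)
    then have "y - e *\<^sub>R a \<in> dual_polytope \<Delta>" "y + e *\<^sub>R a \<in> dual_polytope \<Delta>"
      unfolding dual_polytope_eq by (force simp: inner_diff_left inner_add_left)+
    moreover have "y \<in> open_segment (y - e *\<^sub>R a) (y + e *\<^sub>R a)"
    proof -
      have "y - e *\<^sub>R a \<noteq> y + e *\<^sub>R a"
      proof
        assume "y - e *\<^sub>R a = y + e *\<^sub>R a"
        then have "(2 * e) *\<^sub>R a = 0" by (simp add: algebra_simps flip: scaleR_2)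
        then show False using a(1) e(1) by simp
      qed
      moreover have "y = (1 - 1 / 2) *\<^sub>R (y - e *\<^sub>R a) + (1 / 2) *\<^sub>R (y + e *\<^sub>R a)"
        by (simp add: algebra_simps flip: scaleR_add_left)
      ultimately show ?thesis unfolding in_segment by (intro conjI exI[of _ "1 / 2"]) auto
    qed
    ultimately show False using y by (auto simp: extreme_point_of_def)
  qed
  obtain B where B: "B \<subseteq> A" "independent B" "A \<subseteq> span B" by (rule maximal_independent_subset)
  have "span B = UNIV" using span span_mono[OF B(3)] by (simp add: span_span top.extremum_unique)
  then have "card B = DIM('a)" using dim_eq_card_independent[OF B(2)] dim_span[of B] by simp
  then have fr: "frame B" using B(2) by (simp add: frame_def)
  have "B \<subseteq> N" using B(1) V_N by (auto simp: A_def)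
  then obtain k :: nat where k: "k > 0" "\<And>x w. x \<in> N \<Longrightarrow> w \<in> B \<Longrightarrow> of_nat k * coord B w x \<in> \<int>"
    using coord_common_denominator[OF fr] by blast
  have "(of_nat k *\<^sub>R y) \<bullet> x \<in> \<int>" if x: "x \<in> N" for x
  proof -
    have "y \<bullet> x = (\<Sum>w\<in>B. coord B w x * (y \<bullet> w))" by (rule inner_eq_sum_coord[OF fr])
    also have "\<dots> = (\<Sum>w\<in>B. - coord B w x)" using B(1) by (intro sum.cong) (auto simp: A_def)
    finally have "(of_nat k *\<^sub>R y) \<bullet> x = (\<Sum>w\<in>B. - (of_nat k * coord B w x))"
      by (simp add: sum_distrib_left sum_negf)
    then show ?thesis using k(2)[OF x] by (auto intro!: Ints_sum)
  qed
  then show ?thesis using k(1) by (auto simp: dual_lattice_def)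
qed

text \<open>Guarantees that the choice of the scale in \<open>rational_normalized_volume\<close> has
  its intended property.\<close>

lemma dual_scale_exists:
  "\<exists>l::nat. l > 0 \<and> lattice_polytope (dual_lattice N) ((\<lambda>x. real l *\<^sub>R x) ` dual_polytope \<Delta>)"
proof -
  define X where "X = {y. y extreme_point_of dual_polytope \<Delta>}"
  have finX: "finite X"
    unfolding X_def by (rule finite_polyhedron_extreme_points[OF polytope_imp_polyhedron[OF polytope_dual]])
  obtain k :: "'a \<Rightarrow> nat" where k: "\<And>y. y \<in> X \<Longrightarrow> k y > 0 \<and> of_nat (k y) *\<^sub>R y \<in> dual_lattice N"
    using dual_vertex_rational unfolding X_def mem_Collect_eq by metis
  define l where "l = (\<Prod>y\<in>X. k y)"
  have l0: "l > 0" using k finX by (auto simp: l_def intro!: prod_pos)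
  have lX: "real l *\<^sub>R y \<in> dual_lattice N" if y: "y \<in> X" for y
  proof -
    have "l = k y * (\<Prod>z\<in>X - {y}. k z)" unfolding l_def by (rule prod.remove[OF finX y])
    then have e: "(real l *\<^sub>R y) \<bullet> x = of_nat (\<Prod>z\<in>X - {y}. k z) * ((of_nat (k y) *\<^sub>R y) \<bullet> x)" for x
      by (simp add: mult_ac)
    show ?thesis using k[OF y] unfolding dual_lattice_def mem_Collect_eq e by (intro ballI Ints_mult) auto
  qed
  have lin: "linear (\<lambda>x::'a. real l *\<^sub>R x)" by (rule linear_scale_self)
  have "dual_polytope \<Delta> = convex hull X" unfolding X_def
    using polytope_dual by (intro Krein_Milman_Minkowski polytope_imp_compact polytope_imp_convex)
  then have "(\<lambda>x. real l *\<^sub>R x) ` dual_polytope \<Delta> = convex hull ((\<lambda>x. real l *\<^sub>R x) ` X)"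
    by (simp add: convex_hull_linear_image[OF lin])
  then have "{v. v extreme_point_of (\<lambda>x. real l *\<^sub>R x) ` dual_polytope \<Delta>} \<subseteq> dual_lattice N"
    using extreme_point_of_convex_hull lX by fastforce
  then show ?thesis using l0 polytope_linear_image[OF lin polytope_dual] by (auto simp: lattice_polytope_def)
qed

end

context triangulated
begin

text \<open>Extends the minimum defining \<open>kink_min\<close> from \<open>E\<close> to all valid
  functionals. The test point \<open>z\<close> is deep along the wall and just beyond it, with
  coordinate - 1 at \<open>w\<close>; there \<open>gauge_near_edge\<close> computes the gauge, which
  bounds \<open>g\<close>.\<close>

lemma kink_min_le_valid:
  assumes T: "T \<in> \<T>" and w: "w \<in> T" and g: "\<And>x. x \<in> \<Delta> \<Longrightarrow> g \<bullet> x \<le> 1" "\<forall>v\<in>T - {w}. g \<bullet> v = 1"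
  shows "kink_min T w \<le> g \<bullet> w"
proof -
  have fr: "frame T" by (rule \<T>_frame[OF T])
  obtain C where C: "stable C {- w}" by (rule stable_exists[of "{- w}"]) auto
  define x where "x = (\<Sum>v\<in>T. (if v = w then 0 else of_nat C) *\<^sub>R v)"
  have cx: "coord T v x = (if v = w then 0 else of_nat C)" if "v \<in> T" for v
    unfolding x_def by (rule coord_lincomb[OF fr that])
  define z where "z = 2 *\<^sub>R x + - w"
  have cz: "coord T w z = - 1"
  proof -
    have "z = 2 *\<^sub>R x - w" by (simp add: z_def)
    then show ?thesis using cx[OF w] coord_basis[OF fr w, of w] by (simp add: coord_diff[OF fr] coord_scale[OF fr])
  qed
  have "h \<bullet> v = 1" if "h \<in> E" "h \<bullet> z = gauge z" "v \<in> T - {w}" for h v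
  proof -
    have "\<forall>v\<in>T. coord T v x \<ge> 0" "coord T v x \<ge> of_nat C" "v \<in> T" using cx that(3) by auto
    then show ?thesis using C T that(1,2) unfolding stable_def z_def by blast
  qed
  then have "gauge z = height T z + (1 - kink_min T w) * (\<bar>coord T w z\<bar> - coord T w z) / 2"
    by (rule gauge_near_edge[OF T w])
  moreover have "g \<bullet> z \<le> gauge z" by (rule valid_le_gauge[OF g(1)])
  moreover have "g \<bullet> z = height T z - (1 - g \<bullet> w) * coord T w z" by (rule inner_edge[OF T w g(2)])
  ultimately show ?thesis unfolding cz by simp
qed

lemma edge_on_line:
  assumes \<theta>: "edge \<theta>" and T: "T \<in> \<T>" and w: "w \<in> T" and sub: "T - {w} \<subseteq> \<theta>" and z: "z \<in> \<theta>"
  shows "coord T w z = 0" "height T z = 1"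
proof -
  have fr: "frame T" by (rule \<T>_frame[OF T])
  obtain A d l where e: "edge_data \<theta> A d l" by (rule edge_data_exists[OF \<theta>])
  obtain i where i: "T - {w} = {A + of_nat i *\<^sub>R d, A + of_nat (Suc i) *\<^sub>R d}"
    by (rule edge_points_in_triangle[OF e T w sub])
  define p where "p = A + of_nat i *\<^sub>R d"
  define q where "q = A + of_nat (Suc i) *\<^sub>R d"
  have pq: "T - {w} = {p, q}" unfolding p_def q_def by (rule i)
  then have T': "p \<in> T" "q \<in> T" "p \<noteq> w" "q \<noteq> w" by auto
  obtain t where "z = A + t *\<^sub>R d" using z edge_point_iff[OF e] by blast
  then have zpq: "z = (1 - (t - of_nat i)) *\<^sub>R p + (t - of_nat i) *\<^sub>R q"
    by (simp add: p_def q_def algebra_simps)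
  have "coord T w p = 0" "coord T w q = 0" using T' coord_basis[OF fr T'(1), of w] coord_basis[OF fr T'(2), of w] by simp_all
  then show "coord T w z = 0" unfolding zpq by (simp add: coord_add[OF fr] coord_scale[OF fr])
  have "height T p = 1" "height T q = 1" using height_basis[OF fr] T' by simp_all
  then show "height T z = 1" unfolding zpq
    by (simp add: linear_add[OF linear_height[OF fr]] linear_cmul[OF linear_height[OF fr]])
qed

text \<open>The point \<open>w\<close> is off the line of the edge, so a functional exposing the
  edge is below 1 at \<open>w\<close>; \<open>kink_min\<close> is at most this value.\<close>

lemma jump_pos_edge:
  assumes \<theta>: "edge \<theta>" and T: "T \<in> \<T>" and w: "w \<in> T" and sub: "T - {w} \<subseteq> \<theta>"
  shows "jump T w > 0"
proof -
  have fr: "frame T" by (rule \<T>_frame[OF T])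
  have "w \<notin> \<theta>" using edge_on_line(1)[OF \<theta> T w sub, of w] coord_basis[OF fr w, of w] by auto
  obtain h where h: "\<And>x. x \<in> \<Delta> \<Longrightarrow> h \<bullet> x \<le> 1" "\<theta> = {x\<in>\<Delta>. h \<bullet> x = 1}"
    by (rule edge_exposed[OF \<theta>]) (rule that)
  have "w \<in> \<Delta>" using w \<T>_sub[OF T] V_\<Delta> by blast
  then have "h \<bullet> w < 1" using h(1)[of w] h(2) \<open>w \<notin> \<theta>\<close> by force
  moreover have "kink_min T w \<le> h \<bullet> w" using sub h(2) by (intro kink_min_le_valid[OF T w h(1)]) auto
  ultimately show ?thesis using index_height(1)[OF T] by (simp add: jump_def)
qed

text \<open>The dual edge runs between the functionals of the two facets through \<open>\<theta>\<close>; their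
  difference vanishes on \<open>\<theta>\<close> and is the jump times a primitive functional.\<close>

lemma dual_face_edge:
  assumes \<theta>: "edge \<theta>" and T: "T \<in> \<T>" and w: "w \<in> T" and sub: "T - {w} \<subseteq> \<theta>"
    and h: "h \<in> E" "\<And>x. h \<bullet> x = height T x" and m: "\<And>x. m \<bullet> x = of_nat (index T) * coord T w x"
  shows "dual_face \<Delta> \<theta> = closed_segment (- h) (- h + jump T w *\<^sub>R m)"
proof (intro equalityI subsetI)
  have n0: "index T > 0" by (rule index_height(1)[OF T])
  have j0: "jump T w > 0" by (rule jump_pos_edge[OF \<theta> T w sub])
  have \<theta>\<Delta>: "\<theta> \<subseteq> \<Delta>" using \<theta> face_of_imp_subset by (auto simp: edge_def)
  have seg: "y \<in> closed_segment (- h) (- h + jump T w *\<^sub>R m) \<longleftrightarrow> (\<exists>u\<ge>0. u \<le> 1 \<and> y = - h + (u * jump T w) *\<^sub>R m)" for y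
    unfolding in_segment by (simp add: algebra_simps)
  {
    fix y assume y: "y \<in> dual_face \<Delta> \<theta>"
    let ?g = "- y"
    have g: "\<And>x. x \<in> \<Delta> \<Longrightarrow> ?g \<bullet> x \<le> 1" "\<forall>v\<in>T - {w}. ?g \<bullet> v = 1"
      using y sub unfolding dual_face_def dual_polytope_def by force+
    define t where "t = (1 - ?g \<bullet> w) / of_nat (index T)"
    have "y \<bullet> z = (- h + t *\<^sub>R m) \<bullet> z" for z
    proof -
      have "(- h + t *\<^sub>R m) \<bullet> z = - height T z + (1 - ?g \<bullet> w) * coord T w z"
        using n0 by (simp add: inner_diff_left h(2) m t_def)
      then show ?thesis using inner_edge[OF T w g(2), of z] by simp
    qed
    then have yt: "y = - h + t *\<^sub>R m" using vector_eq_rdot by blast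
    have "w \<in> \<Delta>" using w \<T>_sub[OF T] V_\<Delta> by blast
    then have "t \<ge> 0" using g(1)[of w] by (simp add: t_def)
    moreover have "t \<le> jump T w"
      unfolding t_def jump_def using kink_min_le_valid[OF T w g] by (intro divide_right_mono) auto
    ultimately show "y \<in> closed_segment (- h) (- h + jump T w *\<^sub>R m)"
      unfolding seg yt using j0 by (intro exI[of _ "t / jump T w"]) auto
  next
    fix y assume "y \<in> closed_segment (- h) (- h + jump T w *\<^sub>R m)"
    then obtain u where u: "u \<ge> 0" "u \<le> 1" "y = - h + (u * jump T w) *\<^sub>R m" unfolding seg by blast
    obtain g where g: "g \<in> E" "\<forall>v\<in>T - {w}. g \<bullet> v = 1" "g \<bullet> w = kink_min T w"
      using kink_min_props(4)[OF T] by blast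
    \<comment> \<open>Along the segment, \<open>- y\<close> is the convex combination of
      \<open>h\<close> and \<open>g\<close> with parameter \<open>u\<close>, hence valid on
      \<open>\<Delta>\<close>.\<close>
    have yx: "y \<bullet> x = - ((1 - u) * (h \<bullet> x) + u * (g \<bullet> x))" for x
    proof -
      have gx: "g \<bullet> x = height T x - jump T w * (m \<bullet> x)"
        using inner_edge[OF T w g(2), of x] n0 by (simp add: g(3) m jump_def)
      show ?thesis unfolding u(3) gx h(2) by (simp add: inner_diff_left h(2) algebra_simps)
    qed
    have "y \<bullet> x \<ge> - 1" if "x \<in> \<Delta>" for x
    proof -
      have "h \<bullet> x \<le> 1" "g \<bullet> x \<le> 1" using that h(1) g(1) by (auto simp: \<Delta>_eq)
      then have "(1 - u) * (h \<bullet> x) + u * (g \<bullet> x) \<le> 1"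
        using u(1,2) by (intro convex_bound_le) auto
      then show ?thesis unfolding yx by simp
    qed
    moreover have "y \<bullet> x = - 1" if "x \<in> \<theta>" for x
      unfolding u(3) using edge_on_line[OF \<theta> T w sub that] by (simp add: inner_diff_left h(2) m)
    ultimately show "y \<in> dual_face \<Delta> \<theta>" by (simp add: dual_face_def dual_polytope_def)
  }
qed

text \<open>The functional \<open>m\<close> is primitive in the dual lattice because it has the
  value 1 at \<open>x1\<close>, so the segment has lattice length \<open>jump T w\<close>. The
  auxiliary scale \<open>l\<close> cancels.\<close>

lemma dual_volume_edge:
  assumes \<theta>: "edge \<theta>" and T: "T \<in> \<T>" and w: "w \<in> T" and sub: "T - {w} \<subseteq> \<theta>"
  shows "rational_normalized_volume (dual_lattice N) (dual_polytope \<Delta>) (dual_face \<Delta> \<theta>) = jump T w"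
proof -
  have fr: "frame T" by (rule \<T>_frame[OF T])
  obtain h where h: "h \<in> E" "\<And>x. h \<bullet> x = height T x" by (rule height_functional[OF T]) (rule that)
  obtain x1 where x1: "x1 \<in> N" "par T w x1 = 1" by (rule par_surj[OF T w])
  have par: "of_nat (index T) * coord T w x = of_int (par T w x)" if "x \<in> N" for x using par_eq[OF T w that] by simp
  have lin: "linear (\<lambda>x. of_nat (index T) * coord T w x)"
    using linear_compose_scale_right[OF linear_coord[OF fr], of "of_nat (index T)"] by simp
  obtain m where m: "\<And>x. m \<bullet> x = of_nat (index T) * coord T w x"
    using functional_in_dual[OF T lin _ x1(1)] par x1 by (metis Ints_of_int of_int_1)
  have mx1: "m \<bullet> x1 = 1" using m[of x1] par[OF x1(1)] x1(2) by simp
  then have m0: "m \<noteq> 0" by auto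
  have M: "t *\<^sub>R m \<in> dual_lattice N \<longleftrightarrow> t \<in> \<int>" for t
  proof
    assume "t *\<^sub>R m \<in> dual_lattice N"
    then have "(t *\<^sub>R m) \<bullet> x1 \<in> \<int>" using x1(1) unfolding dual_lattice_def by blast
    then show "t \<in> \<int>" by (simp add: mx1)
  next
    assume "t \<in> \<int>"
    then show "t *\<^sub>R m \<in> dual_lattice N" by (auto simp: dual_lattice_def m par)
  qed
  have j0: "jump T w > 0" by (rule jump_pos_edge[OF \<theta> T w sub])
  define l where "l = (SOME l::nat. l > 0 \<and> lattice_polytope (dual_lattice N) ((\<lambda>x. real l *\<^sub>R x) ` dual_polytope \<Delta>))"
  have l0: "l > 0" unfolding l_def using someI_ex[OF dual_scale_exists] by blast
  have face: "dual_face \<Delta> \<theta> = closed_segment (- h) (- h + jump T w *\<^sub>R m)"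
    by (rule dual_face_edge[OF \<theta> T w sub h m])
  have dim: "aff_dim (dual_face \<Delta> \<theta>) = 1"
    unfolding face by (rule relative_volume_segment(1)[OF m0 M j0])
  have lin: "linear (\<lambda>x::'a. real l *\<^sub>R x)" by (rule linear_scale_self)
  have seg: "(\<lambda>x. real l *\<^sub>R x) ` dual_face \<Delta> \<theta>
      = closed_segment (- (real l *\<^sub>R h)) (- (real l *\<^sub>R h) + (real l * jump T w) *\<^sub>R m)"
    unfolding face closed_segment_linear_image[OF lin, symmetric] by (simp add: algebra_simps)
  have r0: "real l * jump T w > 0" using l0 j0 by simp
  have "normalized_volume (dual_lattice N) ((\<lambda>x. real l *\<^sub>R x) ` dual_face \<Delta> \<theta>) = real l * jump T w"
    unfolding seg normalized_volume_def
    using relative_volume_segment[OF m0 M r0, of "- (real l *\<^sub>R h)"] by simp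
  then show ?thesis unfolding rational_normalized_volume_def l_def[symmetric] Let_def dim using l0 by simp
qed

lemma aff_dim_side:
  assumes T: "T \<in> \<T>" and w: "w \<in> T" shows "aff_dim (T - {w}) = 1"
proof -
  have "independent (T - {w})"
    using independent_mono[of T "T - {w}"] \<T>_frame[OF T] by (auto simp: frame_def)
  then have "\<not> affine_dependent (T - {w})" using affine_dependent_imp_dependent by blast
  then show ?thesis using card_T[OF T] w finite_T[OF T] aff_dim_affine_independent[of "T - {w}"] by simp
qed

lemma edge_unique:
  assumes T: "T \<in> \<T>" and w: "w \<in> T" and e: "edge \<theta>" "edge \<theta>'" "T - {w} \<subseteq> \<theta>" "T - {w} \<subseteq> \<theta>'"
  shows "\<theta> = \<theta>'"
proof (rule face_eqI[of _ _ "T - {w}"])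
qed (use e aff_dim_side[OF T w] in \<open>auto simp: edge_def\<close>)

text \<open>A nonzero jump provides two supporting functionals \<open>h\<close> and \<open>g\<close>
  that are 1 on the side \<open>T - {w}\<close> but differ at \<open>w\<close>. The face where both
  are 1 is confined to the line of the side.\<close>

lemma edge_if_jump:
  assumes T: "T \<in> \<T>" and w: "w \<in> T" and j: "jump T w \<noteq> 0"
  shows "\<exists>\<theta>. edge \<theta> \<and> T - {w} \<subseteq> \<theta>"
proof -
  have fr: "frame T" by (rule \<T>_frame[OF T])
  obtain h where h: "h \<in> E" "\<And>x. h \<bullet> x = height T x" by (rule height_functional[OF T]) (rule that)
  obtain g where g: "g \<in> E" "\<forall>v\<in>T - {w}. g \<bullet> v = 1" "g \<bullet> w = kink_min T w"
    using kink_min_props(4)[OF T] by blast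
  have k1: "kink_min T w \<noteq> 1" using j by (auto simp: jump_def)
  define \<theta> where "\<theta> = (\<Delta> \<inter> {x. h \<bullet> x = 1}) \<inter> (\<Delta> \<inter> {x. g \<bullet> x = 1})"
  have face: "\<theta> face_of \<Delta>" unfolding \<theta>_def
    using h(1) g(1) by (intro face_of_Int face_of_Int_supporting_hyperplane_le convex_\<Delta>) (auto simp: \<Delta>_eq)
  have sub: "T - {w} \<subseteq> \<theta>"
    using \<T>_sub[OF T] V_\<Delta> g(2) by (auto simp: \<theta>_def h(2) height_basis[OF fr])
  have "\<theta> \<subseteq> affine hull (T - {w})"
  proof
    fix x assume x: "x \<in> \<theta>"
    then have hx: "height T x = 1" and "g \<bullet> x = 1" by (auto simp: \<theta>_def h(2))
    then have "(1 - kink_min T w) * coord T w x = 0" using inner_edge[OF T w g(2), of x] g(3) by simp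
    then have c0: "coord T w x = 0" using k1 by simp
    have "(\<Sum>v\<in>T - {w}. coord T v x) = 1"
      using hx sum.remove[OF finite_T[OF T] w, of "\<lambda>v. coord T v x"] c0 by (simp add: height_def)
    moreover have "(\<Sum>v\<in>T - {w}. coord T v x *\<^sub>R v) = x"
      using sum_coord[OF fr, of x] sum.remove[OF finite_T[OF T] w, of "\<lambda>v. coord T v x *\<^sub>R v"] c0 by simp
    ultimately show "x \<in> affine hull (T - {w})"
      unfolding affine_hull_finite[OF finite_Diff[OF finite_T[OF T]]] by blast
  qed
  then have "aff_dim \<theta> \<le> 1" using aff_dim_subset[of \<theta> "affine hull (T - {w})"] aff_dim_side[OF T w] by simp
  moreover have "aff_dim \<theta> \<ge> 1" using aff_dim_subset[OF sub] aff_dim_side[OF T w] by simp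
  ultimately show ?thesis using face sub by (auto simp: edge_def)
qed

lemma finite_edges: "finite {\<theta>. edge \<theta>}"
  using finite_polytope_faces[OF polytope] by (rule rev_finite_subset) (auto simp: edge_def)

text \<open>Double counting of pairs of a triangle and a vertex by the edge containing the opposite
  side: a pair without such an edge has jump 0, and an edge of lattice length l has 2 l pairs, each
  with the dual length as jump.\<close>

theorem edge_sum:
  "(\<Sum>\<theta> | edge \<theta>. normalized_volume N \<theta>
      * rational_normalized_volume (dual_lattice N) (dual_polytope \<Delta>) (dual_face \<Delta> \<theta>))
    = (\<Sum>T\<in>\<T>. \<Sum>w\<in>T. jump T w) / 2"
proof -
  let ?r = "\<lambda>\<theta>. rational_normalized_volume (dual_lattice N) (dual_polytope \<Delta>) (dual_face \<Delta> \<theta>)"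
  let ?S = "{\<theta>. edge \<theta>}"
  have 1: "jump T w = (\<Sum>\<theta>\<in>?S. ?r \<theta> * (if T - {w} \<subseteq> \<theta> then 1 else 0))" if T: "T \<in> \<T>" and w: "w \<in> T" for T w
  proof (cases "\<exists>\<theta>. edge \<theta> \<and> T - {w} \<subseteq> \<theta>")
    case True
    then obtain \<theta> where \<theta>: "edge \<theta>" "T - {w} \<subseteq> \<theta>" by blast
    have "?r \<theta>' * (if T - {w} \<subseteq> \<theta>' then 1 else 0) = (if \<theta>' = \<theta> then ?r \<theta> else 0)" if "\<theta>' \<in> ?S" for \<theta>'
    proof -
      have "T - {w} \<subseteq> \<theta>' \<longleftrightarrow> \<theta>' = \<theta>" using edge_unique[OF T w _ \<theta>(1) _ \<theta>(2)] that \<theta>(2) by blast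
      then show ?thesis by simp
    qed
    then have "(\<Sum>\<theta>'\<in>?S. ?r \<theta>' * (if T - {w} \<subseteq> \<theta>' then 1 else 0)) = (\<Sum>\<theta>'\<in>?S. if \<theta>' = \<theta> then ?r \<theta> else 0)"
      by (rule sum.cong[OF refl])
    also have "\<dots> = ?r \<theta>" using finite_edges \<theta>(1) by simp
    finally show ?thesis unfolding dual_volume_edge[OF \<theta>(1) T w \<theta>(2)] by (rule sym)
  next
    case False
    then have "jump T w = 0" using edge_if_jump[OF T w] by blast
    moreover have "(\<Sum>\<theta>\<in>?S. ?r \<theta> * (if T - {w} \<subseteq> \<theta> then 1 else 0)) = 0"
      using False by (intro sum.neutral) auto
    ultimately show ?thesis by simp
  qed
  have "(\<Sum>T\<in>\<T>. \<Sum>w\<in>T. jump T w) = (\<Sum>T\<in>\<T>. \<Sum>w\<in>T. \<Sum>\<theta>\<in>?S. ?r \<theta> * (if T - {w} \<subseteq> \<theta> then 1 else 0))"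
    by (intro sum.cong refl 1)
  also have "\<dots> = (\<Sum>T\<in>\<T>. \<Sum>\<theta>\<in>?S. \<Sum>w\<in>T. ?r \<theta> * (if T - {w} \<subseteq> \<theta> then 1 else 0))"
    by (intro sum.cong refl sum.swap)
  also have "\<dots> = (\<Sum>\<theta>\<in>?S. \<Sum>T\<in>\<T>. \<Sum>w\<in>T. ?r \<theta> * (if T - {w} \<subseteq> \<theta> then 1 else 0))"
    by (rule sum.swap)
  also have "\<dots> = (\<Sum>\<theta>\<in>?S. ?r \<theta> * (2 * normalized_volume N \<theta>))"
  proof (intro sum.cong refl)
    fix \<theta> assume "\<theta> \<in> ?S"
    then have \<theta>: "edge \<theta>" by simp
    obtain A d l where e: "edge_data \<theta> A d l" by (rule edge_data_exists[OF \<theta>])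
    show "(\<Sum>T\<in>\<T>. \<Sum>w\<in>T. ?r \<theta> * (if T - {w} \<subseteq> \<theta> then 1 else 0)) = ?r \<theta> * (2 * normalized_volume N \<theta>)"
      unfolding sum_distrib_left[symmetric] edge_incidence_sum[OF \<theta> e] normalized_volume_edge[OF e] ..
  qed
  also have "\<dots> = 2 * (\<Sum>\<theta>\<in>?S. normalized_volume N \<theta> * ?r \<theta>)" unfolding sum_distrib_left by (simp add: mult_ac)
  finally show ?thesis by simp
qed

text \<open>Triangles are grouped by facet. All triangles in one facet have the lattice distance of
  the facet as index, and their number is its normalized volume.\<close>

theorem facet_sum:
  "(\<Sum>\<theta> | \<theta> face_of \<Delta> \<and> aff_dim \<theta> = 2.
      1 / real (lattice_distance N \<Delta> \<theta>) * normalized_volume N \<theta>) = (\<Sum>T\<in>\<T>. 1 / of_nat (index T))"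
proof -
  let ?S = "{\<theta>. \<theta> face_of \<Delta> \<and> aff_dim \<theta> = 2}"
  have fin: "finite ?S" using finite_polytope_faces[OF polytope] by (rule rev_finite_subset) auto
  have "(\<Sum>T\<in>\<T>. 1 / of_nat (index T) :: real) = (\<Sum>\<theta>\<in>?S. \<Sum>T | T \<in> \<T> \<and> facet T = \<theta>. 1 / of_nat (index T))"
    using facet_face by (intro sum.group[symmetric] finite_\<T> fin) auto
  also have "\<dots> = (\<Sum>\<theta>\<in>?S. 1 / real (lattice_distance N \<Delta> \<theta>) * normalized_volume N \<theta>)"
  proof (intro sum.cong refl)
    fix F assume "F \<in> ?S"
    then have F: "F face_of \<Delta>" "aff_dim F = 2" by auto
    obtain T0 where T0: "T0 \<in> \<T>" "T0 \<subseteq> F" by (rule facet_contains_triangle[OF F])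
    have F0: "F = facet T0" by (rule facet_unique[OF T0(1) F T0(2)])
    have "{T\<in>\<T>. T \<subseteq> F} = {T. T \<in> \<T> \<and> facet T = F}" using facet_iff[OF _ F] by blast
    then have nv: "normalized_volume N F = of_nat (card {T. T \<in> \<T> \<and> facet T = F})"
      using normalized_volume_facet[OF T0(1)] by (simp add: F0)
    have "(\<Sum>T | T \<in> \<T> \<and> facet T = F. 1 / of_nat (index T) :: real)
        = (\<Sum>T | T \<in> \<T> \<and> facet T = F. 1 / real (lattice_distance N \<Delta> F))"
      using lattice_distance_facet by (intro sum.cong refl) auto
    then show "(\<Sum>T | T \<in> \<T> \<and> facet T = F. 1 / of_nat (index T))
        = 1 / real (lattice_distance N \<Delta> F) * normalized_volume N F" by (simp add: nv)
  qed
  finally show ?thesis by simp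
qed

theorem facet_edge_formula:
  "24 = normalized_volume N \<Delta>
      - (\<Sum>\<theta> | \<theta> face_of \<Delta> \<and> aff_dim \<theta> = 2. 1 / real (lattice_distance N \<Delta> \<theta>) * normalized_volume N \<theta>)
      + (\<Sum>\<theta> | \<theta> face_of \<Delta> \<and> aff_dim \<theta> = 1. normalized_volume N \<theta>
           * rational_normalized_volume (dual_lattice N) (dual_polytope \<Delta>) (dual_face \<Delta> \<theta>))"
  using edge_sum unfolding facet_sum normalized_volume_\<Delta> sum_jumps edge_def
  by (simp add: sum_subtractf)

end

text \<open>Since 0 is an interior point, every half-space of the polyhedron has a positive bound,
  which can be scaled to 1.\<close>

lemma (in lattice) facet_functionals:
  assumes P: "lattice_polytope N \<Delta>" and int: "interior \<Delta> \<inter> N = {0}"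
  obtains E where "fano N b \<Delta> E"
proof -
  have "polyhedron \<Delta>" using P polytope_imp_polyhedron by (auto simp: lattice_polytope_def)
  then obtain F where F: "finite F" "\<Delta> = \<Inter>F" "\<forall>h\<in>F. \<exists>a c. a \<noteq> 0 \<and> h = {x. a \<bullet> x \<le> c}"
    unfolding polyhedron_def by blast
  have "\<exists>a. H = {x. a \<bullet> x \<le> 1}" if H: "H \<in> F" for H
  proof -
    obtain a c where ac: "a \<noteq> 0" "H = {x. a \<bullet> x \<le> c}" using F(3) H by blast
    have "0 \<in> interior \<Delta>" using int by blast
    also have "interior \<Delta> \<subseteq> interior H" using H F(2) by (intro interior_mono) auto
    also have "\<dots> = {x. a \<bullet> x < c}" unfolding ac(2) by (rule interior_halfspace_le[OF ac(1)])
    finally have c: "c > 0" by simp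
    then have "H = {x. (a /\<^sub>R c) \<bullet> x \<le> 1}" unfolding ac(2) by (auto simp: field_simps)
    then show ?thesis by blast
  qed
  then obtain a where a: "\<And>H. H \<in> F \<Longrightarrow> H = {x. a H \<bullet> x \<le> 1}" by metis
  have "\<Delta> = {x. \<forall>h\<in>a ` F. h \<bullet> x \<le> 1}" unfolding F(2) using a by auto
  then have "fano N b \<Delta> (a ` F)" using P int F(1) by unfold_locales auto
  then show ?thesis by (rule that)
qed

theorem theorem0p2:
  fixes N \<Delta> :: "'a::euclidean_space set"
  assumes "DIM('a) = 3"
    and "full_lattice N"
    and "canonical_Fano N \<Delta>"
  shows "24 = normalized_volume N \<Delta>
      - (\<Sum>\<theta> | \<theta> face_of \<Delta> \<and> aff_dim \<theta> = 2.
           1 / real (lattice_distance N \<Delta> \<theta>) * normalized_volume N \<theta>)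
      + (\<Sum>\<theta> | \<theta> face_of \<Delta> \<and> aff_dim \<theta> = 1.
           normalized_volume N \<theta>
           * rational_normalized_volume (dual_lattice N) (dual_polytope \<Delta>) (dual_face \<Delta> \<theta>))"
proof -
  obtain b where "lattice_basis DIM('a) b N" using assms(2) by (auto simp: full_lattice_def)
  then interpret lattice N b by unfold_locales
  have P: "lattice_polytope N \<Delta>" "interior \<Delta> \<inter> N = {0}"
    using assms(3) by (auto simp: canonical_Fano_def)
  obtain E where "fano N b \<Delta> E" by (rule facet_functionals[OF P])
  then interpret fano N b \<Delta> E .
  obtain \<T> where \<T>: "\<And>T. T \<in> \<T> \<Longrightarrow> T \<subseteq> V \<and> frame T" "\<And>T. T \<in> \<T> \<Longrightarrow> \<exists>h\<in>E. \<forall>v\<in>T. h \<bullet> v = 1"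
    "\<And>T. T \<in> \<T> \<Longrightarrow> N \<inter> convex hull T \<subseteq> T"
    "\<And>x. generic x \<Longrightarrow> \<exists>!T. T \<in> \<T> \<and> (\<forall>w\<in>T. coord T w x \<ge> 0)"
    by (rule exists_triangulation) (rule that)
  interpret triangulated N b \<Delta> E \<T> using \<T> assms(1) by unfold_locales auto
  show ?thesis by (rule facet_edge_formula)
qed

end
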